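(* Let $K$ be a number field of degree $d$ and discriminant $\Delta_K$, let $1 \le k < n$ be integers, let $I = \{i_1,\dots,i_k\} \subset \{1,\dots,n\}$ be a subset of cardinality $k$, $I' = \{1,\dots,n\}\setminus I$, and $\boldsymbol{x}_{I'} = (x_j)_{j\in I'}$. For $1 \le l \le k$ let $$F_l(x_1,\dots,x_n) = \sum_{j=1}^k x_{i_j} F_{l,j}(\boldsymbol{x}_{I'}) + F_{l,k+1}(\boldsymbol{x}_{I'})$$ be nonzero polynomials of respective degrees $m_1,\dots,m_k$, where $F_{l,j} \in K[\boldsymbol{x}_{I'}]$ for $1\le l \le k$, $1 \le j \le k+1$. Assume that the $k\times k$ matrix $\mathcal{F} = (F_{l,j}(\boldsymbol{x}_{I'}))_{1\le l\le k,\,1\le j\le k}$ has the same rank (over the field of rational functions $K(\boldsymbol{x}_{I'})$) as the $k\times(k+1)$ matrix obtained by augmenting $\mathcal{F}$ by the column $(F_{l,k+1}(\boldsymbol{x}_{I'}))_{1\le l\le k}$. Then $\bigcap_{l=1}^k Z_K(F_l) \neq \emptyset$, and there exists a point $\boldsymbol{z} \in \bigcap_{l=1}^k Z_K(F_l)$ with $$h(\boldsymbol{z}) \le k^{k+1} |\Delta_K|^{\frac1d} \left(\frac{D+2}{2}\right)^{2km+1} \left(\mathcal{N}\,\mathfrak{H}\right)^{2k},$$ where $D = \sum_{l=1}^k m_l$, $m = \max_{1\le l\le k} m_l$, $\mathcal{N} = \max_{1\le l\le k}\mathcal{N}(F_l)$ and $\mathfrak{H} = \max_{1\le l\le k} 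h(F_l)$.
   Context: For a polynomial $F \in K[x_1,\dots,x_n]$, $Z_K(F) = \{\boldsymbol{z}\in K^n : F(\boldsymbol{z}) = 0\}$, and $\mathcal{N}(F)$ is the number of nonzero monomials of $F$. Degrees are total degrees. Heights: let $M(K)$ be the set of places of $K$, and for $v\in M(K)$ let $d_v = [K_v:\mathbb{Q}_v]$ be the local degree. The absolute value $|\cdot|_v$ is normalized to extend the usual archimedean or $p$-adic absolute value on $\mathbb{Q}$, so that $\prod_{v\in M(K)} |x|_v^{d_v} = 1$ for all nonzero $x\in K$. For a vector $\boldsymbol{x} = (x_1,\dots,x_N)$ over $K$ put $|\boldsymbol{x}|_v = \max_i |x_i|_v$ and $H(\boldsymbol{x}) = \left(\prod_{v\in M(K)} |\boldsymbol{x}|_v^{d_v}\right)^{1/d}$. The inhomogeneous (Weil) height is $h(\boldsymbol{x}) = H(1,\boldsymbol{x})$. For a polynomial $F$ over $K$, $h(F)$ is $h$ of the coefficient vector of $F$. *)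

theory Defs
  imports
    "HOL-Library.Poly_Mapping"
    "HOL-Library.FuncSet"
    "HOL-Computational_Algebra.Fraction_Field"
    "HOL-Computational_Algebra.Primes"
    "HOL-Algebra.QuotRing"
    "HOL-Algebra.Embedded_Algebras"
    "Jordan_Normal_Form.VS_Connect"
begin

section \<open>Number fields\<close>

class number_field = field_char_0 +
  assumes finite_dim_over_rat:
    "\<exists>B. finite B \<and> (\<forall>x. \<exists>c. x = (\<Sum>b\<in>B. of_rat (c b) * b))"

definition nf_degree :: "'k::number_field itself \<Rightarrow> nat" where
  "nf_degree _ = Vector_Spaces.vector_space.dim (\<lambda>(r::rat) x. of_rat r * x) (UNIV :: 'k set)"

definition integral_basis :: "(nat \<Rightarrow> 'k::number_field) \<Rightarrow> bool" where
  "integral_basis \<omega> \<longleftrightarrow>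
     (\<forall>i < nf_degree TYPE('k). algebraic_int (\<omega> i)) \<and>
     (\<forall>x. algebraic_int x \<longrightarrow>
        (\<exists>!c. c \<in> {..<nf_degree TYPE('k)} \<rightarrow>\<^sub>E (UNIV :: int set) \<and>
              x = (\<Sum>i<nf_degree TYPE('k). of_int (c i) * \<omega> i)))"

definition complex_embeddings :: "('k::number_field \<Rightarrow> complex) set" where
  "complex_embeddings = {\<sigma>. field_hom \<sigma>}"

text \<open>The discriminant is \<open>(det (\<sigma>\<^sub>i(\<omega>\<^sub>j)))\<^sup>2\<close>; this is a rational integer that depends neither on
  the integral basis \<open>\<omega>\<close> nor on the enumeration \<open>\<sigma>\<close> of the embeddings.\<close>

definition nf_discriminant :: "'k::number_field itself \<Rightarrow> int" where
  "nf_discriminant _ = (THE \<delta>. \<exists>(\<omega> :: nat \<Rightarrow> 'k) \<sigma>.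
     integral_basis \<omega> \<and> bij_betw \<sigma> {..<nf_degree TYPE('k)} complex_embeddings \<and>
     of_int \<delta> = (Determinant.det
        (mat (nf_degree TYPE('k)) (nf_degree TYPE('k)) (\<lambda>(i, j). \<sigma> i (\<omega> j))))\<^sup>2)"


section \<open>Places and local degrees\<close>

definition absolute_value :: "('k::field \<Rightarrow> real) \<Rightarrow> bool" where
  "absolute_value \<nu> \<longleftrightarrow>
     (\<forall>x. \<nu> x \<ge> 0) \<and> (\<forall>x. \<nu> x = 0 \<longleftrightarrow> x = 0) \<and>
     (\<forall>x y. \<nu> (x * y) = \<nu> x * \<nu> y) \<and> (\<forall>x y. \<nu> (x + y) \<le> \<nu> x + \<nu> y)"

definition padic_abs :: "nat \<Rightarrow> rat \<Rightarrow> real" where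
  "padic_abs p q = (if q = 0 then 0
     else real p powi (int (multiplicity (int p) (snd (quotient_of q)))
                     - int (multiplicity (int p) (fst (quotient_of q)))))"

text \<open>Each equivalence class of nontrivial absolute values contains exactly one that extends the
  usual archimedean or a \<open>p\<close>-adic absolute value of \<open>\<rat>\<close>; a place is identified with this
  normalized representative.\<close>

definition places :: "('k::number_field \<Rightarrow> real) set" where
  "places = {\<nu>. absolute_value \<nu> \<and>
     ((\<forall>q. \<nu> (of_rat q) = \<bar>of_rat q\<bar>) \<or>
      (\<exists>p. prime p \<and> (\<forall>q. \<nu> (of_rat q) = padic_abs p q)))}"

definition cauchy_seq :: "('k::field \<Rightarrow> real) \<Rightarrow> (nat \<Rightarrow> 'k) \<Rightarrow> bool" where
  "cauchy_seq \<nu> X \<longleftrightarrow> (\<forall>e>0. \<exists>N. \<forall>m\<ge>N. \<forall>n\<ge>N. \<nu> (X m - X n) < e)"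

definition cauchy_ring :: "('k::field \<Rightarrow> real) \<Rightarrow> (nat \<Rightarrow> 'k) ring" where
  "cauchy_ring \<nu> = \<lparr>carrier = {X. cauchy_seq \<nu> X},
     mult = (\<lambda>X Y n. X n * Y n), one = (\<lambda>_. 1), zero = (\<lambda>_. 0), add = (\<lambda>X Y n. X n + Y n)\<rparr>"

definition null_seqs :: "('k::field \<Rightarrow> real) \<Rightarrow> (nat \<Rightarrow> 'k) set" where
  "null_seqs \<nu> = {X. (\<lambda>n. \<nu> (X n)) \<longlonglongrightarrow> 0}"

definition completion :: "('k::field \<Rightarrow> real) \<Rightarrow> (nat \<Rightarrow> 'k) set ring" where
  "completion \<nu> = cauchy_ring \<nu> Quot null_seqs \<nu>"

text \<open>The completion of \<open>\<rat>\<close> inside the completion of the field: the classes of the Cauchy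
  sequences of rational numbers.\<close>

definition rat_completion :: "('k::number_field \<Rightarrow> real) \<Rightarrow> (nat \<Rightarrow> 'k) set set" where
  "rat_completion \<nu> =
     {null_seqs \<nu> +>\<^bsub>cauchy_ring \<nu>\<^esub> X |X. cauchy_seq \<nu> X \<and> range X \<subseteq> \<rat>}"

definition local_degree :: "('k::number_field \<Rightarrow> real) \<Rightarrow> nat" where
  "local_degree \<nu> =
     Embedded_Algebras.ring.dim (completion \<nu>) (rat_completion \<nu>) (carrier (completion \<nu>))"


section \<open>Heights\<close>

text \<open>A vector is a family \<open>x\<close> indexed by a finite nonempty set \<open>A\<close>.\<close>

definition sup_abs :: "('k \<Rightarrow> real) \<Rightarrow> 'i set \<Rightarrow> ('i \<Rightarrow> 'k) \<Rightarrow> real" where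
  "sup_abs \<nu> A x = Max ((\<lambda>i. \<nu> (x i)) ` A)"

text \<open>\<open>prod\<close> is \<open>1\<close> on infinite index sets. All but finitely many factors equal \<open>1\<close> for a
  nonzero vector, so the product is taken over the remaining places.\<close>

definition proj_height :: "'i set \<Rightarrow> ('i \<Rightarrow> 'k::number_field) \<Rightarrow> real" where
  "proj_height A x =
     (\<Prod>\<nu>\<in>{\<nu>\<in>places. sup_abs \<nu> A x \<noteq> 1}. sup_abs \<nu> A x ^ local_degree \<nu>)
       powr (1 / real (nf_degree TYPE('k)))"

text \<open>\<open>h(x) = H(1, x)\<close>, where \<open>None\<close> is the index of the additional coordinate \<open>1\<close>.\<close>

definition weil_height :: "'i set \<Rightarrow> ('i \<Rightarrow> 'k::number_field) \<Rightarrow> real" where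
  "weil_height A x = proj_height (insert None (Some ` A)) (case_option 1 x)"


section \<open>Polynomials in the variables \<open>x\<^sub>j\<close>, \<open>j \<in> \<nat>\<close>\<close>

type_synonym 'k mpoly = "(nat \<Rightarrow>\<^sub>0 nat) \<Rightarrow>\<^sub>0 'k"

definition mvar :: "nat \<Rightarrow> 'k::comm_ring_1 mpoly" where
  "mvar j = Poly_Mapping.single (Poly_Mapping.single j 1) 1"

definition mpoly_ring :: "nat set \<Rightarrow> 'k::comm_ring_1 mpoly set" where
  "mpoly_ring J = {p. \<forall>\<alpha>\<in>Poly_Mapping.keys p. Poly_Mapping.keys \<alpha> \<subseteq> J}"

text \<open>Only applied to nonzero polynomials.\<close>

definition total_degree :: "'k::comm_ring_1 mpoly \<Rightarrow> nat" where
  "total_degree p =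
     Max ((\<lambda>\<alpha>. \<Sum>j\<in>Poly_Mapping.keys \<alpha>. Poly_Mapping.lookup \<alpha> j) ` Poly_Mapping.keys p)"

definition num_monomials :: "'k::comm_ring_1 mpoly \<Rightarrow> nat" where
  "num_monomials p = card (Poly_Mapping.keys p)"

definition meval :: "(nat \<Rightarrow> 'k) \<Rightarrow> 'k::comm_ring_1 mpoly \<Rightarrow> 'k" where
  "meval z p = (\<Sum>\<alpha>\<in>Poly_Mapping.keys p.
     Poly_Mapping.lookup p \<alpha> * (\<Prod>j\<in>Poly_Mapping.keys \<alpha>. z j ^ Poly_Mapping.lookup \<alpha> j))"

definition zero_locus :: "nat \<Rightarrow> 'k::comm_ring_1 mpoly \<Rightarrow> (nat \<Rightarrow> 'k) set" where
  "zero_locus n p = {z \<in> {1..n} \<rightarrow>\<^sub>E UNIV. meval z p = 0}"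

definition poly_height :: "'k::number_field mpoly \<Rightarrow> real" where
  "poly_height p = weil_height (Poly_Mapping.keys p) (Poly_Mapping.lookup p)"


section \<open>Rank over a field of rational functions\<close>

text \<open>The field \<open>K(x\<^sub>J)\<close>, as a subfield of the field of fractions of \<open>K[x\<^sub>0, x\<^sub>1, \<dots>]\<close>.\<close>

definition ratfun_field :: "nat set \<Rightarrow> 'k::field mpoly fract ring" where
  "ratfun_field J = \<lparr>carrier = {Fract p q |p q. p \<in> mpoly_ring J \<and> q \<in> mpoly_ring J \<and> q \<noteq> 0},
     mult = (*), one = 1, zero = 0, add = (+)\<rparr>"

definition ratfun_vec :: "nat set \<Rightarrow> nat \<Rightarrow> ('k::field mpoly fract, 'k mpoly fract vec) module" where
  "ratfun_vec J r = (module_vec TYPE('k mpoly fract) r)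
     \<lparr>carrier := {v \<in> carrier_vec r. set\<^sub>v v \<subseteq> carrier (ratfun_field J)}\<rparr>"

text \<open>The analogue over \<open>K(x\<^sub>J)\<close> of the library's \<open>vec_space.rank\<close>, which is only available for
  fields that are full types: the dimension over \<open>K(x\<^sub>J)\<close> of the space spanned by the columns.\<close>

definition ratfun_rank :: "nat set \<Rightarrow> 'k::field mpoly fract mat \<Rightarrow> nat" where
  "ratfun_rank J A = VectorSpace.vectorspace.dim (ratfun_field J)
     (ratfun_vec J (dim_row A)
        \<lparr>carrier := LinearCombinations.module.span (ratfun_field J) (ratfun_vec J (dim_row A))
                     (set (cols A))\<rparr>)"

end

theory Submission
  imports Defs
    "Jordan_Normal_Form.Char_Poly"
    "Jordan_Normal_Form.DL_Rank"
    "HOL-Computational_Algebra.Fundamental_Theorem_Algebra"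
begin

text \<open>Write \<open>G\<close> for the \<open>k \<times> k\<close> matrix of the coefficients \<open>F\<^sub>l\<^sub>j\<close> and \<open>h\<close> for the column of the constant terms. Since
  the two ranks agree, \<open>h\<close> lies in the column space of \<open>G\<close> over \<open>K(x\<^sub>I\<^sub>')\<close>
  (\<open>ratfun_rank_eq_imp_solvable\<close>). Let \<open>g\<close> be a nonzero minor of \<open>G\<close> of the largest size \<open>r\<close>. All
  bordered minors vanish, those that are bordered by \<open>h\<close> included, so that \<open>g\<close> times any row of the
  augmented matrix is a polynomial combination of the \<open>r\<close> rows of the minor
  (\<open>minor_row_relations\<close>). After a specialisation of \<open>x\<^sub>I\<^sub>'\<close> at which \<open>g\<close> takes a nonzero value
  \<open>w\<close>, it therefore suffices to solve the \<open>r\<close> equations of these rows in the \<open>r\<close> unknowns of its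
  columns; the other unknowns are set to \<open>0\<close>, and Cramer's rule writes \<open>w\<close> times each unknown as an
  \<open>r \<times> r\<close> determinant in the values of the \<open>F\<^sub>l\<^sub>j\<close> (\<open>solve_by_minor\<close>). The degree of \<open>g\<close> is at most
  \<open>D\<close>, so the specialisation can be chosen in the integers of absolute value at most \<open>(D + 1) / 2\<close>
  (\<open>nonvanishing_on_grid\<close>).

  At an archimedean place every row of such a determinant is bounded by
  \<open>N ((D + 2) / 2)\<^sup>m\<close> times the local height of one of the \<open>F\<^sub>l\<close>, and at the other places the local
  height alone suffices, because these places are ultrametric. The local bounds of
  \<open>w\<close> and of \<open>w\<close> times the coordinates combine to a bound of the height
  (\<open>weil_height_bound\<close>) as soon as the product of the \<open>|w|\<^sub>v\<close> with the local degrees as exponents is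
  at least \<open>1\<close>. This gives the bound
  \<open>k! (N ((D + 2) / 2)\<^sup>m)\<^sup>k ((D + 2) / 2) \<HH>\<^sup>k\<close>, which is below the claimed one since the
  discriminant is a nonzero integer (\<open>nf_discriminant_ge_1\<close>).

  The arithmetic input is thus the inequality \<open>product_formula_ge_1\<close>. By the product formula
  of \<open>\<rat>\<close>, applied to the norm of \<open>w\<close>, it follows from a local statement: for a nontrivial absolute
  value \<open>a\<close> of \<open>\<rat>\<close>, the value of \<open>a\<close> at the norm of \<open>w\<close> is at most the product of
  \<open>\<nu>(w)\<close>, with the local degree as exponent, over the extensions \<open>\<nu>\<close> of \<open>a\<close> to \<open>K\<close>. It is proved in
  the following way. A Zorn argument on submultiplicative functions
  yields enough extensions of \<open>a\<close> to detect every spectral radius (\<open>absolute_value_extension\<close>).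
  Norms, then characteristic polynomials and traces, and finally, as the trace form is nondegenerate,
  rational coordinates are bounded in terms of the values at all the extensions (\<open>qcoord_bound\<close>). Let
  \<open>I\<^sub>\<nu>\<close> be a set of indices for which the elements \<open>b\<^sub>i\<close> of a fixed rational basis form a basis of the
  completion at \<open>\<nu>\<close>. Weak approximation makes a rational basis of \<open>K\<close> out of all these local bases, in
  which multiplication by \<open>w\<close> has a matrix with rows of size \<open>O(\<nu>(w))\<close>. The determinant of this
  matrix is the norm, and passing to the powers of \<open>w\<close> removes the implied constant
  (\<open>local_norm_inequality\<close>).\<close>

section \<open>Rational coordinates on a number field\<close>

interpretation rvs: vector_space "\<lambda>(r::rat) (x::'k::field_char_0). of_rat r * x"
  by (rule vector_space.intro) (simp_all add: distrib_left distrib_right of_rat_add of_rat_mult mult.assoc)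

definition qcomb :: "nat \<Rightarrow> (nat \<Rightarrow> 'k::field_char_0) \<Rightarrow> (nat \<Rightarrow> rat) \<Rightarrow> 'k" where
  "qcomb n b c = (\<Sum>i<n. of_rat (c i) * b i)"

definition qindep :: "nat \<Rightarrow> (nat \<Rightarrow> 'k::field_char_0) \<Rightarrow> bool" where
  "qindep n b \<longleftrightarrow> (\<forall>c. qcomb n b c = 0 \<longrightarrow> (\<forall>i<n. c i = 0))"

definition qspan :: "nat \<Rightarrow> (nat \<Rightarrow> 'k::field_char_0) \<Rightarrow> 'k set" where
  "qspan n b = range (qcomb n b)"

lemma qcomb_diff: "qcomb n b (\<lambda>i. c i - e i) = qcomb n b c - qcomb n b e"
  by (simp add: qcomb_def of_rat_diff algebra_simps sum_subtractf)

lemma qcomb_add: "qcomb n b (\<lambda>i. c i + e i) = qcomb n b c + qcomb n b e"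
  by (simp add: qcomb_def of_rat_add algebra_simps sum.distrib)

lemma qcomb_scale: "qcomb n b (\<lambda>i. q * c i) = of_rat q * qcomb n b c"
  by (simp add: qcomb_def of_rat_mult algebra_simps sum_distrib_left)

lemma qindep_unique:
  assumes "qindep n b" "qcomb n b c = qcomb n b e" "i < n" shows "c i = e i"
proof -
  have "qcomb n b (\<lambda>i. c i - e i) = 0" by (simp add: qcomb_diff assms)
  then show ?thesis using assms(1,3) unfolding qindep_def by fastforce
qed

lemma qcomb_unit: "i < n \<Longrightarrow> qcomb n b (\<lambda>j. if j = i then 1 else 0) = b i"
  unfolding qcomb_def by (subst sum.remove[of _ i]) auto

lemma qindep_inj: assumes "qindep n b" shows "inj_on b {..<n}"
proof (rule inj_onI)
  fix i j assume ij: "i \<in> {..<n}" "j \<in> {..<n}" "b i = b j"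
  have "qcomb n b (\<lambda>k. if k = i then 1 else 0) = qcomb n b (\<lambda>k. if k = j then 1 else 0)"
    using ij by (simp add: qcomb_unit)
  then have "(if i = i then 1 else 0) = (if i = j then 1 else (0::rat))"
    using qindep_unique[OF assms, of "\<lambda>k. if k = i then 1 else 0" "\<lambda>k. if k = j then 1 else 0" i] ij by auto
  then show "i = j" by (auto split: if_splits)
qed

lemma qindep_independent: assumes "qindep n b" shows "rvs.independent (b ` {..<n})"
proof -
  have inj: "inj_on b {..<n}" by (rule qindep_inj[OF assms])
  show ?thesis
  proof
    assume "rvs.dependent (b ` {..<n})"
    then obtain u i where s: "(\<Sum>v\<in>b ` {..<n}. of_rat (u v) * v) = 0" and i: "i \<in> {..<n}" "u (b i) \<noteq> 0"
      unfolding rvs.dependent_finite[OF finite_imageI[OF finite_lessThan]] by auto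
    have "qcomb n b (u \<circ> b) = 0"
      using s by (simp add: qcomb_def sum.reindex[OF inj])
    then show False using assms i unfolding qindep_def by auto
  qed
qed

lemma qspan_span: "rvs.span (b ` {..<n}) \<subseteq> qspan n b"
proof (rule rvs.span_minimal)
  show "b ` {..<n} \<subseteq> qspan n b"
  proof
    fix x assume "x \<in> b ` {..<n}"
    then obtain i where "i < n" "x = b i" by auto
    then show "x \<in> qspan n b" using qcomb_unit[of i n b] unfolding qspan_def by (metis rangeI)
  qed
  show "rvs.subspace (qspan n b)"
  proof (rule rvs.subspaceI)
    show "0 \<in> qspan n b" unfolding qspan_def by (rule range_eqI[of _ _ "\<lambda>_. 0"]) (simp add: qcomb_def)
    fix x y :: 'a and q assume "x \<in> qspan n b" "y \<in> qspan n b"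
    then obtain c e where "x = qcomb n b c" "y = qcomb n b e" unfolding qspan_def by blast
    then have "x + y = qcomb n b (\<lambda>i. c i + e i)" "of_rat q * x = qcomb n b (\<lambda>i. q * c i)"
      by (simp_all add: qcomb_add qcomb_scale)
    then show "x + y \<in> qspan n b" "of_rat q * x \<in> qspan n b" unfolding qspan_def by auto
  qed
qed

lemma qspan_eq: "qspan n b = rvs.span (b ` {..<n})"
proof
  show "qspan n b \<subseteq> rvs.span (b ` {..<n})"
    unfolding qspan_def qcomb_def by (safe, rule rvs.span_sum, rule rvs.span_scale, rule rvs.span_base) auto
qed (rule qspan_span)

text \<open>The dimension is attached to the whole space, so a basis extracted from the finite spanning set that
  the class provides has the degree as its cardinality.\<close>

lemma nf_finite_basis:
  obtains B :: "'k::number_field set" where "finite B" "rvs.independent B" "rvs.span B = UNIV"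
    "card B = nf_degree TYPE('k)"
proof -
  obtain B :: "'k set" where B: "finite B" "\<forall>x. \<exists>c. x = (\<Sum>b\<in>B. of_rat (c b) * b)"
    using finite_dim_over_rat by blast
  have sp: "rvs.span B = UNIV"
  proof -
    have "x \<in> rvs.span B" for x
    proof -
      obtain c where c: "x = (\<Sum>b\<in>B. of_rat (c b) * b)" using B(2) by blast
      show ?thesis unfolding c by (rule rvs.span_sum, rule rvs.span_scale, rule rvs.span_base)
    qed
    then show ?thesis by auto
  qed
  obtain B' where B': "B' \<subseteq> B" "rvs.independent B'" "B \<subseteq> rvs.span B'"
    using rvs.maximal_independent_subset[of B] by blast
  have sp': "rvs.span B' = UNIV"
    using rvs.span_mono[OF B'(3)] sp by (simp add: rvs.span_span) blast
  have "rvs.dim (UNIV :: 'k set) = card B'"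
    by (rule rvs.dim_unique[of B']) (use B' sp' in auto)
  then have "card B' = nf_degree TYPE('k)" by (simp add: nf_degree_def)
  then show ?thesis using that[of B'] B' sp' B(1) finite_subset by blast
qed

lemma qbasis_exists:
  obtains b :: "nat \<Rightarrow> 'k::number_field" where "qindep (nf_degree TYPE('k)) b" "qspan (nf_degree TYPE('k)) b = UNIV"
proof -
  obtain B :: "'k::number_field set" where B: "finite B" "rvs.independent B" "rvs.span B = UNIV"
    "card B = nf_degree TYPE('k)" by (rule nf_finite_basis)
  obtain b where b: "bij_betw b {..<nf_degree TYPE('k)} B"
    using ex_bij_betw_nat_finite[OF B(1)] B(4) by (metis atLeast0LessThan)
  have im: "b ` {..<nf_degree TYPE('k)} = B" using b by (simp add: bij_betw_def)
  have "qindep (nf_degree TYPE('k)) b"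
    unfolding qindep_def
  proof safe
    fix c i assume c: "qcomb (nf_degree TYPE('k)) b c = 0" and i: "i < nf_degree TYPE('k)"
    let ?g = "the_inv_into {..<nf_degree TYPE('k)} b"
    have "(\<Sum>v\<in>B. of_rat (c (?g v)) * v) = 0"
      using c unfolding qcomb_def sum.reindex_bij_betw[OF b, symmetric]
      by (simp add: the_inv_into_f_f[OF bij_betw_imp_inj_on[OF b]])
    then have "\<forall>v\<in>B. c (?g v) = 0"
      using rvs.independentD[OF B(2) B(1) order_refl, of "\<lambda>v. c (?g v)"] by blast
    then have "c (?g (b i)) = 0" using i im by blast
    then show "c i = 0" using b i by (simp add: bij_betw_def the_inv_into_f_f)
  qed
  moreover have "qspan (nf_degree TYPE('k)) b = UNIV" by (simp add: qspan_eq im B(3))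
  ultimately show ?thesis by (rule that)
qed

lemma qindep_le_degree:
  fixes b :: "nat \<Rightarrow> 'k::number_field"
  assumes "qindep n b" shows "n \<le> nf_degree TYPE('k)"
proof -
  obtain B :: "'k::number_field set" where B: "finite B" "rvs.independent B" "rvs.span B = UNIV"
    "card B = nf_degree TYPE('k)" by (rule nf_finite_basis)
  have "card (b ` {..<n}) \<le> card B"
    using rvs.independent_span_bound[OF B(1) qindep_independent[OF assms]] unfolding B(3) by blast
  then show ?thesis using qindep_inj[OF assms] B(4) by (simp add: card_image)
qed

lemma qindep_span_degree:
  fixes b :: "nat \<Rightarrow> 'k::number_field"
  assumes "qindep (nf_degree TYPE('k)) b" shows "qspan (nf_degree TYPE('k)) b = UNIV"
proof -
  let ?d = "nf_degree TYPE('k)"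
  have i: "rvs.independent (b ` {..<?d})" by (rule qindep_independent[OF assms])
  have "card (b ` {..<?d}) = ?d" using qindep_inj[OF assms] by (simp add: card_image)
  obtain B :: "'k::number_field set" where B: "finite B" "rvs.independent B" "rvs.span B = UNIV"
    "card B = nf_degree TYPE('k)" by (rule nf_finite_basis)
  have "x \<in> rvs.span (b ` {..<?d})" for x
  proof (rule ccontr)
    assume x: "x \<notin> rvs.span (b ` {..<?d})"
    have "rvs.independent (insert x (b ` {..<?d}))" by (rule rvs.independent_insertI[OF x i])
    then have "card (insert x (b ` {..<?d})) \<le> card B"
      using rvs.independent_span_bound[OF B(1), of "insert x (b ` {..<?d})"] unfolding B(3) by blast
    moreover have "x \<notin> b ` {..<?d}" using x rvs.span_base[of x "b ` {..<?d}"] by argo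
    ultimately show False using B(4) \<open>card (b ` {..<?d}) = ?d\<close> by simp
  qed
  then have "rvs.span (b ` {..<?d}) = UNIV" by blast
  then show ?thesis unfolding qspan_eq .
qed

lemma nf_degree_pos: "nf_degree TYPE('k::number_field) > 0"
proof (rule ccontr)
  assume "\<not> ?thesis"
  then have z: "nf_degree TYPE('k) = 0" by simp
  obtain b :: "nat \<Rightarrow> 'k" where "qindep (nf_degree TYPE('k)) b" "qspan (nf_degree TYPE('k)) b = UNIV"
    by (rule qbasis_exists)
  then have "(1::'k) \<in> qspan 0 b" using z by simp
  then show False by (auto simp: qspan_def qcomb_def)
qed


section \<open>Rational functionals as combinations of complex embeddings\<close>

definition qlinear :: "('k::field_char_0 \<Rightarrow> complex) \<Rightarrow> bool" where
  "qlinear \<phi> \<longleftrightarrow> (\<forall>x y. \<phi> (x + y) = \<phi> x + \<phi> y) \<and> (\<forall>q x. \<phi> (of_rat q * x) = of_rat q * \<phi> x)"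

lemma qlinear_sum: assumes "qlinear \<phi>" shows "\<phi> (\<Sum>i\<in>A. f i) = (\<Sum>i\<in>A. \<phi> (f i))"
proof -
  have z: "\<phi> 0 = 0" using assms unfolding qlinear_def by (metis mult_zero_left of_rat_0)
  show ?thesis by (induction A rule: infinite_finite_induct) (use assms z in \<open>auto simp: qlinear_def\<close>)
qed

lemma qlinear_qcomb: assumes "qlinear \<phi>" shows "\<phi> (qcomb n b c * y) = (\<Sum>i<n. of_rat (c i) * \<phi> (b i * y))"
proof -
  have "\<phi> (qcomb n b c * y) = \<phi> (\<Sum>i<n. of_rat (c i) * (b i * y))"
    by (simp add: qcomb_def sum_distrib_right mult.assoc)
  also have "\<dots> = (\<Sum>i<n. of_rat (c i) * \<phi> (b i * y))"
    using assms by (simp add: qlinear_sum[OF assms] qlinear_def)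
  finally show ?thesis .
qed

lemma algebraic_relation:
  fixes x :: "'k::number_field" obtains f :: "rat poly" where "f \<noteq> 0" "poly (map_poly of_rat f) x = 0"
proof -
  let ?n = "Suc (nf_degree TYPE('k))"
  have "\<not> qindep ?n (\<lambda>i. x ^ i)" using qindep_le_degree[of ?n "\<lambda>i. x ^ i"] by auto
  then obtain c i where c: "qcomb ?n (\<lambda>i. x ^ i) c = 0" "i < ?n" "c i \<noteq> 0" unfolding qindep_def by blast
  define f where "f = (\<Sum>i<?n. Polynomial.monom (c i) i)"
  have co: "poly.coeff f j = (if j < ?n then c j else 0)" for j
    unfolding f_def by (simp add: coeff_sum sum.delta' del: sum.lessThan_Suc)
  have "f \<noteq> 0" using co[of i] c by auto
  moreover have "map_poly of_rat f = (\<Sum>i<?n. Polynomial.monom (of_rat (c i) :: 'k) i)"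
    by (rule poly_eqI) (simp add: coeff_map_poly co coeff_sum del: sum.lessThan_Suc)
  then have "poly (map_poly of_rat f) x = qcomb ?n (\<lambda>i. x ^ i) c"
    by (simp add: poly_sum poly_monom qcomb_def del: sum.lessThan_Suc)
  ultimately show ?thesis using that c by simp
qed

lemma map_poly_of_rat_mult: "map_poly of_rat (p * q) = map_poly of_rat p * (map_poly of_rat q :: 'a::field_char_0 poly)"
  by (rule poly_eqI) (simp add: coeff_map_poly coeff_mult of_rat_sum of_rat_mult)

text \<open>A relation of least degree works. A double complex root \<open>r\<close> would be a root of the minimal rational
  polynomial \<open>m\<close> of \<open>r\<close>; then one of \<open>m\<close> and its cofactor annihilates \<open>x\<close>, which by minimality makes \<open>m\<close>
  of full degree, although \<open>r\<close> is also a root of the derivative.\<close>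

lemma separable_relation:
  fixes x :: "'k::number_field"
  obtains f :: "rat poly" where "f \<noteq> 0" "poly (map_poly of_rat f) x = 0" "rsquarefree (map_poly of_rat f :: complex poly)"
proof -
  define P where "P = (\<lambda>f::rat poly. f \<noteq> 0 \<and> poly (map_poly of_rat f) x = 0)"
  obtain f0 where "P f0" unfolding P_def by (rule algebraic_relation[of x]) blast
  then obtain f where f: "P f" and fmin: "\<And>g. P g \<Longrightarrow> Polynomial.degree f \<le> Polynomial.degree g"
    using ex_has_least_nat[of P f0 Polynomial.degree] by blast
  have "rsquarefree (map_poly of_rat f :: complex poly)"
    unfolding rsquarefree_roots
  proof (intro allI notI)
    fix r :: complex
    assume r: "poly (map_poly of_rat f) r = 0 \<and> poly (pderiv (map_poly of_rat f)) r = 0"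
    define Q where "Q = (\<lambda>f::rat poly. f \<noteq> 0 \<and> poly (map_poly of_rat f) r = 0)"
    have "Q f" using f r by (simp add: P_def Q_def)
    then obtain m where m: "Q m" and mmin: "\<And>g. Q g \<Longrightarrow> Polynomial.degree m \<le> Polynomial.degree g"
      using ex_has_least_nat[of Q f Polynomial.degree] by blast
    have m0: "m \<noteq> 0" using m by (simp add: Q_def)
    have hm: "poly (map_poly of_rat f) r = poly (map_poly of_rat (f div m)) r * poly (map_poly of_rat m) r + poly (map_poly of_rat (f mod m)) r"
      by (simp only: poly_mult[symmetric] map_poly_of_rat_mult[symmetric] poly_add[symmetric]
          of_rat_hom.map_poly_hom_add[symmetric] div_mult_mod_eq)
    have "f mod m = 0"
    proof (rule ccontr)
      assume nz: "f mod m \<noteq> 0"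
      then have "Q (f mod m)" using hm r m by (simp add: Q_def)
      then show False using mmin[of "f mod m"] nz degree_mod_less'[OF m0 nz] by simp
    qed
    \<comment> \<open>so \<open>m\<close> divides \<open>f\<close>, and one of the two factors annihilates \<open>x\<close>\<close>
    then have fm: "f = (f div m) * m" using div_mult_mod_eq[of f m] by simp
    have degm: "Polynomial.degree m > 0"
    proof (rule ccontr)
      assume "\<not> ?thesis"
      then have "Polynomial.degree m = 0" by blast
      then obtain a where "m = [:a:]" by (rule degree_eq_zeroE)
      then show False using m by (auto simp: Q_def)
    qed
    have d0: "f div m \<noteq> 0" using f fm by (auto simp: P_def)
    have dg: "Polynomial.degree f = Polynomial.degree (f div m) + Polynomial.degree m"
      by (subst fm, rule degree_mult_eq[OF d0 m0])
    have "poly (map_poly of_rat (f div m)) x * poly (map_poly of_rat m) x = 0"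
      unfolding poly_mult[symmetric] map_poly_of_rat_mult[symmetric] fm[symmetric] using f by (simp add: P_def)
    then consider "poly (map_poly of_rat (f div m)) x = 0" | "poly (map_poly of_rat m) x = 0" by auto
    then have "Polynomial.degree f = Polynomial.degree m"
    proof cases
      case 1 then have "P (f div m)" using d0 by (simp add: P_def)
      then show ?thesis using fmin[of "f div m"] dg degm by simp
    next
      case 2 then have "P m" using m0 by (simp add: P_def)
      then show ?thesis using fmin[of m] dg by simp
    qed
    moreover have "Q (pderiv f)"
    proof -
      have "pderiv f \<noteq> 0" using calculation degm by (simp add: pderiv_eq_0_iff)
      moreover have "pderiv (map_poly of_rat f :: complex poly) = map_poly of_rat (pderiv f)"
        by (rule poly_eqI) (simp add: coeff_pderiv coeff_map_poly of_rat_mult of_rat_add)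
      ultimately show ?thesis using r by (simp add: Q_def)
    qed
    then have "Polynomial.degree m \<le> Polynomial.degree f - 1" using mmin[of "pderiv f"] by (simp add: degree_pderiv)
    ultimately show False using degm by simp
  qed
  then show ?thesis by (intro that[of f]) (use f in \<open>auto simp: P_def\<close>)
qed

text \<open>The action of the polynomial \<open>p\<close> on functionals when the variable acts as multiplication by \<open>x\<close>
  in the argument.\<close>

definition pact :: "'k::field_char_0 \<Rightarrow> complex poly \<Rightarrow> ('k \<Rightarrow> complex) \<Rightarrow> 'k \<Rightarrow> complex" where
  "pact x p \<phi> y = (\<Sum>k\<le>Polynomial.degree p. poly.coeff p k * \<phi> (x ^ k * y))"

lemma pact_le: assumes "Polynomial.degree p \<le> n" shows "pact x p \<phi> y = (\<Sum>k\<le>n. poly.coeff p k * \<phi> (x ^ k * y))"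
  unfolding pact_def
  by (rule sum.mono_neutral_left) (use assms in \<open>auto simp: coeff_eq_0\<close>)

lemma pact_add: "pact x (p + q) \<phi> y = pact x p \<phi> y + pact x q \<phi> y"
proof -
  let ?n = "max (Polynomial.degree p) (Polynomial.degree q)"
  have "pact x (p + q) \<phi> y = (\<Sum>k\<le>?n. poly.coeff (p + q) k * \<phi> (x ^ k * y))"
    by (rule pact_le) (rule Polynomial.degree_add_le_max)
  moreover have "pact x p \<phi> y = (\<Sum>k\<le>?n. poly.coeff p k * \<phi> (x ^ k * y))" by (rule pact_le) simp
  moreover have "pact x q \<phi> y = (\<Sum>k\<le>?n. poly.coeff q k * \<phi> (x ^ k * y))" by (rule pact_le) simp
  ultimately show ?thesis by (simp add: distrib_right sum.distrib)
qed

lemma pact_smult: "pact x (Polynomial.smult a p) \<phi> y = a * pact x p \<phi> y"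
  by (subst pact_le[OF degree_smult_le]) (simp add: pact_def sum_distrib_left mult.assoc)

lemma pact_shift: "pact x (pCons 0 p) \<phi> y = pact x p \<phi> (x * y)"
  by (subst pact_le[OF degree_pCons_le]) (simp add: pact_def sum.atMost_Suc_shift algebra_simps del: sum.atMost_Suc)

lemma pact_one: "pact x 1 \<phi> y = \<phi> y" by (simp add: pact_def)

lemma pact_zero: "pact x 0 \<phi> y = 0" by (simp add: pact_def)

lemma pact_sum: "pact x (\<Sum>r\<in>R. p r) \<phi> y = (\<Sum>r\<in>R. pact x (p r) \<phi> y)"
  by (induction R rule: infinite_finite_induct) (auto simp: pact_zero pact_add)

lemma pact_qlinear: assumes "qlinear \<phi>" shows "qlinear (pact x p \<phi>)"
proof -
  have "x ^ k * (of_rat q * y) = of_rat q * (x ^ k * y)" for k q y by (simp add: mult.left_commute)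
  then show ?thesis using assms
    by (simp add: qlinear_def pact_def distrib_left sum.distrib sum_distrib_left mult.left_commute)
qed

text \<open>A number \<open>x\<close> satisfies an equation with simple complex roots \<open>r\<close>, so multiplication by \<open>x\<close> acts
  diagonalisably on functionals, and the Lagrange interpolation polynomials at the roots project to the eigenspaces. The
  projections are polynomials in \<open>x\<close> and hence preserve the eigenvectors of all other multiplications,
  which is what makes the splitting iterable.\<close>

lemma eigen_split:
  fixes x :: "'k::number_field"
  assumes \<phi>: "qlinear \<phi>"
  shows "\<exists>R \<psi>. finite R \<and> (\<forall>y. \<phi> y = (\<Sum>r\<in>R. \<psi> r y)) \<and> (\<forall>r\<in>R. qlinear (\<psi> r)) \<and>
    (\<forall>r\<in>R. \<forall>y. \<psi> r (x * y) = r * \<psi> r y) \<and>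
    (\<forall>r\<in>R. \<forall>z s. (\<forall>y. \<phi> (z * y) = s * \<phi> y) \<longrightarrow> (\<forall>y. \<psi> r (z * y) = s * \<psi> r y))"
proof -
  obtain f :: "rat poly" where f: "f \<noteq> 0" "poly (map_poly of_rat f) x = 0" "rsquarefree (map_poly of_rat f :: complex poly)"
    by (rule separable_relation)
  define g :: "complex poly" where "g = map_poly of_rat f"
  define R where "R = {z. poly g z = 0}"
  define M where "M = (\<Prod>z\<in>R. [:- z, 1:])"
  have g0: "g \<noteq> 0" using f(1) by (simp add: g_def)
  have fin: "finite R" unfolding R_def by (rule poly_roots_finite[OF g0])
  have gM: "g = Polynomial.smult (Polynomial.lead_coeff g) M"
    using complex_poly_decompose_rsquarefree[of g] f(3) by (simp add: g_def M_def R_def)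
  have killg: "pact x g \<phi> y = 0" for y
  proof -
    have "pact x g \<phi> y = \<phi> (poly (map_poly of_rat f) x * y)"
      using \<phi> by (simp add: pact_def g_def poly_altdef sum_distrib_right qlinear_sum coeff_map_poly qlinear_def mult.assoc)
    also have "\<dots> = 0" using f(2) qlinear_sum[OF \<phi>, of _ "{}"] by simp
    finally show ?thesis .
  qed
  have killM: "pact x M \<phi> y = 0" for y
    using killg[of y] g0 by (subst (asm) gM) (simp add: pact_smult)
  \<comment> \<open>the Lagrange polynomials: \<open>l r\<close> is \<open>1\<close> at \<open>r\<close> and \<open>0\<close> at the other roots\<close>
  define l where "l = (\<lambda>r. Polynomial.smult (1 / (\<Prod>s\<in>R-{r}. r - s)) (\<Prod>s\<in>R-{r}. [:- s, 1:]))"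
  define \<psi> where "\<psi> = (\<lambda>r. pact x (l r) \<phi>)"
  have Rne: "R \<noteq> {}"
  proof
    assume "R = {}"
    then have "M = 1" by (simp add: M_def)
    then have "Polynomial.degree (Polynomial.smult (Polynomial.lead_coeff g) M) = 0" by simp
    then have "Polynomial.degree f = 0" unfolding gM[symmetric] by (simp add: g_def)
    then obtain a where "f = [:a:]" by (rule degree_eq_zeroE)
    then show False using f(1,2) by simp
  qed
  have degl: "Polynomial.degree (l r) < card R" if "r \<in> R" for r
  proof -
    have "Polynomial.degree (\<Prod>s\<in>R-{r}. [:- s, 1:]) \<le> (\<Sum>s\<in>R-{r}. Polynomial.degree [:- s, 1:])"
      using degree_prod_sum_le[of "R-{r}" "\<lambda>s. [:- s, 1:]"] fin by (simp add: o_def)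
    also have "\<dots> = card R - 1" using fin that by simp
    finally have "Polynomial.degree (l r) \<le> card R - 1"
      unfolding l_def using degree_smult_le le_trans by blast
    moreover have "card R > 0" using fin Rne by (simp add: card_gt_0_iff)
    ultimately show ?thesis by linarith
  qed
  have "(\<Sum>r\<in>R. l r) = 1"
  proof (rule poly_eqI_degree[of R])
    show "Polynomial.degree (\<Sum>r\<in>R. l r) < card R"
      by (rule degree_sum_less) (use degl fin Rne in \<open>auto simp: card_gt_0_iff\<close>)
    show "Polynomial.degree (1 :: complex poly) < card R" using fin Rne by (simp add: card_gt_0_iff)
    fix z assume z: "z \<in> R"
    have "poly (l r) z = (if r = z then 1 else 0)" if "r \<in> R" for r
      using that z fin by (auto simp: l_def poly_prod)
    then have "poly (\<Sum>r\<in>R. l r) z = (\<Sum>r\<in>R. if r = z then 1 else 0)" by (simp add: poly_sum)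
    then show "poly (\<Sum>r\<in>R. l r) z = poly 1 z" using z fin by simp
  qed
  then have sum: "\<phi> y = (\<Sum>r\<in>R. \<psi> r y)" for y
    using pact_sum[of x l R \<phi> y] by (simp add: pact_one \<psi>_def)
  have eig: "\<psi> r (x * y) = r * \<psi> r y" if r: "r \<in> R" for r y
  proof -
    have "M = [:- r, 1:] * (\<Prod>s\<in>R-{r}. [:- s, 1:])" unfolding M_def using r fin by (simp add: prod.remove)
    then have "Polynomial.smult (1 / (\<Prod>s\<in>R-{r}. r - s)) M = Polynomial.smult (- r) (l r) + pCons 0 (l r)"
      by (simp add: l_def smult_diff_right mult.commute)
    then have "pact x (Polynomial.smult (- r) (l r) + pCons 0 (l r)) \<phi> y = 0"
      by (simp only: killM pact_smult mult_zero_right flip: \<open>Polynomial.smult _ M = _\<close>)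
    then show ?thesis unfolding pact_add pact_smult pact_shift \<psi>_def by simp
  qed
  have other: "\<psi> r (z * y) = s * \<psi> r y" if "\<And>y. \<phi> (z * y) = s * \<phi> y" for r z s y
    unfolding \<psi>_def pact_def using that by (simp add: mult.left_commute[of _ z] sum_distrib_left mult.left_commute)
  have "qlinear (\<psi> r)" for r unfolding \<psi>_def by (rule pact_qlinear[OF \<phi>])
  then show ?thesis using fin sum eig other by (intro exI[of _ R] exI[of _ \<psi>]) blast
qed


lemma complex_embeddingsD:
  assumes "\<sigma> \<in> complex_embeddings"
  shows "\<sigma> (x + y) = \<sigma> x + \<sigma> y" "\<sigma> (x * y) = \<sigma> x * \<sigma> y" "\<sigma> 1 = 1" "\<sigma> 0 = 0" "\<sigma> (of_rat q) = of_rat q" "qlinear \<sigma>"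
    "\<sigma> (sum f A) = (\<Sum>i\<in>A. \<sigma> (f i))" "\<sigma> (x ^ n) = \<sigma> x ^ n" "\<sigma> (of_int m) = of_int m"
proof -
  interpret field_hom \<sigma> using assms by (simp add: complex_embeddings_def)
  show a: "\<sigma> (x + y) = \<sigma> x + \<sigma> y" "\<sigma> (x * y) = \<sigma> x * \<sigma> y" "\<sigma> 1 = 1" "\<sigma> 0 = 0" "\<sigma> (x ^ n) = \<sigma> x ^ n" for x y
    by (simp_all add: hom_distribs)
  show int: "\<sigma> (of_int m) = of_int m" for m by (rule hom_of_int)
  show rat: "\<sigma> (of_rat q) = of_rat q" for q
  proof -
    obtain a b where q: "q = of_int a / of_int b" and b: "b \<noteq> 0"
      by (metis Fract_of_int_quotient Rat_cases less_irrefl)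
    have "\<sigma> (of_rat q) * \<sigma> (of_int b) = \<sigma> (of_int a)"
      unfolding q a(2)[symmetric] using b by (simp add: of_rat_divide)
    then show ?thesis using b by (simp add: int q of_rat_divide field_simps)
  qed
  show q: "qlinear \<sigma>" by (simp add: qlinear_def a(1,2) rat)
  show "\<sigma> (sum f A) = (\<Sum>i\<in>A. \<sigma> (f i))" by (rule hom_sum)
qed

definition emb_comb :: "('k::number_field \<Rightarrow> complex) \<Rightarrow> bool" where
  "emb_comb \<phi> \<longleftrightarrow> (\<exists>S c. finite S \<and> S \<subseteq> complex_embeddings \<and> (\<forall>y. \<phi> y = (\<Sum>\<sigma>\<in>S. c \<sigma> * \<sigma> y)))"

lemma emb_comb_superset:
  fixes \<phi> :: "'k::number_field \<Rightarrow> complex"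
  assumes "finite S'" "S \<subseteq> S'" "\<phi> y = (\<Sum>\<sigma>\<in>S. c \<sigma> * \<sigma> y)"
  shows "\<phi> y = (\<Sum>\<sigma>\<in>S'. (if \<sigma> \<in> S then c \<sigma> else 0) * \<sigma> y)"
  unfolding assms(3) by (rule sum.mono_neutral_cong_left) (use assms in auto)

lemma emb_comb_add:
  assumes "emb_comb \<phi>" "emb_comb \<psi>" shows "emb_comb (\<lambda>y. \<phi> y + \<psi> y)"
proof -
  obtain S c where S: "finite S" "S \<subseteq> complex_embeddings" "\<And>y. \<phi> y = (\<Sum>\<sigma>\<in>S. c \<sigma> * \<sigma> y)"
    using assms(1) unfolding emb_comb_def by blast
  obtain T e where T: "finite T" "T \<subseteq> complex_embeddings" "\<And>y. \<psi> y = (\<Sum>\<sigma>\<in>T. e \<sigma> * \<sigma> y)"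
    using assms(2) unfolding emb_comb_def by blast
  have "\<phi> y + \<psi> y = (\<Sum>\<sigma>\<in>S \<union> T. ((if \<sigma> \<in> S then c \<sigma> else 0) + (if \<sigma> \<in> T then e \<sigma> else 0)) * \<sigma> y)" for y
    using emb_comb_superset[of "S \<union> T" S \<phi> y c] emb_comb_superset[of "S \<union> T" T \<psi> y e] S T
    by (simp add: distrib_right sum.distrib)
  then show ?thesis unfolding emb_comb_def using S T
    by (intro exI[of _ "S \<union> T"] exI[of _ "\<lambda>\<sigma>. (if \<sigma> \<in> S then c \<sigma> else 0) + (if \<sigma> \<in> T then e \<sigma> else 0)"]) simp
qed

lemma emb_comb_zero: "emb_comb (\<lambda>y. 0)"
  unfolding emb_comb_def by (rule exI[of _ "{}"]) simp

lemma emb_comb_sum: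
  assumes "finite R" "\<And>r. r \<in> R \<Longrightarrow> emb_comb (\<psi> r)" shows "emb_comb (\<lambda>y. \<Sum>r\<in>R. \<psi> r y)"
  using assms by (induction R rule: finite_induct) (simp_all add: emb_comb_zero emb_comb_add)

text \<open>If \<open>\<phi>\<close> is an eigenvector of all multiplications, then \<open>\<phi>(x y) \<phi>(1) = \<phi>(x) \<phi>(y)\<close>, and
  \<open>\<phi> / \<phi>(1)\<close> is a field homomorphism unless \<open>\<phi>\<close> vanishes.\<close>

lemma joint_eigen_emb_comb:
  fixes b :: "nat \<Rightarrow> 'k::number_field"
  assumes "qspan d b = UNIV" "qlinear \<phi>" and eig: "\<And>i y. i < d \<Longrightarrow> \<phi> (b i * y) = ev i * \<phi> y"
  shows "emb_comb \<phi>"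
proof (cases "\<phi> 1 = 0")
  case True
  have "\<phi> y = 0" for y
  proof -
    obtain c where "y = qcomb d b c" using assms(1) unfolding qspan_def by blast
    then have "\<phi> y = (\<Sum>i<d. of_rat (c i) * \<phi> (b i * 1))" using qlinear_qcomb[OF assms(2), of d b c 1] by simp
    also have "\<dots> = 0" using eig[of _ 1] True by simp
    finally show ?thesis .
  qed
  then have "\<phi> = (\<lambda>y. 0)" by auto
  then show ?thesis using emb_comb_zero by simp
next
  case False
  have mult: "\<phi> (x * y) * \<phi> 1 = \<phi> x * \<phi> y" for x y
  proof -
    obtain c where x: "x = qcomb d b c" using assms(1) unfolding qspan_def by blast
    have "\<phi> (x * z) = (\<Sum>i<d. of_rat (c i) * ev i) * \<phi> z" for z
      unfolding x qlinear_qcomb[OF assms(2)] by (simp add: eig sum_distrib_right mult.assoc)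
    from this[of y] this[of 1] show ?thesis by simp
  qed
  define \<sigma> where "\<sigma> = (\<lambda>x. \<phi> x / \<phi> 1)"
  have "\<phi> 0 = 0" using assms(2) qlinear_sum[OF assms(2), of id "{}"] by simp
  have "field_hom \<sigma>"
  proof unfold_locales
    show "\<sigma> (x * y) = \<sigma> x * \<sigma> y" for x y using mult[of x y] False by (simp add: \<sigma>_def field_simps)
  qed (use False assms(2) \<open>\<phi> 0 = 0\<close> in \<open>simp_all add: \<sigma>_def add_divide_distrib qlinear_def\<close>)
  then show ?thesis unfolding emb_comb_def
    by (intro exI[of _ "{\<sigma>}"] exI[of _ "\<lambda>_. \<phi> 1"]) (use False in \<open>simp add: complex_embeddings_def, simp add: \<sigma>_def\<close>)
qed

text \<open>Splitting successively with respect to all elements of a basis ends with joint eigenvectors.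
  This replaces the theorem of the primitive element: it shows without one that there are enough embeddings.\<close>

lemma qlinear_emb_comb:
  fixes \<phi> :: "'k::number_field \<Rightarrow> complex"
  assumes "qlinear \<phi>" shows "emb_comb \<phi>"
proof -
  define d where "d = nf_degree TYPE('k)"
  obtain b :: "nat \<Rightarrow> 'k" where b: "qspan d b = UNIV" unfolding d_def by (rule qbasis_exists)
  have "emb_comb \<phi>" if "j \<le> d" "qlinear \<phi>" "\<And>i. j \<le> i \<Longrightarrow> i < d \<Longrightarrow> \<exists>s. \<forall>y. \<phi> (b i * y) = s * \<phi> y" for j \<phi>
    using that
  proof (induction j arbitrary: \<phi>)
    case 0
    have "\<forall>i. \<exists>s. i < d \<longrightarrow> (\<forall>y. \<phi> (b i * y) = s * \<phi> y)" using "0.prems"(3) by auto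
    from choice[OF this] obtain s where "\<forall>i. i < d \<longrightarrow> (\<forall>y. \<phi> (b i * y) = s i * \<phi> y)" by auto
    then show ?case using joint_eigen_emb_comb[OF b "0.prems"(2), of s] by blast
  next
    case (Suc j)
    obtain R \<psi> where R: "finite R" "\<forall>y. \<phi> y = (\<Sum>r\<in>R. \<psi> r y)" "\<forall>r\<in>R. qlinear (\<psi> r)"
      "\<forall>r\<in>R. \<forall>y. \<psi> r (b j * y) = r * \<psi> r y"
      "\<forall>r\<in>R. \<forall>z s. (\<forall>y. \<phi> (z * y) = s * \<phi> y) \<longrightarrow> (\<forall>y. \<psi> r (z * y) = s * \<psi> r y)"
      using eigen_split[OF Suc.prems(2), of "b j"] by (elim exE conjE) (rule that; assumption)
    have "emb_comb (\<psi> r)" if r: "r \<in> R" for r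
    proof (rule Suc.IH)
      show "j \<le> d" "qlinear (\<psi> r)" using Suc.prems R(3) r by auto
      fix i assume i: "j \<le> i" "i < d"
      show "\<exists>s. \<forall>y. \<psi> r (b i * y) = s * \<psi> r y"
      proof (cases "i = j")
        case True then show ?thesis using R(4) r by blast
      next
        case False
        then obtain s where "\<forall>y. \<phi> (b i * y) = s * \<phi> y" using Suc.prems(3)[of i] i by auto
        then show ?thesis using R(5) r by blast
      qed
    qed
    then have "emb_comb (\<lambda>y. \<Sum>r\<in>R. \<psi> r y)" by (rule emb_comb_sum[OF R(1)])
    moreover have "(\<lambda>y. \<Sum>r\<in>R. \<psi> r y) = \<phi>" using R(2) by (intro ext) simp
    ultimately show ?case by simp
  qed
  from this[of d \<phi>] assms show ?thesis by simp
qed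

text \<open>Dedekind's independence of characters: from a relation subtract \<open>\<tau>(x)\<close> times itself, with \<open>x\<close> chosen to
  distinguish \<open>\<tau>\<close> from another embedding, to obtain a shorter relation.\<close>

lemma embeddings_independent:
  assumes "finite S" "S \<subseteq> complex_embeddings" "\<And>y. (\<Sum>\<sigma>\<in>S. c \<sigma> * \<sigma> y) = 0" "\<sigma> \<in> S"
  shows "c \<sigma> = 0"
  using assms
proof (induction S arbitrary: c \<sigma> rule: finite_induct)
  case (insert \<tau> S)
  have S: "S \<subseteq> complex_embeddings" and tau: "\<tau> \<in> complex_embeddings" using insert.prems by auto
  have zero: "c \<tau> * \<tau> y + (\<Sum>\<sigma>\<in>S. c \<sigma> * \<sigma> y) = 0" for y using insert.prems(2)[of y] insert.hyps by simp
  have cS: "c \<rho> = 0" if rho: "\<rho> \<in> S" for \<rho>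
  proof -
    obtain x where x: "\<rho> x \<noteq> \<tau> x" using rho insert.hyps by (metis ext)
    have "(\<Sum>\<sigma>\<in>S. (c \<sigma> * (\<sigma> x - \<tau> x)) * \<sigma> y) = 0" for y
    proof -
      have "(\<Sum>\<sigma>\<in>S. (c \<sigma> * (\<sigma> x - \<tau> x)) * \<sigma> y) = (\<Sum>\<sigma>\<in>S. c \<sigma> * \<sigma> (x * y)) - \<tau> x * (\<Sum>\<sigma>\<in>S. c \<sigma> * \<sigma> y)"
        unfolding sum_distrib_left sum_subtractf[symmetric]
        by (rule sum.cong) (use S in \<open>auto simp: complex_embeddingsD(2) algebra_simps\<close>)
      also have "\<dots> = - (c \<tau> * \<tau> (x * y)) + \<tau> x * (c \<tau> * \<tau> y)"
        using zero[of "x * y"] zero[of y] by (simp add: add_eq_0_iff)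
      also have "\<dots> = 0" by (simp add: complex_embeddingsD(2)[OF tau])
      finally show ?thesis .
    qed
    then have "c \<rho> * (\<rho> x - \<tau> x) = 0" by (rule insert.IH[OF S _ rho])
    then show ?thesis using x by simp
  qed
  then have "c \<tau> = 0" using zero[of 1] complex_embeddingsD(3)[OF tau] by simp
  then show ?case using cS insert.prems(3) by auto
qed simp


section \<open>Embeddings, norm and trace\<close>

definition qbasis :: "(nat \<Rightarrow> 'k::number_field) \<Rightarrow> bool" where
  "qbasis b \<longleftrightarrow> qindep (nf_degree TYPE('k)) b"

text \<open>Only the entries below the degree are determined.\<close>

definition qcoord :: "(nat \<Rightarrow> 'k::number_field) \<Rightarrow> 'k \<Rightarrow> nat \<Rightarrow> rat" where
  "qcoord b x = (SOME c. qcomb (nf_degree TYPE('k)) b c = x)"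

lemma qcomb_qcoord:
  fixes b :: "nat \<Rightarrow> 'k::number_field"
  assumes "qbasis b" shows "qcomb (nf_degree TYPE('k)) b (qcoord b x) = x"
proof -
  have "x \<in> qspan (nf_degree TYPE('k)) b" using qindep_span_degree assms unfolding qbasis_def by blast
  then have "\<exists>c. qcomb (nf_degree TYPE('k)) b c = x" unfolding qspan_def by blast
  then show ?thesis unfolding qcoord_def by (rule someI_ex)
qed

lemma qcoord_qcomb:
  fixes b :: "nat \<Rightarrow> 'k::number_field"
  assumes "qbasis b" "i < nf_degree TYPE('k)" shows "qcoord b (qcomb (nf_degree TYPE('k)) b c) i = c i"
  using qindep_unique[OF _ qcomb_qcoord[OF assms(1), of "qcomb (nf_degree TYPE('k)) b c"] assms(2)] assms(1)
  by (simp add: qbasis_def)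

lemma qcoord_add:
  fixes b :: "nat \<Rightarrow> 'k::number_field"
  assumes "qbasis b" "i < nf_degree TYPE('k)" shows "qcoord b (x + y) i = qcoord b x i + qcoord b y i"
  using qcoord_qcomb[OF assms, of "\<lambda>i. qcoord b x i + qcoord b y i"] by (simp add: qcomb_add qcomb_qcoord[OF assms(1)])

lemma qcoord_scale:
  fixes b :: "nat \<Rightarrow> 'k::number_field"
  assumes "qbasis b" "i < nf_degree TYPE('k)" shows "qcoord b (of_rat q * x) i = q * qcoord b x i"
  using qcoord_qcomb[OF assms, of "\<lambda>i. q * qcoord b x i"] by (simp add: qcomb_scale qcomb_qcoord[OF assms(1)])

lemma qcoord_basis:
  fixes b :: "nat \<Rightarrow> 'k::number_field"
  assumes "qbasis b" "i < nf_degree TYPE('k)" "j < nf_degree TYPE('k)"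
  shows "qcoord b (b j) i = (if i = j then 1 else 0)"
  using qcoord_qcomb[OF assms(1,2), of "\<lambda>k. if k = j then 1 else 0"] by (simp add: qcomb_unit[OF assms(3)])

lemma qcoord_qlinear:
  fixes b :: "nat \<Rightarrow> 'k::number_field"
  assumes "qbasis b" "i < nf_degree TYPE('k)" shows "qlinear (\<lambda>x. of_rat (qcoord b x i))"
  using assms by (simp add: qlinear_def qcoord_add qcoord_scale of_rat_add of_rat_mult)

lemma embedding_expand:
  fixes b :: "nat \<Rightarrow> 'k::number_field"
  assumes "qbasis b" "\<sigma> \<in> complex_embeddings"
  shows "\<sigma> y = (\<Sum>j<nf_degree TYPE('k). \<sigma> (b j) * of_rat (qcoord b y j))"
proof -
  have "\<sigma> y = \<sigma> (qcomb (nf_degree TYPE('k)) b (qcoord b y))" by (simp only: qcomb_qcoord[OF assms(1)])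
  also have "\<dots> = (\<Sum>j<nf_degree TYPE('k). \<sigma> (b j) * of_rat (qcoord b y j))"
    unfolding qcomb_def by (simp add: complex_embeddingsD[OF assms(2)] mult.commute)
  finally show ?thesis .
qed

lemma embedding_unique_expansion:
  assumes T: "finite T" "T \<subseteq> complex_embeddings" and s: "\<sigma> \<in> complex_embeddings"
    and a: "\<And>y. \<sigma> y = (\<Sum>\<tau>\<in>T. a \<tau> * \<tau> y)"
  shows "\<sigma> \<in> T" "a \<sigma> = 1"
proof -
  define c where "c = (\<lambda>\<tau>. (if \<tau> \<in> T then a \<tau> else 0) - (if \<tau> = \<sigma> then 1 else 0))"
  have fin: "finite (insert \<sigma> T)" using T by simp
  have "(\<Sum>\<tau>\<in>insert \<sigma> T. c \<tau> * \<tau> y) = 0" for y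
  proof -
    have "(\<Sum>\<tau>\<in>insert \<sigma> T. (if \<tau> \<in> T then a \<tau> else 0) * \<tau> y) = \<sigma> y"
      unfolding a[of y] by (rule sum.mono_neutral_cong_right) (use T in auto)
    moreover have "(\<Sum>\<tau>\<in>insert \<sigma> T. (if \<tau> = \<sigma> then 1 else 0) * \<tau> y) = (\<Sum>\<tau>\<in>{\<sigma>}. \<tau> y)"
      by (rule sum.mono_neutral_cong_right) (use T in auto)
    ultimately show ?thesis unfolding c_def by (simp only: left_diff_distrib sum_subtractf) simp
  qed
  then have "c \<sigma> = 0"
    using embeddings_independent[of "insert \<sigma> T" c \<sigma>] T s by blast
  then show "\<sigma> \<in> T" "a \<sigma> = 1" by (auto simp: c_def split: if_splits)
qed

text \<open>The coordinate functionals are combinations of finitely many embeddings \<open>T\<close>. Expanding an arbitrary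
  embedding in the coordinates and comparing with itself shows, by independence, that it belongs to \<open>T\<close>
  and that the matrix \<open>C\<close> is dual to the matrix of the \<open>\<sigma>(b\<^sub>j)\<close>. Computing the trace of the identity
  in two ways then counts the embeddings.\<close>

lemma embeddings_dual:
  fixes b :: "nat \<Rightarrow> 'k::number_field"
  assumes b: "qbasis b"
  shows "finite (complex_embeddings :: ('k \<Rightarrow> complex) set) \<and>
    card (complex_embeddings :: ('k \<Rightarrow> complex) set) = nf_degree TYPE('k) \<and>
    (\<exists>C. (\<forall>j<nf_degree TYPE('k). \<forall>y. of_rat (qcoord b y j) = (\<Sum>\<sigma>\<in>complex_embeddings. C j \<sigma> * \<sigma> y)) \<and>
      (\<forall>\<sigma>\<in>complex_embeddings. (\<Sum>j<nf_degree TYPE('k). \<sigma> (b j) * C j \<sigma>) = 1))"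
proof -
  define d where "d = nf_degree TYPE('k)"
  define E where "E = (complex_embeddings :: ('k \<Rightarrow> complex) set)"
  have "\<forall>j. \<exists>S. j < d \<longrightarrow> finite S \<and> S \<subseteq> E \<and> (\<exists>c. \<forall>y. of_rat (qcoord b y j) = (\<Sum>\<sigma>\<in>S. c \<sigma> * \<sigma> y))"
  proof
    fix j
    show "\<exists>S. j < d \<longrightarrow> finite S \<and> S \<subseteq> E \<and> (\<exists>c. \<forall>y. of_rat (qcoord b y j) = (\<Sum>\<sigma>\<in>S. c \<sigma> * \<sigma> y))"
    proof (cases "j < d")
      case True
      then show ?thesis using qlinear_emb_comb[OF qcoord_qlinear[OF b, of j]] unfolding emb_comb_def d_def E_def by auto
    qed auto
  qed
  from choice[OF this] obtain S where S0: "\<forall>j. j < d \<longrightarrow> finite (S j) \<and> S j \<subseteq> E \<and> (\<exists>c. \<forall>y. of_rat (qcoord b y j) = (\<Sum>\<sigma>\<in>S j. c \<sigma> * \<sigma> y))"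
    by (elim exE)
  have S: "\<And>j. j < d \<Longrightarrow> finite (S j)" "\<And>j. j < d \<Longrightarrow> S j \<subseteq> E"
    "\<And>j. j < d \<Longrightarrow> \<exists>c. \<forall>y. of_rat (qcoord b y j) = (\<Sum>\<sigma>\<in>S j. c \<sigma> * \<sigma> y)" using S0 by simp_all
  define T where "T = (\<Union>j<d. S j)"
  have finT: "finite T" and TE: "T \<subseteq> E" using S unfolding T_def by auto
  have "\<forall>j. \<exists>c. j < d \<longrightarrow> (\<forall>y. of_rat (qcoord b y j) = (\<Sum>\<sigma>\<in>T. c \<sigma> * \<sigma> y))"
  proof
    fix j
    show "\<exists>c. j < d \<longrightarrow> (\<forall>y. of_rat (qcoord b y j) = (\<Sum>\<sigma>\<in>T. c \<sigma> * \<sigma> y))"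
    proof (cases "j < d")
      case True
      then obtain c where c: "\<forall>y. of_rat (qcoord b y j) = (\<Sum>\<sigma>\<in>S j. c \<sigma> * \<sigma> y)" using S(3) by blast
      have "S j \<subseteq> T" using True by (auto simp: T_def)
      then have "of_rat (qcoord b y j) = (\<Sum>\<sigma>\<in>T. (if \<sigma> \<in> S j then c \<sigma> else 0) * \<sigma> y)" for y
        using emb_comb_superset[OF finT, of "S j" "\<lambda>y. of_rat (qcoord b y j)" y c] c by simp
      then show ?thesis by (intro exI[of _ "\<lambda>\<sigma>. if \<sigma> \<in> S j then c \<sigma> else 0"]) blast
    qed auto
  qed
  from choice[OF this] obtain C where
    C: "\<And>j y. j < d \<Longrightarrow> of_rat (qcoord b y j) = (\<Sum>\<sigma>\<in>T. C j \<sigma> * \<sigma> y)" by auto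
  have exp: "\<sigma> y = (\<Sum>\<tau>\<in>T. (\<Sum>j<d. \<sigma> (b j) * C j \<tau>) * \<tau> y)" if "\<sigma> \<in> E" for \<sigma> y
  proof -
    have "\<sigma> y = (\<Sum>j<d. \<sigma> (b j) * (\<Sum>\<tau>\<in>T. C j \<tau> * \<tau> y))"
      using embedding_expand[OF b that[unfolded E_def], of y] by (simp add: C flip: d_def)
    also have "\<dots> = (\<Sum>j<d. \<Sum>\<tau>\<in>T. \<sigma> (b j) * C j \<tau> * \<tau> y)" by (simp add: sum_distrib_left mult.assoc)
    also have "\<dots> = (\<Sum>\<tau>\<in>T. (\<Sum>j<d. \<sigma> (b j) * C j \<tau>) * \<tau> y)" by (subst sum.swap) (simp add: sum_distrib_right)
    finally show ?thesis .
  qed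
  have "E \<subseteq> T" and one: "\<And>\<sigma>. \<sigma> \<in> E \<Longrightarrow> (\<Sum>j<d. \<sigma> (b j) * C j \<sigma>) = 1"
    using embedding_unique_expansion[OF finT TE[unfolded E_def] _ exp] unfolding E_def by auto
  then have ET: "E = T" using TE by blast
  \<comment> \<open>the trace of the identity, in coordinates and in embeddings\<close>
  have "of_nat d = (\<Sum>j<d. of_rat (qcoord b (b j) j) :: complex)"
    using qcoord_basis[OF b] by (simp add: d_def)
  also have "\<dots> = (\<Sum>j<d. \<Sum>\<sigma>\<in>E. C j \<sigma> * \<sigma> (b j))" by (simp add: C ET)
  also have "\<dots> = (\<Sum>\<sigma>\<in>E. \<Sum>j<d. \<sigma> (b j) * C j \<sigma>)" by (subst sum.swap) (simp add: mult.commute)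
  also have "\<dots> = of_nat (card E)" by (simp add: one)
  finally have "card E = d" by (metis of_nat_eq_iff)
  then show ?thesis using finT ET C one unfolding d_def E_def by blast
qed

definition emb_mat :: "(nat \<Rightarrow> 'k::number_field \<Rightarrow> complex) \<Rightarrow> (nat \<Rightarrow> 'k) \<Rightarrow> complex mat" where
  "emb_mat \<sigma> b = mat (nf_degree TYPE('k)) (nf_degree TYPE('k)) (\<lambda>(i, j). \<sigma> i (b j))"

definition emb_enum :: "(nat \<Rightarrow> 'k::number_field \<Rightarrow> complex) \<Rightarrow> bool" where
  "emb_enum \<sigma> \<longleftrightarrow> bij_betw \<sigma> {..<nf_degree TYPE('k)} complex_embeddings"

lemma emb_enumD: "emb_enum (\<sigma> :: nat \<Rightarrow> 'k::number_field \<Rightarrow> complex) \<Longrightarrow> i < nf_degree TYPE('k) \<Longrightarrow> \<sigma> i \<in> complex_embeddings"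
  unfolding emb_enum_def by (auto dest: bij_betwE)

lemma emb_enum_exists: "\<exists>\<sigma> :: nat \<Rightarrow> 'k::number_field \<Rightarrow> complex. emb_enum \<sigma>"
proof -
  obtain b :: "nat \<Rightarrow> 'k" where b: "qindep (nf_degree TYPE('k)) b" by (rule qbasis_exists)
  then have "qbasis b" by (simp add: qbasis_def)
  note e = embeddings_dual[OF this]
  obtain \<sigma> where "bij_betw \<sigma> {0..<card (complex_embeddings :: ('k \<Rightarrow> complex) set)} (complex_embeddings :: ('k \<Rightarrow> complex) set)"
    using ex_bij_betw_nat_finite e by blast
  then have "emb_enum \<sigma>" using e by (simp add: emb_enum_def atLeast0LessThan)
  then show ?thesis by blast
qed

lemma emb_det_nonzero:
  fixes b :: "nat \<Rightarrow> 'k::number_field"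
  assumes b: "qbasis b" and s: "emb_enum \<sigma>"
  shows "det (emb_mat \<sigma> b) \<noteq> 0"
proof -
  define d where "d = nf_degree TYPE('k)"
  obtain C where C: "\<And>j y. j < d \<Longrightarrow> of_rat (qcoord b y j) = (\<Sum>\<sigma>\<in>complex_embeddings. C j \<sigma> * \<sigma> y)"
    using embeddings_dual[OF b] unfolding d_def by blast
  define A where "A = mat d d (\<lambda>(j, k). C j (\<sigma> k))"
  have "A * emb_mat \<sigma> b = 1\<^sub>m d"
  proof (rule eq_matI)
    fix j i assume "j < dim_row (1\<^sub>m d)" "i < dim_col (1\<^sub>m d)"
    then have ji: "j < d" "i < d" by auto
    have "(A * emb_mat \<sigma> b) $$ (j, i) = (\<Sum>k<d. C j (\<sigma> k) * \<sigma> k (b i))"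
      using ji by (simp add: A_def emb_mat_def scalar_prod_def atLeast0LessThan flip: d_def)
    also have "\<dots> = of_rat (qcoord b (b i) j)"
      using s unfolding C[OF ji(1)] emb_enum_def d_def by (rule sum.reindex_bij_betw)
    finally show "(A * emb_mat \<sigma> b) $$ (j, i) = 1\<^sub>m d $$ (j, i)" using ji qcoord_basis[OF b] by (simp add: d_def)
  qed (simp_all add: A_def emb_mat_def d_def)
  then have "det A * det (emb_mat \<sigma> b) = 1"
    using det_mult[of A d "emb_mat \<sigma> b"] by (simp add: A_def emb_mat_def d_def)
  then show ?thesis by auto
qed

lemma emb_det_nonzero_imp_qbasis:
  fixes b :: "nat \<Rightarrow> 'k::number_field"
  assumes s: "emb_enum \<sigma>" and "det (emb_mat \<sigma> b) \<noteq> 0"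
  shows "qbasis b"
  unfolding qbasis_def qindep_def
proof (intro allI impI)
  fix c i assume c: "qcomb (nf_degree TYPE('k)) b c = 0" and i: "i < nf_degree TYPE('k)"
  define d where "d = nf_degree TYPE('k)"
  define v where "v = vec d (\<lambda>i. of_rat (c i) :: complex)"
  have car: "emb_mat \<sigma> b \<in> carrier_mat d d" by (simp add: emb_mat_def d_def)
  have "emb_mat \<sigma> b *\<^sub>v v = 0\<^sub>v d"
  proof (rule eq_vecI)
    fix k assume "k < dim_vec (0\<^sub>v d)"
    then have k: "k < d" by simp
    have "(emb_mat \<sigma> b *\<^sub>v v) $ k = (\<Sum>i<d. \<sigma> k (b i) * of_rat (c i))"
      using k by (simp add: emb_mat_def v_def scalar_prod_def atLeast0LessThan flip: d_def)
    also have "\<dots> = \<sigma> k (qcomb d b c)"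
      using emb_enumD[OF s] k unfolding qcomb_def d_def by (simp add: complex_embeddingsD mult.commute)
    also have "\<dots> = 0" using c emb_enumD[OF s] k by (simp add: d_def complex_embeddingsD)
    finally show "(emb_mat \<sigma> b *\<^sub>v v) $ k = 0\<^sub>v d $ k" using k by simp
  qed (simp add: emb_mat_def d_def)
  moreover have "v \<in> carrier_vec d" by (simp add: v_def)
  ultimately have "v = 0\<^sub>v d" using det_0_iff_vec_prod_zero[OF car] assms(2) by blast
  then have "v $ i = 0" using i by (simp add: d_def)
  then show "c i = 0" using i by (simp add: v_def d_def)
qed

text \<open>The matrix of multiplication by \<open>w\<close> in the basis \<open>b\<close>.\<close>

definition qnorm_mat :: "(nat \<Rightarrow> 'k::number_field) \<Rightarrow> 'k \<Rightarrow> rat mat" where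
  "qnorm_mat b w = mat (nf_degree TYPE('k)) (nf_degree TYPE('k)) (\<lambda>(i, j). qcoord b (w * b j) i)"

text \<open>The matrix \<open>V\<close> of the embeddings conjugates multiplication by \<open>w\<close> to the diagonal matrix of the
  conjugates of \<open>w\<close>.\<close>

lemma det_qnorm_mat:
  fixes b :: "nat \<Rightarrow> 'k::number_field"
  assumes b: "qbasis b" and s: "emb_enum \<sigma>"
  shows "of_rat (det (qnorm_mat b w)) = (\<Prod>k<nf_degree TYPE('k). \<sigma> k w)"
proof -
  define d where "d = nf_degree TYPE('k)"
  define V where "V = emb_mat \<sigma> b"
  define M where "M = map_mat complex_of_rat (qnorm_mat b w)"
  define L where "L = mat d d (\<lambda>(i, j). if i = j then \<sigma> i w else 0)"
  have car: "V \<in> carrier_mat d d" "M \<in> carrier_mat d d" "L \<in> carrier_mat d d"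
    by (simp_all add: V_def emb_mat_def M_def qnorm_mat_def L_def d_def)
  have "V * M = L * V"
  proof (rule eq_matI)
    fix k j assume "k < dim_row (L * V)" "j < dim_col (L * V)"
    then have kj: "k < d" "j < d" using car by auto
    have "(V * M) $$ (k, j) = (\<Sum>i<d. \<sigma> k (b i) * of_rat (qcoord b (w * b j) i))"
      using kj by (simp add: V_def M_def emb_mat_def qnorm_mat_def scalar_prod_def atLeast0LessThan flip: d_def)
    also have "\<dots> = \<sigma> k (w * b j)"
      using embedding_expand[OF b emb_enumD[OF s], of k "w * b j"] kj by (simp add: d_def)
    also have "\<dots> = \<sigma> k w * \<sigma> k (b j)" using emb_enumD[OF s] kj by (simp add: d_def complex_embeddingsD)
    also have "\<dots> = (\<Sum>i<d. if i = k then \<sigma> k w * \<sigma> i (b j) else 0)" using kj by simp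
    also have "\<dots> = (\<Sum>i<d. (if k = i then \<sigma> k w else 0) * \<sigma> i (b j))" by (rule sum.cong) auto
    also have "\<dots> = (L * V) $$ (k, j)"
      using kj by (simp add: V_def L_def emb_mat_def scalar_prod_def atLeast0LessThan flip: d_def)
    finally show "(V * M) $$ (k, j) = (L * V) $$ (k, j)" .
  qed (use car in auto)
  then have "det V * det M = det L * det V" unfolding det_mult[OF car(1,2), symmetric] det_mult[OF car(3,1), symmetric] by simp
  then have "det M = det L" using emb_det_nonzero[OF b s] by (simp add: V_def)
  also have "det L = (\<Prod>k<d. \<sigma> k w)"
  proof -
    have "det L = prod_list (diag_mat L)"
      by (rule det_upper_triangular[OF _ car(3)]) (auto simp: L_def upper_triangular_def)
    also have "diag_mat L = map (\<lambda>k. \<sigma> k w) [0..<d]" by (auto simp: diag_mat_def L_def)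
    finally show ?thesis by (simp add: prod.list_conv_set_nth prod.distinct_set_conv_list atLeast0LessThan flip: prod.distinct_set_conv_list)
  qed
  also have "det M = of_rat (det (qnorm_mat b w))" unfolding M_def by (rule of_rat_hom.hom_det)
  finally show ?thesis by (simp add: d_def)
qed

definition qtrace :: "'k::number_field \<Rightarrow> rat" where
  "qtrace x = (let b = (SOME b. qbasis b) in \<Sum>j<nf_degree TYPE('k). qcoord b (x * b j) j)"

lemma qbasis_ex: "\<exists>b :: nat \<Rightarrow> 'k::number_field. qbasis b"
  by (rule qbasis_exists) (auto simp: qbasis_def)

lemma qtrace_embeddings:
  fixes x :: "'k::number_field"
  shows "of_rat (qtrace x) = (\<Sum>\<sigma>\<in>complex_embeddings. \<sigma> x)"
proof -
  define d where "d = nf_degree TYPE('k)"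
  define b :: "nat \<Rightarrow> 'k" where "b = (SOME b. qbasis b)"
  have b: "qbasis b" unfolding b_def by (rule someI_ex[OF qbasis_ex])
  obtain C where C: "\<And>j y. j < d \<Longrightarrow> of_rat (qcoord b y j) = (\<Sum>\<sigma>\<in>complex_embeddings. C j \<sigma> * \<sigma> y)"
    "\<And>\<sigma>. \<sigma> \<in> complex_embeddings \<Longrightarrow> (\<Sum>j<d. \<sigma> (b j) * C j \<sigma>) = 1"
    using embeddings_dual[OF b] unfolding d_def by blast
  have "of_rat (qtrace x) = (\<Sum>j<d. of_rat (qcoord b (x * b j) j) :: complex)"
    by (simp add: qtrace_def b_def[symmetric] of_rat_sum d_def)
  also have "\<dots> = (\<Sum>j<d. \<Sum>\<sigma>\<in>complex_embeddings. C j \<sigma> * \<sigma> (x * b j))" by (simp add: C)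
  also have "\<dots> = (\<Sum>\<sigma>\<in>complex_embeddings. \<Sum>j<d. C j \<sigma> * \<sigma> (x * b j))" by (rule sum.swap)
  also have "\<dots> = (\<Sum>\<sigma>\<in>complex_embeddings. \<sigma> x * (\<Sum>j<d. \<sigma> (b j) * C j \<sigma>))"
    by (rule sum.cong) (auto simp: complex_embeddingsD sum_distrib_left algebra_simps)
  also have "\<dots> = (\<Sum>\<sigma>\<in>complex_embeddings. \<sigma> x)" by (simp add: C(2))
  finally show ?thesis .
qed


section \<open>Algebraic integers and the discriminant\<close>

text \<open>Such a number is an eigenvalue of the integer matrix \<open>A\<close>, hence a root of its monic
  characteristic polynomial.\<close>

lemma algebraic_int_if_integer_matrix:
  fixes x :: "'a::field_char_0" and v :: "'i \<Rightarrow> 'a"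
  assumes fin: "finite I" and k: "k \<in> I" "v k \<noteq> 0"
    and eq: "\<And>i. i \<in> I \<Longrightarrow> x * v i = (\<Sum>j\<in>I. of_int (A i j) * v j)"
  shows "algebraic_int x"
proof -
  define n where "n = card I"
  obtain e where e: "bij_betw e {0..<n} I" using ex_bij_betw_nat_finite[OF fin] unfolding n_def by blast
  define M :: "int mat" where "M = mat n n (\<lambda>(i, j). A (e i) (e j))"
  define w where "w = vec n (\<lambda>i. v (e i))"
  have car: "M \<in> carrier_mat n n" "of_int_hom.mat_hom M \<in> carrier_mat n n" "w \<in> carrier_vec n"
    by (simp_all add: M_def w_def)
  obtain k' where k': "k' < n" "e k' = k" using k e unfolding bij_betw_def by (metis atLeastLessThan_iff imageE)
  then have "w $ k' \<noteq> 0" using k by (simp add: w_def)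
  then have w0: "w \<noteq> 0\<^sub>v n" using k' by auto
  have "of_int_hom.mat_hom M *\<^sub>v w = x \<cdot>\<^sub>v w"
  proof (rule eq_vecI)
    fix i assume "i < dim_vec (x \<cdot>\<^sub>v w)"
    then have i: "i < n" by (simp add: w_def)
    then have "e i \<in> I" using e by (auto dest: bij_betwE)
    have "(of_int_hom.mat_hom M *\<^sub>v w) $ i = (\<Sum>j\<in>{0..<n}. of_int (A (e i) (e j)) * v (e j))"
      using i by (simp add: M_def w_def scalar_prod_def)
    also have "\<dots> = (\<Sum>j\<in>I. of_int (A (e i) j) * v j)" by (rule sum.reindex_bij_betw[OF e])
    also have "\<dots> = (x \<cdot>\<^sub>v w) $ i" using eq[OF \<open>e i \<in> I\<close>] i by (simp add: w_def)
    finally show "(of_int_hom.mat_hom M *\<^sub>v w) $ i = (x \<cdot>\<^sub>v w) $ i" .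
  qed (simp add: M_def w_def)
  then have "eigenvalue (of_int_hom.mat_hom M) x"
    unfolding eigenvalue_def eigenvector_def using car w0 by auto
  then have "poly (char_poly (of_int_hom.mat_hom M :: 'a mat)) x = 0"
    using eigenvalue_root_char_poly[OF car(2)] by blast
  then have "poly (of_int_poly (char_poly M)) x = 0" by (simp only: of_int_hom.char_poly_hom[OF car(1)])
  moreover have "monic (char_poly M)" using degree_monic_char_poly[OF car(1)] by simp
  ultimately show ?thesis unfolding algebraic_int_altdef_ipoly by blast
qed

definition zcombs :: "('i \<Rightarrow> 'a::comm_ring_1) \<Rightarrow> 'i set \<Rightarrow> 'a set" where
  "zcombs v I = {\<Sum>i\<in>I. of_int (c i) * v i | c. True}"

lemma zcombsI: "x = (\<Sum>i\<in>I. of_int (c i) * v i) \<Longrightarrow> x \<in> zcombs v I"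
  unfolding zcombs_def by (intro CollectI exI[of _ c]) simp

lemma zcombs_zero: "0 \<in> zcombs v I"
  by (rule zcombsI[of _ "\<lambda>_. 0"]) simp

lemma zcombs_add: assumes "x \<in> zcombs v I" "y \<in> zcombs v I" shows "x + y \<in> zcombs v I"
proof -
  obtain c e where "x = (\<Sum>i\<in>I. of_int (c i) * v i)" "y = (\<Sum>i\<in>I. of_int (e i) * v i)" using assms unfolding zcombs_def by blast
  then have "x + y = (\<Sum>i\<in>I. of_int (c i + e i) * v i)" by (simp add: distrib_right sum.distrib)
  then show ?thesis by (rule zcombsI)
qed

lemma zcombs_scale: assumes "x \<in> zcombs v I" shows "of_int a * x \<in> zcombs v I"
proof -
  obtain c where "x = (\<Sum>i\<in>I. of_int (c i) * v i)" using assms unfolding zcombs_def by blast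
  then have "of_int a * x = (\<Sum>i\<in>I. of_int (a * c i) * v i)" by (simp add: sum_distrib_left mult.assoc)
  then show ?thesis by (rule zcombsI)
qed

lemma zcombs_sum: "(\<And>j. j \<in> J \<Longrightarrow> f j \<in> zcombs v I) \<Longrightarrow> (\<Sum>j\<in>J. of_int (a j) * f j) \<in> zcombs v I"
  by (induction J rule: infinite_finite_induct) (simp_all add: zcombs_zero zcombs_add zcombs_scale)

lemma zcombs_base: assumes "finite I" "i \<in> I" shows "v i \<in> zcombs v I"
proof -
  have "v i = (\<Sum>j\<in>I. of_int (if j = i then 1 else 0) * v j)"
    using assms by (subst sum.remove[OF assms]) simp
  then show ?thesis by (rule zcombsI)
qed

lemma algebraic_int_if_zcombs_stable:
  fixes x :: "'a::field_char_0"
  assumes "finite I" "k \<in> I" "v k \<noteq> 0" "\<And>i. i \<in> I \<Longrightarrow> x * v i \<in> zcombs v I"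
  shows "algebraic_int x"
proof -
  have "\<forall>i. \<exists>c. i \<in> I \<longrightarrow> x * v i = (\<Sum>j\<in>I. of_int (c j) * v j)"
    using assms(4) unfolding zcombs_def by blast
  from choice[OF this] obtain A where "\<forall>i. i \<in> I \<longrightarrow> x * v i = (\<Sum>j\<in>I. of_int (A i j) * v j)" by (elim exE)
  then show ?thesis using algebraic_int_if_integer_matrix[of I k v x A] assms by blast
qed

text \<open>The equation of integral dependence reduces all powers to those below its degree.\<close>

lemma algebraic_int_power_zcombs:
  fixes x :: "'a::field_char_0"
  assumes "algebraic_int x"
  shows "\<exists>m>0. \<forall>n. x ^ n \<in> zcombs (\<lambda>i. x ^ i) {..<m}"
proof -
  obtain p :: "int poly" where p: "poly (of_int_poly p) x = 0" "Polynomial.lead_coeff p = 1"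
    using assms unfolding algebraic_int_altdef_ipoly by blast
  define m where "m = Polynomial.degree p"
  have m0: "m > 0"
  proof (rule ccontr)
    assume "\<not> m > 0"
    then have "Polynomial.degree p = 0" by (simp add: m_def)
    then obtain a where a: "p = [:a:]" by (rule degree_eq_zeroE)
    then show False using p by simp
  qed
  have red: "x ^ (m + n) = (\<Sum>i<m. of_int (- poly.coeff p i) * x ^ (i + n))" for n
  proof -
    have "0 = poly (of_int_poly p) x * x ^ n" using p by simp
    also have "\<dots> = (\<Sum>i\<le>m. of_int (poly.coeff p i) * x ^ (i + n))"
      unfolding poly_altdef m_def by (simp add: sum_distrib_right power_add mult.assoc)
    also have "\<dots> = (\<Sum>i<m. of_int (poly.coeff p i) * x ^ (i + n)) + x ^ (m + n)"
      using p(2) by (simp add: m_def lessThan_Suc_atMost[symmetric])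
    finally show ?thesis by (simp add: sum_negf eq_neg_iff_add_eq_0 add.commute)
  qed
  have "x ^ n \<in> zcombs (\<lambda>i. x ^ i) {..<m}" for n
  proof (induction n rule: less_induct)
    case (less n)
    show ?case
    proof (cases "n < m")
      case True then show ?thesis using zcombs_base[of "{..<m}" n "\<lambda>i. x ^ i"] by simp
    next
      case False
      then have "x ^ n = (\<Sum>i<m. of_int (- poly.coeff p i) * x ^ (i + (n - m)))" using red[of "n - m"] by simp
      also have "\<dots> \<in> zcombs (\<lambda>i. x ^ i) {..<m}"
        by (rule zcombs_sum) (rule less, use False in auto)
      finally show ?thesis .
    qed
  qed
  then show ?thesis using m0 by blast
qed

text \<open>The products \<open>x\<^sup>i y\<^sup>j\<close> below the two degrees span a module over the integers that is stable under both \<open>x\<close> and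
  \<open>y\<close>.\<close>

lemma
  fixes x y :: "'a::field_char_0"
  assumes "algebraic_int x" "algebraic_int y"
  shows algebraic_int_plus: "algebraic_int (x + y)" and algebraic_int_times: "algebraic_int (x * y)"
proof -
  obtain m where m: "m > 0" "\<And>n. x ^ n \<in> zcombs (\<lambda>i. x ^ i) {..<m}" using algebraic_int_power_zcombs[OF assms(1)] by blast
  obtain l where l: "l > 0" "\<And>n. y ^ n \<in> zcombs (\<lambda>i. y ^ i) {..<l}" using algebraic_int_power_zcombs[OF assms(2)] by blast
  define I where "I = {..<m} \<times> {..<l}"
  define v where "v = (\<lambda>(i, j). x ^ i * y ^ j)"
  have mem: "x ^ a * y ^ b \<in> zcombs v I" for a b
  proof -
    obtain c e where c: "x ^ a = (\<Sum>i<m. of_int (c i) * x ^ i)" "y ^ b = (\<Sum>i<l. of_int (e i) * y ^ i)"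
      using m(2)[of a] l(2)[of b] unfolding zcombs_def by blast
    have "x ^ a * y ^ b = (\<Sum>(i, j)\<in>I. (of_int (c i) * x ^ i) * (of_int (e j) * y ^ j))"
      unfolding c I_def by (simp add: sum_product sum.cartesian_product)
    also have "\<dots> = (\<Sum>k\<in>I. of_int (c (fst k) * e (snd k)) * v k)"
      by (rule sum.cong) (auto simp: v_def algebra_simps)
    finally show ?thesis unfolding zcombs_def by (intro CollectI exI[of _ "\<lambda>k. c (fst k) * e (snd k)"] conjI TrueI)
  qed
  have I: "finite I" "(0, 0) \<in> I" "v (0, 0) \<noteq> 0" using m l by (simp_all add: I_def v_def)
  show "algebraic_int (x + y)"
  proof (rule algebraic_int_if_zcombs_stable[where v = v, OF I])
    fix k assume "k \<in> I"
    have "(x + y) * v k = x ^ Suc (fst k) * y ^ snd k + x ^ fst k * y ^ Suc (snd k)"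
      by (simp add: v_def case_prod_beta algebra_simps)
    then show "(x + y) * v k \<in> zcombs v I" by (simp only: zcombs_add mem)
  qed
  show "algebraic_int (x * y)"
  proof (rule algebraic_int_if_zcombs_stable[where v = v, OF I])
    fix k assume "k \<in> I"
    have "(x * y) * v k = x ^ Suc (fst k) * y ^ Suc (snd k)"
      by (simp add: v_def case_prod_beta algebra_simps)
    then show "(x * y) * v k \<in> zcombs v I" by (simp only: mem)
  qed
qed

lemma algebraic_int_of_int: "algebraic_int (of_int n :: 'a::field_char_0)"
  by (rule int_imp_algebraic_int) simp

lemma algebraic_int_sum: "(\<And>i. i \<in> A \<Longrightarrow> algebraic_int (f i)) \<Longrightarrow> algebraic_int (sum f A :: 'a::field_char_0)"
  using algebraic_int_of_int[of 0] by (induction A rule: infinite_finite_induct) (auto intro: algebraic_int_plus)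

lemma algebraic_int_embedding:
  assumes "algebraic_int x" "\<sigma> \<in> complex_embeddings" shows "algebraic_int (\<sigma> x)"
proof -
  obtain p :: "int poly" where p: "poly (of_int_poly p) x = 0" "Polynomial.lead_coeff p = 1"
    using assms(1) unfolding algebraic_int_altdef_ipoly by blast
  have "poly (of_int_poly p) (\<sigma> x) = \<sigma> (poly (of_int_poly p) x)"
    unfolding poly_altdef by (simp add: complex_embeddingsD[OF assms(2)])
  also have "\<dots> = 0" using p(1) complex_embeddingsD(4)[OF assms(2)] by simp
  finally show ?thesis using p(2) unfolding algebraic_int_altdef_ipoly by blast
qed

text \<open>The trace is a rational number and, as a sum of conjugates, an algebraic integer.\<close>

lemma qtrace_int:
  fixes x :: "'k::number_field" assumes "algebraic_int x" shows "qtrace x \<in> \<int>"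
proof -
  have "algebraic_int (of_rat (qtrace x) :: complex)"
    unfolding qtrace_embeddings by (rule algebraic_int_sum) (rule algebraic_int_embedding[OF assms])
  then have "(of_rat (qtrace x) :: complex) \<in> \<int>"
    by (rule rational_algebraic_int_is_int) auto
  then obtain n where "(of_rat (qtrace x) :: complex) = of_int n" by (rule Ints_cases)
  then have "(of_rat (qtrace x) :: complex) = of_rat (of_int n)" by simp
  then have "qtrace x = of_int n" unfolding of_rat_eq_iff .
  then show ?thesis by simp
qed

definition qdisc :: "(nat \<Rightarrow> 'k::number_field) \<Rightarrow> rat" where
  "qdisc b = det (mat (nf_degree TYPE('k)) (nf_degree TYPE('k)) (\<lambda>(i, j). qtrace (b i * b j)))"

lemma qdisc_embeddings:
  fixes b :: "nat \<Rightarrow> 'k::number_field"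
  assumes s: "emb_enum \<sigma>"
  shows "of_rat (qdisc b) = (det (emb_mat \<sigma> b))\<^sup>2"
proof -
  define d where "d = nf_degree TYPE('k)"
  define V where "V = emb_mat \<sigma> b"
  have car: "V \<in> carrier_mat d d" by (simp add: V_def emb_mat_def d_def)
  have "of_rat (qdisc b) = det (map_mat of_rat (mat d d (\<lambda>(i, j). qtrace (b i * b j))) :: complex mat)"
    unfolding qdisc_def d_def by (rule of_rat_hom.hom_det[symmetric])
  also have "map_mat of_rat (mat d d (\<lambda>(i, j). qtrace (b i * b j))) = V\<^sup>T * V"
  proof (rule eq_matI)
    fix i j assume "i < dim_row (V\<^sup>T * V)" "j < dim_col (V\<^sup>T * V)"
    then have ij: "i < d" "j < d" using car by auto
    have "(V\<^sup>T * V) $$ (i, j) = (\<Sum>k<d. \<sigma> k (b i) * \<sigma> k (b j))"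
      using ij by (simp add: V_def emb_mat_def scalar_prod_def atLeast0LessThan flip: d_def)
    also have "\<dots> = (\<Sum>k<d. \<sigma> k (b i * b j))"
      using emb_enumD[OF s] by (simp add: d_def complex_embeddingsD)
    also have "\<dots> = (\<Sum>\<tau>\<in>complex_embeddings. \<tau> (b i * b j))"
      using s unfolding emb_enum_def d_def by (rule sum.reindex_bij_betw)
    also have "\<dots> = of_rat (qtrace (b i * b j))" by (rule qtrace_embeddings[symmetric])
    finally show "map_mat of_rat (mat d d (\<lambda>(i, j). qtrace (b i * b j))) $$ (i, j) = (V\<^sup>T * V) $$ (i, j)"
      using ij by simp
  qed (use car in auto)
  also have "det (V\<^sup>T * V) = (det V)\<^sup>2"
    using det_mult[of "V\<^sup>T" d V] det_transpose[OF car] car by (simp add: power2_eq_square)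
  finally show ?thesis by (simp add: V_def)
qed

lemma det_int:
  fixes A :: "'a::field_char_0 mat"
  assumes "\<And>i j. i < dim_row A \<Longrightarrow> j < dim_col A \<Longrightarrow> A $$ (i, j) \<in> \<int>" shows "det A \<in> \<int>"
proof (cases "dim_row A = dim_col A")
  case True
  have "A $$ (i, p i) \<in> \<int>" if "p permutes {0..<dim_row A}" "i \<in> {0..<dim_row A}" for p i
    using permutes_in_image[OF that(1), of i] that True assms[of i "p i"] by auto
  then show ?thesis unfolding det_def using True by (auto intro!: Ints_sum Ints_mult Ints_prod)
qed (simp add: det_def)

lemma qdisc_int:
  fixes b :: "nat \<Rightarrow> 'k::number_field"
  assumes "\<And>i. i < nf_degree TYPE('k) \<Longrightarrow> algebraic_int (b i)" shows "qdisc b \<in> \<int>"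
  unfolding qdisc_def by (rule det_int) (auto intro!: qtrace_int algebraic_int_times assms)

lemma qdisc_nonzero_iff:
  fixes b :: "nat \<Rightarrow> 'k::number_field" shows "qdisc b \<noteq> 0 \<longleftrightarrow> qbasis b"
proof -
  obtain \<sigma> :: "nat \<Rightarrow> 'k \<Rightarrow> complex" where s: "emb_enum \<sigma>" using emb_enum_exists by blast
  have "of_rat (qdisc b) = (det (emb_mat \<sigma> b))\<^sup>2" by (rule qdisc_embeddings[OF s])
  then have "qdisc b \<noteq> 0 \<longleftrightarrow> det (emb_mat \<sigma> b) \<noteq> 0" by (metis of_rat_eq_0_iff power2_eq_square mult_eq_0_iff)
  then show ?thesis using emb_det_nonzero[OF _ s] emb_det_nonzero_imp_qbasis[OF s] by blast
qed


lemma common_denominator: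
  assumes "finite S" shows "\<exists>m::int. m > 0 \<and> (\<forall>q\<in>S. of_int m * (q :: rat) \<in> \<int>)"
  using assms
proof (induction S rule: finite_induct)
  case empty then show ?case by (intro exI[of _ 1]) simp
next
  case (insert q S)
  then obtain m where m: "m > 0" "\<forall>q\<in>S. of_int m * q \<in> \<int>" by blast
  obtain a b where q: "q = of_int a / of_int b" "b > 0" by (metis Fract_of_int_quotient Rat_cases)
  have "of_int (m * b) * r \<in> \<int>" if "r \<in> insert q S" for r
  proof (cases "r = q")
    case True
    then have "of_int (m * b) * r = of_int (m * a)" using q by simp
    then show ?thesis by (metis Ints_of_int)
  next
    case False
    then have "of_int m * r \<in> \<int>" using that m by simp
    then have "of_int b * (of_int m * r) \<in> \<int>" by (rule Ints_mult[OF Ints_of_int])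
    moreover have "of_int (m * b) * r = of_int b * (of_int m * r)" by simp
    ultimately show ?thesis by (simp only:)
  qed
  moreover have "m * b > 0" using m q by simp
  ultimately show ?case by blast
qed

text \<open>A common denominator of the entries makes the matrix of multiplication by \<open>x\<close> integral.\<close>

lemma integral_multiple:
  fixes x :: "'k::number_field" shows "\<exists>m::int. m > 0 \<and> algebraic_int (of_int m * x)"
proof -
  define d where "d = nf_degree TYPE('k)"
  obtain b :: "nat \<Rightarrow> 'k" where b: "qbasis b" using qbasis_ex by blast
  obtain m :: int where m: "m > 0" "\<forall>q\<in>(\<lambda>(i, j). qcoord b (x * b j) i) ` ({..<d} \<times> {..<d}). of_int m * q \<in> \<int>"
    using common_denominator[of "(\<lambda>(i, j). qcoord b (x * b j) i) ` ({..<d} \<times> {..<d})"] by auto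
  define A where "A = (\<lambda>j i. \<lfloor>of_int m * qcoord b (x * b j) i\<rfloor>)"
  have A: "of_int (A j i) = of_int m * qcoord b (x * b j) i" if "i < d" "j < d" for i j
  proof -
    have "of_int m * qcoord b (x * b j) i \<in> \<int>" using m(2) that by auto
    then show ?thesis unfolding A_def by (metis Ints_cases floor_of_int)
  qed
  have dpos: "0 < d" unfolding d_def by (rule nf_degree_pos)
  have "\<exists>k<d. b k \<noteq> 0"
  proof (rule ccontr)
    assume "\<not> ?thesis"
    then have "qcomb d b (\<lambda>_. 1) = 0" by (simp add: qcomb_def)
    then show False using b dpos unfolding qbasis_def qindep_def d_def by fastforce
  qed
  then obtain k where k: "k \<in> {..<d}" "b k \<noteq> 0" by auto
  have "algebraic_int (of_int m * x)"
  proof (rule algebraic_int_if_integer_matrix[of "{..<d}" k b, OF finite_lessThan k])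
    fix j assume j: "j \<in> {..<d}"
    have "of_int m * x * b j = of_rat (of_int m) * qcomb d b (qcoord b (x * b j))"
      unfolding qcomb_qcoord[OF b, folded d_def] by simp
    also have "\<dots> = (\<Sum>i<d. of_rat (of_int m * qcoord b (x * b j) i) * b i)"
      unfolding qcomb_def by (simp add: sum_distrib_left of_rat_mult mult.assoc)
    also have "\<dots> = (\<Sum>i<d. of_rat (of_int (A j i)) * b i)"
      by (rule sum.cong) (use j A in auto)
    finally show "of_int m * x * b j = (\<Sum>i<d. of_int (A j i) * b i)" by simp
  qed
  then show ?thesis using m(1) by blast
qed

text \<open>By Cramer's rule, exchanging one basis vector multiplies the determinant of the embeddings by one
  coordinate of the new vector.\<close>

lemma qdisc_replace:
  fixes b :: "nat \<Rightarrow> 'k::number_field"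
  assumes b: "qbasis b" and i: "i < nf_degree TYPE('k)"
  shows "qdisc (b(i := qcomb (nf_degree TYPE('k)) b c)) = (c i)\<^sup>2 * qdisc b"
proof -
  define d where "d = nf_degree TYPE('k)"
  obtain \<sigma> :: "nat \<Rightarrow> 'k \<Rightarrow> complex" where s: "emb_enum \<sigma>" using emb_enum_exists by blast
  define V where "V = emb_mat \<sigma> b"
  define v where "v = vec d (\<lambda>j. of_rat (c j) :: complex)"
  have car: "V \<in> carrier_mat d d" "v \<in> carrier_vec d" by (simp_all add: V_def v_def emb_mat_def d_def)
  have "emb_mat \<sigma> (b(i := qcomb d b c)) = replace_col V (V *\<^sub>v v) i"
  proof (rule eq_matI)
    fix k j assume "k < dim_row (replace_col V (V *\<^sub>v v) i)" "j < dim_col (replace_col V (V *\<^sub>v v) i)"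
    then have kj: "k < d" "j < d" using car by (auto simp: replace_col_def)
    have "(V *\<^sub>v v) $ k = \<sigma> k (qcomb d b c)"
      using kj emb_enumD[OF s, of k] unfolding qcomb_def
      by (simp add: V_def v_def emb_mat_def scalar_prod_def atLeast0LessThan complex_embeddingsD mult.commute flip: d_def)
    then show "emb_mat \<sigma> (b(i := qcomb d b c)) $$ (k, j) = replace_col V (V *\<^sub>v v) i $$ (k, j)"
      using kj car by (simp add: replace_col_def emb_mat_def V_def flip: d_def)
  qed (use car in \<open>auto simp: replace_col_def emb_mat_def d_def\<close>)
  then have "det (emb_mat \<sigma> (b(i := qcomb d b c))) = of_rat (c i) * det V"
    using cramer_lemma_mat[OF car, of i] i by (simp add: v_def d_def)
  then have "of_rat (qdisc (b(i := qcomb d b c))) = (of_rat ((c i)\<^sup>2 * qdisc b) :: complex)"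
    unfolding qdisc_embeddings[OF s] of_rat_mult V_def by (simp add: power_mult_distrib of_rat_power)
  then show ?thesis by (simp add: d_def)
qed

text \<open>If some coordinate of \<open>x\<close> had a fractional part \<open>q > 0\<close>, then replacing the corresponding basis
  vector by \<open>x\<close> minus a multiple of this vector would scale the discriminant by \<open>q\<^sup>2 < 1\<close>.\<close>

lemma qcoord_integral_if_minimal:
  fixes b :: "nat \<Rightarrow> 'k::number_field"
  assumes b: "qbasis b" "\<And>i. i < nf_degree TYPE('k) \<Longrightarrow> algebraic_int (b i)"
    and min: "\<And>b' :: nat \<Rightarrow> 'k. qbasis b' \<Longrightarrow> (\<And>i. i < nf_degree TYPE('k) \<Longrightarrow> algebraic_int (b' i)) \<Longrightarrow> \<bar>qdisc b\<bar> \<le> \<bar>qdisc b'\<bar>"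
    and x: "algebraic_int x" and i: "i < nf_degree TYPE('k)"
  shows "qcoord b x i \<in> \<int>"
proof (rule ccontr)
  define d where "d = nf_degree TYPE('k)"
  assume n: "qcoord b x i \<notin> \<int>"
  define q where "q = qcoord b x i - of_int \<lfloor>qcoord b x i\<rfloor>"
  have q: "0 < q" "q < 1"
    using n floor_correct[of "qcoord b x i"] unfolding q_def by (auto simp: order_less_le) (metis Ints_of_int)
  \<comment> \<open>the coordinates of \<open>x\<close> minus the integral part of its coordinate at \<open>i\<close>\<close>
  define c where "c = (\<lambda>j. qcoord b x j - of_int \<lfloor>qcoord b x i\<rfloor> * (if j = i then 1 else 0))"
  have comb: "qcomb d b c = x + of_int (- \<lfloor>qcoord b x i\<rfloor>) * b i"
    unfolding c_def qcomb_diff qcomb_scale using qcomb_qcoord[OF b(1), of x] i by (simp add: d_def qcomb_unit)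
  have D: "qdisc (b(i := qcomb d b c)) = q\<^sup>2 * qdisc b" using qdisc_replace[OF b(1) i, of c] by (simp add: c_def q_def d_def)
  have D0: "qdisc b \<noteq> 0" using b(1) qdisc_nonzero_iff by blast
  have "\<bar>qdisc b\<bar> \<le> \<bar>qdisc (b(i := qcomb d b c))\<bar>"
  proof (rule min)
    show "qbasis (b(i := qcomb d b c))" using qdisc_nonzero_iff[of "b(i := qcomb d b c)"] D D0 q by simp
    show "algebraic_int ((b(i := qcomb d b c)) j)" if "j < nf_degree TYPE('k)" for j
      unfolding comb using b(2)[OF that] b(2)[OF i] x by (auto intro!: algebraic_int_plus algebraic_int_times algebraic_int_of_int simp del: of_int_minus)
  qed
  then have "\<bar>qdisc b\<bar> \<le> q\<^sup>2 * \<bar>qdisc b\<bar>" unfolding D by (simp add: abs_mult)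
  moreover have "q\<^sup>2 < 1" using q by (simp add: power_less_one_iff)
  ultimately show False using D0 by (simp add: not_le[symmetric] mult_le_cancel_right1)
qed

text \<open>Discriminants of rational bases of algebraic integers are nonzero integers, so there is one of least
  absolute value.\<close>

lemma integral_basis_exists: "\<exists>\<omega> :: nat \<Rightarrow> 'k::number_field. integral_basis \<omega>"
proof -
  define d where "d = nf_degree TYPE('k)"
  define P where "P = (\<lambda>b :: nat \<Rightarrow> 'k. qbasis b \<and> (\<forall>i<d. algebraic_int (b i)))"
  obtain b0 :: "nat \<Rightarrow> 'k" where b0: "qbasis b0" using qbasis_ex by blast
  obtain m where m: "\<And>i. m i > 0" "\<And>i. algebraic_int (of_int (m i) * b0 i)"
    using choice[of "\<lambda>i m. m > 0 \<and> algebraic_int (of_int m * b0 i)"] integral_multiple by blast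
  have "qbasis (\<lambda>i. of_int (m i) * b0 i)"
    unfolding qbasis_def qindep_def
  proof (intro allI impI)
    fix c i assume "qcomb (nf_degree TYPE('k)) (\<lambda>i. of_int (m i) * b0 i) c = 0" and i: "i < nf_degree TYPE('k)"
    then have "qcomb (nf_degree TYPE('k)) b0 (\<lambda>i. c i * of_int (m i)) = 0"
      by (simp add: qcomb_def of_rat_mult mult.assoc)
    then have "c i * of_int (m i) = 0" using b0 i unfolding qbasis_def qindep_def by blast
    then show "c i = 0" using m(1)[of i] by simp
  qed
  then have "P (\<lambda>i. of_int (m i) * b0 i)" using m(2) by (simp add: P_def)
  then obtain b where b: "P b" and min: "\<And>b'. P b' \<Longrightarrow> nat \<lfloor>\<bar>qdisc b\<bar>\<rfloor> \<le> nat \<lfloor>\<bar>qdisc b'\<bar>\<rfloor>"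
    using ex_has_least_nat[of P _ "\<lambda>b. nat \<lfloor>\<bar>qdisc b\<bar>\<rfloor>"] by blast
  have "\<bar>qdisc b\<bar> \<le> \<bar>qdisc b'\<bar>" if Pb': "P b'" for b'
  proof -
    obtain u where u: "qdisc b = of_int u" using qdisc_int[of b] b unfolding P_def d_def by (blast elim: Ints_cases)
    obtain v where v: "qdisc b' = of_int v" using qdisc_int[of b'] Pb' unfolding P_def d_def by (blast elim: Ints_cases)
    show ?thesis using min[OF Pb'] unfolding u v by (simp flip: of_int_abs)
  qed
  then have int: "qcoord b x i \<in> \<int>" if "algebraic_int x" "i < d" for x i
    using qcoord_integral_if_minimal[of b x i] b that unfolding P_def d_def by blast
  have "integral_basis b"
    unfolding integral_basis_def
  proof (intro conjI allI impI)
    show "algebraic_int (b i)" if "i < nf_degree TYPE('k)" for i using b that by (simp add: P_def d_def)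
    fix x :: 'k assume x: "algebraic_int x"
    have bb: "qbasis b" using b by (simp add: P_def)
    show "\<exists>!c. c \<in> {..<nf_degree TYPE('k)} \<rightarrow>\<^sub>E (UNIV :: int set) \<and> x = (\<Sum>i<nf_degree TYPE('k). of_int (c i) * b i)"
    proof (rule ex1I[of _ "\<lambda>i\<in>{..<d}. \<lfloor>qcoord b x i\<rfloor>"])
      have "x = qcomb d b (qcoord b x)" using qcomb_qcoord[OF bb, of x] by (simp add: d_def)
      also have "\<dots> = (\<Sum>i<d. of_int \<lfloor>qcoord b x i\<rfloor> * b i)"
        unfolding qcomb_def
      proof (rule sum.cong)
        fix i assume "i \<in> {..<d}"
        then have "qcoord b x i = of_int \<lfloor>qcoord b x i\<rfloor>" using int[OF x, of i] by (metis Ints_cases floor_of_int lessThan_iff)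
        then show "of_rat (qcoord b x i) * b i = of_int \<lfloor>qcoord b x i\<rfloor> * b i" by (metis of_rat_of_int_eq)
      qed simp
      finally show "(\<lambda>i\<in>{..<d}. \<lfloor>qcoord b x i\<rfloor>) \<in> {..<nf_degree TYPE('k)} \<rightarrow>\<^sub>E (UNIV :: int set) \<and>
         x = (\<Sum>i<nf_degree TYPE('k). of_int ((\<lambda>i\<in>{..<d}. \<lfloor>qcoord b x i\<rfloor>) i) * b i)"
        by (simp add: d_def PiE_def)
      fix c assume c: "c \<in> {..<nf_degree TYPE('k)} \<rightarrow>\<^sub>E (UNIV :: int set) \<and> x = (\<Sum>i<nf_degree TYPE('k). of_int (c i) * b i)"
      then have "x = qcomb d b (\<lambda>i. of_int (c i))" by (simp add: qcomb_def d_def)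
      then have eq: "qcoord b x i = of_int (c i)" if "i < d" for i using qcoord_qcomb[OF bb, of i] that unfolding d_def by simp
      show "c = (\<lambda>i\<in>{..<d}. \<lfloor>qcoord b x i\<rfloor>)"
      proof
        fix i show "c i = (\<lambda>i\<in>{..<d}. \<lfloor>qcoord b x i\<rfloor>) i"
          using eq[of i] c by (cases "i < d") (auto simp: PiE_def extensional_def d_def)
      qed
    qed
  qed
  then show ?thesis by blast
qed

text \<open>A rational relation can be cleared of denominators and then contradicts the uniqueness of the
  integral expansion of \<open>0\<close>.\<close>

lemma integral_basis_qbasis:
  fixes \<omega> :: "nat \<Rightarrow> 'k::number_field"
  assumes "integral_basis \<omega>" shows "qbasis \<omega>"
  unfolding qbasis_def qindep_def
proof (intro allI impI)
  define d where "d = nf_degree TYPE('k)"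
  fix c i assume c: "qcomb (nf_degree TYPE('k)) \<omega> c = 0" and i: "i < nf_degree TYPE('k)"
  obtain m :: int where m: "m > 0" "\<forall>q\<in>c ` {..<d}. of_int m * q \<in> \<int>"
    using common_denominator[of "c ` {..<d}"] by auto
  define e where "e = (\<lambda>i\<in>{..<d}. \<lfloor>of_int m * c i\<rfloor>)"
  have e: "of_int (e i) = of_int m * c i" if "i < d" for i
  proof -
    have "of_int m * c i \<in> \<int>" using m(2) that by auto
    then show ?thesis using that unfolding e_def by (metis Ints_cases floor_of_int lessThan_iff restrict_apply')
  qed
  have ez: "0 = (\<Sum>i<d. of_int (e i) * \<omega> i)"
  proof -
    have "(\<Sum>i<d. of_int (e i) * \<omega> i) = qcomb d \<omega> (\<lambda>i. of_int m * c i)"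
      unfolding qcomb_def by (rule sum.cong) (auto simp flip: e)
    also have "\<dots> = 0" unfolding qcomb_scale using c by (simp add: d_def)
    finally show ?thesis by simp
  qed
  have "algebraic_int (0::'k)" by simp
  then have uniq: "\<exists>!c. c \<in> {..<d} \<rightarrow>\<^sub>E (UNIV :: int set) \<and> 0 = (\<Sum>i<d. of_int (c i) * \<omega> i)"
    using assms unfolding integral_basis_def d_def by blast
  have "e = (\<lambda>i\<in>{..<d}. 0)"
  proof (rule ex1E[OF uniq])
    fix c0 assume "\<forall>y. y \<in> {..<d} \<rightarrow>\<^sub>E (UNIV :: int set) \<and> 0 = (\<Sum>i<d. of_int (y i) * \<omega> i) \<longrightarrow> y = c0"
    note u = this[rule_format]
    have "e = c0" by (rule u) (use ez in \<open>simp add: e_def PiE_def\<close>)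
    moreover have "(\<lambda>i\<in>{..<d}. 0) = c0" by (rule u) (simp add: PiE_def)
    ultimately show ?thesis by simp
  qed
  then have "e i = 0" using i by (simp add: d_def)
  then show "c i = 0" using e[of i] i m by (simp add: d_def)
qed

lemma integral_basis_qdisc:
  fixes \<omega> \<omega>' :: "nat \<Rightarrow> 'k::number_field"
  assumes "integral_basis \<omega>" "integral_basis \<omega>'" shows "\<exists>n::int. qdisc \<omega>' = qdisc \<omega> * (of_int n)\<^sup>2"
proof -
  define d where "d = nf_degree TYPE('k)"
  obtain \<sigma> :: "nat \<Rightarrow> 'k \<Rightarrow> complex" where s: "emb_enum \<sigma>" using emb_enum_exists by blast
  have "\<exists>c. \<omega>' j = (\<Sum>i<d. of_int (c i) * \<omega> i)" if "j < d" for j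
  proof -
    have "algebraic_int (\<omega>' j)" using assms(2) that unfolding integral_basis_def d_def by simp
    then have "\<exists>!c. c \<in> {..<d} \<rightarrow>\<^sub>E (UNIV :: int set) \<and> \<omega>' j = (\<Sum>i<d. of_int (c i) * \<omega> i)"
      using assms(1) unfolding integral_basis_def d_def by simp
    from ex1_implies_ex[OF this] show ?thesis by (elim exE conjE) (rule exI)
  qed
  then have "\<forall>j. \<exists>c. j < d \<longrightarrow> \<omega>' j = (\<Sum>i<d. of_int (c i) * \<omega> i)" by blast
  from choice[OF this] obtain c where c: "\<forall>j. j < d \<longrightarrow> \<omega>' j = (\<Sum>i<d. of_int (c j i) * \<omega> i)" by (elim exE)
  define A :: "int mat" where "A = mat d d (\<lambda>(i, j). c j i)"
  have car: "A \<in> carrier_mat d d" "emb_mat \<sigma> \<omega> \<in> carrier_mat d d" "map_mat of_int A \<in> carrier_mat d d"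
    by (simp_all add: A_def emb_mat_def d_def)
  have "emb_mat \<sigma> \<omega>' = emb_mat \<sigma> \<omega> * map_mat of_int A"
  proof (rule eq_matI)
    fix k j assume "k < dim_row (emb_mat \<sigma> \<omega> * map_mat complex_of_int A)" "j < dim_col (emb_mat \<sigma> \<omega> * map_mat complex_of_int A)"
    then have kj: "k < d" "j < d" using car by auto
    then show "emb_mat \<sigma> \<omega>' $$ (k, j) = (emb_mat \<sigma> \<omega> * map_mat complex_of_int A) $$ (k, j)"
      using c emb_enumD[OF s, of k] 
      by (simp add: A_def emb_mat_def scalar_prod_def atLeast0LessThan complex_embeddingsD mult.commute flip: d_def)
  qed (simp_all add: A_def emb_mat_def d_def)
  then have "det (emb_mat \<sigma> \<omega>') = det (emb_mat \<sigma> \<omega>) * of_int (det A)"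
    using det_mult[OF car(2,3)] by (simp add: of_int_hom.hom_det)
  then have "(of_rat (qdisc \<omega>') :: complex) = of_rat (qdisc \<omega> * (of_int (det A))\<^sup>2)"
    by (simp add: qdisc_embeddings[OF s] of_rat_mult of_rat_power power_mult_distrib)
  then show ?thesis unfolding of_rat_eq_iff by blast
qed

text \<open>Two integral bases differ by integer matrices in both directions, so their discriminants agree. This
  makes the definite description in the definition of the discriminant meaningful; the common value is a nonzero
  integer.\<close>

theorem nf_discriminant_ge_1: "\<bar>real_of_int (nf_discriminant TYPE('k::number_field))\<bar> \<ge> 1"
proof -
  obtain \<omega> :: "nat \<Rightarrow> 'k" where w: "integral_basis \<omega>" using integral_basis_exists by blast
  have nz: "qdisc \<omega> \<noteq> 0" using qdisc_nonzero_iff integral_basis_qbasis[OF w] by blast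
  have "qdisc \<omega> \<in> \<int>" by (rule qdisc_int) (use w in \<open>simp add: integral_basis_def\<close>)
  then obtain D where D: "qdisc \<omega> = of_int D" by (rule Ints_cases)
  obtain \<sigma> :: "nat \<Rightarrow> 'k \<Rightarrow> complex" where s: "emb_enum \<sigma>" using emb_enum_exists by blast
  have eq: "qdisc \<omega>' = qdisc \<omega>" if w': "integral_basis \<omega>'" for \<omega>' :: "nat \<Rightarrow> 'k"
  proof -
    obtain n where n: "qdisc \<omega>' = qdisc \<omega> * (of_int n)\<^sup>2" using integral_basis_qdisc[OF w w'] by blast
    obtain l where l: "qdisc \<omega> = qdisc \<omega>' * (of_int l)\<^sup>2" using integral_basis_qdisc[OF w' w] by blast
    have "of_int ((n * l)\<^sup>2) = (1::rat)" using n l nz by (simp add: power_mult_distrib mult.commute)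
    then have "(n * l)\<^sup>2 = 1" by (metis of_int_eq_1_iff)
    then have "\<bar>n * l\<bar> = 1" unfolding power2_eq_1_iff by linarith
    then have "\<bar>n\<bar> = 1" by (auto simp: abs_mult zmult_eq_1_iff)
    then have "n\<^sup>2 = 1" by (metis power2_abs power_one)
    then have "(of_int n :: rat)\<^sup>2 = 1" by (metis of_int_1 of_int_power)
    then show ?thesis using n by simp
  qed
  have char: "(\<exists>(\<omega> :: nat \<Rightarrow> 'k) \<sigma>. integral_basis \<omega> \<and> bij_betw \<sigma> {..<nf_degree TYPE('k)} complex_embeddings \<and>
     of_int \<delta> = (det (mat (nf_degree TYPE('k)) (nf_degree TYPE('k)) (\<lambda>(i, j). \<sigma> i (\<omega> j))))\<^sup>2) \<longleftrightarrow> \<delta> = D" for \<delta>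
  proof
    assume "\<exists>(\<omega> :: nat \<Rightarrow> 'k) \<sigma>. integral_basis \<omega> \<and> bij_betw \<sigma> {..<nf_degree TYPE('k)} complex_embeddings \<and>
     of_int \<delta> = (det (mat (nf_degree TYPE('k)) (nf_degree TYPE('k)) (\<lambda>(i, j). \<sigma> i (\<omega> j))))\<^sup>2"
    then obtain \<omega>' :: "nat \<Rightarrow> 'k" and \<tau> where t: "integral_basis \<omega>'" "emb_enum \<tau>" "of_int \<delta> = (det (emb_mat \<tau> \<omega>'))\<^sup>2"
      unfolding emb_enum_def emb_mat_def by blast
    then have "of_int \<delta> = (of_rat (qdisc \<omega>) :: complex)" using qdisc_embeddings[OF t(2)] eq[OF t(1)] by metis
    then show "\<delta> = D" unfolding D by simp
  next
    assume "\<delta> = D"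
    then have "of_int \<delta> = (det (emb_mat \<sigma> \<omega>))\<^sup>2" using qdisc_embeddings[OF s, of \<omega>] D by simp
    then show "\<exists>(\<omega> :: nat \<Rightarrow> 'k) \<sigma>. integral_basis \<omega> \<and> bij_betw \<sigma> {..<nf_degree TYPE('k)} complex_embeddings \<and>
     of_int \<delta> = (det (mat (nf_degree TYPE('k)) (nf_degree TYPE('k)) (\<lambda>(i, j). \<sigma> i (\<omega> j))))\<^sup>2"
      using w s unfolding emb_enum_def emb_mat_def by blast
  qed
  have "nf_discriminant TYPE('k) = D" unfolding nf_discriminant_def char by simp
  moreover have "D \<noteq> 0" using nz D by simp
  then have "\<bar>D\<bar> \<ge> 1" by linarith
  then have "\<bar>real_of_int D\<bar> \<ge> 1" by linarith
  ultimately show ?thesis by simp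
qed


section \<open>Extension of absolute values\<close>

text \<open>Submultiplicative seminorms of \<open>K\<close> bounded by \<open>a\<close> on the rational numbers. The minimal ones among
  them turn out to be the absolute values that extend \<open>a\<close>.\<close>

definition sub_abs :: "(rat \<Rightarrow> real) \<Rightarrow> ('k::field_char_0 \<Rightarrow> real) \<Rightarrow> bool" where
  "sub_abs a s \<longleftrightarrow> (\<forall>x. s x \<ge> 0) \<and> (\<forall>x y. s (x + y) \<le> s x + s y) \<and> (\<forall>x y. s (x * y) \<le> s x * s y) \<and>
     s 1 = 1 \<and> (\<forall>q. s (of_rat q) \<le> a q)"

lemma absolute_valueD:
  assumes "absolute_value \<nu>"
  shows "\<nu> x \<ge> 0" "\<nu> x = 0 \<longleftrightarrow> x = 0" "\<nu> (x * y) = \<nu> x * \<nu> y" "\<nu> (x + y) \<le> \<nu> x + \<nu> y"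
    "\<nu> 0 = 0" "\<nu> 1 = 1" "\<nu> (- x) = \<nu> x" "\<nu> (x ^ n) = \<nu> x ^ n" "\<nu> (inverse x) = inverse (\<nu> x)" "x \<noteq> 0 \<Longrightarrow> \<nu> x > 0"
    "\<nu> (x / y) = \<nu> x / \<nu> y" "\<nu> (x - y) \<le> \<nu> x + \<nu> y"
proof -
  show nn: "\<nu> x \<ge> 0" and z: "\<nu> x = 0 \<longleftrightarrow> x = 0" and m: "\<nu> (x * y) = \<nu> x * \<nu> y" and tri: "\<nu> (x + y) \<le> \<nu> x + \<nu> y" for x y
    using assms by (auto simp: absolute_value_def)
  show "\<nu> 0 = 0" using z by simp
  show "x \<noteq> 0 \<Longrightarrow> \<nu> x > 0" using nn[of x] z[of x] by linarith
  have "\<nu> 1 * \<nu> 1 = \<nu> 1" using m[of 1 1] by simp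
  then show one: "\<nu> 1 = 1" using z[of 1] by simp
  have "\<nu> (-1) * \<nu> (-1) = 1" using m[of "-1" "-1"] one by simp
  then have "\<nu> (-1) = 1" using nn[of "-1"] by (auto simp: square_eq_1_iff)
  then show neg: "\<nu> (- x) = \<nu> x" for x using m[of "-1" x] by simp
  show "\<nu> (x ^ n) = \<nu> x ^ n" by (induction n) (simp_all add: one m)
  show inv: "\<nu> (inverse x) = inverse (\<nu> x)" for x
  proof (cases "x = 0")
    case False
    then have "\<nu> x * \<nu> (inverse x) = 1" using m[of x "inverse x"] one by simp
    then show ?thesis by (metis inverse_unique)
  qed (use z[of 0] in simp)
  show "\<nu> (x / y) = \<nu> x / \<nu> y" by (simp add: divide_inverse m inv)
  show "\<nu> (x - y) \<le> \<nu> x + \<nu> y" using tri[of x "- y"] neg[of y] by simp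
qed

lemma absolute_value_sum:
  assumes "absolute_value \<nu>" shows "\<nu> (sum f A) \<le> (\<Sum>i\<in>A. \<nu> (f i))"
proof (induction A rule: infinite_finite_induct)
  case (insert x F)
  then show ?case using absolute_valueD(4)[OF assms, of "f x" "sum f F"] by simp
qed (simp_all add: absolute_valueD(5)[OF assms])

lemma absolute_value_prod:
  assumes "absolute_value \<nu>" shows "\<nu> (prod f A) = (\<Prod>i\<in>A. \<nu> (f i))"
  by (induction A rule: infinite_finite_induct) (simp_all add: absolute_valueD(3,6)[OF assms])

lemma sub_absD:
  assumes "sub_abs a s"
  shows "s x \<ge> 0" "s (x + y) \<le> s x + s y" "s (x * y) \<le> s x * s y" "s 1 = 1" "s (of_rat q) \<le> a q"
  using assms by (auto simp: sub_abs_def)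

lemma sub_abs_zero: assumes "sub_abs a s" "absolute_value a" shows "s 0 = 0"
  using sub_absD(5)[OF assms(1), of 0] absolute_valueD(5)[OF assms(2)] sub_absD(1)[OF assms(1), of 0] by simp

lemma sub_abs_sum: assumes "sub_abs a s" "absolute_value a" shows "s (sum f A) \<le> (\<Sum>i\<in>A. s (f i))"
proof (induction A rule: infinite_finite_induct)
  case (insert x F)
  then show ?case using sub_absD(2)[OF assms(1), of "f x" "sum f F"] by simp
qed (simp_all add: sub_abs_zero[OF assms])

lemma sub_abs_power: assumes "sub_abs a s" shows "s (x ^ n) \<le> s x ^ n"
proof (induction n)
  case (Suc n)
  have "s (x ^ Suc n) \<le> s x * s (x ^ n)" using sub_absD(3)[OF assms, of x "x ^ n"] by simp
  also have "\<dots> \<le> s x * s x ^ n" by (rule mult_left_mono[OF Suc sub_absD(1)[OF assms]])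
  finally show ?case by simp
qed (simp add: sub_absD(4)[OF assms])

text \<open>The weighted coefficient norm on \<open>K[T]\<close> with \<open>T\<close> of size \<open>t\<close>; its quotient by \<open>T = y\<^sup>-\<^sup>1\<close> is the
  largest seminorm below \<open>s\<close> in which the inverse of \<open>y\<close> has size at most \<open>t\<close>.\<close>

definition weight :: "('k::field_char_0 \<Rightarrow> real) \<Rightarrow> real \<Rightarrow> 'k poly \<Rightarrow> real" where
  "weight s t p = (\<Sum>i\<le>Polynomial.degree p. s (poly.coeff p i) * t ^ i)"

context
  fixes a :: "rat \<Rightarrow> real" and s :: "'k::field_char_0 \<Rightarrow> real" and t :: real
  assumes a: "absolute_value a" and s: "sub_abs a s" and t: "t > 0"
begin

lemma weight_le: assumes "Polynomial.degree p \<le> n" shows "weight s t p = (\<Sum>i\<le>n. s (poly.coeff p i) * t ^ i)"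
  unfolding weight_def
  by (rule sum.mono_neutral_left) (use assms sub_abs_zero[OF s a] in \<open>auto simp: coeff_eq_0\<close>)

lemma weight_nonneg: "weight s t p \<ge> 0"
  unfolding weight_def using sub_absD(1)[OF s] t by (intro sum_nonneg mult_nonneg_nonneg) auto

lemma weight_add: "weight s t (p + q) \<le> weight s t p + weight s t q"
proof -
  let ?n = "max (Polynomial.degree p) (Polynomial.degree q)"
  have "weight s t (p + q) \<le> (\<Sum>i\<le>?n. s (poly.coeff p i) * t ^ i + s (poly.coeff q i) * t ^ i)"
    unfolding weight_le[of "p + q" ?n, OF degree_add_le_max]
    by (rule sum_mono) (use sub_absD(2)[OF s] t in \<open>simp flip: distrib_right\<close>)
  then show ?thesis by (simp add: weight_le[of p ?n] weight_le[of q ?n] sum.distrib)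
qed

lemma weight_smult: "weight s t (Polynomial.smult c p) \<le> s c * weight s t p"
  by (subst weight_le[OF degree_smult_le], unfold weight_def sum_distrib_left, rule sum_mono)
    (use sub_absD(3)[OF s] t in \<open>simp flip: mult.assoc\<close>)

lemma weight_pCons: "weight s t (pCons c p) = s c + t * weight s t p"
  by (subst weight_le[OF degree_pCons_le])
    (simp add: weight_def sum.atMost_Suc_shift sum_distrib_left mult_ac sub_abs_zero[OF s a] del: sum.atMost_Suc)

lemma weight_zero: "weight s t 0 = 0" using sub_abs_zero[OF s a] by (simp add: weight_def)

lemma weight_mult: "weight s t (p * q) \<le> weight s t p * weight s t q"
proof (induction p)
  case 0 then show ?case by (simp add: weight_zero)
next
  case (pCons c p)
  have "weight s t (pCons c p * q) \<le> weight s t (Polynomial.smult c q) + weight s t (pCons 0 (p * q))"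
    unfolding mult_pCons_left by (rule weight_add)
  also have "\<dots> \<le> s c * weight s t q + t * (weight s t p * weight s t q)"
    unfolding weight_pCons[of 0 "p * q"] sub_abs_zero[OF s a] add_0_left
    by (intro add_mono weight_smult mult_left_mono pCons.IH) (use t in auto)
  also have "\<dots> = weight s t (pCons c p) * weight s t q" by (simp add: weight_pCons algebra_simps)
  finally show ?case .
qed

lemma weight_const: "weight s t [:c:] = s c" using weight_pCons[of c 0] by (simp add: weight_zero)

text \<open>Suppose that \<open>1 = \<Sum> c\<^sub>i y\<^sup>-\<^sup>i\<close> with weight \<open>\<theta> < 1\<close>. Multiplying by \<open>y\<^sup>N\<close> bounds
  \<open>A N = s(y\<^sup>N) t\<^sup>N\<close> by \<open>\<theta>\<close> times the largest of the values \<open>A (N - i)\<close> with \<open>i\<close> at most the degree, so \<open>A\<close>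
  decays geometrically, against \<open>A N \<ge> 1\<close>.\<close>

lemma weight_ge_one:
  assumes y: "y \<noteq> 0" and grow: "\<And>n. s (y ^ n) * t ^ n \<ge> 1" and p: "poly p (inverse y) = 1"
  shows "weight s t p \<ge> 1"
proof (rule ccontr)
  define \<theta> where "\<theta> = weight s t p"
  define n where "n = Polynomial.degree p"
  define A where "A = (\<lambda>N. s (y ^ N) * t ^ N)"
  assume "\<not> ?thesis"
  then have th: "\<theta> < 1" "\<theta> \<ge> 0" using weight_nonneg by (auto simp: \<theta>_def)
  have A0: "A N \<ge> 0" for N unfolding A_def using sub_absD(1)[OF s] t by simp
  \<comment> \<open>the relation multiplied by \<open>y\<^sup>N\<close>\<close>
  have rec: "A N \<le> (\<Sum>i\<le>n. s (poly.coeff p i) * t ^ i * A (N - i))" if "N \<ge> n" for N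
  proof -
    have "y ^ N = y ^ N * poly p (inverse y)" using p by simp
    also have "\<dots> = (\<Sum>i\<le>n. poly.coeff p i * (y ^ N * inverse y ^ i))"
      unfolding poly_altdef n_def by (simp add: sum_distrib_left mult_ac)
    also have "\<dots> = (\<Sum>i\<le>n. poly.coeff p i * y ^ (N - i))"
    proof (rule sum.cong)
      fix i assume "i \<in> {..n}"
      then have "y ^ N = y ^ (N - i) * y ^ i" using that by (simp flip: power_add)
      then show "poly.coeff p i * (y ^ N * inverse y ^ i) = poly.coeff p i * y ^ (N - i)"
        using y by (simp add: power_inverse)
    qed simp
    finally have "s (y ^ N) \<le> (\<Sum>i\<le>n. s (poly.coeff p i * y ^ (N - i)))" using sub_abs_sum[OF s a] by metis
    also have "\<dots> \<le> (\<Sum>i\<le>n. s (poly.coeff p i) * s (y ^ (N - i)))" by (rule sum_mono) (rule sub_absD(3)[OF s])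
    finally have "A N \<le> (\<Sum>i\<le>n. s (poly.coeff p i) * s (y ^ (N - i))) * t ^ N"
      unfolding A_def using t by (simp add: mult_right_mono)
    also have "\<dots> = (\<Sum>i\<le>n. s (poly.coeff p i) * t ^ i * A (N - i))"
      unfolding sum_distrib_right A_def
    proof (rule sum.cong)
      fix i assume "i \<in> {..n}"
      then have "t ^ N = t ^ i * t ^ (N - i)" using that by (simp flip: power_add)
      then show "s (poly.coeff p i) * s (y ^ (N - i)) * t ^ N = s (poly.coeff p i) * t ^ i * (s (y ^ (N - i)) * t ^ (N - i))"
        by simp
    qed simp
    finally show ?thesis .
  qed
  have step: "A N \<le> \<theta> * B" if "N \<ge> n" "\<And>i. i \<le> n \<Longrightarrow> A (N - i) \<le> B" for N B
  proof -
    have "A N \<le> (\<Sum>i\<le>n. s (poly.coeff p i) * t ^ i * A (N - i))" by (rule rec[OF that(1)])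
    also have "\<dots> \<le> (\<Sum>i\<le>n. s (poly.coeff p i) * t ^ i * B)"
      by (rule sum_mono) (use that(2) sub_absD(1)[OF s] t in \<open>auto intro!: mult_left_mono\<close>)
    also have "\<dots> = \<theta> * B" by (simp add: \<theta>_def weight_def n_def sum_distrib_right)
    finally show ?thesis .
  qed
  have A1: "A N \<ge> 1" for N using grow by (simp add: A_def)
  have n0: "n > 0"
  proof (rule ccontr)
    assume "\<not> n > 0"
    then have "A 0 \<le> \<theta> * A 0" using step[of 0 "A 0"] by simp
    then show False using A1[of 0] th mult_strict_right_mono[of \<theta> 1 "A 0"] by simp
  qed
  define B where "B = Max (A ` {..n})"
  have B: "A i \<le> B" if "i \<le> n" for i unfolding B_def using that by simp
  have B0: "B \<ge> 1" using B[of 0] A1[of 0] by simp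
  have bound: "A N \<le> B" for N
  proof (induction N rule: less_induct)
    case (less N)
    show ?case
    proof (cases "N \<le> n")
      case False
      have m: "A (N - i) \<le> max B (A N)" if "i \<le> n" for i
        using less[of "N - i"] False that by (cases i) (auto simp: le_max_iff_disj)
      show ?thesis
      proof (rule ccontr)
        assume c: "\<not> A N \<le> B"
        then have "A N \<le> \<theta> * A N" using step[of N "max B (A N)"] m False by (simp add: max_def)
        then show False using A1[of N] th mult_strict_right_mono[of \<theta> 1 "A N"] by simp
      qed
    qed (use B in auto)
  qed
  have decay: "A N \<le> \<theta> ^ k * B" if "N \<ge> k * n" for N k
    using that
  proof (induction k arbitrary: N)
    case (Suc k)
    have "A N \<le> \<theta> * (\<theta> ^ k * B)"
    proof (rule step)
      show "n \<le> N" using Suc.prems by simp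
      show "A (N - i) \<le> \<theta> ^ k * B" if "i \<le> n" for i using Suc.IH[of "N - i"] Suc.prems that by simp
    qed
    then show ?case by (simp add: mult.assoc)
  qed (use bound in auto)
  obtain k where "\<theta> ^ k < 1 / B" using real_arch_pow_inv[of "1 / B" \<theta>] th B0 by auto
  then have "\<theta> ^ k * B < 1" using B0 by (simp add: field_simps)
  then show False using decay[of k "k * n"] A1[of "k * n"] by simp
qed

end

text \<open>The spectral radius of \<open>y\<close> is at least \<open>r\<close>, so one may lower the seminorm until \<open>y\<^sup>-\<^sup>1\<close> has size
  at most \<open>1 / r\<close>: take the quotient of the weight on \<open>K[T]\<close> at \<open>T = y\<^sup>-\<^sup>1\<close>. The bound
  \<open>weight_ge_one\<close> guarantees that \<open>1\<close> keeps size \<open>1\<close>.\<close>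

lemma adjoin_inverse:
  fixes s :: "'k::field_char_0 \<Rightarrow> real"
  assumes a: "absolute_value a" and s: "sub_abs a s" and y: "y \<noteq> 0" and r: "r > 0" "\<And>n. r ^ n \<le> s (y ^ n)"
  shows "\<exists>s'. sub_abs a s' \<and> (\<forall>x. s' x \<le> s x) \<and> s' (inverse y) \<le> 1 / r"
proof -
  define t where "t = 1 / r"
  have t: "t > 0" using r by (simp add: t_def)
  define W where "W = weight s t"
  define s' where "s' = (\<lambda>z. INF p\<in>{p. poly p (inverse y) = z}. W p)"
  note wn = weight_nonneg[OF a s t, folded W_def]
  have bdd: "bdd_below (W ` Z)" for Z by (rule bdd_belowI[of _ 0]) (use wn in auto)
  have upper: "s' z \<le> W p" if "poly p (inverse y) = z" for z p
    unfolding s'_def by (rule cINF_lower[OF bdd]) (use that in auto)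
  have lower: "B \<le> s' z" if "\<And>p. poly p (inverse y) = z \<Longrightarrow> B \<le> W p" for z B
    unfolding s'_def by (rule cINF_greatest) (use that in \<open>auto intro: exI[of _ "[:z:]"]\<close>)
  have near: "\<exists>p. poly p (inverse y) = z \<and> W p < s' z + e" if "e > 0" for z e
  proof (rule ccontr)
    assume "\<not> ?thesis"
    then have "s' z + e \<le> s' z" by (intro lower) (auto simp: not_less)
    then show False using that by simp
  qed
  have nn: "s' z \<ge> 0" for z by (rule lower) (rule wn)
  have le: "s' z \<le> s z" for z using upper[of "[:z:]" z] weight_const[OF a s t] by (simp add: W_def)
  have "s' (x + z) \<le> s' x + s' z" for x z
  proof (rule field_le_epsilon)
    fix e :: real assume "e > 0"
    then obtain p q where pq: "poly p (inverse y) = x" "W p < s' x + e / 2" "poly q (inverse y) = z" "W q < s' z + e / 2"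
      using near[of "e / 2" x] near[of "e / 2" z] by auto
    have "s' (x + z) \<le> W (p + q)" by (rule upper) (simp add: pq)
    also have "\<dots> \<le> W p + W q" unfolding W_def by (rule weight_add[OF a s t])
    finally show "s' (x + z) \<le> s' x + s' z + e" using pq by simp
  qed
  moreover have "s' (x * z) \<le> s' x * s' z" for x z
  proof (rule tendsto_lowerbound)
    have "((\<lambda>e. (s' x + e) * (s' z + e)) \<longlongrightarrow> (s' x + 0) * (s' z + 0)) (at_right 0)" by (intro tendsto_intros)
    then show "((\<lambda>e. (s' x + e) * (s' z + e)) \<longlongrightarrow> s' x * s' z) (at_right 0)" by simp
    show "\<forall>\<^sub>F e in at_right 0. s' (x * z) \<le> (s' x + e) * (s' z + e)"
    proof (rule eventually_at_right_less[THEN eventually_mono])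
      fix e :: real assume "0 < e"
      then obtain p q where pq: "poly p (inverse y) = x" "W p < s' x + e" "poly q (inverse y) = z" "W q < s' z + e"
        using near[of e x] near[of e z] by auto
      have "s' (x * z) \<le> W (p * q)" by (rule upper) (simp add: pq)
      also have "\<dots> \<le> W p * W q" unfolding W_def by (rule weight_mult[OF a s t])
      also have "\<dots> \<le> (s' x + e) * (s' z + e)" by (rule mult_mono) (use pq wn nn[of x] \<open>0 < e\<close> in auto)
      finally show "s' (x * z) \<le> (s' x + e) * (s' z + e)" .
    qed
  qed simp
  moreover have "s' 1 = 1"
  proof (rule antisym)
    show "s' 1 \<le> 1" using le[of 1] sub_absD(4)[OF s] by simp
    show "1 \<le> s' 1"
    proof (rule lower)
      fix p assume p: "poly p (inverse y) = 1"
      have "s (y ^ n) * t ^ n \<ge> 1" for n using r(2)[of n] r(1) by (simp add: t_def power_one_over field_simps)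
      then show "1 \<le> W p" unfolding W_def using weight_ge_one[OF a s t y _ p] by blast
    qed
  qed
  moreover have "s' (of_rat q) \<le> a q" for q using le[of "of_rat q"] sub_absD(5)[OF s, of q] by simp
  ultimately have "sub_abs a s'" unfolding sub_abs_def using nn by blast
  moreover have "s' (inverse y) \<le> 1 / r"
    using upper[of "[:0, 1:]" "inverse y"] weight_pCons[OF a s t, of 0 "[:1:]"] weight_const[OF a s t, of 1] sub_abs_zero[OF s a] sub_absD(4)[OF s]
    by (simp add: W_def t_def)
  ultimately show ?thesis using le by blast
qed

text \<open>Zorn's lemma; the infimum of a chain is again submultiplicative and subadditive because two
  approximations can be made by the same member of the chain.\<close>

lemma minimal_sub_abs:
  fixes s0 :: "'k::field_char_0 \<Rightarrow> real"
  assumes s0: "sub_abs a s0"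
  shows "\<exists>s. sub_abs a s \<and> s \<le> s0 \<and> (\<forall>s'. sub_abs a s' \<and> s' \<le> s \<longrightarrow> s' = s)"
proof -
  define A where "A = {s. sub_abs a s \<and> s \<le> s0}"
  define P where "P = (\<lambda>s s' :: 'k \<Rightarrow> real. s' \<le> s)"
  have "\<exists>m\<in>A. \<forall>s\<in>A. P m s \<longrightarrow> s = m"
  proof (rule predicate_Zorn)
    show "partial_order_on A (relation_of P A)"
      by (rule partial_order_on_relation_ofI) (auto simp: P_def)
    fix C assume C: "C \<in> Chains (relation_of P A)"
    have CA: "C \<subseteq> A" using C by (auto simp: Chains_def relation_of_def)
    have tot: "s \<le> s' \<or> s' \<le> s" if "s \<in> C" "s' \<in> C" for s s' using C that by (auto simp: Chains_def relation_of_def P_def)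
    show "\<exists>u\<in>A. \<forall>s\<in>C. P s u"
    proof (cases "C = {}")
      case True then show ?thesis using s0 by (auto simp: A_def)
    next
      case False
      define u where "u = (\<lambda>x. INF s\<in>C. s x)"
      have sub: "sub_abs a s" if "s \<in> C" for s using CA that by (auto simp: A_def)
      have bdd: "bdd_below ((\<lambda>s. s x) ` C)" for x by (rule bdd_belowI[of _ 0]) (use sub_absD(1)[OF sub] in auto)
      have upper: "u x \<le> s x" if "s \<in> C" for s x unfolding u_def by (rule cINF_lower[OF bdd that])
      have lower: "B \<le> u x" if "\<And>s. s \<in> C \<Longrightarrow> B \<le> s x" for B x unfolding u_def by (rule cINF_greatest[OF False that])
      have near: "\<exists>s\<in>C. s x < u x + e" if "e > 0" for x e
      proof (rule ccontr)
        assume "\<not> ?thesis"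
        then have "u x + e \<le> u x" by (intro lower) (auto simp: not_less)
        then show False using that by simp
      qed
      have near2: "\<exists>s\<in>C. s x < u x + e \<and> s y < u y + e" if epos: "e > 0" for x y e
      proof -
        obtain s1 s2 where s: "s1 \<in> C" "s2 \<in> C" "s1 x < u x + e" "s2 y < u y + e" using near[OF epos] by blast
        then show ?thesis using tot[OF s(1,2)] by (meson le_funD le_less_trans)
      qed
      have nn: "u x \<ge> 0" for x by (rule lower) (use sub_absD(1)[OF sub] in auto)
      have "u (x + y) \<le> u x + u y" for x y
      proof (rule field_le_epsilon)
        fix e :: real assume "e > 0"
        then obtain s where s: "s \<in> C" "s x < u x + e / 2" "s y < u y + e / 2" using near2[of "e / 2" x y] by auto
        then show "u (x + y) \<le> u x + u y + e" using upper[OF s(1), of "x + y"] sub_absD(2)[OF sub[OF s(1)], of x y] by simp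
      qed
      moreover have "u (x * y) \<le> u x * u y" for x y
      proof (rule tendsto_lowerbound)
        have "((\<lambda>e. (u x + e) * (u y + e)) \<longlongrightarrow> (u x + 0) * (u y + 0)) (at_right 0)" by (intro tendsto_intros)
        then show "((\<lambda>e. (u x + e) * (u y + e)) \<longlongrightarrow> u x * u y) (at_right 0)" by simp
        show "\<forall>\<^sub>F e in at_right 0. u (x * y) \<le> (u x + e) * (u y + e)"
        proof (rule eventually_at_right_less[THEN eventually_mono])
          fix e :: real assume "0 < e"
          then obtain s where s: "s \<in> C" "s x < u x + e" "s y < u y + e" using near2[of e x y] by auto
          have "u (x * y) \<le> s x * s y" using upper[OF s(1), of "x * y"] sub_absD(3)[OF sub[OF s(1)], of x y] by simp
          also have "\<dots> \<le> (u x + e) * (u y + e)"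
            by (rule mult_mono) (use s sub_absD(1)[OF sub[OF s(1)]] nn[of x] \<open>0 < e\<close> in auto)
          finally show "u (x * y) \<le> (u x + e) * (u y + e)" .
        qed
      qed simp
      moreover have "u 1 = 1" 
      proof (rule antisym)
        show "1 \<le> u 1" by (rule lower) (simp add: sub_absD(4)[OF sub])
        obtain s1 where s1: "s1 \<in> C" using False by blast
        then show "u 1 \<le> 1" using upper[OF s1, of 1] sub_absD(4)[OF sub[OF s1]] by simp
      qed
      moreover obtain s1 where s1: "s1 \<in> C" using False by blast
      then have "u (of_rat q) \<le> a q" for q using upper[OF s1, of "of_rat q"] sub_absD(5)[OF sub[OF s1], of q] by simp
      ultimately have "sub_abs a u" unfolding sub_abs_def using nn by blast
      moreover have "u \<le> s0" using upper[OF s1] CA s1 by (auto simp: A_def le_fun_def intro: order_trans)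
      ultimately show ?thesis using upper by (intro bexI[of _ u]) (auto simp: A_def P_def le_fun_def)
    qed
  qed
  then obtain s where s: "s \<in> A" "\<And>s'. s' \<in> A \<Longrightarrow> s' \<le> s \<Longrightarrow> s' = s" by (auto simp: P_def)
  then show ?thesis unfolding A_def by (intro exI[of _ s]) (auto intro: order_trans)
qed

text \<open>Minimality and \<open>adjoin_inverse\<close> give \<open>s(y\<^sup>-\<^sup>1) \<le> 1 / r\<close> whenever \<open>r\<^sup>n \<le> s(y\<^sup>n)\<close> for all \<open>n\<close>. Applied
  to \<open>y\<^sup>-\<^sup>1\<close> this makes \<open>s\<close> multiplicative on powers; then \<open>r = s(y)\<close> is admissible, and
  \<open>s(y\<^sup>-\<^sup>1) = 1 / s(y)\<close> gives multiplicativity.\<close>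

lemma minimal_sub_abs_multiplicative:
  fixes s :: "'k::field_char_0 \<Rightarrow> real"
  assumes a: "absolute_value a" and s: "sub_abs a s" and min: "\<And>s'. sub_abs a s' \<Longrightarrow> s' \<le> s \<Longrightarrow> s' = s"
  shows "absolute_value s \<and> (\<forall>q. s (of_rat q) = a q)"
proof -
  note D = sub_absD[OF s]
  have inv: "s (inverse y) \<le> 1 / r" if yr: "y \<noteq> 0" "r > 0" "\<And>n. r ^ n \<le> s (y ^ n)" for y r
  proof -
    obtain s' where s': "sub_abs a s'" "\<forall>x. s' x \<le> s x" "s' (inverse y) \<le> 1 / r"
      using adjoin_inverse[OF a s yr] by blast
    have "s' = s" by (rule min[OF s'(1)]) (use s'(2) in \<open>simp add: le_fun_def\<close>)
    then show ?thesis using s'(3) by simp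
  qed
  have pos: "s y > 0" if "y \<noteq> 0" for y
  proof -
    have "1 \<le> s y * s (inverse y)" using D(3)[of y "inverse y"] D(4) that by simp
    then show ?thesis using D(1)[of y] by (cases "s y = 0") auto
  qed
  have powmult: "s y ^ n \<le> s (y ^ n)" if y: "y \<noteq> 0" for y n
  proof (cases "n = 0")
    case False
    \<comment> \<open>by submultiplicativity, the spectral radius of \<open>y\<^sup>-\<^sup>1\<close> is at least this \<open>r\<close>\<close>
    define r where "r = root n (1 / s (y ^ n))"
    have yn: "s (y ^ n) > 0" using pos y by simp
    have r: "r > 0" "r ^ n = 1 / s (y ^ n)" using False yn unfolding r_def by (simp_all add: real_root_gt_zero)
    have "r ^ m \<le> s (inverse y ^ m)" for m
    proof (rule power_le_imp_le_base)
      show "0 \<le> s (inverse y ^ m)" by (rule D(1))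
      have "1 \<le> s (y ^ (n * m)) * s (inverse y ^ (m * n))"
        using D(3)[of "y ^ (n * m)" "inverse y ^ (m * n)"] y D(4) by (simp add: mult.commute flip: power_mult_distrib)
      also have "\<dots> \<le> s (y ^ n) ^ m * s (inverse y ^ m) ^ n"
        using sub_abs_power[OF s, of "y ^ n" m] sub_abs_power[OF s, of "inverse y ^ m" n] D(1) by (intro mult_mono) (auto simp: power_mult)
      finally have "1 / s (y ^ n) ^ m \<le> s (inverse y ^ m) ^ n" using yn by (simp add: field_simps)
      moreover have "(r ^ m) ^ n = 1 / s (y ^ n) ^ m"
        by (metis mult.commute power_mult power_one_over r(2))
      ultimately show "(r ^ m) ^ Suc (n - 1) \<le> s (inverse y ^ m) ^ Suc (n - 1)" using False by simp
    qed
    then have "s y \<le> 1 / r" using inv[of "inverse y" r] y r by simp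
    then have "s y ^ n \<le> (1 / r) ^ n" using D(1) by (rule power_mono)
    also have "\<dots> = s (y ^ n)" using r yn by (simp add: power_one_over)
    finally show ?thesis .
  qed (simp add: D(4))
  have mult: "s (z * y) = s z * s y" for z y
  proof (cases "y = 0")
    case True then show ?thesis using sub_abs_zero[OF s a] by simp
  next
    case False
    have iy: "s (inverse y) \<le> 1 / s y" using inv[OF False pos[OF False] powmult[OF False]] by simp
    have "s z = s (z * y * inverse y)" using False by (simp add: mult.assoc)
    also have "\<dots> \<le> s (z * y) * s (inverse y)" by (rule D(3))
    also have "\<dots> \<le> s (z * y) * (1 / s y)" by (rule mult_left_mono[OF iy D(1)])
    finally have "s z * s y \<le> s (z * y)" using pos[OF False] by (simp add: field_simps)
    then show ?thesis using D(3)[of z y] by simp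
  qed
  have "s 0 = 0" by (rule sub_abs_zero[OF s a])
  then have av: "absolute_value s" unfolding absolute_value_def using D(1,2) mult pos by (metis less_irrefl)
  have "s (of_rat q) = a q" for q
  proof (cases "q = 0")
    case True then show ?thesis using \<open>s 0 = 0\<close> absolute_valueD(5)[OF a] by simp
  next
    case False
    have "1 / s (of_rat q) \<le> 1 / a q" using D(5)[of "inverse q"] absolute_valueD(9)[OF a, of q] absolute_valueD(9)[OF av, of "of_rat q"]
      by (simp add: inverse_eq_divide of_rat_divide)
    moreover have "a q > 0" "s (of_rat q) > 0" using False absolute_valueD(10)[OF a] absolute_valueD(10)[OF av, of "of_rat q"] by auto
    ultimately have "a q \<le> s (of_rat q)" by (simp add: field_simps)
    then show ?thesis using D(5)[of q] by simp
  qed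
  then show ?thesis using av by blast
qed

text \<open>An extension exists whose value at \<open>y\<close> reaches any lower bound \<open>r\<close> of the spectral radius of \<open>y\<close>.\<close>

theorem absolute_value_extension:
  fixes s0 :: "'k::field_char_0 \<Rightarrow> real"
  assumes a: "absolute_value a" and s0: "sub_abs a s0" and y: "y \<noteq> 0" and r: "r > 0" "\<And>n. r ^ n \<le> s0 (y ^ n)"
  shows "\<exists>\<nu>. absolute_value \<nu> \<and> (\<forall>q. \<nu> (of_rat q) = a q) \<and> r \<le> \<nu> y"
proof -
  obtain s1 where s1: "sub_abs a s1" "s1 (inverse y) \<le> 1 / r" using adjoin_inverse[OF a s0 y r] by blast
  obtain s where s: "sub_abs a s" "s \<le> s1" "\<And>s'. sub_abs a s' \<Longrightarrow> s' \<le> s \<Longrightarrow> s' = s"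
    using minimal_sub_abs[OF s1(1)] by blast
  have av: "absolute_value s" "\<forall>q. s (of_rat q) = a q" using minimal_sub_abs_multiplicative[OF a s(1,3)] by blast+
  have "inverse (s y) \<le> 1 / r" using s(2) s1(2) absolute_valueD(9)[OF av(1), of y] by (metis le_funD order_trans)
  moreover have "s y > 0" using absolute_valueD(10)[OF av(1) y] .
  ultimately have "r \<le> s y" using r(1) by (simp add: field_simps)
  then show ?thesis using av by blast
qed


section \<open>Norm and trace bounds from the extensions of an absolute value\<close>

definition extensions :: "(rat \<Rightarrow> real) \<Rightarrow> ('k::number_field \<Rightarrow> real) set" where
  "extensions a = {\<nu>. absolute_value \<nu> \<and> (\<forall>q. \<nu> (of_rat q) = a q)}"

lemma extensionsD:
  assumes "\<nu> \<in> extensions a" shows "absolute_value \<nu>" "\<nu> (of_rat q) = a q"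
  using assms by (auto simp: extensions_def)

definition qnorm :: "'k::number_field \<Rightarrow> rat" where
  "qnorm w = det (qnorm_mat (SOME b. qbasis b) w)"

lemma qnorm_embeddings:
  fixes w :: "'k::number_field"
  assumes "emb_enum \<sigma>" shows "of_rat (qnorm w) = (\<Prod>k<nf_degree TYPE('k). \<sigma> k w)"
  unfolding qnorm_def by (rule det_qnorm_mat[OF someI_ex[OF qbasis_ex] assms])

lemma qnorm_det:
  fixes w :: "'k::number_field"
  assumes "qbasis b" shows "qnorm w = det (qnorm_mat b w)"
proof -
  obtain \<sigma> :: "nat \<Rightarrow> 'k \<Rightarrow> complex" where s: "emb_enum \<sigma>" using emb_enum_exists by blast
  have "(of_rat (qnorm w) :: complex) = of_rat (det (qnorm_mat b w))"
    unfolding qnorm_embeddings[OF s] det_qnorm_mat[OF assms s] ..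
  then show ?thesis by simp
qed

lemma qnorm_power: "qnorm (w ^ n) = qnorm (w :: 'k::number_field) ^ n"
proof -
  obtain \<sigma> :: "nat \<Rightarrow> 'k \<Rightarrow> complex" where s: "emb_enum \<sigma>" using emb_enum_exists by blast
  have "(of_rat (qnorm (w ^ n)) :: complex) = of_rat (qnorm w ^ n)"
    unfolding of_rat_power qnorm_embeddings[OF s] using emb_enumD[OF s] by (simp add: complex_embeddingsD prod_power_distrib)
  then show ?thesis by (simp del: of_rat_power)
qed

lemma embedding_nonzero:
  assumes "\<sigma> \<in> complex_embeddings" "w \<noteq> 0" shows "\<sigma> w \<noteq> 0"
proof
  assume "\<sigma> w = 0"
  then have "\<sigma> (w * inverse w) = 0" using complex_embeddingsD(2)[OF assms(1), of w "inverse w"] by simp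
  then show False using complex_embeddingsD(3)[OF assms(1)] assms(2) by simp
qed

lemma qnorm_nonzero: assumes "w \<noteq> 0" shows "qnorm (w :: 'k::number_field) \<noteq> 0"
proof -
  obtain \<sigma> :: "nat \<Rightarrow> 'k \<Rightarrow> complex" where s: "emb_enum \<sigma>" using emb_enum_exists by blast
  have "(of_rat (qnorm w) :: complex) \<noteq> 0"
    unfolding qnorm_embeddings[OF s] using embedding_nonzero[OF emb_enumD[OF s] assms] by simp
  then show ?thesis by simp
qed

lemma qtrace_add: "qtrace (x + y) = qtrace x + qtrace (y :: 'k::number_field)"
proof -
  have "(of_rat (qtrace (x + y)) :: complex) = of_rat (qtrace x + qtrace y)"
    unfolding of_rat_add qtrace_embeddings by (simp add: complex_embeddingsD sum.distrib)
  then show ?thesis by (simp del: of_rat_add)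
qed

lemma qtrace_scale: "qtrace (of_rat q * x) = q * qtrace (x :: 'k::number_field)"
proof -
  have "(of_rat (qtrace (of_rat q * x)) :: complex) = of_rat (q * qtrace x)"
    unfolding of_rat_mult qtrace_embeddings by (simp add: complex_embeddingsD sum_distrib_left)
  then show ?thesis by (simp del: of_rat_mult)
qed

lemma qtrace_sum: "qtrace (\<Sum>i\<in>A. f i) = (\<Sum>i\<in>A. qtrace (f i :: 'k::number_field))"
  using qtrace_scale[of 0] by (induction A rule: infinite_finite_induct) (simp_all add: qtrace_add)

text \<open>The standard device to remove a multiplicative constant from an inequality between multiplicative
  functions.\<close>

lemma le_if_power_le:
  fixes x y C :: real
  assumes "y \<ge> 0" "\<And>k::nat. x ^ k \<le> C * y ^ k" shows "x \<le> y"
proof (rule ccontr)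
  assume n: "\<not> x \<le> y"
  show False
  proof (cases "y = 0")
    case True then show ?thesis using assms(2)[of 1] n by simp
  next
    case False
    then have "x / y > 1" "y > 0" using n assms(1) by auto
    then obtain k where "C < (x / y) ^ k" using real_arch_pow by blast
    then show False using assms(2)[of k] \<open>y > 0\<close> by (simp add: power_divide field_simps)
  qed
qed

lemma absolute_value_sign:
  assumes "absolute_value a" shows "a (of_int (sign p)) = 1"
  using absolute_valueD(6,7)[OF assms] by (simp add: sign_def)

lemma absolute_value_det_le:
  fixes M :: "'f::field mat"
  assumes a: "absolute_value a" and M: "M \<in> carrier_mat n n"
    and bound: "\<And>i j. i < n \<Longrightarrow> j < n \<Longrightarrow> a (M $$ (i, j)) \<le> R i"
  shows "a (det M) \<le> fact n * (\<Prod>i<n. R i)"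
proof -
  have "a (det M) \<le> (\<Sum>p\<in>{p. p permutes {0..<n}}. a (of_int (sign p) * (\<Prod>i = 0..<n. M $$ (i, p i))))"
    using M absolute_value_sum[OF a] unfolding det_def by simp
  also have "\<dots> \<le> (\<Sum>p\<in>{p. p permutes {0..<n}}. (\<Prod>i<n. R i))"
  proof (rule sum_mono)
    fix p assume "p \<in> {p. p permutes {0..<n}}"
    then have p: "p permutes {0..<n}" by simp
    have "a (of_int (sign p) * (\<Prod>i = 0..<n. M $$ (i, p i))) = (\<Prod>i<n. a (M $$ (i, p i)))"
      by (simp add: absolute_valueD(3)[OF a] absolute_value_sign[OF a] absolute_value_prod[OF a] atLeast0LessThan)
    also have "\<dots> \<le> (\<Prod>i<n. R i)"
      by (rule prod_mono) (use bound permutes_in_image[OF p] absolute_valueD(1)[OF a] in auto)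
    finally show "a (of_int (sign p) * (\<Prod>i = 0..<n. M $$ (i, p i))) \<le> (\<Prod>i<n. R i)" .
  qed
  also have "\<dots> = fact n * (\<Prod>i<n. R i)" by (simp add: card_permutations[of _ n])
  finally show ?thesis .
qed

definition coord_norm :: "(rat \<Rightarrow> real) \<Rightarrow> (nat \<Rightarrow> 'k::number_field) \<Rightarrow> 'k \<Rightarrow> real" where
  "coord_norm a b x = (\<Sum>i<nf_degree TYPE('k). a (qcoord b x i))"

text \<open>The operator norm of multiplication by \<open>x\<close> for the norm \<open>coord_norm\<close>, which is attained at a
  basis element. The extensions of \<open>a\<close> are obtained from this seminorm.\<close>

definition op_norm :: "(rat \<Rightarrow> real) \<Rightarrow> (nat \<Rightarrow> 'k::number_field) \<Rightarrow> 'k \<Rightarrow> real" where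
  "op_norm a b x = Max ((\<lambda>j. coord_norm a b (x * b j)) ` {..<nf_degree TYPE('k)})"

context
  fixes a :: "rat \<Rightarrow> real" and b :: "nat \<Rightarrow> 'k::number_field"
  assumes a: "absolute_value a" and b: "qbasis b"
begin

lemma coord_norm_nonneg: "coord_norm a b x \<ge> 0"
  unfolding coord_norm_def by (rule sum_nonneg) (rule absolute_valueD(1)[OF a])

lemma coord_norm_add: "coord_norm a b (x + y) \<le> coord_norm a b x + coord_norm a b y"
  unfolding coord_norm_def sum.distrib[symmetric]
  by (rule sum_mono) (use b in \<open>simp add: qcoord_add absolute_valueD(4)[OF a]\<close>)

lemma coord_norm_scale: "coord_norm a b (of_rat q * x) = a q * coord_norm a b x"
  unfolding coord_norm_def using b by (simp add: qcoord_scale absolute_valueD(3)[OF a] sum_distrib_left)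

lemma coord_norm_sum: "coord_norm a b (\<Sum>i\<in>A. f i) \<le> (\<Sum>i\<in>A. coord_norm a b (f i))"
proof (induction A rule: infinite_finite_induct)
  case (insert x F)
  then show ?case using coord_norm_add[of "f x" "sum f F"] by simp
qed (use coord_norm_scale[of 0 0] absolute_valueD(5)[OF a] in auto)

lemma op_norm_ge: "j < nf_degree TYPE('k) \<Longrightarrow> coord_norm a b (x * b j) \<le> op_norm a b x"
  unfolding op_norm_def by (rule Max_ge) auto

lemma op_norm_le: "(\<And>j. j < nf_degree TYPE('k) \<Longrightarrow> coord_norm a b (x * b j) \<le> B) \<Longrightarrow> op_norm a b x \<le> B"
  unfolding op_norm_def using nf_degree_pos[where 'k = 'k] by (intro Max.boundedI) auto

lemma coord_norm_mult: "coord_norm a b (x * y) \<le> op_norm a b x * coord_norm a b y"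
proof -
  let ?d = "nf_degree TYPE('k)"
  have "x * y = (\<Sum>j<?d. of_rat (qcoord b y j) * (x * b j))"
    by (subst qcomb_qcoord[OF b, of y, symmetric]) (simp add: qcomb_def sum_distrib_left mult_ac)
  then have "coord_norm a b (x * y) \<le> (\<Sum>j<?d. coord_norm a b (of_rat (qcoord b y j) * (x * b j)))"
    using coord_norm_sum by metis
  also have "\<dots> \<le> (\<Sum>j<?d. op_norm a b x * a (qcoord b y j))"
    unfolding coord_norm_scale mult.commute[of "a _"]
    by (rule sum_mono) (use op_norm_ge absolute_valueD(1)[OF a] in \<open>auto intro: mult_right_mono\<close>)
  also have "\<dots> = op_norm a b x * coord_norm a b y" by (simp add: coord_norm_def sum_distrib_left)
  finally show ?thesis .
qed

lemma coord_norm_basis: "j < nf_degree TYPE('k) \<Longrightarrow> coord_norm a b (b j) = 1"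
  unfolding coord_norm_def
  by (simp add: qcoord_basis[OF b] if_distrib[of a] absolute_valueD(5,6)[OF a] cong: if_cong)

lemma op_norm_nonneg: "op_norm a b x \<ge> 0"
  using op_norm_ge[OF nf_degree_pos, of x] coord_norm_nonneg[of "x * b 0"] by linarith

lemma op_norm_rat: "op_norm a b (of_rat q) = a q"
proof (rule antisym)
  show "op_norm a b (of_rat q) \<le> a q" by (rule op_norm_le) (simp add: coord_norm_scale coord_norm_basis)
  show "a q \<le> op_norm a b (of_rat q)"
    using op_norm_ge[OF nf_degree_pos, of "of_rat q"] coord_norm_basis[OF nf_degree_pos] by (simp add: coord_norm_scale)
qed

lemma sub_abs_op_norm: "sub_abs a (op_norm a b)"
  unfolding sub_abs_def
proof (intro conjI allI)
  show "op_norm a b x \<ge> 0" for x by (rule op_norm_nonneg)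
  show "op_norm a b (x + y) \<le> op_norm a b x + op_norm a b y" for x y
    by (rule op_norm_le) (unfold distrib_right, rule order_trans[OF coord_norm_add add_mono[OF op_norm_ge op_norm_ge]])
  show "op_norm a b (x * y) \<le> op_norm a b x * op_norm a b y" for x y
    by (rule op_norm_le) (unfold mult.assoc, rule order_trans[OF coord_norm_mult mult_left_mono[OF op_norm_ge op_norm_nonneg]])
  show "op_norm a b 1 = 1" using op_norm_rat[of 1] absolute_valueD(6)[OF a] by simp
  show "op_norm a b (of_rat q) \<le> a q" for q by (simp add: op_norm_rat)
qed

lemma qnorm_le_op_norm: "a (qnorm w) \<le> fact (nf_degree TYPE('k)) * op_norm a b w ^ nf_degree TYPE('k)"
proof -
  let ?d = "nf_degree TYPE('k)"
  have "a (qcoord b (w * b j) i) \<le> op_norm a b w" if "i < ?d" "j < ?d" for i j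
  proof -
    have "a (qcoord b (w * b j) i) \<le> coord_norm a b (w * b j)"
      unfolding coord_norm_def using member_le_sum[of i "{..<?d}" "\<lambda>i. a (qcoord b (w * b j) i)"] that absolute_valueD(1)[OF a] by simp
    then show ?thesis using op_norm_ge[OF that(2), of w] by linarith
  qed
  then show ?thesis unfolding qnorm_det[OF b]
    using absolute_value_det_le[OF a, of "qnorm_mat b w" ?d "\<lambda>_. op_norm a b w"] by (simp add: qnorm_mat_def)
qed

text \<open>If all extensions are at most \<open>B\<close> at \<open>w\<close>, then by \<open>absolute_value_extension\<close> the spectral
  radius of \<open>w\<close> is at most \<open>B\<close>: for each \<open>r > B\<close> some power has \<open>op_norm (w\<^sup>n) < r\<^sup>n\<close>. The
  determinant bound for the norm, applied to the powers of \<open>w\<^sup>n\<close>, does the rest.\<close>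

lemma qnorm_le_extensions:
  assumes B: "B > 0" "\<And>\<nu>. \<nu> \<in> extensions a \<Longrightarrow> \<nu> w \<le> B"
  shows "a (qnorm (w::'k)) \<le> B ^ nf_degree TYPE('k)"
proof (cases "w = 0")
  case True
  obtain \<sigma> :: "nat \<Rightarrow> 'k \<Rightarrow> complex" where s: "emb_enum \<sigma>" using emb_enum_exists by blast
  have "(of_rat (qnorm (0::'k)) :: complex) = 0"
    unfolding qnorm_embeddings[OF s] using emb_enumD[OF s nf_degree_pos] nf_degree_pos[where 'k = 'k]
    by (intro prod_zero) (auto simp: complex_embeddingsD intro!: bexI[of _ 0])
  then show ?thesis using True B absolute_valueD(5)[OF a] by simp
next
  case w: False
  let ?d = "nf_degree TYPE('k)"
  have above: "a (qnorm w) \<le> r ^ ?d" if r: "r > B" for r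
  proof -
    have "\<exists>n. \<not> r ^ n \<le> op_norm a b (w ^ n)"
    proof (rule ccontr)
      assume "\<not> ?thesis"
      then obtain \<nu> where "absolute_value \<nu>" "\<forall>q. \<nu> (of_rat q) = a q" "r \<le> \<nu> w"
        using absolute_value_extension[OF a sub_abs_op_norm w, of r] r B(1) by auto
      then show False using B(2)[of \<nu>] r by (auto simp: extensions_def)
    qed
    then obtain n where n: "op_norm a b (w ^ n) < r ^ n" by (auto simp: not_le)
    have n0: "n \<noteq> 0"
    proof
      assume "n = 0" then show False using n sub_absD(4)[OF sub_abs_op_norm] by simp
    qed
    have "a (qnorm w) ^ n \<le> (r ^ ?d) ^ n"
    proof (rule le_if_power_le)
      fix k
      have "(a (qnorm w) ^ n) ^ k = a (qnorm ((w ^ n) ^ k))" by (simp add: qnorm_power absolute_valueD(8)[OF a])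
      also have "\<dots> \<le> fact ?d * op_norm a b ((w ^ n) ^ k) ^ ?d" by (rule qnorm_le_op_norm)
      also have "\<dots> \<le> fact ?d * ((r ^ n) ^ k) ^ ?d"
      proof (intro mult_left_mono power_mono)
        show "op_norm a b ((w ^ n) ^ k) \<le> (r ^ n) ^ k"
          using sub_abs_power[OF sub_abs_op_norm, of "w ^ n" k] power_mono[of "op_norm a b (w ^ n)" "r ^ n" k] n op_norm_nonneg
          by (meson less_imp_le order_trans)
      qed (use op_norm_nonneg in auto)
      also have "((r ^ n) ^ k) ^ ?d = ((r ^ ?d) ^ n) ^ k" by (simp add: mult.commute mult.left_commute flip: power_mult)
      finally show "(a (qnorm w) ^ n) ^ k \<le> fact ?d * ((r ^ ?d) ^ n) ^ k" .
    qed (use r B(1) in simp)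
    then have "a (qnorm w) ^ Suc (n - 1) \<le> (r ^ ?d) ^ Suc (n - 1)" using n0 by simp
    then show ?thesis by (rule power_le_imp_le_base) (use r B(1) in simp)
  qed
  show ?thesis
  proof (rule tendsto_lowerbound)
    have "((\<lambda>e. (B + e) ^ ?d) \<longlongrightarrow> (B + 0) ^ ?d) (at_right 0)" by (intro tendsto_intros)
    then show "((\<lambda>e. (B + e) ^ ?d) \<longlongrightarrow> B ^ ?d) (at_right 0)" by simp
    show "\<forall>\<^sub>F e in at_right 0. a (qnorm w) \<le> (B + e) ^ ?d"
      by (rule eventually_at_right_less[THEN eventually_mono]) (rule above, simp)
  qed simp
qed

end

text \<open>Interpolation by repeated synthetic division: the values of the quotient by \<open>T - s\<close> are divided
  differences of the given values, so the constant depends on the nodes only and the induction shifts the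
  nodes by one.\<close>

lemma coeff_bound_by_values:
  assumes a: "absolute_value (a :: rat \<Rightarrow> real)"
  shows "\<exists>C\<ge>0. \<forall>p B. Polynomial.degree p \<le> n \<longrightarrow> (B::real) \<ge> 0 \<longrightarrow>
    (\<forall>i\<le>n. \<exists>v. poly p (of_nat (s + i) :: complex) = of_rat v \<and> a v \<le> B) \<longrightarrow>
    (\<forall>k. \<exists>u. poly.coeff p k = of_rat u \<and> a u \<le> C * B)"
proof (induction n arbitrary: s)
  case (0 s)
  show ?case
  proof (rule exI[of _ 1], intro conjI allI impI)
    fix p :: "complex poly" and B :: real and k
    assume p: "Polynomial.degree p \<le> 0" "0 \<le> B" "\<forall>i\<le>0. \<exists>v. poly p (of_nat (s + i)) = of_rat v \<and> a v \<le> B"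
    then obtain c where c: "p = [:c:]" using degree_eq_zeroE[of p] by auto
    show "\<exists>u. poly.coeff p k = of_rat u \<and> a u \<le> 1 * B"
    proof (cases k)
      case 0 then show ?thesis using p(3) c by auto
    next
      case (Suc k') then show ?thesis using p(2) c absolute_valueD(5)[OF a] by (intro exI[of _ 0]) simp
    qed
  qed simp
next
  case (Suc n s)
  obtain C where C0: "C \<ge> 0" and C1: "\<forall>p B. Polynomial.degree p \<le> n \<longrightarrow> (B::real) \<ge> 0 \<longrightarrow>
    (\<forall>i\<le>n. \<exists>v. poly p (of_nat (Suc s + i) :: complex) = of_rat v \<and> a v \<le> B) \<longrightarrow>
    (\<forall>k. \<exists>u. poly.coeff p k = of_rat u \<and> a u \<le> C * B)"
    using Suc.IH[of "Suc s"] by (elim exE conjE) (rule that)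
  note C = C0 C1[THEN spec, THEN spec, THEN mp, THEN mp, THEN mp]
  define L where "L = Max ((\<lambda>i. 1 / a (of_nat (Suc i))) ` {..n})"
  have L: "1 / a (of_nat (Suc i)) \<le> L" if "i \<le> n" for i unfolding L_def using that by (intro Max_ge) auto
  have apos: "a (of_nat (Suc i)) > 0" for i by (rule absolute_valueD(10)[OF a]) simp
  have L0: "L \<ge> 0" using L[of 0] apos[of 0] by (meson le0 less_imp_le order_trans zero_le_divide_1_iff)
  define s' :: rat where "s' = of_nat s"
  show ?case
  proof (rule exI[of _ "a s' * (C * (2 * L)) + C * (2 * L) + 1"], intro conjI allI impI)
    show "0 \<le> a s' * (C * (2 * L)) + C * (2 * L) + 1" using C(1) L0 absolute_valueD(1)[OF a, of s'] by simp
    fix p :: "complex poly" and B :: real and k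
    assume p: "Polynomial.degree p \<le> Suc n" "0 \<le> B" "\<forall>i\<le>Suc n. \<exists>v. poly p (of_nat (s + i)) = of_rat v \<and> a v \<le> B"
    define r where "r = synthetic_div p (of_nat s)"
    have pr: "p = pCons 0 r - Polynomial.smult (of_nat s) r + [:poly p (of_nat s):]"
      using synthetic_div_correct[of p "of_nat s"] unfolding r_def by (simp add: algebra_simps)
    have val: "poly p x = (x - of_nat s) * poly r x + poly p (of_nat s)" for x
      by (subst pr) (simp add: algebra_simps)
    obtain v0 where v0: "poly p (of_nat s) = of_rat v0" "a v0 \<le> B" using p(3)[rule_format, of 0] by auto
    have "\<forall>k. \<exists>u. poly.coeff r k = of_rat u \<and> a u \<le> C * (2 * B * L)"
    proof (rule C(2))
      show "Polynomial.degree r \<le> n" using p(1) by (simp add: r_def degree_synthetic_div)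
      show "0 \<le> 2 * B * L" using p(2) L0 by simp
      show "\<forall>i\<le>n. \<exists>v. poly r (of_nat (Suc s + i)) = of_rat v \<and> a v \<le> 2 * B * L"
      proof (intro allI impI)
        fix i assume i: "i \<le> n"
        obtain v where v: "poly p (of_nat (s + Suc i)) = of_rat v" "a v \<le> B" using p(3)[rule_format, of "Suc i"] i by auto
        have "of_rat v = of_nat (Suc i) * poly r (of_nat (Suc s + i)) + of_rat v0"
          using val[of "of_nat (s + Suc i)"] v v0 by simp
        then have "poly r (of_nat (Suc s + i)) = of_rat ((v - v0) / of_nat (Suc i))"
          by (simp add: of_rat_divide of_rat_diff of_rat_add field_simps del: of_nat_Suc of_nat_add)
        moreover have "a ((v - v0) / of_nat (Suc i)) \<le> 2 * B * L"
        proof -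
          have "a ((v - v0) / of_nat (Suc i)) = a (v - v0) * (1 / a (of_nat (Suc i)))" by (simp add: absolute_valueD(11)[OF a])
          also have "\<dots> \<le> (2 * B) * L"
            by (rule mult_mono) (use absolute_valueD(12)[OF a, of v v0] v v0 L[OF i] p(2) apos[of i] in auto)
          finally show ?thesis .
        qed
        ultimately show "\<exists>v. poly r (of_nat (Suc s + i)) = of_rat v \<and> a v \<le> 2 * B * L" by blast
      qed
    qed
    then have rc: "\<exists>u. poly.coeff r k = of_rat u \<and> a u \<le> C * (2 * B * L)" for k by blast
    obtain u where u: "poly.coeff r k = of_rat u" "a u \<le> C * (2 * B * L)" using rc by blast
    obtain u' where u': "(case k of 0 \<Rightarrow> of_rat v0 | Suc k' \<Rightarrow> poly.coeff r k') = of_rat u'" "a u' \<le> C * (2 * B * L) + B"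
    proof (cases k)
      case 0
      have "0 \<le> C * (2 * B * L)" using C(1) L0 p(2) by simp
      then show ?thesis by (intro that[of v0]) (simp add: 0, insert v0(2), linarith)
    next
      case (Suc k')
      obtain w where "poly.coeff r k' = of_rat w" "a w \<le> C * (2 * B * L)" using rc by blast
      then show ?thesis by (intro that[of w]) (use Suc p(2) in auto)
    qed
    have "poly.coeff p k = of_rat (u' - s' * u)"
      by (subst pr) (use u u' v0 in \<open>auto simp: s'_def of_rat_diff of_rat_mult split: nat.splits\<close>)
    moreover have "a (u' - s' * u) \<le> (a s' * (C * (2 * L)) + C * (2 * L) + 1) * B"
    proof -
      have "a (u' - s' * u) \<le> a u' + a s' * a u" using absolute_valueD(12)[OF a, of u' "s' * u"] by (simp add: absolute_valueD(3)[OF a])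
      also have "\<dots> \<le> (C * (2 * B * L) + B) + a s' * (C * (2 * B * L))"
        by (intro add_mono u' mult_left_mono u absolute_valueD(1)[OF a])
      finally show ?thesis by (simp add: algebra_simps)
    qed
    ultimately show "\<exists>u. poly.coeff p k = of_rat u \<and> a u \<le> (a s' * (C * (2 * L)) + C * (2 * L) + 1) * B" by blast
  qed
qed

lemma prod_linear_coeff:
  assumes "finite S"
  shows "Polynomial.degree (\<Prod>k\<in>S. [:f k, 1:]) = card S \<and>
    poly.coeff (\<Prod>k\<in>S. [:f k, 1:]) (card S) = (1::'a::idom) \<and>
    (S \<noteq> {} \<longrightarrow> poly.coeff (\<Prod>k\<in>S. [:f k, 1:]) (card S - 1) = (\<Sum>k\<in>S. f k))"
  using assms
proof (induction S rule: finite_induct)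
  case (insert k S)
  let ?P = "\<Prod>k\<in>S. [:f k, 1:]"
  have P0: "?P \<noteq> 0" using insert by (metis coeff_0 one_neq_zero)
  have m: "(\<Prod>k\<in>insert k S. [:f k, 1:]) = Polynomial.smult (f k) ?P + pCons 0 ?P" using insert by simp
  have deg: "Polynomial.degree (\<Prod>k\<in>insert k S. [:f k, 1:]) = Suc (card S)"
  proof -
    have "Polynomial.degree ([:f k, 1:] * ?P) = Polynomial.degree [:f k, 1:] + Polynomial.degree ?P"
      by (rule degree_mult_eq) (use P0 in auto)
    moreover have "(\<Prod>k\<in>insert k S. [:f k, 1:]) = [:f k, 1:] * ?P" by (rule prod.insert[OF insert.hyps])
    ultimately show ?thesis using insert.IH by (simp only:) simp
  qed
  show ?case
  proof (intro conjI impI)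
    show "Polynomial.degree (\<Prod>k\<in>insert k S. [:f k, 1:]) = card (insert k S)"
      unfolding deg using insert.hyps by simp
    show "poly.coeff (\<Prod>k\<in>insert k S. [:f k, 1:]) (card (insert k S)) = 1"
      unfolding m using insert by (simp add: coeff_eq_0)
    show "poly.coeff (\<Prod>k\<in>insert k S. [:f k, 1:]) (card (insert k S) - 1) = (\<Sum>k\<in>insert k S. f k)"
      unfolding m using insert by (cases "card S") (auto simp: coeff_pCons)
  qed
qed simp

text \<open>The trace is a coefficient of the polynomial \<open>\<Prod> (T + \<sigma>(y))\<close>, whose values at
  the integers \<open>i\<close> are the norms of \<open>i + y\<close>. These are bounded by \<open>qnorm_le_extensions\<close>.\<close>

lemma qtrace_bound_unit:
  assumes a: "absolute_value a"
  shows "\<exists>C\<ge>0. \<forall>y::'k::number_field. (\<forall>\<nu>\<in>extensions a. \<nu> y \<le> 1) \<longrightarrow> a (qtrace y) \<le> C"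
proof -
  let ?d = "nf_degree TYPE('k)"
  obtain b :: "nat \<Rightarrow> 'k" where b: "qbasis b" using qbasis_ex by blast
  obtain \<sigma> :: "nat \<Rightarrow> 'k \<Rightarrow> complex" where s: "emb_enum \<sigma>" using emb_enum_exists by blast
  obtain C where C0: "C \<ge> 0" and C1: "\<forall>p B. Polynomial.degree p \<le> ?d \<longrightarrow> (B::real) \<ge> 0 \<longrightarrow>
    (\<forall>i\<le>?d. \<exists>v. poly p (of_nat (0 + i) :: complex) = of_rat v \<and> a v \<le> B) \<longrightarrow>
    (\<forall>k. \<exists>u. poly.coeff p k = of_rat u \<and> a u \<le> C * B)"
    using coeff_bound_by_values[OF a, of ?d 0] by (elim exE conjE) (rule that)
  note C = C0 C1[THEN spec, THEN spec, THEN mp, THEN mp, THEN mp]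
  define T where "T = Max ((\<lambda>i. a (of_nat i)) ` {..?d}) + 1"
  have T: "a (of_nat i) + 1 \<le> T" if "i \<le> ?d" for i unfolding T_def using that by simp
  have T0: "T > 0" using T[of 0] absolute_valueD(5)[OF a] by simp
  have "a (qtrace y) \<le> C * T ^ ?d" if y: "\<forall>\<nu>\<in>extensions a. \<nu> y \<le> 1" for y :: 'k
  proof -
    define p where "p = (\<Prod>k<?d. [:\<sigma> k y, 1:])"
    have pc: "Polynomial.degree p = ?d" "poly.coeff p (?d - 1) = (\<Sum>k<?d. \<sigma> k y)"
      using prod_linear_coeff[of "{..<?d}" "\<lambda>k. \<sigma> k y"] nf_degree_pos[where 'k = 'k] by (auto simp: p_def)
    have "\<forall>k. \<exists>u. poly.coeff p k = of_rat u \<and> a u \<le> C * T ^ ?d"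
    proof (rule C(2))
      show "\<forall>i\<le>?d. \<exists>v. poly p (of_nat (0 + i)) = of_rat v \<and> a v \<le> T ^ ?d"
      proof (intro allI impI)
        fix i assume i: "i \<le> ?d"
        have "poly p (of_nat (0 + i)) = (\<Prod>k<?d. \<sigma> k (of_nat i + y))"
        proof -
          have "\<sigma> k (of_nat i + y) = \<sigma> k y + of_nat i" if "k < ?d" for k
            using complex_embeddingsD(1)[OF emb_enumD[OF s that], of "of_nat i" y] complex_embeddingsD(9)[OF emb_enumD[OF s that], of "int i"] by simp
          then show ?thesis by (simp add: p_def poly_prod)
        qed
        also have "\<dots> = of_rat (qnorm (of_nat i + y))" by (rule qnorm_embeddings[OF s, symmetric])
        finally have "poly p (of_nat (0 + i)) = of_rat (qnorm (of_nat i + y))" .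
        moreover have "a (qnorm (of_nat i + y)) \<le> T ^ ?d"
        proof (rule qnorm_le_extensions[OF a b T0])
          fix \<nu> :: "'k \<Rightarrow> real" assume nu: "\<nu> \<in> extensions a"
          have "\<nu> (of_nat i + y) \<le> \<nu> (of_rat (of_nat i)) + \<nu> y" using absolute_valueD(4)[OF extensionsD(1)[OF nu]] by simp
          also have "\<dots> \<le> T" using T[OF i] y nu unfolding extensionsD(2)[OF nu] by force
          finally show "\<nu> (of_nat i + y) \<le> T" .
        qed
        ultimately show "\<exists>v. poly p (of_nat (0 + i)) = of_rat v \<and> a v \<le> T ^ ?d" by blast
      qed
    qed (use pc T0 in auto)
    then obtain u where u: "poly.coeff p (?d - 1) = of_rat u" "a u \<le> C * T ^ ?d" by blast
    have "(\<Sum>k<?d. \<sigma> k y) = (\<Sum>\<tau>\<in>complex_embeddings. \<tau> y)"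
      using s unfolding emb_enum_def by (rule sum.reindex_bij_betw)
    then have "of_rat (qtrace y) = (of_rat u :: complex)" using qtrace_embeddings[of y] pc u by simp
    then show ?thesis using u by simp
  qed
  then show ?thesis using C(1) T0 by (intro exI[of _ "C * T ^ ?d"]) auto
qed

text \<open>The values of \<open>a\<close> at the powers of \<open>t\<close> meet every interval of multiplicative length \<open>1 / a t\<close>, which permits
  normalising by rational scalars.\<close>

lemma absolute_value_scaling:
  assumes a: "absolute_value a" and t: "0 < a t" "a t < 1" and B: "(B::real) > 0"
  shows "\<exists>q. B \<le> a q \<and> a q \<le> B / a t"
proof -
  define \<tau> where "\<tau> = 1 / a t"
  have tau: "\<tau> > 1" using t by (simp add: \<tau>_def)
  obtain m where "1 / B < \<tau> ^ m" using real_arch_pow[OF tau] by blast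
  then have m: "1 \<le> B * \<tau> ^ m" using B by (simp add: field_simps)
  define P where "P = (\<lambda>n. B * \<tau> ^ m \<le> \<tau> ^ n)"
  obtain n0 where "B * \<tau> ^ m < \<tau> ^ n0" using real_arch_pow[OF tau] by blast
  then have "P n0" by (simp add: P_def)
  define n where "n = (LEAST n. P n)"
  have n: "P n" unfolding n_def using \<open>P n0\<close> by (rule LeastI)
  have up: "\<tau> ^ n \<le> \<tau> * (B * \<tau> ^ m)"
  proof (cases n)
    case 0 then show ?thesis using tau m by (simp add: mult_ge1_I less_imp_le)
  next
    case (Suc k)
    then have "\<not> P k" unfolding n_def by (metis lessI not_less_Least)
    then show ?thesis using Suc tau by (simp add: P_def)
  qed
  have q: "a (t ^ m / t ^ n) = \<tau> ^ n / \<tau> ^ m" using t by (simp add: absolute_valueD(8,11)[OF a] \<tau>_def power_one_over)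
  have tm: "\<tau> ^ m > 0" using tau by simp
  have "B \<le> \<tau> ^ n / \<tau> ^ m" using n tm by (simp add: P_def field_simps)
  moreover have "\<tau> ^ n / \<tau> ^ m \<le> \<tau> * B" using up tm by (simp add: divide_le_eq mult.assoc)
  then have "\<tau> ^ n / \<tau> ^ m \<le> B / a t" by (simp add: \<tau>_def)
  ultimately show ?thesis using q by metis
qed

lemma qtrace_bound:
  assumes a: "absolute_value a" and t: "0 < a t" "a t < 1"
  shows "\<exists>C\<ge>0. \<forall>(y::'k::number_field) B. 0 < B \<longrightarrow> (\<forall>\<nu>\<in>extensions a. \<nu> y \<le> B) \<longrightarrow> a (qtrace y) \<le> C * B"
proof -
  obtain C where C: "C \<ge> 0" "\<And>y::'k. (\<forall>\<nu>\<in>extensions a. \<nu> y \<le> 1) \<Longrightarrow> a (qtrace y) \<le> C"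
    using qtrace_bound_unit[OF a] by blast
  have "a (qtrace y) \<le> C / a t * B" if B: "0 < B" and y: "\<forall>\<nu>\<in>extensions a. \<nu> y \<le> B" for y :: 'k and B
  proof -
    obtain q where q: "B \<le> a q" "a q \<le> B / a t" using absolute_value_scaling[OF a t B] by blast
    have q0: "q \<noteq> 0" using q B absolute_valueD(5)[OF a] by auto
    have aq: "a q > 0" using q B by linarith
    have "a (qtrace (of_rat (1 / q) * y)) \<le> C"
    proof (rule C(2), rule ballI)
      fix \<nu> :: "'k \<Rightarrow> real" assume nu: "\<nu> \<in> extensions a"
      have "\<nu> (of_rat (1 / q) * y) = \<nu> y / a q"
        unfolding absolute_valueD(3)[OF extensionsD(1)[OF nu]] extensionsD(2)[OF nu] absolute_valueD(6,11)[OF a] by simp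
      then show "\<nu> (of_rat (1 / q) * y) \<le> 1" using y nu q aq by (auto simp: divide_le_eq intro: order_trans)
    qed
    then have "a (qtrace y) / a q \<le> C" unfolding qtrace_scale by (simp add: absolute_valueD(3,6,11)[OF a])
    then have "a (qtrace y) \<le> C * a q" using aq by (simp add: field_simps)
    also have "\<dots> \<le> C * (B / a t)" by (rule mult_left_mono[OF q(2) C(1)])
    finally show ?thesis by simp
  qed
  then show ?thesis using C(1) t by (intro exI[of _ "C / a t"]) auto
qed


section \<open>Weak approximation and the bound of coordinates\<close>

context
  fixes a :: "rat \<Rightarrow> real" and t :: rat
  assumes a: "absolute_value a" and t: "0 < a t" "a t < 1"
begin

text \<open>Distinct extensions are inequivalent. A high power of an element on which they differ has a large
  gap between the two values, and the gap contains the value of a rational number.\<close>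

lemma extensions_separate:
  assumes nu: "\<nu> \<in> extensions a" and mu: "\<mu> \<in> extensions a" and ne: "\<nu> \<noteq> \<mu>"
  shows "\<exists>y::'k::number_field. \<nu> y > 1 \<and> \<mu> y < 1"
proof -
  note N = absolute_valueD[OF extensionsD(1)[OF nu]] and M = absolute_valueD[OF extensionsD(1)[OF mu]]
  obtain x where x: "\<nu> x \<noteq> \<mu> x" using ne by (metis ext)
  have x0: "x \<noteq> 0" using x N(5) M(5) by metis
  obtain x where x: "\<mu> x < \<nu> x" "x \<noteq> 0"
  proof (cases "\<mu> x < \<nu> x")
    case False
    then have "\<nu> x < \<mu> x" using x by simp
    then have "\<mu> (inverse x) < \<nu> (inverse x)" unfolding N(9) M(9) using N(10)[OF x0] by simp
    then show ?thesis using that[of "inverse x"] x0 by simp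
  qed (use that[of x] x0 in simp)
  have "\<nu> x / \<mu> x > 1" using x M(10) by simp
  then obtain n where n: "1 / a t < (\<nu> x / \<mu> x) ^ n" using real_arch_pow by blast
  have mp: "\<mu> x ^ n > 0" using M(10)[OF x(2)] by simp
  have gap: "\<mu> x ^ n / a t < \<nu> x ^ n" using n mp by (simp add: power_divide field_simps)
  \<comment> \<open>the midpoint of the gap, to be approximated by the value of a rational scalar\<close>
  define g where "g = (\<mu> x ^ n / a t + \<nu> x ^ n) / 2"
  have g1: "\<mu> x ^ n / a t < g" using less_half_sum[OF gap] by (simp add: g_def)
  have g2: "g < \<nu> x ^ n" using gt_half_sum[OF gap] by (simp add: g_def)
  note g = g1 g2
  have "a t * g > 0" using mp g t by (smt (verit) divide_pos_pos mult_pos_pos)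
  then obtain q where q: "a t * g \<le> a q" "a q \<le> a t * g / a t" using absolute_value_scaling[OF a t] by blast
  have aq: "a q > 0" using q \<open>a t * g > 0\<close> by linarith
  have "\<mu> x ^ n < a q" using g(1) q(1) t by (simp add: field_simps)
  moreover have "a q < \<nu> x ^ n" using g(2) q(2) t by simp
  ultimately have "\<nu> (x ^ n / of_rat q) > 1" "\<mu> (x ^ n / of_rat q) < 1"
    using aq by (simp_all add: N(8,11) M(8,11) extensionsD(2)[OF nu] extensionsD(2)[OF mu])
  then show ?thesis by blast
qed

text \<open>As \<open>n\<close> grows, \<open>y\<^sup>n / (1 + y\<^sup>n)\<close> tends to \<open>1\<close> where \<open>y\<close> is large and to \<open>0\<close> where it is
  small.\<close>

lemma power_quotient_limits:
  fixes y :: "'k::number_field"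
  assumes nu: "\<nu> \<in> extensions a"
  shows "\<nu> y > 1 \<Longrightarrow> 0 < (\<delta>::real) \<Longrightarrow> \<forall>\<^sub>F n in sequentially. 1 + y ^ n \<noteq> 0 \<and> \<nu> (y ^ n / (1 + y ^ n) - 1) < \<delta>"
    and "\<nu> y < 1 \<Longrightarrow> 0 < \<delta> \<Longrightarrow> \<forall>\<^sub>F n in sequentially. \<nu> (y ^ n / (1 + y ^ n)) < \<delta>"
proof -
  note N = absolute_valueD[OF extensionsD(1)[OF nu]]
  assume d: "0 < \<delta>"
  {
    assume y: "\<nu> y > 1"
    obtain n0 where n0: "1 + 1 / \<delta> < \<nu> y ^ n0" using real_arch_pow[OF y] by blast
    show "\<forall>\<^sub>F n in sequentially. 1 + y ^ n \<noteq> 0 \<and> \<nu> (y ^ n / (1 + y ^ n) - 1) < \<delta>"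
    proof (rule eventually_sequentiallyI[of n0])
      fix n assume "n0 \<le> n"
      then have "\<nu> y ^ n0 \<le> \<nu> y ^ n" using y by (intro power_increasing) auto
      then have big: "\<nu> y ^ n - 1 > 1 / \<delta>" using n0 by linarith
      have "\<nu> (y ^ n) \<le> \<nu> (1 + y ^ n) + \<nu> 1" using N(12)[of "1 + y ^ n" 1] by simp
      then have low: "\<nu> y ^ n - 1 \<le> \<nu> (1 + y ^ n)" by (simp add: N(6,8))
      then have l2: "\<nu> (1 + y ^ n) > 1 / \<delta>" using big by linarith
      moreover have "1 / \<delta> > 0" using d by simp
      ultimately have ne: "1 + y ^ n \<noteq> 0" using N(5) by force
      have "y ^ n / (1 + y ^ n) - 1 = - (1 / (1 + y ^ n))" using ne by (simp add: field_simps)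
      then have "\<nu> (y ^ n / (1 + y ^ n) - 1) = 1 / \<nu> (1 + y ^ n)" by (simp only: N(7,11,6))
      also have "\<dots> < \<delta>" using l2 d N(10)[OF ne] by (simp add: field_simps)
      finally show "1 + y ^ n \<noteq> 0 \<and> \<nu> (y ^ n / (1 + y ^ n) - 1) < \<delta>" using ne by blast
    qed
  }
  {
    assume y: "\<nu> y < 1"
    define \<eta> where "\<eta> = min (1/2) (\<delta> / 2)"
    have eta: "\<eta> > 0" "\<eta> \<le> 1/2" "\<eta> \<le> \<delta> / 2" using d by (auto simp: \<eta>_def)
    obtain n0 where n0: "\<nu> y ^ n0 < \<eta>" using real_arch_pow_inv[OF eta(1) y] by blast
    show "\<forall>\<^sub>F n in sequentially. \<nu> (y ^ n / (1 + y ^ n)) < \<delta>"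
    proof (rule eventually_sequentiallyI[of n0])
      fix n assume "n0 \<le> n"
      then have "\<nu> y ^ n \<le> \<nu> y ^ n0" using y N(1) by (intro power_decreasing) auto
      then have small: "\<nu> y ^ n < \<eta>" using n0 by linarith
      have "\<nu> 1 \<le> \<nu> (1 + y ^ n) + \<nu> (y ^ n)" using N(12)[of "1 + y ^ n" "y ^ n"] by simp
      then have low: "1/2 < \<nu> (1 + y ^ n)" using small eta by (simp add: N(6,8))
      have "\<nu> (y ^ n / (1 + y ^ n)) = \<nu> y ^ n / \<nu> (1 + y ^ n)" by (simp only: N(8,11))
      also have "\<dots> < \<eta> / (1/2)" by (rule frac_less) (use small low N(1) in auto)
      also have "\<dots> \<le> \<delta>" using eta by simp
      finally show "\<nu> (y ^ n / (1 + y ^ n)) < \<delta>" .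
    qed
  }
qed

text \<open>The induction of Artin and Whaples. If \<open>y\<close> separates \<open>\<nu>\<close> from \<open>S\<close> and \<open>z\<close> separates it from \<open>\<mu>\<close>,
  take \<open>y\<^sup>n z\<close> when \<open>\<mu>(y) \<le> 1\<close> and \<open>z y\<^sup>n / (1 + y\<^sup>n)\<close> otherwise.\<close>

lemma extensions_separate_finite:
  assumes "finite S" "S \<subseteq> extensions a" "\<nu> \<in> extensions a" "\<nu> \<notin> S"
  shows "\<exists>y::'k::number_field. \<nu> y > 1 \<and> (\<forall>\<mu>\<in>S. \<mu> y < 1)"
  using assms
proof (induction S rule: finite_induct)
  case empty
  have "1 / a t > 1" using t by simp
  then have "\<nu> (of_rat (1 / t)) > 1" unfolding extensionsD(2)[OF empty(2)] by (simp add: absolute_valueD(6,11)[OF a])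
  then show ?case by blast
next
  case (insert \<mu> S)
  note N = absolute_valueD[OF extensionsD(1)[OF insert.prems(2)]]
  have mu: "\<mu> \<in> extensions a" using insert.prems by simp
  note M = absolute_valueD[OF extensionsD(1)[OF mu]]
  obtain y where y: "\<nu> y > 1" "\<forall>\<mu>\<in>S. \<mu> y < 1" using insert by auto
  obtain z where z: "\<nu> z > 1" "\<mu> z < 1" using extensions_separate[OF insert.prems(2) mu] insert.prems by auto
  have S: "\<rho> \<in> extensions a" if "\<rho> \<in> S" for \<rho> using insert.prems(1) that by auto
  consider "\<mu> y \<le> 1" | "\<mu> y > 1" by linarith
  then show ?case
  proof cases
    case 1
    have "\<forall>\<rho>\<in>S. \<forall>\<^sub>F n in sequentially. \<rho> (y ^ n * z) < 1"
    proof
      fix \<rho> assume r: "\<rho> \<in> S"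
      note P = absolute_valueD[OF extensionsD(1)[OF S[OF r]]]
      have "(\<lambda>n. \<rho> y ^ n * \<rho> z) \<longlonglongrightarrow> 0 * \<rho> z"
        by (intro tendsto_intros LIMSEQ_power_zero) (use y r P(1) in auto)
      then have "\<forall>\<^sub>F n in sequentially. \<rho> y ^ n * \<rho> z < 1" by (intro order_tendstoD(2)) auto
      then show "\<forall>\<^sub>F n in sequentially. \<rho> (y ^ n * z) < 1" by (simp add: P(3,8))
    qed
    then have "\<forall>\<^sub>F n in sequentially. \<forall>\<rho>\<in>S. \<rho> (y ^ n * z) < 1" by (rule eventually_ball_finite[OF insert.hyps(1)])
    then obtain n where n: "\<forall>\<rho>\<in>S. \<rho> (y ^ n * z) < 1" using eventually_happens by fastforce
    have "\<nu> (y ^ n * z) > 1" using y(1) z(1) by (simp add: N(3,8)) (metis less_1_mult mult_1 less_imp_le one_le_power order_le_less)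
    moreover have "\<mu> (y ^ n * z) < 1"
      using z(2) mult_right_mono[OF power_le_one[OF M(1) 1, of n] M(1)[of z]] by (simp add: M(3,8))
    ultimately show ?thesis using n by blast
  next
    case 2
    \<comment> \<open>a relative error below \<open>g\<close> keeps \<open>\<nu>(z) > 1\<close> and \<open>\<mu>(z) < 1\<close>\<close>
    define u where "u = (\<lambda>n. y ^ n / (1 + y ^ n))"
    define g where "g = min (1 - 1 / \<nu> z) (if \<mu> z = 0 then 1 else 1 / \<mu> z - 1)"
    have g0: "g > 0" using z M(1)[of z] by (auto simp: g_def)
    have "\<forall>\<rho>\<in>S. \<forall>\<^sub>F n in sequentially. \<rho> (u n * z) < 1"
    proof
      fix \<rho> assume r: "\<rho> \<in> S"
      note P = absolute_valueD[OF extensionsD(1)[OF S[OF r]]]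
      have "\<forall>\<^sub>F n in sequentially. \<rho> (u n) < 1 / (\<rho> z + 1)"
        unfolding u_def by (rule power_quotient_limits(2)[OF S[OF r]]) (use y r P(1)[of z] in auto)
      then show "\<forall>\<^sub>F n in sequentially. \<rho> (u n * z) < 1"
      proof (rule eventually_mono)
        fix n assume "\<rho> (u n) < 1 / (\<rho> z + 1)"
        then have "\<rho> (u n) * (\<rho> z + 1) < 1" using P(1)[of z] by (simp add: pos_less_divide_eq)
        then show "\<rho> (u n * z) < 1" using P(1)[of "u n"] by (simp add: P(3) distrib_left)
      qed
    qed
    then have "\<forall>\<^sub>F n in sequentially. \<forall>\<rho>\<in>S. \<rho> (u n * z) < 1" by (rule eventually_ball_finite[OF insert.hyps(1)])
    moreover have "\<forall>\<^sub>F n in sequentially. 1 + y ^ n \<noteq> 0 \<and> \<nu> (u n - 1) < g"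
      unfolding u_def by (rule power_quotient_limits(1)[OF insert.prems(2) y(1) g0])
    moreover have "\<forall>\<^sub>F n in sequentially. 1 + y ^ n \<noteq> 0 \<and> \<mu> (u n - 1) < g"
      unfolding u_def by (rule power_quotient_limits(1)[OF mu 2 g0])
    ultimately have "\<forall>\<^sub>F n in sequentially. (\<forall>\<rho>\<in>S. \<rho> (u n * z) < 1) \<and> \<nu> (u n - 1) < g \<and> \<mu> (u n - 1) < g"
      by eventually_elim blast
    then obtain n where n: "\<forall>\<rho>\<in>S. \<rho> (u n * z) < 1" "\<nu> (u n - 1) < g" "\<mu> (u n - 1) < g"
      using eventually_happens by fastforce
    have "1 \<le> \<nu> (u n) + \<nu> (u n - 1)" using N(12)[of "u n" "u n - 1"] N(6) by simp
    then have "\<nu> (u n) > 1 / \<nu> z" using n(2) by (simp add: g_def)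
    then have nz: "\<nu> (u n * z) > 1" using z(1) by (simp add: N(3) divide_less_eq)
    have "\<mu> (u n) \<le> \<mu> (u n - 1) + 1" using M(4)[of "u n - 1" 1] M(6) by simp
    then have "\<mu> (u n) < 1 + g" using n(3) by simp
    have "\<mu> (u n * z) < 1"
    proof (cases "\<mu> z = 0")
      case False
      then have "g \<le> 1 / \<mu> z - 1" by (simp add: g_def)
      then have "\<mu> (u n) < 1 / \<mu> z" using \<open>\<mu> (u n) < 1 + g\<close> by linarith
      then show ?thesis using M(1)[of z] False by (simp add: M(3) pos_less_divide_eq)
    qed (simp add: M(3))
    then show ?thesis using n(1) nz by blast
  qed
qed

lemma weak_approximation:
  assumes fin: "finite S" and S: "S \<subseteq> extensions a" and nu: "\<nu> \<in> S" and d: "\<delta> > 0"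
  shows "\<exists>e::'k::number_field. \<nu> (e - 1) < \<delta> \<and> (\<forall>\<mu>\<in>S - {\<nu>}. \<mu> e < \<delta>)"
proof -
  have nuE: "\<nu> \<in> extensions a" using S nu by blast
  obtain y where y: "\<nu> y > 1" "\<forall>\<mu>\<in>S - {\<nu>}. \<mu> y < 1"
    using extensions_separate_finite[of "S - {\<nu>}" \<nu>] fin S nu by blast
  have "\<forall>\<mu>\<in>S - {\<nu>}. \<forall>\<^sub>F n in sequentially. \<mu> (y ^ n / (1 + y ^ n)) < \<delta>"
    using power_quotient_limits(2)[OF _ _ d] S y(2) by blast
  then have "\<forall>\<^sub>F n in sequentially. \<forall>\<mu>\<in>S - {\<nu>}. \<mu> (y ^ n / (1 + y ^ n)) < \<delta>"
    by (rule eventually_ball_finite[rotated]) (use fin in auto)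
  moreover have "\<forall>\<^sub>F n in sequentially. 1 + y ^ n \<noteq> 0 \<and> \<nu> (y ^ n / (1 + y ^ n) - 1) < \<delta>"
    by (rule power_quotient_limits(1)[OF nuE y(1) d])
  ultimately have "\<forall>\<^sub>F n in sequentially. (\<forall>\<mu>\<in>S - {\<nu>}. \<mu> (y ^ n / (1 + y ^ n)) < \<delta>) \<and> \<nu> (y ^ n / (1 + y ^ n) - 1) < \<delta>"
    by eventually_elim blast
  then obtain n where "(\<forall>\<mu>\<in>S - {\<nu>}. \<mu> (y ^ n / (1 + y ^ n)) < \<delta>) \<and> \<nu> (y ^ n / (1 + y ^ n) - 1) < \<delta>"
    using eventually_happens by fastforce
  then show ?thesis by blast
qed

text \<open>Approximate idempotents for the places in \<open>S\<close> are linearly independent: at the place of its largest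
  coefficient, a relation is dominated by a single term.\<close>

lemma card_extensions_le:
  assumes fin: "finite S" and S: "S \<subseteq> (extensions a :: ('k::number_field \<Rightarrow> real) set)"
  shows "card S \<le> nf_degree TYPE('k)"
proof -
  define g where "g = card S"
  obtain h where h: "bij_betw h {..<g} S" using ex_bij_betw_nat_finite[OF fin] unfolding g_def atLeast0LessThan by blast
  have hS: "h i \<in> S" if "i < g" for i using h that by (auto dest: bij_betwE)
  define \<delta> :: real where "\<delta> = 1 / (2 * (g + 1))"
  have d: "\<delta> > 0" by (simp add: \<delta>_def)
  have "\<forall>i. \<exists>e::'k. i < g \<longrightarrow> h i (e - 1) < \<delta> \<and> (\<forall>\<mu>\<in>S - {h i}. \<mu> e < \<delta>)"
    using weak_approximation[OF fin S _ d] hS by blast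
  from choice[OF this] obtain e :: "nat \<Rightarrow> 'k" where
    e: "\<forall>i. i < g \<longrightarrow> h i (e i - 1) < \<delta> \<and> (\<forall>\<mu>\<in>S - {h i}. \<mu> (e i) < \<delta>)" by (elim exE)
  have "qindep g e"
    unfolding qindep_def
  proof (intro allI impI)
    fix c i assume c: "qcomb g e c = 0" and i: "i < g"
    define m where "m = Max ((\<lambda>i. a (c i)) ` {..<g})"
    have "m \<in> (\<lambda>i. a (c i)) ` {..<g}" unfolding m_def by (rule Max_in) (use i in auto)
    then obtain j where j: "j < g" "m = a (c j)" by auto
    have m: "a (c i) \<le> m" if "i < g" for i unfolding m_def using that by (intro Max_ge) auto
    have hj: "h j \<in> extensions a" using hS[OF j(1)] S by blast
    note N = absolute_valueD[OF extensionsD(1)[OF hj]]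
    have "of_rat (c j) * 1 = - (\<Sum>i<g. of_rat (c i) * (e i - (if i = j then 1 else 0)))"
    proof -
      have "(\<Sum>i<g. of_rat (c i) * (e i - (if i = j then 1 else 0))) = qcomb g e c - (\<Sum>i<g. if i = j then of_rat (c i) else 0)"
        unfolding qcomb_def sum_subtractf[symmetric] by (rule sum.cong) (auto simp: algebra_simps)
      also have "\<dots> = - of_rat (c j)" using j c by simp
      finally show ?thesis by simp
    qed
    then have "h j (of_rat (c j)) = h j (\<Sum>i<g. of_rat (c i) * (e i - (if i = j then 1 else 0)))"
      by (simp only: mult_1_right N(7))
    then have "m = h j (\<Sum>i<g. of_rat (c i) * (e i - (if i = j then 1 else 0)))"
      by (simp only: j(2) extensionsD(2)[OF hj])
    also have "\<dots> \<le> (\<Sum>i<g. h j (of_rat (c i) * (e i - (if i = j then 1 else 0))))"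
      by (rule absolute_value_sum[OF extensionsD(1)[OF hj]])
    also have "\<dots> \<le> (\<Sum>i<g. m * \<delta>)"
    proof (rule sum_mono)
      fix i assume "i \<in> {..<g}"
      then have ig: "i < g" by simp
      have "h j (e i - (if i = j then 1 else 0)) \<le> \<delta>"
      proof (cases "i = j")
        case False
        then have "h j \<in> S - {h i}" using h hS[OF j(1)] ig j(1) by (auto simp: bij_betw_def inj_on_def)
        then show ?thesis using e ig False by (simp add: less_imp_le)
      qed (use e ig in \<open>auto simp: less_imp_le\<close>)
      then show "h j (of_rat (c i) * (e i - (if i = j then 1 else 0))) \<le> m * \<delta>"
        unfolding N(3) extensionsD(2)[OF hj] using m[OF ig] N(1) absolute_valueD(1)[OF a] by (intro mult_mono) (auto intro: order_trans)
    qed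
    also have "\<dots> = m * (g * \<delta>)" by simp
    finally have "m * (1 - g * \<delta>) \<le> 0" by (simp add: algebra_simps)
    moreover have "1 - g * \<delta> > 0" by (simp add: \<delta>_def field_simps)
    ultimately have "m \<le> 0" by (simp add: mult_le_0_iff)
    then have "a (c i) \<le> 0" using m[OF i] by simp
    then show "c i = 0" using absolute_valueD(10)[OF a, of "c i"] by force
  qed
  then show ?thesis unfolding g_def by (rule qindep_le_degree)
qed

lemma finite_extensions: "finite (extensions a :: ('k::number_field \<Rightarrow> real) set)"
proof (rule ccontr)
  assume "infinite (extensions a :: ('k \<Rightarrow> real) set)"
  then obtain S :: "('k \<Rightarrow> real) set" where "S \<subseteq> extensions a" "finite S" "card S = Suc (nf_degree TYPE('k))"
    using infinite_arbitrarily_large by blast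
  then show False using card_extensions_le[of S] by simp
qed

lemma extensions_bound:
  fixes b :: "nat \<Rightarrow> 'k::number_field"
  shows "\<exists>\<beta>\<ge>1. \<forall>\<nu>\<in>extensions a. \<forall>i<n. \<nu> (b i) \<le> \<beta>"
proof -
  define A where "A = insert 1 ((\<lambda>(\<nu>, i). \<nu> (b i)) ` ((extensions a :: ('k \<Rightarrow> real) set) \<times> {..<n}))"
  have "finite A"
    unfolding A_def by (intro finite.insertI finite_imageI finite_cartesian_product finite_extensions finite_lessThan)
  then have "\<forall>x\<in>A. x \<le> Max A" by simp
  then show ?thesis by (intro exI[of _ "Max A"]) (auto simp: A_def)
qed

text \<open>The coordinates of \<open>x\<close> solve the linear system with the Gram matrix \<open>G\<close> of the trace form and the right-hand side
  \<open>qtrace (x b\<^sub>i)\<close>. The matrix is invertible since the discriminant does not vanish, and the traces are bounded by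
  \<open>qtrace_bound\<close>.\<close>

lemma qcoord_bound:
  fixes b :: "nat \<Rightarrow> 'k::number_field"
  assumes b: "qbasis b"
  shows "\<exists>C>0. \<forall>x B. 0 < B \<longrightarrow> (\<forall>\<nu>\<in>extensions a. \<nu> x \<le> B) \<longrightarrow> (\<forall>i<nf_degree TYPE('k). a (qcoord b x i) \<le> C * B)"
proof -
  define d where "d = nf_degree TYPE('k)"
  define G where "G = mat d d (\<lambda>(i, j). qtrace (b i * b j))"
  have G: "G \<in> carrier_mat d d" by (simp add: G_def)
  define D where "D = det G"
  have D0: "D \<noteq> 0" using qdisc_nonzero_iff[of b] b by (simp add: D_def G_def qdisc_def d_def)
  define H where "H = adj_mat G"
  have H: "H \<in> carrier_mat d d" "H * G = D \<cdot>\<^sub>m 1\<^sub>m d" using adj_mat[OF G] by (auto simp: H_def D_def)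
  obtain C0 where C0: "C0 \<ge> 0" "\<forall>(y::'k) B. 0 < B \<longrightarrow> (\<forall>\<nu>\<in>extensions a. \<nu> y \<le> B) \<longrightarrow> a (qtrace y) \<le> C0 * B"
    using qtrace_bound[OF a t] by blast
  obtain \<beta> where beta: "\<beta> \<ge> 1" "\<forall>\<nu>\<in>extensions a. \<forall>i<d. \<nu> (b i) \<le> \<beta>" using extensions_bound by blast
  \<comment> \<open>a bound for the row sums of the adjugate of \<open>G\<close>\<close>
  define h where "h = (\<Sum>i<d. \<Sum>j<d. a (H $$ (i, j)))"
  have h: "(\<Sum>j<d. a (H $$ (i, j))) \<le> h" if "i < d" for i
    unfolding h_def using that absolute_valueD(1)[OF a]
    by (intro member_le_sum[of i "{..<d}" "\<lambda>i. \<Sum>j<d. a (H $$ (i, j))"]) (auto intro: sum_nonneg)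
  have h0: "h \<ge> 0" unfolding h_def using absolute_valueD(1)[OF a] by (intro sum_nonneg) auto
  have main: "a (qcoord b x k) \<le> (h * C0 * \<beta> / a D + 1) * B"
    if B: "0 < B" and x: "\<forall>\<nu>\<in>extensions a. \<nu> x \<le> B" and k: "k < d" for x B k
  proof -
    define c where "c = vec d (qcoord b x)"
    define s where "s = vec d (\<lambda>i. qtrace (x * b i))"
    have car: "c \<in> carrier_vec d" by (simp add: c_def)
    have Gc: "G *\<^sub>v c = s"
    proof (rule eq_vecI)
      fix i assume "i < dim_vec s"
      then have i: "i < d" by (simp add: s_def)
      have "(G *\<^sub>v c) $ i = (\<Sum>j<d. qtrace (b i * b j) * qcoord b x j)"
        using i by (simp add: G_def c_def scalar_prod_def atLeast0LessThan)
      also have "\<dots> = (\<Sum>j<d. qtrace (of_rat (qcoord b x j) * (b j * b i)))"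
        unfolding qtrace_scale by (simp add: mult.commute)
      also have "\<dots> = qtrace (qcomb d b (qcoord b x) * b i)"
        unfolding qtrace_sum[symmetric] qcomb_def sum_distrib_right by (simp add: mult.assoc)
      also have "\<dots> = s $ i" using i qcomb_qcoord[OF b] by (simp add: s_def d_def)
      finally show "(G *\<^sub>v c) $ i = s $ i" .
    qed (simp add: G_def s_def)
    have "H *\<^sub>v s = (H * G) *\<^sub>v c" unfolding Gc[symmetric] by (rule assoc_mult_mat_vec[symmetric, OF H(1) G car])
    also have "\<dots> = D \<cdot>\<^sub>v c"
    proof -
      have "D * (if P then 1 else 0) * q = (if P then D * q else 0)" for P q by simp
      then show ?thesis unfolding H(2) by (intro eq_vecI) (auto simp: scalar_prod_def c_def)
    qed
    finally have "(H *\<^sub>v s) $ k = D * qcoord b x k" using k by (simp add: c_def)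
    moreover have "(H *\<^sub>v s) $ k = (\<Sum>j<d. H $$ (k, j) * qtrace (x * b j))"
      using k H(1) by (simp add: s_def scalar_prod_def atLeast0LessThan)
    ultimately have "a D * a (qcoord b x k) = a (\<Sum>j<d. H $$ (k, j) * qtrace (x * b j))"
      by (metis absolute_valueD(3)[OF a])
    also have "\<dots> \<le> (\<Sum>j<d. a (H $$ (k, j) * qtrace (x * b j)))" by (rule absolute_value_sum[OF a])
    also have "\<dots> \<le> (\<Sum>j<d. a (H $$ (k, j)) * (C0 * (B * \<beta>)))"
    proof (rule sum_mono)
      fix j assume j: "j \<in> {..<d}"
      have "a (qtrace (x * b j)) \<le> C0 * (B * \<beta>)"
      proof (rule C0(2)[rule_format])
        show "0 < B * \<beta>" using B beta by simp
        fix \<nu> :: "'k \<Rightarrow> real" assume nu: "\<nu> \<in> extensions a"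
        note N = absolute_valueD[OF extensionsD(1)[OF nu]]
        show "\<nu> (x * b j) \<le> B * \<beta>" unfolding N(3) using x beta nu j B N(1) by (intro mult_mono) auto
      qed
      then show "a (H $$ (k, j) * qtrace (x * b j)) \<le> a (H $$ (k, j)) * (C0 * (B * \<beta>))"
        unfolding absolute_valueD(3)[OF a] by (rule mult_left_mono) (rule absolute_valueD(1)[OF a])
    qed
    also have "\<dots> \<le> h * (C0 * (B * \<beta>))"
      unfolding sum_distrib_right[symmetric] by (rule mult_right_mono[OF h[OF k]]) (use C0 B beta in auto)
    finally have "a (qcoord b x k) \<le> h * C0 * \<beta> / a D * B"
      using absolute_valueD(10)[OF a D0] by (simp add: field_simps)
    then show ?thesis using B by (simp add: distrib_right)
  qed
  have "h * C0 * \<beta> / a D \<ge> 0" using h0 C0 beta absolute_valueD(1)[OF a, of D] by simp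
  then show ?thesis using main unfolding d_def by (intro exI[of _ "h * C0 * \<beta> / a D + 1"]) auto
qed

end


section \<open>Local bases and the local norm inequality\<close>

text \<open>Says without reference to completions that the \<open>b\<^sub>i\<close> with \<open>i \<in> I\<close> are a basis of
  the completion at \<open>\<nu>\<close> over the completion of the rational numbers: rational coefficients are
  controlled by the value of the combination, and the combinations are dense.\<close>

definition local_basis :: "(rat \<Rightarrow> real) \<Rightarrow> ('k::number_field \<Rightarrow> real) \<Rightarrow> nat set \<Rightarrow> (nat \<Rightarrow> 'k) \<Rightarrow> bool" where
  "local_basis a \<nu> I b \<longleftrightarrow> finite I \<and>
     (\<exists>\<epsilon>>0. \<forall>c. \<forall>i\<in>I. \<epsilon> * a (c i) \<le> \<nu> (\<Sum>i\<in>I. of_rat (c i) * b i)) \<and>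
     (\<forall>x. \<forall>\<eta>>0. \<exists>c. \<nu> (x - (\<Sum>i\<in>I. of_rat (c i) * b i)) < \<eta>)"

text \<open>A smallest subset of a global basis with dense combinations works. If the coefficient at \<open>i\<close> were not
  controlled, there would be combinations of arbitrarily small value relative to their coefficient at \<open>i\<close>, by means of
  which \<open>b\<^sub>i\<close> could be eliminated without losing density.\<close>

lemma local_basis_exists:
  fixes b :: "nat \<Rightarrow> 'k::number_field"
  assumes a: "absolute_value a" and nu: "\<nu> \<in> extensions a" and b: "qbasis b"
  shows "\<exists>I\<subseteq>{..<nf_degree TYPE('k)}. local_basis a \<nu> I b"
proof -
  define d where "d = nf_degree TYPE('k)"
  note N = absolute_valueD[OF extensionsD(1)[OF nu]]
  define P where "P = (\<lambda>I. I \<subseteq> {..<d} \<and> (\<forall>x. \<forall>\<eta>>0. \<exists>c. \<nu> (x - (\<Sum>i\<in>I. of_rat (c i) * b i)) < \<eta>))"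
  have "P {..<d}"
    unfolding P_def
  proof (intro conjI allI impI)
    fix x and \<eta> :: real assume "\<eta> > 0"
    have "x - (\<Sum>i\<in>{..<d}. of_rat (qcoord b x i) * b i) = 0" using qcomb_qcoord[OF b, of x] by (simp add: qcomb_def d_def)
    then show "\<exists>c. \<nu> (x - (\<Sum>i\<in>{..<d}. of_rat (c i) * b i)) < \<eta>" using \<open>\<eta> > 0\<close> N(5) by (intro exI[of _ "qcoord b x"]) simp
  qed simp
  then obtain I where I: "P I" and min: "\<And>J. P J \<Longrightarrow> card I \<le> card J" using ex_has_least_nat[of P _ card] by blast
  have fin: "finite I" using I finite_subset unfolding P_def by blast
  have "\<exists>\<epsilon>>0. \<forall>c. \<forall>i\<in>I. \<epsilon> * a (c i) \<le> \<nu> (\<Sum>i\<in>I. of_rat (c i) * b i)"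
  proof (rule ccontr)
    assume no: "\<not> ?thesis"
    have "\<exists>i\<in>I. \<forall>\<epsilon>>0. \<exists>c. \<nu> (\<Sum>i\<in>I. of_rat (c i) * b i) < \<epsilon> * a (c i)"
    proof (rule ccontr)
      assume "\<not> ?thesis"
      then have "\<forall>i. \<exists>\<epsilon>. i \<in> I \<longrightarrow> \<epsilon> > 0 \<and> (\<forall>c. \<epsilon> * a (c i) \<le> \<nu> (\<Sum>i\<in>I. of_rat (c i) * b i))" by (auto simp: not_less)
      from choice[OF this] obtain \<epsilon> where
        e: "\<forall>i. i \<in> I \<longrightarrow> \<epsilon> i > 0 \<and> (\<forall>c. \<epsilon> i * a (c i) \<le> \<nu> (\<Sum>i\<in>I. of_rat (c i) * b i))" by (elim exE)
      define \<epsilon>0 where "\<epsilon>0 = Min (insert 1 (\<epsilon> ` I))"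
      have "\<epsilon>0 \<in> insert 1 (\<epsilon> ` I)" unfolding \<epsilon>0_def by (rule Min_in) (use fin in auto)
      then have "\<epsilon>0 > 0" using e by auto
      moreover have "\<epsilon>0 * a (c i) \<le> \<nu> (\<Sum>i\<in>I. of_rat (c i) * b i)" if "i \<in> I" for c i
      proof -
        have "\<epsilon>0 \<le> \<epsilon> i" unfolding \<epsilon>0_def by (rule Min_le) (use fin that in auto)
        then have "\<epsilon>0 * a (c i) \<le> \<epsilon> i * a (c i)" by (rule mult_right_mono) (rule absolute_valueD(1)[OF a])
        then show ?thesis using e that by (meson order_trans)
      qed
      ultimately show False using no by blast
    qed
    then obtain i where i: "i \<in> I" "\<forall>\<epsilon>>0. \<exists>c. \<nu> (\<Sum>i\<in>I. of_rat (c i) * b i) < \<epsilon> * a (c i)" by blast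
    have "P (I - {i})"
      unfolding P_def
    proof (intro conjI allI impI)
      show "I - {i} \<subseteq> {..<d}" using I unfolding P_def by blast
      fix x and \<eta> :: real assume eta: "\<eta> > 0"
      obtain c where c: "\<nu> (x - (\<Sum>i\<in>I. of_rat (c i) * b i)) < \<eta> / 2" using I eta unfolding P_def by (meson half_gt_zero)
      define \<epsilon> where "\<epsilon> = \<eta> / (2 * (1 + a (c i)))"
      have e0: "\<epsilon> > 0" using eta absolute_valueD(1)[OF a, of "c i"] by (simp add: \<epsilon>_def)
      obtain f where f: "\<nu> (\<Sum>i\<in>I. of_rat (f i) * b i) < \<epsilon> * a (f i)" using i(2) e0 by blast
      have af: "a (f i) > 0"
      proof (rule ccontr)
        assume "\<not> ?thesis"
        then have "a (f i) = 0" using absolute_valueD(1)[OF a, of "f i"] by linarith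
        then show False using f N(1)[of "\<Sum>i\<in>I. of_rat (f i) * b i"] by simp
      qed
      \<comment> \<open>subtracting \<open>q\<close> times the small combination \<open>f\<close> cancels the coefficient at \<open>i\<close>\<close>
      define q where "q = c i / f i"
      define g where "g = (\<lambda>j. c j - q * f j)"
      have gi: "g i = 0" using af absolute_valueD(5)[OF a] by (auto simp: g_def q_def)
      have hlp: "x - A = (x - C) + D" if "A = C - D" for A C D :: 'k using that by simp
      have "(\<Sum>j\<in>I - {i}. of_rat (g j) * b j) = (\<Sum>j\<in>I. of_rat (g j) * b j)"
        using gi sum.remove[OF fin i(1), of "\<lambda>j. of_rat (g j) * b j"] by simp
      also have "\<dots> = (\<Sum>j\<in>I. of_rat (c j) * b j) - of_rat q * (\<Sum>j\<in>I. of_rat (f j) * b j)"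
        by (simp only: g_def of_rat_diff of_rat_mult left_diff_distrib sum_subtractf sum_distrib_left mult.assoc)
      finally have eqx: "x - (\<Sum>j\<in>I - {i}. of_rat (g j) * b j) = (x - (\<Sum>j\<in>I. of_rat (c j) * b j)) + of_rat q * (\<Sum>j\<in>I. of_rat (f j) * b j)"
        by (rule hlp)
      have "\<nu> (x - (\<Sum>j\<in>I - {i}. of_rat (g j) * b j)) \<le> \<nu> (x - (\<Sum>j\<in>I. of_rat (c j) * b j)) + \<nu> (of_rat q * (\<Sum>j\<in>I. of_rat (f j) * b j))"
        unfolding eqx by (rule N(4))
      also have "\<dots> = \<nu> (x - (\<Sum>j\<in>I. of_rat (c j) * b j)) + a q * \<nu> (\<Sum>j\<in>I. of_rat (f j) * b j)"
        by (simp only: N(3) extensionsD(2)[OF nu])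
      also have "\<dots> < \<eta> / 2 + \<eta> / 2"
      proof (rule add_less_le_mono[OF c])
        have "a q * \<nu> (\<Sum>j\<in>I. of_rat (f j) * b j) \<le> a q * (\<epsilon> * a (f i))"
          using f absolute_valueD(1)[OF a] by (intro mult_left_mono) auto
        also have "\<dots> = \<epsilon> * a (c i)" using af by (simp add: q_def absolute_valueD(11)[OF a])
        also have "\<dots> = (\<eta> / 2) * (a (c i) / (1 + a (c i)))" by (simp add: \<epsilon>_def)
        also have "\<dots> \<le> (\<eta> / 2) * 1"
          by (rule mult_left_mono) (use eta absolute_valueD(1)[OF a, of "c i"] in \<open>auto simp: divide_le_eq\<close>)
        finally show "a q * \<nu> (\<Sum>j\<in>I. of_rat (f j) * b j) \<le> \<eta> / 2" by simp
      qed
      finally show "\<exists>c. \<nu> (x - (\<Sum>i\<in>I - {i}. of_rat (c i) * b i)) < \<eta>" by (intro exI[of _ g]) simp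
    qed
    then have "card I \<le> card (I - {i})" by (rule min)
    then show False using fin i(1) by (metis card_Diff1_less not_less)
  qed
  then show ?thesis using I fin unfolding local_basis_def P_def d_def by blast
qed

lemma qindep_in_span_le:
  assumes y: "qindep m y" and s: "\<And>j. j < m \<Longrightarrow> y j \<in> qspan n b" shows "m \<le> n"
proof -
  have "y ` {..<m} \<subseteq> rvs.span (b ` {..<n})" using s unfolding qspan_eq by blast
  then have "card (y ` {..<m}) \<le> card (b ` {..<n})"
    using rvs.independent_span_bound[OF _ qindep_independent[OF y], of "b ` {..<n}"] by simp
  also have "\<dots> \<le> n" using card_image_le[of "{..<n}" b] by simp
  finally show ?thesis using qindep_inj[OF y] by (simp add: card_image)
qed

text \<open>Elements whose coordinates are close to those of a basis still form a basis: in a relation, the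
  largest coefficient would be at most half of itself.\<close>

lemma qindep_perturbation:
  fixes b y :: "nat \<Rightarrow> 'k::number_field"
  assumes a: "absolute_value a" and b: "qbasis b"
    and close: "\<And>i j. i < nf_degree TYPE('k) \<Longrightarrow> j < nf_degree TYPE('k) \<Longrightarrow> a (qcoord b (b j - y j) i) \<le> 1 / (2 * real (nf_degree TYPE('k)))"
  shows "qindep (nf_degree TYPE('k)) y"
  unfolding qindep_def
proof (intro allI impI)
  define d where "d = nf_degree TYPE('k)"
  fix c i assume c: "qcomb (nf_degree TYPE('k)) y c = 0" and i: "i < nf_degree TYPE('k)"
  define m where "m = Max ((\<lambda>i. a (c i)) ` {..<d})"
  have "m \<in> (\<lambda>i. a (c i)) ` {..<d}" unfolding m_def by (rule Max_in) (use i in \<open>auto simp: d_def\<close>)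
  then obtain j where j: "j < d" "m = a (c j)" by auto
  have m: "a (c i) \<le> m" if "i < d" for i unfolding m_def using that by (intro Max_ge) auto
  have m0: "m \<ge> 0" using j absolute_valueD(1)[OF a] by simp
  have "qcomb d b c = (\<Sum>k<d. of_rat (c k) * (b k - y k))"
    using c by (simp add: qcomb_def d_def right_diff_distrib sum_subtractf)
  also have "\<dots> = qcomb d b (\<lambda>i. \<Sum>k<d. c k * qcoord b (b k - y k) i)"
  proof -
    have "(\<Sum>k<d. of_rat (c k) * (b k - y k)) = (\<Sum>k<d. of_rat (c k) * qcomb d b (qcoord b (b k - y k)))"
      by (simp only: qcomb_qcoord[OF b, folded d_def])
    also have "\<dots> = (\<Sum>k<d. \<Sum>i<d. of_rat (c k * qcoord b (b k - y k) i) * b i)"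
      unfolding qcomb_def sum_distrib_left of_rat_mult mult.assoc ..
    also have "\<dots> = qcomb d b (\<lambda>i. \<Sum>k<d. c k * qcoord b (b k - y k) i)"
      unfolding qcomb_def of_rat_sum sum_distrib_right by (rule sum.swap)
    finally show ?thesis .
  qed
  finally have "c j = (\<Sum>k<d. c k * qcoord b (b k - y k) j)"
    using qindep_unique[of d b c _ j] b j(1) unfolding qbasis_def d_def by blast
  then have "m \<le> (\<Sum>k<d. a (c k * qcoord b (b k - y k) j))" unfolding j(2) using absolute_value_sum[OF a] by metis
  also have "\<dots> \<le> (\<Sum>k<d. m * (1 / (2 * real d)))"
    unfolding absolute_valueD(3)[OF a]
    by (intro sum_mono mult_mono m) (use close j(1) m0 absolute_valueD(1)[OF a] in \<open>auto simp: d_def\<close>)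
  also have "\<dots> = m / 2" using nf_degree_pos[where 'k = 'k] by (simp add: d_def)
  finally have "m \<le> 0" by simp
  then have "a (c i) \<le> 0" using m[of i] i by (simp add: d_def)
  then show "c i = 0" using absolute_valueD(10)[OF a, of "c i"] by force
qed

text \<open>Multiply each local basis at \<open>\<nu>\<close> by an element \<open>e\<^sub>\<nu>\<close> that is within \<open>\<delta>\<close> of \<open>1\<close> at \<open>\<nu>\<close> and within \<open>\<delta>\<close> of \<open>0\<close> at the other
  places. For small \<open>\<delta>\<close> these elements are independent by the lower bounds in the local bases, and they
  approximate a global basis by the density statements; hence they form a basis and the
  cardinalities add up to the degree. In this basis the row of index \<open>(\<nu>, i)\<close> of multiplication by \<open>w\<close>
  is at most a constant times \<open>\<nu>(w)\<close>, up to an error that vanishes with \<open>\<delta>\<close>, so the determinant bound gives the norm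
  inequality up to a constant, and the powers of \<open>w\<close> remove the constant.\<close>

theorem local_norm_inequality:
  fixes b :: "nat \<Rightarrow> 'k::number_field"
  assumes a: "absolute_value a" and t: "0 < a t" "a t < 1" and b: "qbasis b"
    and I: "\<And>\<nu>. \<nu> \<in> extensions a \<Longrightarrow> I \<nu> \<subseteq> {..<nf_degree TYPE('k)} \<and> local_basis a \<nu> (I \<nu>) b"
  shows "(\<Sum>\<nu>\<in>extensions a. card (I \<nu>)) = nf_degree TYPE('k) \<and>
    a (qnorm (w::'k)) \<le> (\<Prod>\<nu>\<in>extensions a. \<nu> w ^ card (I \<nu>))"
proof -
  define d where "d = nf_degree TYPE('k)"
  define S where "S = (extensions a :: ('k \<Rightarrow> real) set)"
  define J where "J = Sigma S I"
  define n where "n = card J"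
  have finS: "finite S" unfolding S_def by (rule finite_extensions[OF a t])
  have finI: "finite (I \<nu>)" if "\<nu> \<in> S" for \<nu> using I that unfolding S_def local_basis_def by blast
  have finJ: "finite J" unfolding J_def using finS finI by (rule finite_SigmaI)
  have N: "absolute_value \<nu>" "\<And>q. \<nu> (of_rat q) = a q" if "\<nu> \<in> S" for \<nu> using extensionsD that unfolding S_def by blast+
  have nJ: "n = (\<Sum>\<nu>\<in>S. card (I \<nu>))" unfolding n_def J_def using finS finI by (simp add: card_SigmaI)
  have "\<forall>\<nu>. \<exists>\<epsilon>. \<nu> \<in> S \<longrightarrow> \<epsilon> > 0 \<and> (\<forall>c. \<forall>i\<in>I \<nu>. \<epsilon> * a (c i) \<le> \<nu> (\<Sum>i\<in>I \<nu>. of_rat (c i) * b i))"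
    using I unfolding S_def local_basis_def by blast
  from choice[OF this] obtain E where
    E: "\<forall>\<nu>. \<nu> \<in> S \<longrightarrow> E \<nu> > 0 \<and> (\<forall>c. \<forall>i\<in>I \<nu>. E \<nu> * a (c i) \<le> \<nu> (\<Sum>i\<in>I \<nu>. of_rat (c i) * b i))" by (elim exE)
  define \<epsilon> where "\<epsilon> = Min (insert 1 (E ` S))"
  have "\<epsilon> \<in> insert 1 (E ` S)" unfolding \<epsilon>_def by (rule Min_in) (use finS in auto)
  then have e0: "\<epsilon> > 0" using E by auto
  have eps: "\<epsilon> * a (c i) \<le> \<nu> (\<Sum>i\<in>I \<nu>. of_rat (c i) * b i)" if "\<nu> \<in> S" "i \<in> I \<nu>" for \<nu> c i
  proof -
    have "\<epsilon> \<le> E \<nu>" unfolding \<epsilon>_def by (rule Min_le) (use finS that in auto)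
    then have "\<epsilon> * a (c i) \<le> E \<nu> * a (c i)" by (rule mult_right_mono) (rule absolute_valueD(1)[OF a])
    then show ?thesis using E that by (meson order_trans)
  qed
  have div: "u \<le> (1 / \<epsilon>) * v" if "\<epsilon> * u \<le> v" for u v
    using that e0 by (simp add: pos_le_divide_eq mult.commute)
  obtain \<beta> where beta: "\<beta> \<ge> 1" "\<forall>\<nu>\<in>S. \<forall>i<d. \<nu> (b i) \<le> \<beta>" using extensions_bound[OF a t] unfolding S_def by blast
  have bI: "\<nu> (b (snd k)) \<le> \<beta>" if "\<nu> \<in> S" "k \<in> J" for \<nu> k
    using beta(2) that I[of "fst k"] unfolding J_def S_def d_def by (auto simp: subset_iff)
  obtain Cq where Cq: "Cq > 0" "\<forall>x B. 0 < B \<longrightarrow> (\<forall>\<nu>\<in>S. \<nu> x \<le> B) \<longrightarrow> (\<forall>i<d. a (qcoord b x i) \<le> Cq * B)"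
    using qcoord_bound[OF a t b] unfolding S_def d_def by blast
  obtain h where h: "bij_betw h {..<n} J" using ex_bij_betw_nat_finite[OF finJ] unfolding n_def atLeast0LessThan by blast
  have hJ: "h k \<in> J" if "k < n" for k using h that by (auto dest: bij_betwE)
  define g where "g = the_inv_into {..<n} h"
  have gh: "g (h k) = k" if "k < n" for k unfolding g_def using h that by (simp add: bij_betw_def the_inv_into_f_f)
  define appr where "appr = (\<lambda>(\<delta>::real) (e :: ('k \<Rightarrow> real) \<Rightarrow> 'k). \<forall>\<nu>\<in>S. \<nu> (e \<nu> - 1) \<le> \<delta> \<and> (\<forall>\<mu>\<in>S - {\<nu>}. \<mu> (e \<nu>) \<le> \<delta>))"
  have appr_ex: "\<exists>e. appr \<delta> e" if "\<delta> > 0" for \<delta>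
  proof -
    have "\<forall>\<nu>. \<exists>e::'k. \<nu> \<in> S \<longrightarrow> \<nu> (e - 1) < \<delta> \<and> (\<forall>\<mu>\<in>S - {\<nu>}. \<mu> e < \<delta>)"
      using weak_approximation[OF a t finS _ _ that] unfolding S_def by blast
    from choice[OF this] obtain e :: "('k \<Rightarrow> real) \<Rightarrow> 'k" where
      "\<forall>\<nu>. \<nu> \<in> S \<longrightarrow> \<nu> (e \<nu> - 1) < \<delta> \<and> (\<forall>\<mu>\<in>S - {\<nu>}. \<mu> (e \<nu>) < \<delta>)" by (elim exE)
    then show ?thesis unfolding appr_def by (intro exI[of _ e]) (auto intro: less_imp_le)
  qed
  \<comment> \<open>the twisted local bases, indexed by \<open>J\<close>\<close>
  define bb where "bb = (\<lambda>(e :: ('k \<Rightarrow> real) \<Rightarrow> 'k) (k :: ('k \<Rightarrow> real) \<times> nat). e (fst k) * b (snd k))"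
  have appr_err: "\<nu> (e (fst k) - (if fst k = \<nu> then 1 else 0)) \<le> \<delta>" if "appr \<delta> e" "\<nu> \<in> S" "k \<in> J" for \<delta> e \<nu> k
  proof -
    have f: "fst k \<in> S" using that(3) by (auto simp: J_def)
    then show ?thesis using that(1,2) unfolding appr_def by (cases "fst k = \<nu>") auto
  qed
  \<comment> \<open>at \<open>\<nu>\<close> only the part of a combination that belongs to \<open>\<nu>\<close> matters, up to \<open>\<delta>\<close>\<close>
  have twist: "\<nu> ((\<Sum>k\<in>J. of_rat (c k) * bb e k) - (\<Sum>i\<in>I \<nu>. of_rat (c (\<nu>, i)) * b i)) \<le> real n * (m * (\<delta> * \<beta>))"
    if e: "appr \<delta> e" and nu: "\<nu> \<in> S" and m: "\<And>k. k \<in> J \<Longrightarrow> a (c k) \<le> m" and d0: "\<delta> > 0" and m0: "m \<ge> 0" for \<delta> e \<nu> c m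
  proof -
    note M = absolute_valueD[OF N(1)[OF nu]]
    have "(\<Sum>k\<in>J. if fst k = \<nu> then of_rat (c k) * b (snd k) else 0) = (\<Sum>\<mu>\<in>S. \<Sum>i\<in>I \<mu>. if \<mu> = \<nu> then of_rat (c (\<mu>, i)) * b i else 0)"
      unfolding J_def by (subst sum.Sigma) (use finS finI in \<open>auto intro!: sum.cong\<close>)
    also have "\<dots> = (\<Sum>\<mu>\<in>S. if \<mu> = \<nu> then (\<Sum>i\<in>I \<mu>. of_rat (c (\<mu>, i)) * b i) else 0)" by (rule sum.cong) auto
    also have "\<dots> = (\<Sum>i\<in>I \<nu>. of_rat (c (\<nu>, i)) * b i)" using finS nu by simp
    finally have idx: "(\<Sum>k\<in>J. if fst k = \<nu> then of_rat (c k) * b (snd k) else 0) = (\<Sum>i\<in>I \<nu>. of_rat (c (\<nu>, i)) * b i)" .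
    have tw: "(\<Sum>k\<in>J. of_rat (c k) * bb e k) - (\<Sum>i\<in>I \<nu>. of_rat (c (\<nu>, i)) * b i)
        = (\<Sum>k\<in>J. of_rat (c k) * ((e (fst k) - (if fst k = \<nu> then 1 else 0)) * b (snd k)))"
      unfolding idx[symmetric] sum_subtractf[symmetric] by (rule sum.cong) (auto simp: bb_def algebra_simps)
    have "\<nu> ((\<Sum>k\<in>J. of_rat (c k) * bb e k) - (\<Sum>i\<in>I \<nu>. of_rat (c (\<nu>, i)) * b i))
        \<le> (\<Sum>k\<in>J. \<nu> (of_rat (c k) * ((e (fst k) - (if fst k = \<nu> then 1 else 0)) * b (snd k))))"
      unfolding tw by (rule absolute_value_sum[OF N(1)[OF nu]])
    also have "\<dots> \<le> (\<Sum>k\<in>J. m * (\<delta> * \<beta>))"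
    proof (rule sum_mono)
      fix k assume k: "k \<in> J"
      show "\<nu> (of_rat (c k) * ((e (fst k) - (if fst k = \<nu> then 1 else 0)) * b (snd k))) \<le> m * (\<delta> * \<beta>)"
        unfolding M(3) N(2)[OF nu]
        by (intro mult_mono m k appr_err[OF e nu k] bI[OF nu k] mult_nonneg_nonneg M(1) m0) (use d0 in auto)
    qed
    also have "\<dots> = real n * (m * (\<delta> * \<beta>))" by (simp add: n_def)
    finally show ?thesis .
  qed
  \<comment> \<open>Coefficients in the twisted basis are bounded by the value at their own place, up to \<open>\<delta>\<close>. The crude bound \<open>m \<le> 2 M / \<epsilon>\<close> of the largest coefficient comes first and then controls the error term.\<close>
  have coef: "a (c (\<nu>, i)) \<le> (1 / \<epsilon>) * (\<nu> x + real n * (2 / \<epsilon> * M * (\<delta> * \<beta>)))"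
    if e: "appr \<delta> e" and d0: "\<delta> > 0" "real n * (\<delta> * \<beta>) \<le> \<epsilon> / 2" and x: "x = (\<Sum>k\<in>J. of_rat (c k) * bb e k)"
      and M: "\<And>\<nu>. \<nu> \<in> S \<Longrightarrow> \<nu> x \<le> M" and k: "(\<nu>, i) \<in> J" for \<delta> e c x M \<nu> i
  proof -
    define m where "m = Max ((\<lambda>k. a (c k)) ` J)"
    have "m \<in> (\<lambda>k. a (c k)) ` J" unfolding m_def by (rule Max_in) (use finJ k in auto)
    then obtain k0 where k0: "k0 \<in> J" "m = a (c k0)" by auto
    have m: "a (c k) \<le> m" if "k \<in> J" for k unfolding m_def using that finJ by (intro Max_ge) auto
    have m0: "m \<ge> 0" using k0 absolute_valueD(1)[OF a] by simp
    have step: "\<epsilon> * a (c (\<mu>, j)) \<le> \<mu> x + real n * (m * (\<delta> * \<beta>))" if "(\<mu>, j) \<in> J" for \<mu> j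
    proof -
      have mu: "\<mu> \<in> S" "j \<in> I \<mu>" using that by (auto simp: J_def)
      note U = absolute_valueD[OF N(1)[OF mu(1)]]
      have "\<epsilon> * a (c (\<mu>, j)) \<le> \<mu> (\<Sum>i\<in>I \<mu>. of_rat (c (\<mu>, i)) * b i)" using eps[OF mu, of "\<lambda>i. c (\<mu>, i)"] .
      also have "\<dots> = \<mu> (x - (x - (\<Sum>i\<in>I \<mu>. of_rat (c (\<mu>, i)) * b i)))" by simp
      also have "\<dots> \<le> \<mu> x + \<mu> (x - (\<Sum>i\<in>I \<mu>. of_rat (c (\<mu>, i)) * b i))" by (rule U(12))
      also have "\<dots> \<le> \<mu> x + real n * (m * (\<delta> * \<beta>))" unfolding x using twist[OF e mu(1) m d0(1) m0] by simp
      finally show ?thesis .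
    qed
    have "\<epsilon> * m \<le> fst k0 x + real n * (m * (\<delta> * \<beta>))" using step[of "fst k0" "snd k0"] k0 by simp
    also have "\<dots> \<le> M + m * (\<epsilon> / 2)"
    proof (rule add_mono)
      show "fst k0 x \<le> M" using M k0(1) by (auto simp: J_def)
      show "real n * (m * (\<delta> * \<beta>)) \<le> m * (\<epsilon> / 2)" using mult_left_mono[OF d0(2) m0] by (simp add: algebra_simps)
    qed
    finally have "\<epsilon> * m \<le> M + m * (\<epsilon> / 2)" .
    then have "\<epsilon> * m \<le> 2 * M" by (simp add: mult.commute)
    then have "m \<le> 2 / \<epsilon> * M" using div[of m "2 * M"] by simp
    then have "real n * (m * (\<delta> * \<beta>)) \<le> real n * (2 / \<epsilon> * M * (\<delta> * \<beta>))"
      using d0(1) beta(1) by (intro mult_left_mono mult_right_mono) auto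
    then have "\<epsilon> * a (c (\<nu>, i)) \<le> \<nu> x + real n * (2 / \<epsilon> * M * (\<delta> * \<beta>))"
      by (rule order_trans[OF step[OF k] add_left_mono])
    then show ?thesis by (rule div)
  qed
  have comb: "qcomb n (\<lambda>k. bb e (h k)) c = (\<Sum>k\<in>J. of_rat (c (g k)) * bb e k)" for e c
    unfolding qcomb_def sum.reindex_bij_betw[OF h, symmetric] using gh by (intro sum.cong) auto
  define L where "L = 1 + real n * ((\<beta> + 1) / \<epsilon> * \<beta>)"
  have L: "L \<ge> 1" using beta(1) e0 by (simp add: L_def)
  \<comment> \<open>small enough for the independence and for the perturbation of a global basis\<close>
  define \<delta>0 where "\<delta>0 = min 1 (min (\<epsilon> / (2 * (real n + 1) * \<beta>)) (1 / (2 * real d * Cq * L)))"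
  have dpos: "d > 0" unfolding d_def by (rule nf_degree_pos)
  have d00: "\<delta>0 > 0" using e0 beta(1) Cq(1) L dpos by (simp add: \<delta>0_def)
  have small: "\<delta> \<le> 1" "real n * (\<delta> * \<beta>) \<le> \<epsilon> / 2" "Cq * (\<delta> * L) \<le> 1 / (2 * real d)" if "0 < \<delta>" "\<delta> \<le> \<delta>0" for \<delta>
  proof -
    show "\<delta> \<le> 1" using that by (simp add: \<delta>0_def)
    have "\<delta> \<le> \<epsilon> / (2 * (real n + 1) * \<beta>)" using that by (simp add: \<delta>0_def)
    then have "\<delta> * (2 * (real n + 1) * \<beta>) \<le> \<epsilon>" using beta(1) by (subst (asm) pos_le_divide_eq) auto
    moreover have "real n * (\<delta> * \<beta>) \<le> (real n + 1) * (\<delta> * \<beta>)" using that beta(1) by (intro mult_right_mono) auto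
    ultimately show "real n * (\<delta> * \<beta>) \<le> \<epsilon> / 2" by (simp add: algebra_simps)
    have "\<delta> \<le> 1 / (2 * real d * Cq * L)" using that by (simp add: \<delta>0_def)
    then show "Cq * (\<delta> * L) \<le> 1 / (2 * real d)" using Cq(1) L dpos by (simp add: field_simps)
  qed
  have indep: "qindep n (\<lambda>k. bb e (h k))" if e: "appr \<delta> e" and dl: "0 < \<delta>" "\<delta> \<le> \<delta>0" for \<delta> e
    unfolding qindep_def
  proof (intro allI impI)
    fix c i assume c: "qcomb n (\<lambda>k. bb e (h k)) c = 0" and i: "i < n"
    obtain \<nu> j where nj: "h i = (\<nu>, j)" by (cases "h i")
    then have k: "(\<nu>, j) \<in> J" using hJ[OF i] by simp
    then have nuS: "\<nu> \<in> S" by (auto simp: J_def)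
    have "a (c (g (\<nu>, j))) \<le> (1 / \<epsilon>) * (\<nu> 0 + real n * (2 / \<epsilon> * 0 * (\<delta> * \<beta>)))"
      by (rule coef[OF e dl(1) small(2)[OF dl] _ _ k, where c = "\<lambda>k. c (g k)"])
        (use c comb N(1) in \<open>auto simp: absolute_valueD(5)\<close>)
    then have "a (c i) \<le> 0" using gh[OF i] nj absolute_valueD(5)[OF N(1)[OF nuS]] by simp
    then show "c i = 0" using absolute_valueD(10)[OF a, of "c i"] by force
  qed
  have nd: "n = d"
  proof (rule antisym)
    obtain e where e: "appr \<delta>0 e" using appr_ex[OF d00] by blast
    have "qindep n (\<lambda>k. bb e (h k))" by (rule indep[OF e d00 order_refl])
    then show "n \<le> d" unfolding d_def by (rule qindep_le_degree)
    have "\<exists>y \<in> qspan n (\<lambda>k. bb e (h k)). \<forall>i<d. a (qcoord b (b j - y) i) \<le> 1 / (2 * real d)" if j: "j < d" for j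
    proof -
      have "\<forall>\<nu>. \<exists>c. \<nu> \<in> S \<longrightarrow> \<nu> (b j - (\<Sum>i\<in>I \<nu>. of_rat (c i) * b i)) < \<delta>0"
        using I d00 unfolding S_def local_basis_def by blast
      from choice[OF this] obtain c where c: "\<forall>\<nu>. \<nu> \<in> S \<longrightarrow> \<nu> (b j - (\<Sum>i\<in>I \<nu>. of_rat (c \<nu> i) * b i)) < \<delta>0" by (elim exE)
      define f where "f = (\<lambda>(\<nu>, i). c \<nu> i)"
      have f: "a (f k) \<le> (\<beta> + 1) / \<epsilon>" if k: "k \<in> J" for k
      proof -
        obtain \<nu> i where ki: "k = (\<nu>, i)" by (cases k)
        then have nu: "\<nu> \<in> S" "i \<in> I \<nu>" using k by (auto simp: J_def)
        note U = absolute_valueD[OF N(1)[OF nu(1)]]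
        have "\<epsilon> * a (c \<nu> i) \<le> \<nu> (b j - (b j - (\<Sum>i\<in>I \<nu>. of_rat (c \<nu> i) * b i)))" using eps[OF nu] by simp
        also have "\<dots> \<le> \<nu> (b j) + \<nu> (b j - (\<Sum>i\<in>I \<nu>. of_rat (c \<nu> i) * b i))" by (rule U(12))
        also have "\<dots> \<le> \<beta> + 1" using beta(2) nu(1) j c small(1)[OF d00 order_refl] by (intro add_mono) (auto intro: less_imp_le order_trans)
        finally show ?thesis using e0 unfolding ki f_def by (simp add: field_simps)
      qed
      define y where "y = (\<Sum>k\<in>J. of_rat (f k) * bb e k)"
      have "y = qcomb n (\<lambda>k. bb e (h k)) (\<lambda>i. f (h i))"
        unfolding y_def qcomb_def using sum.reindex_bij_betw[OF h, of "\<lambda>k. of_rat (f k) * bb e k"] by simp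
      then have yspan: "y \<in> qspan n (\<lambda>k. bb e (h k))" unfolding qspan_def by blast
      have "\<nu> (b j - y) \<le> \<delta>0 * L" if nu: "\<nu> \<in> S" for \<nu>
      proof -
        note U = absolute_valueD[OF N(1)[OF nu]]
        define z where "z = (\<Sum>i\<in>I \<nu>. of_rat (c \<nu> i) * b i)"
        have "\<nu> (b j - y) = \<nu> ((b j - z) - (y - z))" by simp
        also have "\<dots> \<le> \<nu> (b j - z) + \<nu> (y - z)" by (rule U(12))
        also have "\<dots> \<le> \<delta>0 + real n * ((\<beta> + 1) / \<epsilon> * (\<delta>0 * \<beta>))"
        proof (rule add_mono)
          show "\<nu> (b j - z) \<le> \<delta>0" using c nu by (auto simp: z_def intro: less_imp_le)
          show "\<nu> (y - z) \<le> real n * ((\<beta> + 1) / \<epsilon> * (\<delta>0 * \<beta>))"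
            using twist[OF e nu, of f "(\<beta> + 1) / \<epsilon>", OF f d00] e0 beta(1) by (simp add: y_def z_def f_def)
        qed
        also have "\<dots> = \<delta>0 * L" by (simp add: L_def algebra_simps)
        finally show ?thesis .
      qed
      moreover have "0 < \<delta>0 * L" using d00 L by simp
      ultimately have "\<forall>i<d. a (qcoord b (b j - y) i) \<le> Cq * (\<delta>0 * L)"
        using Cq(2)[THEN spec, THEN spec, of "\<delta>0 * L" "b j - y"] by blast
      then have "\<forall>i<d. a (qcoord b (b j - y) i) \<le> 1 / (2 * real d)" using small(3)[OF d00 order_refl] by (meson order_trans)
      then show ?thesis using yspan by blast
    qed
    then have "\<forall>j. \<exists>y. j < d \<longrightarrow> y \<in> qspan n (\<lambda>k. bb e (h k)) \<and> (\<forall>i<d. a (qcoord b (b j - y) i) \<le> 1 / (2 * real d))" by blast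
    from choice[OF this] obtain y where y: "\<forall>j. j < d \<longrightarrow> y j \<in> qspan n (\<lambda>k. bb e (h k)) \<and> (\<forall>i<d. a (qcoord b (b j - y j) i) \<le> 1 / (2 * real d))"
      by (elim exE)
    have "qindep d y" unfolding d_def by (rule qindep_perturbation[OF a b]) (use y in \<open>simp add: d_def\<close>)
    then show "d \<le> n" using qindep_in_span_le[of d y n "\<lambda>k. bb e (h k)"] y by blast
  qed
  define Q where "Q = (\<lambda>w::'k. \<Prod>\<nu>\<in>S. \<nu> w ^ card (I \<nu>))"
  define C1 where "C1 = 2 * \<beta> / \<epsilon>"
  have C10: "C1 > 0" using beta(1) e0 by (simp add: C1_def)
  \<comment> \<open>the estimate with a constant: for each \<open>\<delta>\<close> a basis adapted to it is used, and \<open>\<delta>\<close> tends to \<open>0\<close>\<close>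
  have bound: "a (qnorm w) \<le> fact d * C1 ^ d * Q w" for w
  proof -
    define Mw where "Mw = Max (insert 1 ((\<lambda>\<nu>. \<nu> w) ` S))"
    have Mw: "\<nu> w \<le> Mw" if "\<nu> \<in> S" for \<nu> unfolding Mw_def using finS that by (intro Max_ge) auto
    have Mw0: "Mw \<ge> 1" unfolding Mw_def using finS by (intro Max_ge) auto
    define C2 where "C2 = real n * (2 * \<beta> / \<epsilon>) * Mw"
    have est: "a (qnorm w) \<le> fact d * (\<Prod>k<d. C1 * (fst (h k) w + \<delta> * C2))" if dl: "0 < \<delta>" "\<delta> \<le> \<delta>0" for \<delta>
    proof -
      obtain e where e: "appr \<delta> e" using appr_ex[OF dl(1)] by blast
      define u where "u = (\<lambda>k. bb e (h k))"
      have u: "qbasis u" using indep[OF e dl] unfolding qbasis_def u_def nd d_def .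
      have le1: "\<nu> (e (fst k)) \<le> 2" if "\<nu> \<in> S" "k \<in> J" for \<nu> k
      proof -
        note U = absolute_valueD[OF N(1)[OF that(1)]]
        define z :: 'k where "z = (if fst k = \<nu> then 1 else 0)"
        have "\<nu> (e (fst k)) \<le> \<nu> (e (fst k) - z) + \<nu> z" using U(4)[of "e (fst k) - z" z] by simp
        also have "\<dots> \<le> 1 + 1" using appr_err[OF e that] small(1)[OF dl] U(5,6) by (intro add_mono) (auto simp: z_def)
        finally show ?thesis by simp
      qed
      have "a (qnorm_mat u w $$ (k, j)) \<le> C1 * (fst (h k) w + \<delta> * C2)" if kj: "k < d" "j < d" for k j
      proof -
        obtain \<nu> i where hk: "h k = (\<nu>, i)" by (cases "h k")
        have kJ: "(\<nu>, i) \<in> J" using hJ[of k] kj nd hk by simp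
        then have nu: "\<nu> \<in> S" by (auto simp: J_def)
        have wu: "\<mu> (w * u j) \<le> 2 * \<beta> * \<mu> w" if mu: "\<mu> \<in> S" for \<mu>
        proof -
          note U = absolute_valueD[OF N(1)[OF mu]]
          have hj: "h j \<in> J" using hJ[of j] kj nd by simp
          have "\<mu> (e (fst (h j))) * \<mu> (b (snd (h j))) \<le> 2 * \<beta>"
            by (intro mult_mono le1[OF mu hj] bI[OF mu hj] U(1)) auto
          then have "\<mu> w * (\<mu> (e (fst (h j))) * \<mu> (b (snd (h j)))) \<le> \<mu> w * (2 * \<beta>)" by (rule mult_left_mono[OF _ U(1)])
          then show ?thesis by (simp add: u_def bb_def U(3) mult.commute)
        qed
        have "a (qcoord u (w * u j) (g (\<nu>, i))) \<le> (1 / \<epsilon>) * (\<nu> (w * u j) + real n * (2 / \<epsilon> * (2 * \<beta> * Mw) * (\<delta> * \<beta>)))"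
        proof (rule coef[OF e dl(1) small(2)[OF dl] _ _ kJ, where c = "\<lambda>k. qcoord u (w * u j) (g k)"])
          show "w * u j = (\<Sum>k\<in>J. of_rat (qcoord u (w * u j) (g k)) * bb e k)"
            unfolding comb[symmetric] u_def[symmetric] nd d_def using qcomb_qcoord[OF u, of "w * u j"] by simp
          show "\<mu> (w * u j) \<le> 2 * \<beta> * Mw" if "\<mu> \<in> S" for \<mu>
            by (rule order_trans[OF wu[OF that] mult_left_mono[OF Mw[OF that]]]) (use beta(1) in simp)
        qed
        also have "\<dots> \<le> (1 / \<epsilon>) * (2 * \<beta> * \<nu> w + real n * (2 / \<epsilon> * (2 * \<beta> * Mw) * (\<delta> * \<beta>)))"
          by (rule mult_left_mono[OF add_right_mono[OF wu[OF nu]]]) (use e0 in simp)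
        also have "\<dots> = C1 * (\<nu> w + \<delta> * C2)" by (simp add: C1_def C2_def algebra_simps)
        finally show ?thesis using kj gh[of k] nd hk by (simp add: qnorm_mat_def d_def)
      qed
      moreover have "qnorm_mat u w \<in> carrier_mat d d" by (simp add: qnorm_mat_def d_def)
      ultimately show ?thesis unfolding qnorm_det[OF u]
        using absolute_value_det_le[OF a, of "qnorm_mat u w" d "\<lambda>k. C1 * (fst (h k) w + \<delta> * C2)"] by blast
    qed
    have "a (qnorm w) \<le> fact d * (\<Prod>k<d. C1 * (fst (h k) w))"
    proof (rule tendsto_lowerbound)
      have "((\<lambda>\<delta>. fact d * (\<Prod>k<d. C1 * (fst (h k) w + \<delta> * C2))) \<longlongrightarrow> fact d * (\<Prod>k<d. C1 * (fst (h k) w + 0 * C2))) (at_right 0)"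
        by (intro tendsto_intros)
      then show "((\<lambda>\<delta>. fact d * (\<Prod>k<d. C1 * (fst (h k) w + \<delta> * C2))) \<longlongrightarrow> fact d * (\<Prod>k<d. C1 * (fst (h k) w))) (at_right 0)" by simp
      have "\<forall>\<^sub>F \<delta> in at_right 0. \<delta> \<in> {0<..<\<delta>0}" by (rule eventually_at_right_real[OF d00])
      then show "\<forall>\<^sub>F \<delta> in at_right 0. a (qnorm w) \<le> fact d * (\<Prod>k<d. C1 * (fst (h k) w + \<delta> * C2))"
        by (rule eventually_mono) (rule est, auto)
    qed simp
    also have "(\<Prod>k<d. C1 * (fst (h k) w)) = C1 ^ d * (\<Prod>k<d. fst (h k) w)" by (simp add: prod.distrib)
    also have "(\<Prod>k<d. fst (h k) w) = (\<Prod>k\<in>J. fst k w)" using prod.reindex_bij_betw[OF h, of "\<lambda>k. fst k w"] nd by simp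
    also have "\<dots> = Q w" unfolding J_def Q_def using prod.Sigma[of S I "\<lambda>\<nu> i. \<nu> w"] finS finI by (simp add: case_prod_beta')
    finally show ?thesis by simp
  qed
  have "a (qnorm w) \<le> Q w"
  proof (rule le_if_power_le)
    show "0 \<le> Q w" unfolding Q_def by (intro prod_nonneg ballI zero_le_power) (use absolute_valueD(1)[OF N(1)] in auto)
    fix k
    have "a (qnorm w) ^ k = a (qnorm (w ^ k))" by (simp add: qnorm_power absolute_valueD(8)[OF a])
    also have "\<dots> \<le> fact d * C1 ^ d * Q (w ^ k)" by (rule bound)
    also have "Q (w ^ k) = Q w ^ k"
      unfolding Q_def prod_power_distrib
      by (rule prod.cong) (simp_all add: absolute_valueD(8)[OF N(1)] mult.commute flip: power_mult)
    finally show "a (qnorm w) ^ k \<le> fact d * C1 ^ d * Q w ^ k" .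
  qed
  then show ?thesis using nJ nd unfolding Q_def S_def d_def by simp
qed


section \<open>Completions and local degrees\<close>

context
  fixes \<nu> :: "'k::number_field \<Rightarrow> real"
  assumes nu: "absolute_value \<nu>"
begin

lemma cauchy_seq_bounded: assumes "cauchy_seq \<nu> u" shows "\<exists>B>0. \<forall>n. \<nu> (u n) \<le> B"
proof -
  obtain N where N: "\<forall>m\<ge>N. \<forall>n\<ge>N. \<nu> (u m - u n) < 1" using assms[unfolded cauchy_seq_def, rule_format, of 1] by auto
  define B where "B = Max ((\<lambda>n. \<nu> (u n)) ` {..N}) + 1"
  have b: "\<nu> (u n) \<le> B - 1" if "n \<le> N" for n unfolding B_def using that by (simp add: Max_ge)
  have "\<nu> (u n) \<le> B" for n
  proof (cases "n \<le> N")
    case False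
    have "\<nu> (u n) \<le> \<nu> (u n - u N) + \<nu> (u N)" using absolute_valueD(4)[OF nu, of "u n - u N" "u N"] by simp
    then show ?thesis using N[rule_format, of n N] False b[of N] by simp
  qed (use b[of n] in simp)
  moreover have "B > 0" using b[of N] absolute_valueD(1)[OF nu, of "u N"] by simp
  ultimately show ?thesis by blast
qed

lemma cauchy_seq_const: "cauchy_seq \<nu> (\<lambda>_. c)"
  unfolding cauchy_seq_def using absolute_valueD(5)[OF nu] by simp

lemma cauchy_seq_uminus: "cauchy_seq \<nu> u \<Longrightarrow> cauchy_seq \<nu> (\<lambda>n. - u n)"
  unfolding cauchy_seq_def using absolute_valueD(7)[OF nu] by (metis minus_diff_minus)

lemma cauchy_seq_add:
  assumes "cauchy_seq \<nu> u" "cauchy_seq \<nu> v" shows "cauchy_seq \<nu> (\<lambda>n. u n + v n)"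
  unfolding cauchy_seq_def
proof (intro allI impI)
  fix e :: real assume "e > 0"
  then have h: "e / 2 > 0" by simp
  obtain M where M: "\<forall>m\<ge>M. \<forall>n\<ge>M. \<nu> (u m - u n) < e / 2" using assms(1) h unfolding cauchy_seq_def by blast
  obtain N where N: "\<forall>m\<ge>N. \<forall>n\<ge>N. \<nu> (v m - v n) < e / 2" using assms(2) h unfolding cauchy_seq_def by blast
  show "\<exists>N. \<forall>m\<ge>N. \<forall>n\<ge>N. \<nu> (u m + v m - (u n + v n)) < e"
  proof (intro exI[of _ "max M N"] allI impI)
    fix m n assume mn: "max M N \<le> m" "max M N \<le> n"
    have "\<nu> (u m + v m - (u n + v n)) \<le> \<nu> (u m - u n) + \<nu> (v m - v n)"
      using absolute_valueD(4)[OF nu, of "u m - u n" "v m - v n"] by (simp add: add_diff_add)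
    then show "\<nu> (u m + v m - (u n + v n)) < e" using M[rule_format, of m n] N[rule_format, of m n] mn by simp
  qed
qed

lemma cauchy_seq_mult:
  assumes "cauchy_seq \<nu> u" "cauchy_seq \<nu> v" shows "cauchy_seq \<nu> (\<lambda>n. u n * v n)"
  unfolding cauchy_seq_def
proof (intro allI impI)
  fix e :: real assume e: "e > 0"
  obtain B where B: "B > 0" "\<forall>n. \<nu> (u n) \<le> B" using cauchy_seq_bounded[OF assms(1)] by blast
  obtain C where C: "C > 0" "\<forall>n. \<nu> (v n) \<le> C" using cauchy_seq_bounded[OF assms(2)] by blast
  have h: "e / (2 * C) > 0" "e / (2 * B) > 0" using e B C by auto
  obtain M where M: "\<forall>m\<ge>M. \<forall>n\<ge>M. \<nu> (u m - u n) < e / (2 * C)" using assms(1) h unfolding cauchy_seq_def by blast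
  obtain N where N: "\<forall>m\<ge>N. \<forall>n\<ge>N. \<nu> (v m - v n) < e / (2 * B)" using assms(2) h unfolding cauchy_seq_def by blast
  show "\<exists>N. \<forall>m\<ge>N. \<forall>n\<ge>N. \<nu> (u m * v m - u n * v n) < e"
  proof (intro exI[of _ "max M N"] allI impI)
    fix m n assume mn: "max M N \<le> m" "max M N \<le> n"
    have "u m * v m - u n * v n = u m * (v m - v n) + (u m - u n) * v n" by (simp add: algebra_simps)
    then have "\<nu> (u m * v m - u n * v n) \<le> \<nu> (u m * (v m - v n)) + \<nu> ((u m - u n) * v n)"
      using absolute_valueD(4)[OF nu] by metis
    also have "\<dots> = \<nu> (u m) * \<nu> (v m - v n) + \<nu> (u m - u n) * \<nu> (v n)" by (simp only: absolute_valueD(3)[OF nu])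
    also have "\<dots> \<le> B * \<nu> (v m - v n) + \<nu> (u m - u n) * C"
      by (intro add_mono mult_left_mono mult_right_mono) (use B C absolute_valueD(1)[OF nu] in auto)
    also have "\<dots> < B * (e / (2 * B)) + (e / (2 * C)) * C"
      by (intro add_strict_mono mult_strict_left_mono mult_strict_right_mono) (use M N mn B C in auto)
    also have "\<dots> = e" using B C by simp
    finally show "\<nu> (u m * v m - u n * v n) < e" .
  qed
qed

lemma null_seqs_iff: "u \<in> null_seqs \<nu> \<longleftrightarrow> (\<forall>e>0. \<exists>N. \<forall>n\<ge>N. \<nu> (u n) < e)"
  unfolding null_seqs_def LIMSEQ_def using absolute_valueD(1)[OF nu] by simp

lemma null_seqs_cauchy: assumes "u \<in> null_seqs \<nu>" shows "cauchy_seq \<nu> u"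
  unfolding cauchy_seq_def
proof (intro allI impI)
  fix e :: real assume "e > 0"
  then obtain N where N: "\<forall>n\<ge>N. \<nu> (u n) < e / 2" using assms unfolding null_seqs_iff by (meson half_gt_zero)
  have "\<nu> (u m - u n) < e" if "m \<ge> N" "n \<ge> N" for m n
    using absolute_valueD(12)[OF nu, of "u m" "u n"] N[rule_format, OF that(1)] N[rule_format, OF that(2)] by simp
  then show "\<exists>N. \<forall>m\<ge>N. \<forall>n\<ge>N. \<nu> (u m - u n) < e" by blast
qed

lemma null_seqs_zero: "(\<lambda>_. 0) \<in> null_seqs \<nu>" unfolding null_seqs_def using absolute_valueD(5)[OF nu] by simp

lemma null_seqs_uminus: "u \<in> null_seqs \<nu> \<Longrightarrow> (\<lambda>n. - u n) \<in> null_seqs \<nu>"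
  unfolding null_seqs_def by (simp add: absolute_valueD(7)[OF nu])

lemma null_seqs_add: assumes "u \<in> null_seqs \<nu>" "v \<in> null_seqs \<nu>" shows "(\<lambda>n. u n + v n) \<in> null_seqs \<nu>"
proof -
  have "(\<lambda>n. \<nu> (u n) + \<nu> (v n)) \<longlonglongrightarrow> 0" using tendsto_add[of _ 0 sequentially _ 0] assms unfolding null_seqs_def by fastforce
  then have "(\<lambda>n. \<nu> (u n + v n)) \<longlonglongrightarrow> 0"
    by (rule tendsto_sandwich[OF _ _ tendsto_const, rotated 2]) (simp_all add: absolute_valueD(1,4)[OF nu])
  then show ?thesis by (simp add: null_seqs_def)
qed

lemma null_seqs_mult: assumes "cauchy_seq \<nu> v" "u \<in> null_seqs \<nu>" shows "(\<lambda>n. v n * u n) \<in> null_seqs \<nu>"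
proof -
  obtain C where C: "C > 0" "\<forall>n. \<nu> (v n) \<le> C" using cauchy_seq_bounded[OF assms(1)] by blast
  have "(\<lambda>n. C * \<nu> (u n)) \<longlonglongrightarrow> 0" using tendsto_mult_left[of _ 0 sequentially C] assms(2) unfolding null_seqs_def by fastforce
  then have "(\<lambda>n. \<nu> (v n * u n)) \<longlonglongrightarrow> 0"
    by (rule tendsto_sandwich[OF _ _ tendsto_const, rotated 2])
      (use C absolute_valueD(1)[OF nu] in \<open>auto simp: absolute_valueD(3)[OF nu] intro!: always_eventually mult_right_mono\<close>)
  then show ?thesis by (simp add: null_seqs_def)
qed

lemma null_seqs_mult2: "cauchy_seq \<nu> v \<Longrightarrow> u \<in> null_seqs \<nu> \<Longrightarrow> (\<lambda>n. u n * v n) \<in> null_seqs \<nu>"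
  using null_seqs_mult[of v u] by (simp add: mult.commute)

lemma cauchy_ring_simps:
  "carrier (cauchy_ring \<nu>) = {u. cauchy_seq \<nu> u}" "u \<otimes>\<^bsub>cauchy_ring \<nu>\<^esub> v = (\<lambda>n. u n * v n)"
  "\<one>\<^bsub>cauchy_ring \<nu>\<^esub> = (\<lambda>_. 1)" "\<zero>\<^bsub>cauchy_ring \<nu>\<^esub> = (\<lambda>_. 0)" "u \<oplus>\<^bsub>cauchy_ring \<nu>\<^esub> v = (\<lambda>n. u n + v n)"
  by (simp_all add: cauchy_ring_def)

lemma cauchy_cring: "cring (cauchy_ring \<nu>)"
proof (rule cringI)
  show "abelian_group (cauchy_ring \<nu>)"
  proof (rule abelian_groupI)
    fix u assume u: "u \<in> carrier (cauchy_ring \<nu>)"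
    then show "\<exists>v\<in>carrier (cauchy_ring \<nu>). v \<oplus>\<^bsub>cauchy_ring \<nu>\<^esub> u = \<zero>\<^bsub>cauchy_ring \<nu>\<^esub>"
      by (intro bexI[of _ "\<lambda>n. - u n"]) (auto simp: cauchy_ring_simps cauchy_seq_uminus)
  qed (auto simp: cauchy_ring_simps cauchy_seq_add cauchy_seq_const add.assoc add.commute)
  show "comm_monoid (cauchy_ring \<nu>)"
    by (rule comm_monoidI) (auto simp: cauchy_ring_simps cauchy_seq_mult cauchy_seq_const mult.assoc mult.commute)
qed (auto simp: cauchy_ring_simps distrib_right)

text \<open>Null sequences absorb Cauchy sequences since the latter are bounded.\<close>

lemma null_ideal: "ideal (null_seqs \<nu>) (cauchy_ring \<nu>)"
proof -
  interpret R: cring "cauchy_ring \<nu>" by (rule cauchy_cring)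
  have inv: "\<ominus>\<^bsub>cauchy_ring \<nu>\<^esub> u = (\<lambda>n. - u n)" if "cauchy_seq \<nu> u" for u
    by (rule R.minus_equality) (use that cauchy_seq_uminus in \<open>auto simp: cauchy_ring_simps\<close>)
  show ?thesis
  proof (rule idealI)
    show "ring (cauchy_ring \<nu>)" by (rule R.ring_axioms)
    show "subgroup (null_seqs \<nu>) (add_monoid (cauchy_ring \<nu>))"
    proof (rule R.add.subgroupI)
      show "null_seqs \<nu> \<subseteq> carrier (cauchy_ring \<nu>)" using null_seqs_cauchy by (auto simp: cauchy_ring_simps)
      show "null_seqs \<nu> \<noteq> {}" using null_seqs_zero by blast
      show "\<ominus>\<^bsub>cauchy_ring \<nu>\<^esub> u \<in> null_seqs \<nu>" if "u \<in> null_seqs \<nu>" for u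
        using that by (simp add: inv null_seqs_cauchy null_seqs_uminus)
      show "u \<oplus>\<^bsub>cauchy_ring \<nu>\<^esub> v \<in> null_seqs \<nu>" if "u \<in> null_seqs \<nu>" "v \<in> null_seqs \<nu>" for u v
        using that by (simp add: cauchy_ring_simps null_seqs_add)
    qed
  qed (simp_all add: cauchy_ring_simps null_seqs_mult null_seqs_mult2)
qed

definition cls :: "(nat \<Rightarrow> 'k) \<Rightarrow> (nat \<Rightarrow> 'k) set" where
  "cls u = null_seqs \<nu> +>\<^bsub>cauchy_ring \<nu>\<^esub> u"

lemma cls_set: "cls u = {\<lambda>n. m n + u n |m. m \<in> null_seqs \<nu>}"
  unfolding cls_def a_r_coset_def' by (auto simp: cauchy_ring_simps)

lemma cls_eq_iff: "cls u = cls v \<longleftrightarrow> (\<lambda>n. u n - v n) \<in> null_seqs \<nu>"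
proof
  assume "cls u = cls v"
  moreover have "u \<in> cls u" unfolding cls_set using null_seqs_zero by (intro CollectI exI[of _ "\<lambda>_. 0"]) simp
  ultimately obtain m where "m \<in> null_seqs \<nu>" "u = (\<lambda>n. m n + v n)" unfolding cls_set by blast
  then show "(\<lambda>n. u n - v n) \<in> null_seqs \<nu>" by simp
next
  have sub: "cls u \<subseteq> cls v" if d: "(\<lambda>n. u n - v n) \<in> null_seqs \<nu>" for u v
  proof
    fix x assume "x \<in> cls u"
    then obtain m where m: "m \<in> null_seqs \<nu>" "x = (\<lambda>n. m n + u n)" unfolding cls_set by blast
    have "(\<lambda>n. m n + (u n - v n)) \<in> null_seqs \<nu>" by (rule null_seqs_add[OF m(1) d])
    moreover have "x = (\<lambda>n. (m n + (u n - v n)) + v n)" using m(2) by simp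
    ultimately show "x \<in> cls v" unfolding cls_set by (intro CollectI exI[of _ "\<lambda>n. m n + (u n - v n)"] conjI)
  qed
  assume d: "(\<lambda>n. u n - v n) \<in> null_seqs \<nu>"
  then have d2: "(\<lambda>n. v n - u n) \<in> null_seqs \<nu>" using null_seqs_uminus[OF d] by simp
  show "cls u = cls v" by (rule subset_antisym[OF sub[OF d] sub[OF d2]])
qed

lemma completion_simps:
  "carrier (completion \<nu>) = {cls u |u. cauchy_seq \<nu> u}"
  "\<one>\<^bsub>completion \<nu>\<^esub> = cls (\<lambda>_. 1)" "\<zero>\<^bsub>completion \<nu>\<^esub> = cls (\<lambda>_. 0)"
  "cauchy_seq \<nu> u \<Longrightarrow> cauchy_seq \<nu> v \<Longrightarrow> cls u \<otimes>\<^bsub>completion \<nu>\<^esub> cls v = cls (\<lambda>n. u n * v n)"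
  "cauchy_seq \<nu> u \<Longrightarrow> cauchy_seq \<nu> v \<Longrightarrow> cls u \<oplus>\<^bsub>completion \<nu>\<^esub> cls v = cls (\<lambda>n. u n + v n)"
  "rat_completion \<nu> = {cls u |u. cauchy_seq \<nu> u \<and> range u \<subseteq> \<rat>}"
proof -
  interpret I: ideal "null_seqs \<nu>" "cauchy_ring \<nu>" by (rule null_ideal)
  show "carrier (completion \<nu>) = {cls u |u. cauchy_seq \<nu> u}"
    unfolding completion_def FactRing_def cls_def by (auto simp: A_RCOSETS_def' cauchy_ring_simps)
  show "\<one>\<^bsub>completion \<nu>\<^esub> = cls (\<lambda>_. 1)" by (simp add: completion_def FactRing_def cls_def cauchy_ring_simps)
  have "cls (\<lambda>_. 0) = null_seqs \<nu>" unfolding cls_set by auto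
  then show "\<zero>\<^bsub>completion \<nu>\<^esub> = cls (\<lambda>_. 0)" by (simp add: completion_def FactRing_def)
  show "cls u \<otimes>\<^bsub>completion \<nu>\<^esub> cls v = cls (\<lambda>n. u n * v n)" if "cauchy_seq \<nu> u" "cauchy_seq \<nu> v"
    using I.rcoset_mult_add[of u v] that by (simp add: completion_def FactRing_def cls_def cauchy_ring_simps)
  show "cls u \<oplus>\<^bsub>completion \<nu>\<^esub> cls v = cls (\<lambda>n. u n + v n)" if "cauchy_seq \<nu> u" "cauchy_seq \<nu> v"
    using I.a_rcos_sum[of u v] that by (simp add: completion_def FactRing_def cls_def cauchy_ring_simps)
  show "rat_completion \<nu> = {cls u |u. cauchy_seq \<nu> u \<and> range u \<subseteq> \<rat>}" by (simp add: rat_completion_def cls_def)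
qed

lemma completion_cring: "cring (completion \<nu>)"
  unfolding completion_def by (rule ideal.quotient_is_cring[OF null_ideal cauchy_cring])

lemma cauchy_seq_away_from_zero:
  assumes "cauchy_seq \<nu> u" "u \<notin> null_seqs \<nu>"
  shows "\<exists>e>0. \<exists>N. \<forall>n\<ge>N. e \<le> \<nu> (u n)"
proof -
  obtain e where e: "e > 0" "\<forall>N. \<exists>n\<ge>N. e \<le> \<nu> (u n)" using assms(2) unfolding null_seqs_iff by (auto simp: not_less)
  obtain N where N: "\<forall>m\<ge>N. \<forall>n\<ge>N. \<nu> (u m - u n) < e / 2" using assms(1) e(1) unfolding cauchy_seq_def by (meson half_gt_zero)
  obtain m where m: "m \<ge> N" "e \<le> \<nu> (u m)" using e(2) by blast
  have "e / 2 \<le> \<nu> (u n)" if "n \<ge> N" for n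
    using absolute_valueD(4)[OF nu, of "u m - u n" "u n"] N[rule_format, OF m(1) that] m(2) by simp
  then show ?thesis using e(1) by (intro exI[of _ "e / 2"]) auto
qed

text \<open>A Cauchy sequence that does not tend to \<open>0\<close> stays away from \<open>0\<close> eventually; at the
  finitely many remaining indices the value of the inverse, possibly \<open>inverse 0 = 0\<close>, does not matter.\<close>

lemma cauchy_seq_inverse:
  assumes u: "cauchy_seq \<nu> u" "u \<notin> null_seqs \<nu>"
  shows "cauchy_seq \<nu> (\<lambda>n. inverse (u n))" "(\<lambda>n. u n * inverse (u n) - 1) \<in> null_seqs \<nu>"
proof -
  obtain e M where e: "e > 0" "\<forall>n\<ge>M. e \<le> \<nu> (u n)" using cauchy_seq_away_from_zero[OF u] by blast
  have nz: "u n \<noteq> 0" if "n \<ge> M" for n using e that absolute_valueD(5)[OF nu] by force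
  show "cauchy_seq \<nu> (\<lambda>n. inverse (u n))"
    unfolding cauchy_seq_def
  proof (intro allI impI)
    fix r :: real assume "r > 0"
    then have "r * (e * e) > 0" using e by simp
    then obtain N where N: "\<forall>m\<ge>N. \<forall>n\<ge>N. \<nu> (u m - u n) < r * (e * e)" using u(1) unfolding cauchy_seq_def by blast
    show "\<exists>N. \<forall>m\<ge>N. \<forall>n\<ge>N. \<nu> (inverse (u m) - inverse (u n)) < r"
    proof (intro exI[of _ "max M N"] allI impI)
      fix m n assume mn: "max M N \<le> m" "max M N \<le> n"
      then have z: "u m \<noteq> 0" "u n \<noteq> 0" using nz by auto
      have "inverse (u m) - inverse (u n) = (u n - u m) / (u m * u n)" using z by (simp add: field_simps)
      then have "\<nu> (inverse (u m) - inverse (u n)) = \<nu> (u n - u m) / (\<nu> (u m) * \<nu> (u n))"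
        by (simp only: absolute_valueD(3,11)[OF nu])
      also have "\<dots> < r * (e * e) / (e * e)"
        by (rule frac_less) (use N mn e absolute_valueD(1)[OF nu] in \<open>auto intro!: mult_mono\<close>)
      also have "\<dots> = r" using e by simp
      finally show "\<nu> (inverse (u m) - inverse (u n)) < r" .
    qed
  qed
  show "(\<lambda>n. u n * inverse (u n) - 1) \<in> null_seqs \<nu>"
    unfolding null_seqs_iff using nz absolute_valueD(5)[OF nu] by (auto intro!: exI[of _ M])
qed

text \<open>The entrywise inverse of a sequence of rational numbers is a sequence of rational numbers.\<close>

lemma rat_completion_subfield: "subfield (rat_completion \<nu>) (completion \<nu>)"
proof -
  interpret C: cring "completion \<nu>" by (rule completion_cring)
  let ?K = "rat_completion \<nu>"
  have neg: "\<ominus>\<^bsub>completion \<nu>\<^esub> cls u = cls (\<lambda>n. - u n)" if "cauchy_seq \<nu> u" for u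
    by (rule C.minus_equality) (use that cauchy_seq_uminus[OF that] in \<open>auto simp: completion_simps\<close>)
  have one_zero: "cls (\<lambda>_. 1) \<noteq> cls (\<lambda>_. 0)"
    unfolding cls_eq_iff null_seqs_def using absolute_valueD(6)[OF nu] by (simp add: LIMSEQ_const_iff)
  have sub: "subring ?K (completion \<nu>)"
  proof (rule C.subringI)
    show "?K \<subseteq> carrier (completion \<nu>)" by (auto simp: completion_simps)
    show "\<one>\<^bsub>completion \<nu>\<^esub> \<in> ?K" unfolding completion_simps using cauchy_seq_const by fastforce
    fix h assume "h \<in> ?K"
    then obtain u where u: "h = cls u" "cauchy_seq \<nu> u" "range u \<subseteq> \<rat>" unfolding completion_simps(6) by blast
    show "\<ominus>\<^bsub>completion \<nu>\<^esub> h \<in> ?K" unfolding u(1) neg[OF u(2)] completion_simps(6)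
      using cauchy_seq_uminus[OF u(2)] u(3) by (intro CollectI exI[of _ "\<lambda>n. - u n"]) auto
    fix k assume "k \<in> ?K"
    then obtain v where v: "k = cls v" "cauchy_seq \<nu> v" "range v \<subseteq> \<rat>" unfolding completion_simps(6) by blast
    show "h \<otimes>\<^bsub>completion \<nu>\<^esub> k \<in> ?K" unfolding u(1) v(1) completion_simps(4)[OF u(2) v(2)] completion_simps(6)
      using cauchy_seq_mult[OF u(2) v(2)] u(3) v(3) by (intro CollectI exI[of _ "\<lambda>n. u n * v n"]) (auto simp: image_subset_iff)
    show "h \<oplus>\<^bsub>completion \<nu>\<^esub> k \<in> ?K" unfolding u(1) v(1) completion_simps(5)[OF u(2) v(2)] completion_simps(6)
      using cauchy_seq_add[OF u(2) v(2)] u(3) v(3) by (intro CollectI exI[of _ "\<lambda>n. u n + v n"]) (auto simp: image_subset_iff)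
  qed
  show ?thesis
  proof (rule C.subfieldI)
    show "subcring ?K (completion \<nu>)" by (rule C.subcringI'[OF sub])
    show "Units (completion \<nu>\<lparr>carrier := ?K\<rparr>) = ?K - {\<zero>\<^bsub>completion \<nu>\<^esub>}"
    proof (intro subset_antisym subsetI)
      fix x assume x: "x \<in> Units (completion \<nu>\<lparr>carrier := ?K\<rparr>)"
      then obtain y where y: "x \<in> ?K" "y \<in> ?K" "y \<otimes>\<^bsub>completion \<nu>\<^esub> x = \<one>\<^bsub>completion \<nu>\<^esub>" unfolding Units_def by auto
      have "y \<in> carrier (completion \<nu>)" using y(2) sub by (auto dest: subringE(1))
      then have "y \<otimes>\<^bsub>completion \<nu>\<^esub> \<zero>\<^bsub>completion \<nu>\<^esub> = \<zero>\<^bsub>completion \<nu>\<^esub>" by (rule C.r_null)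
      then have "x \<noteq> \<zero>\<^bsub>completion \<nu>\<^esub>" using y(3) one_zero unfolding completion_simps(2,3) by metis
      then show "x \<in> ?K - {\<zero>\<^bsub>completion \<nu>\<^esub>}" using y by blast
    next
      fix x assume "x \<in> ?K - {\<zero>\<^bsub>completion \<nu>\<^esub>}"
      then obtain u where u: "x = cls u" "cauchy_seq \<nu> u" "range u \<subseteq> \<rat>" "x \<noteq> cls (\<lambda>_. 0)" unfolding completion_simps(3,6) by blast
      have nn: "u \<notin> null_seqs \<nu>" using u(1,4) cls_eq_iff[of u "\<lambda>_. 0"] by simp
      note inv = cauchy_seq_inverse[OF u(2) nn]
      have yK: "cls (\<lambda>n. inverse (u n)) \<in> ?K" unfolding completion_simps(6)
        using inv(1) u(3) by (intro CollectI exI[of _ "\<lambda>n. inverse (u n)"]) (auto intro: Rats_inverse)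
      have p: "cls u \<otimes>\<^bsub>completion \<nu>\<^esub> cls (\<lambda>n. inverse (u n)) = \<one>\<^bsub>completion \<nu>\<^esub>"
        "cls (\<lambda>n. inverse (u n)) \<otimes>\<^bsub>completion \<nu>\<^esub> cls u = \<one>\<^bsub>completion \<nu>\<^esub>"
        using inv(2) by (simp_all add: completion_simps(2) completion_simps(4)[OF u(2) inv(1)] completion_simps(4)[OF inv(1) u(2)] cls_eq_iff mult.commute)
      have xK: "cls u \<in> ?K" using u unfolding completion_simps(6) by blast
      show "x \<in> Units (completion \<nu>\<lparr>carrier := ?K\<rparr>)" unfolding u(1) Units_def using xK yK p by auto
    qed
  qed
qed

text \<open>A linear combination in the completion is computed entrywise on representatives.\<close>

lemma combine_cls:
  assumes "\<And>i. i \<in> set xs \<Longrightarrow> cauchy_seq \<nu> (c i)"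
  shows "ring.combine (completion \<nu>) (map (\<lambda>i. cls (c i)) xs) (map (\<lambda>i. cls (\<lambda>_. b i)) xs) = cls (\<lambda>n. \<Sum>i\<leftarrow>xs. c i n * b i)
    \<and> cauchy_seq \<nu> (\<lambda>n. \<Sum>i\<leftarrow>xs. c i n * b i)"
proof -
  interpret C: cring "completion \<nu>" by (rule completion_cring)
  show ?thesis
    using assms
  proof (induction xs)
    case Nil then show ?case by (simp add: completion_simps(3) cauchy_seq_const)
  next
    case (Cons i xs)
    have c: "cauchy_seq \<nu> (\<lambda>n. c i n * b i)" using Cons.prems by (intro cauchy_seq_mult cauchy_seq_const) simp
    have IH: "C.combine (map (\<lambda>i. cls (c i)) xs) (map (\<lambda>i. cls (\<lambda>_. b i)) xs) = cls (\<lambda>n. \<Sum>i\<leftarrow>xs. c i n * b i)"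
      "cauchy_seq \<nu> (\<lambda>n. \<Sum>i\<leftarrow>xs. c i n * b i)" using Cons by auto
    have m: "cls (c i) \<otimes>\<^bsub>completion \<nu>\<^esub> cls (\<lambda>_. b i) = cls (\<lambda>n. c i n * b i)"
      by (rule completion_simps(4)) (use Cons.prems cauchy_seq_const in auto)
    show ?case using cauchy_seq_add[OF c IH(2)] by (simp add: m IH(1) completion_simps(5)[OF c IH(2)])
  qed
qed

end

lemma list_as_map:
  assumes "distinct xs" "length ys = length xs" shows "\<exists>f. ys = map f xs"
  using assms
proof (induction xs arbitrary: ys)
  case (Cons x xs)
  then obtain y ys' where y: "ys = y # ys'" by (cases ys) auto
  then obtain f where f: "ys' = map f xs" using Cons by auto
  have "ys = map (f(x := y)) (x # xs)" using y f Cons.prems(1) by (auto simp: map_eq_conv)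
  then show ?case by blast
qed simp

text \<open>The lower bounds of a local basis give independence over the completion of the rational numbers. They
  also turn approximations of a Cauchy sequence by rational combinations into Cauchy sequences of coefficients, so that density
  gives generation.\<close>

theorem local_degree_eq_card:
  fixes \<nu> :: "'k::number_field \<Rightarrow> real"
  assumes a: "absolute_value a" and nuE: "\<nu> \<in> extensions a" and lb: "local_basis a \<nu> I b"
  shows "local_degree \<nu> = card I"
proof -
  note nu = extensionsD(1)[OF nuE]
  note N = absolute_valueD[OF nu]
  interpret C: cring "completion \<nu>" by (rule completion_cring[OF nu])
  let ?K = "rat_completion \<nu>"
  have fin: "finite I" using lb by (simp add: local_basis_def)
  obtain \<epsilon> where eps: "\<epsilon> > 0" "\<And>c i. i \<in> I \<Longrightarrow> \<epsilon> * a (c i) \<le> \<nu> (\<Sum>i\<in>I. of_rat (c i) * b i)"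
    using lb unfolding local_basis_def by blast
  have dense: "\<exists>c. \<nu> (x - (\<Sum>i\<in>I. of_rat (c i) * b i)) < \<eta>" if "\<eta> > 0" for x \<eta> using lb that unfolding local_basis_def by blast
  define B where "B = (\<lambda>i. cls \<nu> (\<lambda>_. b i))"
  have Bc: "B i \<in> carrier (completion \<nu>)" for i unfolding B_def completion_simps(1)[OF nu] using cauchy_seq_const[OF nu] by blast
  have repr: "\<exists>c. cauchy_seq \<nu> (\<lambda>n. of_rat (c n)) \<and> k = cls \<nu> (\<lambda>n. of_rat (c n))" if k: "k \<in> ?K" for k
  proof -
    obtain u where u: "k = cls \<nu> u" "cauchy_seq \<nu> u" "range u \<subseteq> \<rat>" using k unfolding completion_simps(6)[OF nu] by blast
    have "\<forall>n. \<exists>q. u n = of_rat q" using u(3) by (metis Rats_cases range_subsetD)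
    then obtain c where "\<forall>n. u n = of_rat (c n)" by metis
    then have "u = (\<lambda>n. of_rat (c n))" by auto
    then show ?thesis using u by blast
  qed
  have indep: "C.independent ?K (map B xs)" if "distinct xs" "set xs \<subseteq> I" for xs
    using that
  proof (induction xs)
    case (Cons j xs)
    have "B j \<notin> C.Span ?K (map B xs)"
    proof
      assume "B j \<in> C.Span ?K (map B xs)"
      then obtain Ks where Ks: "set Ks \<subseteq> ?K" "length Ks = length (map B xs)" "B j = C.combine Ks (map B xs)"
        using C.Span_mem_iff_length_version[OF rat_completion_subfield[OF nu], of "map B xs" "B j"] Bc by auto
      obtain f where f: "Ks = map f xs" using list_as_map[of xs Ks] Ks(2) Cons.prems(1) by auto
      have "\<forall>i. \<exists>c. i \<in> set xs \<longrightarrow> cauchy_seq \<nu> (\<lambda>n. of_rat (c n)) \<and> f i = cls \<nu> (\<lambda>n. of_rat (c n))"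
      proof
        fix i
        show "\<exists>c. i \<in> set xs \<longrightarrow> cauchy_seq \<nu> (\<lambda>n. of_rat (c n)) \<and> f i = cls \<nu> (\<lambda>n. of_rat (c n))"
        proof (cases "i \<in> set xs")
          case True
          then have "f i \<in> ?K" using Ks(1) f by auto
          then show ?thesis using repr by blast
        qed simp
      qed
      from choice[OF this] obtain c where c: "\<forall>i. i \<in> set xs \<longrightarrow> cauchy_seq \<nu> (\<lambda>n. of_rat (c i n)) \<and> f i = cls \<nu> (\<lambda>n. of_rat (c i n))"
        by (elim exE)
      have "Ks = map (\<lambda>i. cls \<nu> (\<lambda>n. of_rat (c i n))) xs" using c f by simp
      then have "B j = cls \<nu> (\<lambda>n. \<Sum>i\<leftarrow>xs. of_rat (c i n) * b i)"
        using combine_cls[OF nu, of xs "\<lambda>i n. of_rat (c i n)" b] c Ks(3) by (simp add: B_def[abs_def])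
      then have null: "(\<lambda>n. b j - (\<Sum>i\<leftarrow>xs. of_rat (c i n) * b i)) \<in> null_seqs \<nu>" unfolding B_def cls_eq_iff[OF nu] .
      have j: "j \<in> I" "j \<notin> set xs" and xsI: "set xs \<subseteq> I" using Cons.prems by auto
      have "\<epsilon> \<le> \<nu> (b j - (\<Sum>i\<leftarrow>xs. of_rat (c i n) * b i))" for n
      proof -
        define e where "e = (\<lambda>i. if i = j then 1 else if i \<in> set xs then - c i n else 0)"
        have "(\<Sum>i\<in>I. of_rat (e i) * b i) = (\<Sum>i\<in>insert j (set xs). of_rat (e i) * b i)"
          by (rule sum.mono_neutral_right) (use fin j xsI in \<open>auto simp: e_def\<close>)
        also have "\<dots> = b j + (\<Sum>i\<in>set xs. of_rat (e i) * b i)" using j by (simp add: e_def)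
        also have "(\<Sum>i\<in>set xs. of_rat (e i) * b i) = - (\<Sum>i\<in>set xs. of_rat (c i n) * b i)"
          unfolding sum_negf[symmetric] by (rule sum.cong) (use j in \<open>auto simp: e_def of_rat_minus\<close>)
        also have "(\<Sum>i\<in>set xs. of_rat (c i n) * b i) = (\<Sum>i\<leftarrow>xs. of_rat (c i n) * b i)"
          using Cons.prems(1) by (simp add: sum_list_distinct_conv_sum_set)
        finally have "(\<Sum>i\<in>I. of_rat (e i) * b i) = b j - (\<Sum>i\<leftarrow>xs. of_rat (c i n) * b i)" by simp
        then show ?thesis using eps(2)[OF j(1), of e] absolute_valueD(6)[OF a] by (simp add: e_def)
      qed
      then show False using null eps(1) unfolding null_seqs_iff[OF nu] by (meson not_less order_refl)
    qed
    moreover have "C.independent ?K (map B xs)" using Cons by auto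
    ultimately show ?case using Bc C.li_Cons by simp
  qed simp
  obtain xs where xs: "distinct xs" "set xs = I" using finite_distinct_list[OF fin] by blast
  have span: "C.Span ?K (map B xs) = carrier (completion \<nu>)"
  proof
    show "C.Span ?K (map B xs) \<subseteq> carrier (completion \<nu>)"
      by (rule C.Span_in_carrier) (use Bc in \<open>auto simp: completion_simps[OF nu]\<close>)
    show "carrier (completion \<nu>) \<subseteq> C.Span ?K (map B xs)"
    proof
      fix z assume "z \<in> carrier (completion \<nu>)"
      then obtain u where u: "z = cls \<nu> u" "cauchy_seq \<nu> u" unfolding completion_simps(1)[OF nu] by blast
      have "\<forall>n. \<exists>c. \<nu> (u n - (\<Sum>i\<in>I. of_rat (c i) * b i)) < inverse (real (Suc n))" using dense by simp
      from choice[OF this] obtain c where c: "\<forall>n. \<nu> (u n - (\<Sum>i\<in>I. of_rat (c n i) * b i)) < inverse (real (Suc n))" by (elim exE)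
      have cs: "cauchy_seq \<nu> (\<lambda>n. of_rat (c n i))" if i: "i \<in> I" for i
        unfolding cauchy_seq_def
      proof (intro allI impI)
        fix e :: real assume "e > 0"
        then have e3: "\<epsilon> * e / 3 > 0" using eps(1) by simp
        obtain M where M: "\<forall>m\<ge>M. \<forall>n\<ge>M. \<nu> (u m - u n) < \<epsilon> * e / 3" using u(2) e3 unfolding cauchy_seq_def by blast
        obtain M' where M': "inverse (real (Suc M')) < \<epsilon> * e / 3" using reals_Archimedean[OF e3] by blast
        show "\<exists>N. \<forall>m\<ge>N. \<forall>n\<ge>N. \<nu> (of_rat (c m i) - of_rat (c n i)) < e"
        proof (intro exI[of _ "max M M'"] allI impI)
          fix m n assume mn: "max M M' \<le> m" "max M M' \<le> n"
          have sm: "\<nu> (u l - (\<Sum>i\<in>I. of_rat (c l i) * b i)) < \<epsilon> * e / 3" if "M' \<le> l" for l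
          proof -
            have "inverse (real (Suc l)) \<le> inverse (real (Suc M'))" using that by (intro le_imp_inverse_le) auto
            then show ?thesis using c[rule_format, of l] M' by linarith
          qed
          define p q where "p = u m - (\<Sum>i\<in>I. of_rat (c m i) * b i)" and "q = u n - (\<Sum>i\<in>I. of_rat (c n i) * b i)"
          have "\<epsilon> * a (c m i - c n i) \<le> \<nu> (\<Sum>i\<in>I. of_rat (c m i - c n i) * b i)" using eps(2)[OF i, of "\<lambda>i. c m i - c n i"] .
          also have "(\<Sum>i\<in>I. of_rat (c m i - c n i) * b i) = (u m - u n) - (p - q)"
            by (simp only: of_rat_diff left_diff_distrib sum_subtractf p_def q_def) (simp add: algebra_simps)
          also have "\<nu> ((u m - u n) - (p - q)) \<le> \<nu> (u m - u n) + (\<nu> p + \<nu> q)"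
            using N(12)[of "u m - u n" "p - q"] N(12)[of p q] by linarith
          also have "\<dots> < \<epsilon> * e / 3 + (\<epsilon> * e / 3 + \<epsilon> * e / 3)"
            using M[rule_format, of m n] sm[of m] sm[of n] mn unfolding p_def q_def by (intro add_strict_mono) auto
          finally have "\<epsilon> * a (c m i - c n i) < \<epsilon> * e" by simp
          then have "a (c m i - c n i) < e" using eps(1) by simp
          then show "\<nu> (of_rat (c m i) - of_rat (c n i)) < e" by (metis extensionsD(2)[OF nuE] of_rat_diff)
        qed
      qed
      have "(\<lambda>n. u n - (\<Sum>i\<leftarrow>xs. of_rat (c n i) * b i)) \<in> null_seqs \<nu>"
        unfolding null_seqs_iff[OF nu]
      proof (intro allI impI)
        fix e :: real assume "e > 0"
        then obtain M' where M': "inverse (real (Suc M')) < e" using reals_Archimedean by blast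
        have "\<nu> (u l - (\<Sum>i\<leftarrow>xs. of_rat (c l i) * b i)) < e" if "M' \<le> l" for l
        proof -
          have "inverse (real (Suc l)) \<le> inverse (real (Suc M'))" using that by (intro le_imp_inverse_le) auto
          moreover have "(\<Sum>i\<leftarrow>xs. of_rat (c l i) * b i) = (\<Sum>i\<in>I. of_rat (c l i) * b i)"
            using xs by (simp add: sum_list_distinct_conv_sum_set)
          ultimately show ?thesis using c[rule_format, of l] M' by (simp only:)
        qed
        then show "\<exists>N. \<forall>n\<ge>N. \<nu> (u n - (\<Sum>i\<leftarrow>xs. of_rat (c n i) * b i)) < e" by blast
      qed
      then have "z = cls \<nu> (\<lambda>n. \<Sum>i\<leftarrow>xs. of_rat (c n i) * b i)" unfolding u(1) cls_eq_iff[OF nu] .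
      also have "\<dots> = C.combine (map (\<lambda>i. cls \<nu> (\<lambda>n. of_rat (c n i))) xs) (map B xs)"
        using combine_cls[OF nu, of xs "\<lambda>i n. of_rat (c n i)" b] cs xs(2) by (simp add: B_def[abs_def])
      finally have z: "z = C.combine (map (\<lambda>i. cls \<nu> (\<lambda>n. of_rat (c n i))) xs) (map B xs)" .
      have "set (map (\<lambda>i. cls \<nu> (\<lambda>n. of_rat (c n i))) xs) \<subseteq> ?K"
        unfolding completion_simps(6)[OF nu] using cs xs(2) by (auto intro!: exI)
      then show "z \<in> C.Span ?K (map B xs)"
        using C.Span_mem_iff_length_version[OF rat_completion_subfield[OF nu], of "map B xs" z] Bc z by (metis image_subset_iff length_map set_map subsetI)
    qed
  qed
  have "C.dimension (length (map B xs)) ?K (carrier (completion \<nu>))"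
    using C.dimensionI[OF rat_completion_subfield[OF nu] indep[OF xs(1)] span] xs(2) by simp
  then have "(C.dim over ?K) (carrier (completion \<nu>)) = length (map B xs)"
    by (rule C.dimI[OF rat_completion_subfield[OF nu]])
  then show ?thesis using xs distinct_card[OF xs(1)] by (simp add: local_degree_def over_def)
qed


section \<open>The product formula\<close>

text \<open>The definition uses the reduced fraction, but a common factor cancels in the difference of the
  multiplicities.\<close>

lemma padic_abs_frac:
  assumes p: "prime p" and x: "x \<noteq> 0" and y: "y \<noteq> 0"
  shows "padic_abs p (of_int x / of_int y) = real p powi (int (multiplicity (int p) y) - int (multiplicity (int p) x))"
proof -
  define q :: rat where "q = of_int x / of_int y"
  obtain r s where rs: "quotient_of q = (r, s)" by (cases "quotient_of q")
  have q: "q = of_int r / of_int s" and s: "s > 0" using quotient_of_div[OF rs] quotient_of_denom_pos[OF rs] by auto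
  have q0: "q \<noteq> 0" using x y by (simp add: q_def)
  then have r: "r \<noteq> 0" using q by auto
  have "of_int (r * y) = (of_int (x * s) :: rat)" using q s y unfolding q_def by (simp add: field_simps)
  then have e: "r * y = x * s" by (simp only: of_int_eq_iff)
  have pe: "prime_elem (int p)" using p by simp
  have "multiplicity (int p) r + multiplicity (int p) y = multiplicity (int p) x + multiplicity (int p) s"
    using arg_cong[OF e, of "multiplicity (int p)"] prime_elem_multiplicity_mult_distrib[OF pe] r y x s by simp
  then have "int (multiplicity (int p) s) - int (multiplicity (int p) r) = int (multiplicity (int p) y) - int (multiplicity (int p) x)" by linarith
  then show ?thesis using q0 rs unfolding q_def[symmetric] by (simp add: padic_abs_def)
qed

lemma rat_frac: "\<exists>x y. (q::rat) = of_int x / of_int y \<and> y \<noteq> 0 \<and> (q \<noteq> 0 \<longrightarrow> x \<noteq> 0)"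
proof -
  obtain r s where rs: "quotient_of q = (r, s)" by (cases "quotient_of q")
  show ?thesis by (intro exI[of _ r] exI[of _ s]) (use quotient_of_div[OF rs] quotient_of_denom_pos[OF rs] in auto)
qed

lemma padic_abs_nonneg: "padic_abs p q \<ge> 0" by (simp add: padic_abs_def)

lemma padic_abs_mult:
  assumes p: "prime p" shows "padic_abs p (q * r) = padic_abs p q * padic_abs p r"
proof (cases "q = 0 \<or> r = 0")
  case False
  obtain x y where q: "q = of_int x / of_int y" "y \<noteq> 0" "q \<noteq> 0 \<longrightarrow> x \<noteq> 0" using rat_frac[of q] by auto
  obtain u v where r: "r = of_int u / of_int v" "v \<noteq> 0" "r \<noteq> 0 \<longrightarrow> u \<noteq> 0" using rat_frac[of r] by auto
  have nz: "x \<noteq> 0" "u \<noteq> 0" using q r False by auto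
  have pe: "prime_elem (int p)" and p0: "real p \<noteq> 0" using p by (auto simp: prime_gt_0_nat)
  have qr: "q * r = of_int (x * u) / of_int (y * v)" using q r by simp
  have "padic_abs p (q * r) = real p powi (int (multiplicity (int p) (y * v)) - int (multiplicity (int p) (x * u)))"
    unfolding qr by (rule padic_abs_frac[OF p]) (use nz q r in auto)
  also have "\<dots> = real p powi ((int (multiplicity (int p) y) - int (multiplicity (int p) x)) + (int (multiplicity (int p) v) - int (multiplicity (int p) u)))"
    using prime_elem_multiplicity_mult_distrib[OF pe] nz q(2) r(2) by (simp add: algebra_simps)
  also have "\<dots> = padic_abs p q * padic_abs p r"
    unfolding q(1) r(1) padic_abs_frac[OF p nz(1) q(2)] padic_abs_frac[OF p nz(2) r(2)]
    by (rule power_int_add) (use p0 in simp)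
  finally show ?thesis .
qed (auto simp: padic_abs_def)

lemma padic_abs_ultra:
  assumes p: "prime p" shows "padic_abs p (q + r) \<le> max (padic_abs p q) (padic_abs p r)"
proof (cases "q = 0 \<or> r = 0 \<or> q + r = 0")
  case True
  moreover have "padic_abs p 0 = 0" by (simp add: padic_abs_def)
  ultimately show ?thesis using padic_abs_nonneg[of p q] padic_abs_nonneg[of p r] by (auto simp: le_max_iff_disj)
next
  case False
  obtain x y where q: "q = of_int x / of_int y" "y \<noteq> 0" "q \<noteq> 0 \<longrightarrow> x \<noteq> 0" using rat_frac[of q] by auto
  obtain u v where r: "r = of_int u / of_int v" "v \<noteq> 0" "r \<noteq> 0 \<longrightarrow> u \<noteq> 0" using rat_frac[of r] by auto
  define x1 y1 u1 where "x1 = x * v" and "y1 = y * v" and "u1 = u * y"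
  have qXY: "q = of_int x1 / of_int y1" "r = of_int u1 / of_int y1" "q + r = of_int (x1 + u1) / of_int y1"
    using q r by (simp_all add: x1_def y1_def u1_def field_simps)
  have nz4: "x1 + u1 \<noteq> 0"
  proof
    assume "x1 + u1 = 0"
    then have "q + r = 0" unfolding qXY(3) by simp
    then show False using False by simp
  qed
  have nz: "x1 \<noteq> 0" "u1 \<noteq> 0" "y1 \<noteq> 0" "x1 + u1 \<noteq> 0" using False q r nz4 by (auto simp: x1_def y1_def u1_def)
  let ?m = "multiplicity (int p)"
  have pp: "\<not> is_unit (int p)" and p1: "real p \<ge> 1" using p prime_gt_1_nat[OF p] by auto
  define k where "k = min (?m x1) (?m u1)"
  have "int p ^ k dvd x1" "int p ^ k dvd u1" unfolding k_def by (auto intro: multiplicity_dvd')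
  then have "int p ^ k dvd x1 + u1" by simp
  then have "k \<le> ?m (x1 + u1)" by (rule multiplicity_geI[OF nz(4) pp])
  then have "real p powi (int (?m y1) - int (?m (x1 + u1))) \<le> real p powi (int (?m y1) - int k)"
    by (intro power_int_increasing p1) auto
  also have "\<dots> \<le> max (real p powi (int (?m y1) - int (?m x1))) (real p powi (int (?m y1) - int (?m u1)))"
    unfolding k_def by (simp add: min_def)
  finally have "padic_abs p (of_int (x1 + u1) / of_int y1) \<le> max (padic_abs p (of_int x1 / of_int y1)) (padic_abs p (of_int u1 / of_int y1))"
    unfolding padic_abs_frac[OF p nz(1,3)] padic_abs_frac[OF p nz(2,3)] padic_abs_frac[OF p nz(4,3)] .
  then show ?thesis unfolding qXY(3)[symmetric] qXY(1,2)[symmetric] .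
qed

lemma padic_abs_absolute_value: assumes p: "prime p" shows "absolute_value (padic_abs p)"
  unfolding absolute_value_def
proof (intro conjI allI)
  show "padic_abs p x \<ge> 0" for x by (rule padic_abs_nonneg)
  show "padic_abs p x = 0 \<longleftrightarrow> x = 0" for x using p by (auto simp: padic_abs_def prime_gt_0_nat)
  show "padic_abs p (x * y) = padic_abs p x * padic_abs p y" for x y by (rule padic_abs_mult[OF p])
  show "padic_abs p (x + y) \<le> padic_abs p x + padic_abs p y" for x y
    using padic_abs_ultra[OF p, of x y] padic_abs_nonneg[of p x] padic_abs_nonneg[of p y] by linarith
qed

lemma padic_abs_int: assumes p: "prime p" shows "padic_abs p (of_int n) \<le> 1"
proof (cases "n = 0")
  case False
  have p1: "real p \<ge> 1" using prime_gt_1_nat[OF p] by simp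
  have "padic_abs p (of_int n) = real p powi (- int (multiplicity (int p) n))"
    using padic_abs_frac[OF p False, of 1] by simp
  also have "\<dots> \<le> 1" using p1 by (simp add: power_int_minus inverse_le_1_iff)
  finally show ?thesis .
qed (simp add: padic_abs_def)

lemma padic_abs_prime: assumes p: "prime p" shows "padic_abs p (of_nat p) = 1 / real p"
proof -
  have "int p \<noteq> 0" "\<not> is_unit (int p)" using p prime_gt_0_nat[OF p] by auto
  then have "multiplicity (int p) (int p) = 1" by (simp add: multiplicity_self)
  then show ?thesis using padic_abs_frac[OF p, of "int p" 1] \<open>int p \<noteq> 0\<close> by (simp add: inverse_eq_divide)
qed

lemma finite_nat_divisors: assumes "n \<noteq> 0" shows "finite {p::nat. int p dvd n}"
proof (rule finite_subset)
  show "{p. int p dvd n} \<subseteq> {..nat \<bar>n\<bar>}"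
  proof
    fix p assume "p \<in> {p. int p dvd n}"
    then have "\<bar>int p\<bar> \<le> \<bar>n\<bar>" using dvd_imp_le_int[OF assms, of "int p"] by simp
    then show "p \<in> {..nat \<bar>n\<bar>}" by simp
  qed
qed simp

lemma padic_abs_gt_1_finite: "finite {p. prime p \<and> padic_abs p q > 1}"
proof -
  obtain x y where q: "q = of_int x / of_int y" "y \<noteq> 0" "q \<noteq> 0 \<longrightarrow> x \<noteq> 0" using rat_frac[of q] by auto
  have "{p. prime p \<and> padic_abs p q > 1} \<subseteq> {p. int p dvd y}"
  proof
    fix p assume "p \<in> {p. prime p \<and> padic_abs p q > 1}"
    then have p: "prime p" "padic_abs p q > 1" by auto
    have "int p dvd y"
    proof (rule ccontr)
      assume "\<not> int p dvd y"
      then have m: "multiplicity (int p) y = 0" by (rule not_dvd_imp_multiplicity_0)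
      have "padic_abs p (of_int y) = 1" using padic_abs_frac[OF p(1) q(2), of 1] m by simp
      then have "padic_abs p q = padic_abs p (of_int x)"
        unfolding q(1) absolute_valueD(11)[OF padic_abs_absolute_value[OF p(1)]] by simp
      then show False using p(2) padic_abs_int[OF p(1), of x] by simp
    qed
    then show "p \<in> {p. int p dvd y}" by simp
  qed
  then show ?thesis by (rule finite_subset) (rule finite_nat_divisors[OF q(2)])
qed

text \<open>The prime factorisation of an integer, over any finite set of primes that contains its divisors.\<close>

lemma prod_prime_powers_int:
  assumes P: "finite P" "\<And>p. p \<in> P \<Longrightarrow> prime p" and n: "n \<noteq> 0" and all: "\<And>p. prime p \<Longrightarrow> int p dvd n \<Longrightarrow> p \<in> P"
  shows "(\<Prod>p\<in>P. real p ^ multiplicity (int p) n) = \<bar>real_of_int n\<bar>"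
proof -
  have "(\<Prod>q\<in>prime_factors n. q ^ multiplicity q n) = \<bar>n\<bar>" using prod_prime_factors[OF n] by simp
  moreover have "(\<Prod>q\<in>prime_factors n. q ^ multiplicity q n) = (\<Prod>q\<in>int ` P. q ^ multiplicity q n)"
  proof (rule prod.mono_neutral_left)
    show "finite (int ` P)" using P by simp
    show "prime_factors n \<subseteq> int ` P"
    proof
      fix q assume "q \<in> prime_factors n"
      then have q: "prime q" "q dvd n" by auto
      then have "q = int (nat q)" "prime (nat q)" by (auto simp: prime_ge_0_int)
      then show "q \<in> int ` P" using all[of "nat q"] q(2) by (metis imageI)
    qed
    show "\<forall>q\<in>int ` P - prime_factors n. q ^ multiplicity q n = 1"
    proof
      fix q assume q: "q \<in> int ` P - prime_factors n"
      then have "prime q" using P(2) by auto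
      then have "\<not> q dvd n" using q n by (auto simp: prime_factors_dvd)
      then show "q ^ multiplicity q n = 1" by (simp add: not_dvd_imp_multiplicity_0)
    qed
  qed
  moreover have "(\<Prod>q\<in>int ` P. q ^ multiplicity q n) = (\<Prod>p\<in>P. int p ^ multiplicity (int p) n)"
    by (subst prod.reindex) (auto simp: inj_on_def)
  ultimately have "(\<Prod>p\<in>P. int p ^ multiplicity (int p) n) = \<bar>n\<bar>" by simp
  then have "real_of_int (\<Prod>p\<in>P. int p ^ multiplicity (int p) n) = real_of_int \<bar>n\<bar>" by (rule arg_cong)
  then show ?thesis by simp
qed

lemma rational_product_formula:
  assumes P: "finite P" "\<And>p. p \<in> P \<Longrightarrow> prime p" and q: "q \<noteq> 0"
    and all: "\<And>p. prime p \<Longrightarrow> padic_abs p q \<noteq> 1 \<Longrightarrow> p \<in> P"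
  shows "\<bar>real_of_rat q\<bar> * (\<Prod>p\<in>P. padic_abs p q) = 1"
proof -
  obtain x y where xy: "q = of_int x / of_int y" "y \<noteq> 0" "q \<noteq> 0 \<longrightarrow> x \<noteq> 0" using rat_frac[of q] by auto
  have x: "x \<noteq> 0" using xy q by simp
  define P' where "P' = P \<union> {p. prime p \<and> int p dvd x * y}"
  have "finite {p. prime p \<and> int p dvd x * y}"
    by (rule finite_subset[OF _ finite_nat_divisors[of "x * y"]]) (use x xy(2) in auto)
  then have P': "finite P'" "\<And>p. p \<in> P' \<Longrightarrow> prime p" using P unfolding P'_def by auto
  have "(\<Prod>p\<in>P. padic_abs p q) = (\<Prod>p\<in>P'. padic_abs p q)"
  proof (rule prod.mono_neutral_left[OF P'(1)])
    show "P \<subseteq> P'" by (simp add: P'_def)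
    show "\<forall>p\<in>P' - P. padic_abs p q = 1" using all P'(2) by blast
  qed
  also have "\<dots> = (\<Prod>p\<in>P'. real p ^ multiplicity (int p) y / real p ^ multiplicity (int p) x)"
  proof (rule prod.cong)
    fix p assume "p \<in> P'"
    then have p: "prime p" by (rule P'(2))
    have "real p \<noteq> 0" using prime_gt_0_nat[OF p] by simp
    then show "padic_abs p q = real p ^ multiplicity (int p) y / real p ^ multiplicity (int p) x"
      unfolding xy(1) padic_abs_frac[OF p x xy(2)] by (simp add: power_int_diff)
  qed simp
  also have "\<dots> = (\<Prod>p\<in>P'. real p ^ multiplicity (int p) y) / (\<Prod>p\<in>P'. real p ^ multiplicity (int p) x)" by (rule prod_dividef)
  also have "(\<Prod>p\<in>P'. real p ^ multiplicity (int p) y) = \<bar>real_of_int y\<bar>"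
    by (rule prod_prime_powers_int[OF P' xy(2)]) (auto simp: P'_def)
  also have "(\<Prod>p\<in>P'. real p ^ multiplicity (int p) x) = \<bar>real_of_int x\<bar>"
    by (rule prod_prime_powers_int[OF P' x]) (auto simp: P'_def)
  finally show ?thesis using x xy by (simp add: of_rat_divide)
qed

definition inf_abs :: "rat \<Rightarrow> real" where "inf_abs q = \<bar>real_of_rat q\<bar>"

lemma inf_abs_absolute_value: "absolute_value inf_abs"
  unfolding absolute_value_def inf_abs_def
  by (intro conjI allI) (simp_all only: of_rat_mult abs_mult of_rat_add abs_triangle_ineq abs_ge_zero abs_eq_0_iff of_rat_eq_0_iff)

lemma places_eq: "places = extensions inf_abs \<union> (\<Union>p\<in>{p. prime p}. extensions (padic_abs p))"
  unfolding places_def extensions_def inf_abs_def by auto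

lemma inf_abs_nontrivial: "0 < inf_abs (1/2)" "inf_abs (1/2) < 1" by (simp_all add: inf_abs_def of_rat_divide)

lemma padic_abs_nontrivial: assumes "prime p" shows "0 < padic_abs p (of_nat p)" "padic_abs p (of_nat p) < 1"
  using padic_abs_prime[OF assms] prime_gt_1_nat[OF assms] by auto

text \<open>A local basis can be chosen at every extension out of the same global basis, and its size is the local degree.\<close>

lemma local_product:
  fixes w :: "'k::number_field"
  assumes a: "absolute_value a" and t: "0 < a t" "a t < 1"
  shows "(\<Sum>\<nu>\<in>(extensions a :: ('k \<Rightarrow> real) set). local_degree \<nu>) = nf_degree TYPE('k)"
    and "a (qnorm w) \<le> (\<Prod>\<nu>\<in>extensions a. \<nu> w ^ local_degree \<nu>)"
proof -
  obtain b :: "nat \<Rightarrow> 'k" where b: "qbasis b" using qbasis_ex by blast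
  have "\<forall>\<nu>::'k \<Rightarrow> real. \<exists>I. \<nu> \<in> extensions a \<longrightarrow> I \<subseteq> {..<nf_degree TYPE('k)} \<and> local_basis a \<nu> I b"
    using local_basis_exists[OF a _ b] by blast
  from choice[OF this] obtain I where
    I: "\<forall>\<nu>::'k \<Rightarrow> real. \<nu> \<in> extensions a \<longrightarrow> I \<nu> \<subseteq> {..<nf_degree TYPE('k)} \<and> local_basis a \<nu> (I \<nu>) b" by (elim exE)
  have ld: "local_degree \<nu> = card (I \<nu>)" if "\<nu> \<in> extensions a" for \<nu> :: "'k \<Rightarrow> real"
    using local_degree_eq_card[OF a that] I that by blast
  have "(\<Sum>\<nu>\<in>extensions a. card (I \<nu>)) = nf_degree TYPE('k) \<and> a (qnorm w) \<le> (\<Prod>\<nu>\<in>extensions a. \<nu> w ^ card (I \<nu>))"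
    by (rule local_norm_inequality[OF a t b]) (use I in blast)
  then show "(\<Sum>\<nu>\<in>(extensions a :: ('k \<Rightarrow> real) set). local_degree \<nu>) = nf_degree TYPE('k)"
    and "a (qnorm w) \<le> (\<Prod>\<nu>\<in>extensions a. \<nu> w ^ local_degree \<nu>)" using ld by simp_all
qed

text \<open>By the binomial theorem \<open>\<nu>(x + y)\<^sup>k \<le> (k + 1) max(\<nu>(x), \<nu>(y))\<^sup>k\<close>, and the linear factor
  is overtaken by any geometric growth.\<close>

lemma ultrametric:
  assumes nu: "absolute_value \<nu>" and int: "\<And>n::nat. \<nu> (of_nat n) \<le> 1"
  shows "\<nu> (x + y) \<le> max (\<nu> x) (\<nu> y)"
proof (rule le_if_power_le)
  note N = absolute_valueD[OF nu]
  define m where "m = max (\<nu> x) (\<nu> y)"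
  have m0: "m \<ge> 0" using N(1)[of x] by (simp add: m_def)
  then show "0 \<le> max (\<nu> x) (\<nu> y)" by (simp add: m_def)
  have step: "\<nu> (x + y) ^ k \<le> real (k + 1) * m ^ k" for k
  proof -
    have "\<nu> (x + y) ^ k = \<nu> (\<Sum>i\<le>k. of_nat (k choose i) * x ^ i * y ^ (k - i))" by (simp add: N(8)[symmetric] binomial_ring)
    also have "\<dots> \<le> (\<Sum>i\<le>k. \<nu> (of_nat (k choose i) * x ^ i * y ^ (k - i)))" by (rule absolute_value_sum[OF nu])
    also have "\<dots> \<le> (\<Sum>i\<le>k. m ^ k)"
    proof (rule sum_mono)
      fix i assume "i \<in> {..k}"
      then have mk: "m ^ k = 1 * m ^ i * m ^ (k - i)" by (simp flip: power_add)
      show "\<nu> (of_nat (k choose i) * x ^ i * y ^ (k - i)) \<le> m ^ k"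
        unfolding mk N(3) N(8) by (intro mult_mono power_mono int mult_nonneg_nonneg zero_le_power N(1) m0) (auto simp: m_def)
    qed
    finally show ?thesis by simp
  qed
  \<comment> \<open>the linear factor disappears under a second passage to powers\<close>
  have "\<nu> (x + y) \<le> m"
  proof (rule ccontr)
    assume n: "\<not> \<nu> (x + y) \<le> m"
    show False
    proof (cases "m = 0")
      case True then show ?thesis using step[of 1] n by simp
    next
      case False
      then have r: "\<nu> (x + y) / m > 1" using n m0 by simp
      define r where "r = \<nu> (x + y) / m - 1"
      have r0: "r > 0" using r by (simp add: r_def)
      have pw: "(1 + r) ^ k \<le> real (k + 1)" for k
        using step[of k] m0 False by (simp add: r_def power_divide divide_le_eq)
      obtain j :: nat where j: "3 / r\<^sup>2 < j" using reals_Archimedean2 by blast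
      have jr: "3 < real j * r\<^sup>2" using j r0 by (simp add: divide_less_eq)
      have "(1 + real j * r)\<^sup>2 \<le> ((1 + r) ^ j)\<^sup>2"
        using Bernoulli_inequality[of r j] r0 by (intro power_mono) auto
      also have "\<dots> \<le> real (2 * j + 1)" using pw[of "j * 2"] by (simp add: power_mult mult.commute)
      finally have "1 + 2 * (real j * r) + (real j * r\<^sup>2) * real j \<le> 2 * real j + 1"
        by (simp add: power2_eq_square algebra_simps)
      moreover have "3 * real j \<le> (real j * r\<^sup>2) * real j" using jr by (intro mult_right_mono) auto
      moreover have "real j * r \<ge> 0" using r0 by simp
      moreover have "real j > 0" using jr by (cases j) auto
      ultimately show False by linarith
    qed
  qed
  then show "\<nu> (x + y) ^ k \<le> 1 * max (\<nu> x) (\<nu> y) ^ k" for k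
    using power_mono[OF _ N(1), of "x + y" m k] by (simp add: m_def)
qed

lemma ultrametric_sum:
  assumes nu: "absolute_value \<nu>" and int: "\<And>n::nat. \<nu> (of_nat n) \<le> 1"
    and B: "B \<ge> 0" "\<And>i. i \<in> A \<Longrightarrow> \<nu> (f i) \<le> B"
  shows "\<nu> (sum f A) \<le> B"
  using B(2)
proof (induction A rule: infinite_finite_induct)
  case (insert i A)
  then have "\<nu> (f i) \<le> B" "\<nu> (sum f A) \<le> B" by auto
  then show ?case using insert.hyps ultrametric[OF nu int, of "f i" "sum f A"] by simp
qed (use B absolute_valueD(5)[OF nu] in auto)

lemma padic_extension_int:
  assumes p: "prime p" and nu: "\<nu> \<in> extensions (padic_abs p)" shows "\<nu> (of_int n) \<le> 1"
  using padic_abs_int[OF p, of n] extensionsD(2)[OF nu, of "of_int n"] by simp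

lemma padic_extension_nat:
  assumes p: "prime p" and nu: "\<nu> \<in> extensions (padic_abs p)" shows "\<nu> (of_nat n) \<le> 1"
  using padic_extension_int[OF assms, of "int n"] by simp

text \<open>Away from the denominators of the matrix of multiplication by \<open>w\<close>, the largest value at a basis element is
  not increased by multiplication by \<open>w\<close>.\<close>

lemma almost_all_primes_le_1:
  fixes w :: "'k::number_field"
  shows "\<exists>P. finite P \<and> (\<forall>p. prime p \<longrightarrow> p \<notin> P \<longrightarrow> (\<forall>\<nu>\<in>extensions (padic_abs p). \<nu> w \<le> 1))"
proof -
  define d where "d = nf_degree TYPE('k)"
  obtain b :: "nat \<Rightarrow> 'k" where b: "qbasis b" using qbasis_ex by blast
  define P where "P = (\<Union>(i, j)\<in>{..<d} \<times> {..<d}. {p. prime p \<and> padic_abs p (qcoord b (w * b j) i) > 1})"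
  have "finite P" unfolding P_def using padic_abs_gt_1_finite by auto
  moreover have "\<nu> w \<le> 1" if p: "prime p" "p \<notin> P" and nu: "\<nu> \<in> extensions (padic_abs p)" for p \<nu>
  proof -
    note N = absolute_valueD[OF extensionsD(1)[OF nu]]
    have int: "padic_abs p (qcoord b (w * b j) i) \<le> 1" if "i < d" "j < d" for i j
    proof (rule ccontr)
      assume "\<not> ?thesis"
      then have "p \<in> P" unfolding P_def by (intro UN_I[of "(i, j)"]) (use p(1) that in auto)
      then show False using p(2) by blast
    qed
    define m where "m = Max ((\<lambda>i. \<nu> (b i)) ` {..<d})"
    have dpos: "d > 0" unfolding d_def by (rule nf_degree_pos)
    have m: "\<nu> (b i) \<le> m" if "i < d" for i unfolding m_def using that by (intro Max_ge) auto
    have m0: "m \<ge> 0" using m[OF dpos] N(1)[of "b 0"] by linarith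
    have "m \<in> (\<lambda>i. \<nu> (b i)) ` {..<d}" unfolding m_def by (rule Max_in) (use dpos in auto)
    then obtain j where j: "j < d" "m = \<nu> (b j)" by auto
    have "m > 0"
    proof -
      have "\<exists>k<d. b k \<noteq> 0"
      proof (rule ccontr)
        assume "\<not> ?thesis"
        then have "qcomb d b (\<lambda>_. 1) = 0" by (simp add: qcomb_def)
        then show False using b dpos unfolding qbasis_def qindep_def d_def by fastforce
      qed
      then show ?thesis using m N(10) by (meson less_le_trans)
    qed
    have "\<nu> w * m = \<nu> (w * b j)" unfolding j(2) by (simp only: N(3))
    also have "w * b j = (\<Sum>i<d. of_rat (qcoord b (w * b j) i) * b i)"
      using qcomb_qcoord[OF b, of "w * b j"] by (simp add: qcomb_def d_def)
    also have "\<nu> \<dots> \<le> m"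
    proof (rule ultrametric_sum[OF extensionsD(1)[OF nu] padic_extension_nat[OF p(1) nu] m0])
      fix i assume "i \<in> {..<d}"
      then have i: "i < d" by simp
      have "\<nu> (of_rat (qcoord b (w * b j) i) * b i) \<le> 1 * m"
        unfolding N(3) extensionsD(2)[OF nu] by (intro mult_mono int i j m N(1)) auto
      then show "\<nu> (of_rat (qcoord b (w * b j) i) * b i) \<le> m" by simp
    qed
    finally show "\<nu> w \<le> 1" using \<open>m > 0\<close> by simp
  qed
  ultimately show ?thesis by blast
qed

lemma almost_all_primes_eq_1:
  fixes w :: "'k::number_field"
  assumes w: "w \<noteq> 0"
  shows "\<exists>P. finite P \<and> (\<forall>p. prime p \<longrightarrow> p \<notin> P \<longrightarrow> (\<forall>\<nu>\<in>extensions (padic_abs p). \<nu> w = 1))"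
proof -
  obtain P where P: "finite P" "\<forall>p. prime p \<longrightarrow> p \<notin> P \<longrightarrow> (\<forall>\<nu>\<in>extensions (padic_abs p). \<nu> w \<le> 1)"
    using almost_all_primes_le_1 by blast
  obtain Q where Q: "finite Q" "\<forall>p. prime p \<longrightarrow> p \<notin> Q \<longrightarrow> (\<forall>\<nu>\<in>extensions (padic_abs p). \<nu> (inverse w) \<le> 1)"
    using almost_all_primes_le_1 by blast
  have "\<nu> w = 1" if p: "prime p" "p \<notin> P \<union> Q" and nu: "\<nu> \<in> extensions (padic_abs p)" for p \<nu>
  proof -
    note N = absolute_valueD[OF extensionsD(1)[OF nu]]
    have "\<nu> w \<le> 1" "\<nu> (inverse w) \<le> 1" using P(2) Q(2) p nu by auto
    then have "\<nu> w \<le> 1" "inverse (\<nu> w) \<le> 1" unfolding N(9) by auto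
    then show ?thesis using N(10)[OF w] by (simp add: inverse_le_1_iff)
  qed
  then show ?thesis using P(1) Q(1) by (intro exI[of _ "P \<union> Q"]) auto
qed

lemma extensions_disjoint: "a \<noteq> a' \<Longrightarrow> extensions a \<inter> extensions a' = {}"
  unfolding extensions_def by force

lemma padic_abs_neq: assumes "prime p" "p \<noteq> q" "prime q" shows "padic_abs p \<noteq> padic_abs q"
proof
  assume e: "padic_abs p = padic_abs q"
  have "\<not> int p dvd int q" using assms by (simp add: primes_dvd_imp_eq) (metis primes_dvd_imp_eq)
  then have "multiplicity (int p) (int q) = 0" by (rule not_dvd_imp_multiplicity_0)
  then have "padic_abs p (of_nat q) = 1" using padic_abs_frac[OF assms(1), of "int q" 1] prime_gt_0_nat[OF assms(3)] by simp
  then show False using e padic_abs_nontrivial(2)[OF assms(3)] by simp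
qed

lemma padic_abs_neq_inf: assumes "prime p" shows "padic_abs p \<noteq> inf_abs"
proof
  assume "padic_abs p = inf_abs"
  then have "inf_abs (of_nat p) < 1" using padic_abs_nontrivial(2)[OF assms] by simp
  then show False using prime_gt_1_nat[OF assms] by (simp add: inf_abs_def)
qed

lemma prod_places:
  fixes g :: "('k::number_field \<Rightarrow> real) \<Rightarrow> real"
  assumes P: "finite P" "\<And>p. p \<in> P \<Longrightarrow> prime p"
  shows "finite (extensions inf_abs \<union> (\<Union>p\<in>P. extensions (padic_abs p)) :: ('k \<Rightarrow> real) set)"
    and "(\<Prod>\<nu>\<in>extensions inf_abs \<union> (\<Union>p\<in>P. extensions (padic_abs p)). g \<nu>) =
      (\<Prod>\<nu>\<in>extensions inf_abs. g \<nu>) * (\<Prod>p\<in>P. \<Prod>\<nu>\<in>extensions (padic_abs p). g \<nu>)"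
proof -
  have f: "finite (extensions inf_abs :: ('k \<Rightarrow> real) set)" by (rule finite_extensions[OF inf_abs_absolute_value inf_abs_nontrivial])
  have fp: "finite (extensions (padic_abs p) :: ('k \<Rightarrow> real) set)" if "p \<in> P" for p
    by (rule finite_extensions[OF padic_abs_absolute_value padic_abs_nontrivial]) (use P(2) that in auto)
  then show "finite (extensions inf_abs \<union> (\<Union>p\<in>P. extensions (padic_abs p)) :: ('k \<Rightarrow> real) set)" using f P(1) by blast
  have "(\<Prod>\<nu>\<in>extensions inf_abs \<union> (\<Union>p\<in>P. extensions (padic_abs p)). g \<nu>) =
      (\<Prod>\<nu>\<in>extensions inf_abs. g \<nu>) * (\<Prod>\<nu>\<in>(\<Union>p\<in>P. extensions (padic_abs p)). g \<nu>)"
  proof (rule prod.union_disjoint[OF f])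
    show "finite (\<Union>p\<in>P. extensions (padic_abs p) :: ('k \<Rightarrow> real) set)" using fp P(1) by blast
    show "extensions inf_abs \<inter> (\<Union>p\<in>P. extensions (padic_abs p)) = ({} :: ('k \<Rightarrow> real) set)"
      using extensions_disjoint[OF padic_abs_neq_inf[OF P(2)]] by blast
  qed
  also have "(\<Prod>\<nu>\<in>(\<Union>p\<in>P. extensions (padic_abs p)). g \<nu>) = (\<Prod>p\<in>P. \<Prod>\<nu>\<in>extensions (padic_abs p). g \<nu>)"
  proof (rule prod.UNION_disjoint[OF P(1)])
    show "\<forall>p\<in>P. finite (extensions (padic_abs p) :: ('k \<Rightarrow> real) set)" using fp by blast
    show "\<forall>p\<in>P. \<forall>q\<in>P. p \<noteq> q \<longrightarrow> extensions (padic_abs p) \<inter> extensions (padic_abs q) = ({} :: ('k \<Rightarrow> real) set)"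
      using extensions_disjoint[OF padic_abs_neq] P(2) by metis
  qed
  finally show "(\<Prod>\<nu>\<in>extensions inf_abs \<union> (\<Union>p\<in>P. extensions (padic_abs p)). g \<nu>) =
      (\<Prod>\<nu>\<in>extensions inf_abs. g \<nu>) * (\<Prod>p\<in>P. \<Prod>\<nu>\<in>extensions (padic_abs p). g \<nu>)" .
qed

lemma finite_places_neq_1:
  fixes w :: "'k::number_field"
  assumes w: "w \<noteq> 0" shows "finite {\<nu>\<in>places. \<nu> w \<noteq> 1}"
proof -
  obtain P where P: "finite P" "\<forall>p. prime p \<longrightarrow> p \<notin> P \<longrightarrow> (\<forall>\<nu>\<in>extensions (padic_abs p). \<nu> w = 1)"
    using almost_all_primes_eq_1[OF w] by blast
  have "{\<nu>\<in>places. \<nu> w \<noteq> 1} \<subseteq> extensions inf_abs \<union> (\<Union>p\<in>{p\<in>P. prime p}. extensions (padic_abs p))"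
    unfolding places_eq using P(2) by blast
  then show ?thesis by (rule finite_subset) (rule prod_places(1), use P in auto)
qed

text \<open>The norm of \<open>w\<close> is a nonzero rational number. Its product formula bounds the product over the
  places of \<open>K\<close> from below, one place of \<open>\<rat>\<close> at a time, by \<open>local_product\<close>.\<close>

theorem product_formula_ge_1:
  fixes w :: "'k::number_field"
  assumes w: "w \<noteq> 0" and T: "finite T" "T \<subseteq> places" "\<And>\<nu>. \<nu> \<in> places \<Longrightarrow> \<nu> w \<noteq> 1 \<Longrightarrow> \<nu> \<in> T"
  shows "(\<Prod>\<nu>\<in>T. \<nu> w ^ local_degree \<nu>) \<ge> 1"
proof -
  obtain P0 where P0: "finite P0" "\<forall>p. prime p \<longrightarrow> p \<notin> P0 \<longrightarrow> (\<forall>\<nu>\<in>extensions (padic_abs p). \<nu> w = 1)"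
    using almost_all_primes_eq_1[OF w] by blast
  define N where "N = qnorm w"
  have N0: "N \<noteq> 0" unfolding N_def by (rule qnorm_nonzero[OF w])
  \<comment> \<open>outside \<open>P\<close>, both \<open>w\<close> and its norm have absolute value \<open>1\<close>\<close>
  define P where "P = {p\<in>P0. prime p} \<union> {p. prime p \<and> padic_abs p N \<noteq> 1}"
  have "{p. prime p \<and> padic_abs p N \<noteq> 1} \<subseteq> {p. prime p \<and> padic_abs p N > 1} \<union> {p. prime p \<and> padic_abs p (inverse N) > 1}"
  proof
    fix p assume "p \<in> {p. prime p \<and> padic_abs p N \<noteq> 1}"
    then have p: "prime p" "padic_abs p N \<noteq> 1" by auto
    note A = absolute_valueD[OF padic_abs_absolute_value[OF p(1)]]
    show "p \<in> {p. prime p \<and> padic_abs p N > 1} \<union> {p. prime p \<and> padic_abs p (inverse N) > 1}"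
    proof (cases "padic_abs p N > 1")
      case False
      then have "padic_abs p (inverse N) > 1" unfolding A(9) using p A(10)[OF N0] by (simp add: one_less_inverse_iff)
      then show ?thesis using p by simp
    qed (use p in simp)
  qed
  then have "finite {p. prime p \<and> padic_abs p N \<noteq> 1}"
    by (rule finite_subset) (intro finite_UnI padic_abs_gt_1_finite)
  then have P: "finite P" "\<And>p. p \<in> P \<Longrightarrow> prime p" using P0(1) unfolding P_def by auto
  define S where "S = (extensions inf_abs \<union> (\<Union>p\<in>P. extensions (padic_abs p)) :: ('k \<Rightarrow> real) set)"
  have S: "finite S" unfolding S_def by (rule prod_places(1)[OF P])
  have one: "\<nu> w = 1" if "\<nu> \<in> places" "\<nu> \<notin> S" for \<nu>
    using that P0(2) unfolding places_eq S_def P_def by blast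
  have Spl: "S \<subseteq> places" unfolding places_eq S_def using P(2) by blast
  have "(\<Prod>\<nu>\<in>T. \<nu> w ^ local_degree \<nu>) = (\<Prod>\<nu>\<in>S \<union> T. \<nu> w ^ local_degree \<nu>)"
    by (rule prod.mono_neutral_left) (use S T Spl in \<open>auto, metis power_one subsetD\<close>)
  also have "\<dots> = (\<Prod>\<nu>\<in>S. \<nu> w ^ local_degree \<nu>)"
  proof (rule prod.mono_neutral_right)
    show "\<forall>\<nu>\<in>S \<union> T - S. \<nu> w ^ local_degree \<nu> = 1"
    proof
      fix \<nu> assume "\<nu> \<in> S \<union> T - S"
      then have "\<nu> w = 1" using one T(2) by blast
      then show "\<nu> w ^ local_degree \<nu> = 1" by simp
    qed
  qed (use S T in auto)
  also have "\<dots> = (\<Prod>\<nu>\<in>extensions inf_abs. \<nu> w ^ local_degree \<nu>) * (\<Prod>p\<in>P. \<Prod>\<nu>\<in>extensions (padic_abs p). \<nu> w ^ local_degree \<nu>)"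
    unfolding S_def by (rule prod_places(2)[OF P])
  also have "\<dots> \<ge> inf_abs N * (\<Prod>p\<in>P. padic_abs p N)"
  proof (rule mult_mono)
    show "inf_abs N \<le> (\<Prod>\<nu>\<in>extensions inf_abs. \<nu> w ^ local_degree \<nu>)"
      unfolding N_def by (rule local_product(2)[OF inf_abs_absolute_value inf_abs_nontrivial])
    show "(\<Prod>p\<in>P. padic_abs p N) \<le> (\<Prod>p\<in>P. \<Prod>\<nu>\<in>extensions (padic_abs p). \<nu> w ^ local_degree \<nu>)"
      unfolding N_def
      by (intro prod_mono conjI padic_abs_nonneg local_product(2)[OF padic_abs_absolute_value padic_abs_nontrivial] P(2))
    show "0 \<le> (\<Prod>\<nu>\<in>extensions inf_abs. \<nu> w ^ local_degree \<nu>)"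
      by (intro prod_nonneg ballI zero_le_power absolute_valueD(1)[OF extensionsD(1)])
    show "0 \<le> (\<Prod>p\<in>P. padic_abs p N)" by (intro prod_nonneg ballI padic_abs_nonneg)
  qed
  also have "inf_abs N * (\<Prod>p\<in>P. padic_abs p N) = 1"
    unfolding inf_abs_def by (rule rational_product_formula[OF P N0]) (auto simp: P_def)
  finally show ?thesis .
qed


section \<open>Heights\<close>

lemma places_absolute_value: "\<nu> \<in> places \<Longrightarrow> absolute_value \<nu>"
  by (simp add: places_def)

lemma sup_abs_le_iff:
  assumes "finite A" "A \<noteq> {}" shows "sup_abs \<nu> A x \<le> B \<longleftrightarrow> (\<forall>i\<in>A. \<nu> (x i) \<le> B)"
  using assms by (simp add: sup_abs_def)

lemma sup_abs_ge: assumes "finite A" "i \<in> A" shows "\<nu> (x i) \<le> sup_abs \<nu> A x"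
  using assms by (simp add: sup_abs_def)

lemma local_height_ge:
  assumes nu: "absolute_value \<nu>" and fin: "finite A"
  shows "1 \<le> sup_abs \<nu> (insert None (Some ` A)) (case_option 1 x)"
    and "i \<in> A \<Longrightarrow> \<nu> (x i) \<le> sup_abs \<nu> (insert None (Some ` A)) (case_option 1 x)"
  using sup_abs_ge[of "insert None (Some ` A)" None \<nu> "case_option 1 x"]
    sup_abs_ge[of "insert None (Some ` A)" "Some i" \<nu> "case_option 1 x"] fin absolute_valueD(6)[OF nu] by auto

lemma local_height_le:
  assumes nu: "absolute_value \<nu>" and fin: "finite A" and "1 \<le> B" "\<And>i. i \<in> A \<Longrightarrow> \<nu> (x i) \<le> B"
  shows "sup_abs \<nu> (insert None (Some ` A)) (case_option 1 x) \<le> B"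
  by (subst sup_abs_le_iff) (use assms absolute_valueD(6)[OF nu] in auto)

text \<open>Outside the places where some coordinate has an absolute value different from \<open>0\<close> and \<open>1\<close>, the maximum with
  the additional coordinate \<open>1\<close> is \<open>1\<close>.\<close>

lemma finite_local_height_neq_1:
  fixes x :: "'i \<Rightarrow> 'k::number_field"
  assumes fin: "finite A"
  shows "finite {\<nu>\<in>places. sup_abs \<nu> (insert None (Some ` A)) (case_option 1 x) \<noteq> 1}"
proof (rule finite_subset)
  show "finite (\<Union>i\<in>{i\<in>A. x i \<noteq> 0}. {\<nu>\<in>places. \<nu> (x i) \<noteq> 1})"
    using fin finite_places_neq_1 by auto
  show "{\<nu>\<in>places. sup_abs \<nu> (insert None (Some ` A)) (case_option 1 x) \<noteq> 1} \<subseteq> (\<Union>i\<in>{i\<in>A. x i \<noteq> 0}. {\<nu>\<in>places. \<nu> (x i) \<noteq> 1})"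
  proof
    fix \<nu> assume "\<nu> \<in> {\<nu>\<in>places. sup_abs \<nu> (insert None (Some ` A)) (case_option 1 x) \<noteq> 1}"
    then have n: "\<nu> \<in> places" "sup_abs \<nu> (insert None (Some ` A)) (case_option 1 x) \<noteq> 1" by auto
    note nu = places_absolute_value[OF n(1)]
    show "\<nu> \<in> (\<Union>i\<in>{i\<in>A. x i \<noteq> 0}. {\<nu>\<in>places. \<nu> (x i) \<noteq> 1})"
    proof (rule ccontr)
      assume c: "\<not> ?thesis"
      have "\<nu> (x i) \<le> 1" if "i \<in> A" for i
        using c n(1) that absolute_valueD(5)[OF nu] by (cases "x i = 0") auto
      then have "sup_abs \<nu> (insert None (Some ` A)) (case_option 1 x) \<le> 1" by (intro local_height_le[OF nu fin]) auto
      then show False using n(2) local_height_ge(1)[OF nu fin, of x] by simp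
    qed
  qed
qed

lemma weil_height_prod:
  fixes x :: "'i \<Rightarrow> 'k::number_field"
  assumes T: "finite T" "T \<subseteq> places" "{\<nu>\<in>places. sup_abs \<nu> (insert None (Some ` A)) (case_option 1 x) \<noteq> 1} \<subseteq> T"
  shows "weil_height A x = (\<Prod>\<nu>\<in>T. sup_abs \<nu> (insert None (Some ` A)) (case_option 1 x) ^ local_degree \<nu>) powr (1 / real (nf_degree TYPE('k)))"
proof -
  have "(\<Prod>\<nu>\<in>{\<nu>\<in>places. sup_abs \<nu> (insert None (Some ` A)) (case_option 1 x) \<noteq> 1}. sup_abs \<nu> (insert None (Some ` A)) (case_option 1 x) ^ local_degree \<nu>)
      = (\<Prod>\<nu>\<in>T. sup_abs \<nu> (insert None (Some ` A)) (case_option 1 x) ^ local_degree \<nu>)"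
    by (rule prod.mono_neutral_left) (use T in auto)
  then show ?thesis by (simp add: weil_height_def proj_height_def)
qed

lemma weil_height_ge_1:
  fixes x :: "'i \<Rightarrow> 'k::number_field"
  assumes fin: "finite A" shows "1 \<le> weil_height A x"
proof -
  have "1 \<le> (\<Prod>\<nu>\<in>{\<nu>\<in>places. sup_abs \<nu> (insert None (Some ` A)) (case_option 1 x) \<noteq> 1}. sup_abs \<nu> (insert None (Some ` A)) (case_option 1 x) ^ local_degree \<nu>)"
    by (rule prod_ge_1) (use local_height_ge(1)[OF places_absolute_value fin] in \<open>auto intro: one_le_power\<close>)
  then show ?thesis
    unfolding weil_height_prod[OF finite_local_height_neq_1[OF fin, of x] _ order_refl, simplified]
    by (intro ge_one_powr_ge_zero) auto
qed

lemma places_cases: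
  assumes "\<nu> \<in> places"
  obtains "\<nu> \<in> extensions inf_abs" | p where "prime p" "\<nu> \<in> extensions (padic_abs p)" "\<nu> \<notin> extensions inf_abs"
  using assms unfolding places_eq by blast

text \<open>Local bounds for a common denominator \<open>w\<close> and for the numerators \<open>w z\<^sub>i\<close> bound \<open>\<nu>(w)\<close> times the
  local height of \<open>z\<close>. In the product over all places the factor of \<open>w\<close> is at least \<open>1\<close> by the
  product formula, and the archimedean constant \<open>C\<close> survives to the first power because the
  archimedean local degrees add up to the degree.\<close>

theorem weil_height_bound:
  fixes z :: "'i \<Rightarrow> 'k::number_field" and f :: "'l \<Rightarrow> 'j \<Rightarrow> 'k"
  assumes fin: "finite A" "finite L" "\<And>l. l \<in> L \<Longrightarrow> finite (B l)" and w: "w \<noteq> 0" and C: "C \<ge> 1"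
    and arch: "\<And>\<nu>. \<nu> \<in> extensions inf_abs \<Longrightarrow>
      \<nu> w \<le> C * (\<Prod>l\<in>L. sup_abs \<nu> (insert None (Some ` B l)) (case_option 1 (f l))) \<and>
      (\<forall>i\<in>A. \<nu> (w * z i) \<le> C * (\<Prod>l\<in>L. sup_abs \<nu> (insert None (Some ` B l)) (case_option 1 (f l))))"
    and nonarch: "\<And>\<nu> p. prime p \<Longrightarrow> \<nu> \<in> extensions (padic_abs p) \<Longrightarrow>
      \<nu> w \<le> (\<Prod>l\<in>L. sup_abs \<nu> (insert None (Some ` B l)) (case_option 1 (f l))) \<and>
      (\<forall>i\<in>A. \<nu> (w * z i) \<le> (\<Prod>l\<in>L. sup_abs \<nu> (insert None (Some ` B l)) (case_option 1 (f l))))"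
  shows "weil_height A z \<le> C * (\<Prod>l\<in>L. weil_height (B l) (f l))"
proof -
  define d where "d = nf_degree TYPE('k)"
  define S where "S = (extensions inf_abs :: ('k \<Rightarrow> real) set)"
  define H where "H = (\<lambda>\<nu> l. sup_abs \<nu> (insert None (Some ` B l)) (case_option 1 (f l)))"
  define h where "h = (\<lambda>\<nu>. sup_abs \<nu> (insert None (Some ` A)) (case_option 1 z))"
  \<comment> \<open>a finite set of places outside of which all local factors are \<open>1\<close>\<close>
  define T where "T = S \<union> {\<nu>\<in>places. h \<nu> \<noteq> 1} \<union> {\<nu>\<in>places. \<nu> w \<noteq> 1} \<union> (\<Union>l\<in>L. {\<nu>\<in>places. H \<nu> l \<noteq> 1})"
  have dpos: "d > 0" unfolding d_def by (rule nf_degree_pos)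
  have finS: "finite S" unfolding S_def by (rule finite_extensions[OF inf_abs_absolute_value inf_abs_nontrivial])
  have finT: "finite T"
    unfolding T_def h_def H_def using finS finite_local_height_neq_1[OF fin(1), of z] finite_places_neq_1[OF w] fin(2)
      finite_local_height_neq_1[OF fin(3)] by blast
  have ST: "S \<subseteq> T" by (auto simp: T_def)
  have Tpl: "T \<subseteq> places" unfolding T_def S_def places_eq by blast
  have av: "absolute_value \<nu>" if "\<nu> \<in> T" for \<nu> using that Tpl places_absolute_value by blast
  have H1: "H \<nu> l \<ge> 1" if "\<nu> \<in> T" "l \<in> L" for \<nu> l unfolding H_def by (rule local_height_ge(1)[OF av[OF that(1)] fin(3)[OF that(2)]])
  define e where "e = (\<lambda>\<nu>. if \<nu> \<in> S then C else 1)"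
  have e1: "e \<nu> \<ge> 1" for \<nu> using C by (simp add: e_def)
  have loc: "\<nu> w * h \<nu> \<le> e \<nu> * (\<Prod>l\<in>L. H \<nu> l)" if nu: "\<nu> \<in> T" for \<nu>
  proof -
    note N = absolute_valueD[OF av[OF nu]]
    have "\<nu> \<in> places" using nu Tpl by blast
    then have b: "\<nu> w \<le> e \<nu> * (\<Prod>l\<in>L. H \<nu> l) \<and> (\<forall>i\<in>A. \<nu> (w * z i) \<le> e \<nu> * (\<Prod>l\<in>L. H \<nu> l))"
    proof (cases rule: places_cases)
      case 1
      then show ?thesis using arch[OF 1] by (simp add: e_def S_def H_def)
    next
      case (2 p)
      then show ?thesis using nonarch[OF 2(1,2)] by (simp add: e_def S_def H_def)
    qed
    have wp: "\<nu> w > 0" by (rule N(10)[OF w])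
    have "h \<nu> \<le> e \<nu> * (\<Prod>l\<in>L. H \<nu> l) / \<nu> w"
      unfolding h_def
    proof (rule local_height_le[OF av[OF nu] fin(1)])
      show "1 \<le> e \<nu> * (\<Prod>l\<in>L. H \<nu> l) / \<nu> w" using b wp by simp
      show "\<nu> (z i) \<le> e \<nu> * (\<Prod>l\<in>L. H \<nu> l) / \<nu> w" if "i \<in> A" for i
        using b that wp by (simp add: N(3) pos_le_divide_eq mult.commute)
    qed
    then show ?thesis using wp by (simp add: pos_le_divide_eq mult.commute)
  qed
  have h1: "h \<nu> \<ge> 1" if "\<nu> \<in> T" for \<nu> unfolding h_def by (rule local_height_ge(1)[OF av[OF that] fin(1)])
  define hp where "hp = (\<Prod>\<nu>\<in>T. h \<nu> ^ local_degree \<nu>)"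
  define Hp where "Hp = (\<lambda>l. \<Prod>\<nu>\<in>T. H \<nu> l ^ local_degree \<nu>)"
  have hp1: "hp \<ge> 1" unfolding hp_def by (rule prod_ge_1) (use h1 in auto)
  have Hp1: "Hp l \<ge> 1" if "l \<in> L" for l unfolding Hp_def by (rule prod_ge_1) (use H1 that in auto)
  have "1 * hp \<le> (\<Prod>\<nu>\<in>T. \<nu> w ^ local_degree \<nu>) * hp"
    by (rule mult_right_mono[OF product_formula_ge_1[OF w finT Tpl]]) (use hp1 in \<open>auto simp: T_def\<close>)
  also have "\<dots> = (\<Prod>\<nu>\<in>T. (\<nu> w * h \<nu>) ^ local_degree \<nu>)" by (simp add: hp_def prod.distrib power_mult_distrib)
  also have "\<dots> \<le> (\<Prod>\<nu>\<in>T. (e \<nu> * (\<Prod>l\<in>L. H \<nu> l)) ^ local_degree \<nu>)"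
    by (intro prod_mono conjI power_mono loc zero_le_power mult_nonneg_nonneg) (use absolute_valueD(1)[OF av] h1 in \<open>auto intro: order_trans[of 0 1]\<close>)
  also have "\<dots> = (\<Prod>\<nu>\<in>T. e \<nu> ^ local_degree \<nu>) * (\<Prod>\<nu>\<in>T. \<Prod>l\<in>L. H \<nu> l ^ local_degree \<nu>)"
    by (simp add: prod.distrib power_mult_distrib prod_power_distrib)
  also have "(\<Prod>\<nu>\<in>T. \<Prod>l\<in>L. H \<nu> l ^ local_degree \<nu>) = (\<Prod>l\<in>L. Hp l)" unfolding Hp_def by (rule prod.swap)
  also have "(\<Prod>\<nu>\<in>T. e \<nu> ^ local_degree \<nu>) = (\<Prod>\<nu>\<in>S. C ^ local_degree \<nu>)"
    by (rule prod.mono_neutral_cong_right[OF finT ST]) (auto simp: e_def)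
  also have "\<dots> = C ^ d"
    using local_product(1)[OF inf_abs_absolute_value inf_abs_nontrivial, where 'k = 'k] by (simp add: S_def d_def flip: power_sum)
  finally have main: "hp \<le> C ^ d * (\<Prod>l\<in>L. Hp l)" by simp
  have hz: "weil_height A z = hp powr (1 / d)"
    unfolding hp_def h_def d_def by (rule weil_height_prod[OF finT Tpl]) (auto simp: T_def h_def)
  have hf: "weil_height (B l) (f l) = Hp l powr (1 / d)" if "l \<in> L" for l
    unfolding Hp_def H_def d_def by (rule weil_height_prod[OF finT Tpl]) (use that in \<open>auto simp: T_def H_def\<close>)
  have "hp powr (1 / d) \<le> (C ^ d * (\<Prod>l\<in>L. Hp l)) powr (1 / d)" by (rule powr_mono2) (use hp1 main in auto)
  also have "\<dots> = (C ^ d) powr (1 / d) * (\<Prod>l\<in>L. Hp l) powr (1 / d)"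
    by (rule powr_mult)
  also have "(C ^ d) powr (1 / d) = C" using C dpos by (simp add: powr_powr flip: powr_realpow)
  also have "(\<Prod>l\<in>L. Hp l) powr (1 / d) = (\<Prod>l\<in>L. Hp l powr (1 / d))"
    by (rule prod_powr_distrib)
  finally show ?thesis unfolding hz by (simp add: hf)
qed


section \<open>Values and degrees of polynomials\<close>

abbreviation "lookup \<equiv> Poly_Mapping.lookup"
abbreviation "mkeys \<equiv> Poly_Mapping.keys"
abbreviation "msingle \<equiv> Poly_Mapping.single"

definition mono_eval :: "(nat \<Rightarrow> 'k::comm_ring_1) \<Rightarrow> (nat \<Rightarrow>\<^sub>0 nat) \<Rightarrow> 'k" where
  "mono_eval z \<alpha> = (\<Prod>j\<in>mkeys \<alpha>. z j ^ lookup \<alpha> j)"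

definition mono_degree :: "(nat \<Rightarrow>\<^sub>0 nat) \<Rightarrow> nat" where
  "mono_degree \<alpha> = (\<Sum>j\<in>mkeys \<alpha>. lookup \<alpha> j)"

lemma mono_eval_superset: "finite S \<Longrightarrow> mkeys \<alpha> \<subseteq> S \<Longrightarrow> mono_eval z \<alpha> = (\<Prod>j\<in>S. z j ^ lookup \<alpha> j)"
  unfolding mono_eval_def by (rule prod.mono_neutral_left) (auto simp: in_keys_iff)

lemma mono_degree_superset: "finite S \<Longrightarrow> mkeys \<alpha> \<subseteq> S \<Longrightarrow> mono_degree \<alpha> = (\<Sum>j\<in>S. lookup \<alpha> j)"
  unfolding mono_degree_def by (rule sum.mono_neutral_left) (auto simp: in_keys_iff)

lemma mono_eval_add: "mono_eval z (\<alpha> + \<beta>) = mono_eval z \<alpha> * mono_eval z \<beta>"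
proof -
  let ?S = "mkeys \<alpha> \<union> mkeys \<beta>"
  have "mkeys (\<alpha> + \<beta>) \<subseteq> ?S" by (rule keys_add)
  then show ?thesis
    by (simp add: mono_eval_superset[of ?S] lookup_add power_add prod.distrib)
qed

lemma mono_degree_add: "mono_degree (\<alpha> + \<beta>) = mono_degree \<alpha> + mono_degree \<beta>"
proof -
  let ?S = "mkeys \<alpha> \<union> mkeys \<beta>"
  have "mkeys (\<alpha> + \<beta>) \<subseteq> ?S" by (rule keys_add)
  then show ?thesis
    by (simp add: mono_degree_superset[of ?S] lookup_add sum.distrib)
qed

lemma mono_degree_ge: "lookup \<alpha> j \<le> mono_degree \<alpha>"
  unfolding mono_degree_def by (cases "j \<in> mkeys \<alpha>") (auto intro: member_le_sum simp: in_keys_iff)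

lemma mono_degree_single: "mono_degree (msingle j n) = n" by (simp add: mono_degree_def)

lemma meval_superset: "finite S \<Longrightarrow> mkeys p \<subseteq> S \<Longrightarrow> meval z p = (\<Sum>\<alpha>\<in>S. lookup p \<alpha> * mono_eval z \<alpha>)"
  unfolding meval_def mono_eval_def[symmetric] by (rule sum.mono_neutral_left) (auto simp: in_keys_iff)

lemma meval_add: "meval z (p + q) = meval z p + meval z q"
proof -
  let ?S = "mkeys p \<union> mkeys q"
  have "mkeys (p + q) \<subseteq> ?S" by (rule keys_add)
  then show ?thesis by (simp add: meval_superset[of ?S] lookup_add distrib_right sum.distrib)
qed

lemma meval_zero: "meval z 0 = 0" by (simp add: meval_def)

lemma meval_sum: "meval z (sum f A) = (\<Sum>i\<in>A. meval z (f i))"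
  by (induction A rule: infinite_finite_induct) (simp_all add: meval_zero meval_add)

lemma meval_single: "meval z (msingle \<alpha> c) = c * mono_eval z \<alpha>"
  by (simp add: meval_def mono_eval_def)

lemma mpoly_sum_monomials: "p = (\<Sum>\<alpha>\<in>mkeys p. msingle \<alpha> (lookup p \<alpha>))"
proof (rule poly_mapping_eqI)
  fix \<gamma>
  show "lookup p \<gamma> = lookup (\<Sum>\<alpha>\<in>mkeys p. msingle \<alpha> (lookup p \<alpha>)) \<gamma>"
    by (simp add: lookup_sum lookup_single when_def in_keys_iff)
qed

lemma mpoly_mult_monomials:
  fixes p q :: "'k::comm_ring_1 mpoly"
  shows "p * q = (\<Sum>\<alpha>\<in>mkeys p. \<Sum>\<beta>\<in>mkeys q. msingle (\<alpha> + \<beta>) (lookup p \<alpha> * lookup q \<beta>))"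
proof -
  have "p * q = (\<Sum>\<alpha>\<in>mkeys p. msingle \<alpha> (lookup p \<alpha>)) * (\<Sum>\<beta>\<in>mkeys q. msingle \<beta> (lookup q \<beta>))"
    using mpoly_sum_monomials[of p] mpoly_sum_monomials[of q] by metis
  then show ?thesis by (simp add: sum_product mult_single)
qed

lemma meval_mult: "meval z (p * q) = meval z p * meval z (q :: 'k::comm_ring_1 mpoly)"
proof -
  have "meval z (p * q) = (\<Sum>\<alpha>\<in>mkeys p. \<Sum>\<beta>\<in>mkeys q. (lookup p \<alpha> * mono_eval z \<alpha>) * (lookup q \<beta> * mono_eval z \<beta>))"
    unfolding mpoly_mult_monomials[of p q] meval_sum meval_single mono_eval_add by (simp add: mult_ac)
  then show ?thesis by (simp add: meval_def mono_eval_def[symmetric] sum_product)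
qed

lemma meval_one: "meval z 1 = (1 :: 'k::comm_ring_1)"
  using meval_single[of z 0 1] by (simp add: mono_eval_def)

lemma meval_uminus: "meval z (- p) = - meval z (p :: 'k::comm_ring_1 mpoly)"
  using meval_add[of z p "- p"] by (simp add: meval_zero eq_neg_iff_add_eq_0 add.commute)

lemma meval_prod: "meval z (prod f A) = (\<Prod>i\<in>A. meval z (f i :: 'k::comm_ring_1 mpoly))"
  by (induction A rule: infinite_finite_induct) (simp_all add: meval_one meval_mult)

lemma meval_of_int_sign: "meval z (of_int (sign p)) = (of_int (sign p) :: 'k::comm_ring_1)"
  by (simp add: sign_def meval_one meval_uminus)

lemma meval_det:
  fixes A :: "'k::comm_ring_1 mpoly mat"
  assumes "A \<in> carrier_mat n n" shows "meval z (det A) = det (map_mat (meval z) A)"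
proof -
  have "meval z (det A) = (\<Sum>p | p permutes {0..<n}. of_int (sign p) * (\<Prod>i = 0..<n. meval z (A $$ (i, p i))))"
    using assms unfolding det_def by (simp add: meval_sum meval_mult meval_prod meval_of_int_sign)
  also have "\<dots> = (\<Sum>p | p permutes {0..<n}. of_int (sign p) * (\<Prod>i = 0..<n. map_mat (meval z) A $$ (i, p i)))"
  proof (rule sum.cong)
    fix p assume "p \<in> {p. p permutes {0..<n}}"
    then have p: "p permutes {0..<n}" by simp
    have "(\<Prod>i = 0..<n. meval z (A $$ (i, p i))) = (\<Prod>i = 0..<n. map_mat (meval z) A $$ (i, p i))"
      by (rule prod.cong) (use assms permutes_in_image[OF p] in auto)
    then show "of_int (sign p) * (\<Prod>i = 0..<n. meval z (A $$ (i, p i))) = of_int (sign p) * (\<Prod>i = 0..<n. map_mat (meval z) A $$ (i, p i))"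
      by simp
  qed simp
  also have "\<dots> = det (map_mat (meval z) A)" using assms unfolding det_def by simp
  finally show ?thesis .
qed

definition degree_le :: "nat \<Rightarrow> 'k::comm_ring_1 mpoly \<Rightarrow> bool" where
  "degree_le n p \<longleftrightarrow> (\<forall>\<alpha>\<in>mkeys p. mono_degree \<alpha> \<le> n)"

lemma degree_le_add: "degree_le n p \<Longrightarrow> degree_le n q \<Longrightarrow> degree_le n (p + q)"
  unfolding degree_le_def using keys_add[of p q] by blast

lemma degree_le_zero: "degree_le n 0" by (simp add: degree_le_def)

lemma degree_le_sum: "(\<And>i. i \<in> A \<Longrightarrow> degree_le n (f i)) \<Longrightarrow> degree_le n (sum f A)"
  by (induction A rule: infinite_finite_induct) (auto simp: degree_le_zero intro: degree_le_add)

lemma degree_le_mult: "degree_le m p \<Longrightarrow> degree_le n q \<Longrightarrow> degree_le (m + n) (p * q)"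
  unfolding degree_le_def using keys_mult[of p q] by (fastforce simp: mono_degree_add intro: add_mono)

lemma degree_le_mono: "degree_le m p \<Longrightarrow> m \<le> n \<Longrightarrow> degree_le n p"
  unfolding degree_le_def by fastforce

lemma degree_le_one: "degree_le n 1" unfolding degree_le_def by (simp add: mono_degree_def)

lemma degree_le_uminus: "degree_le n p \<Longrightarrow> degree_le n (- p)" unfolding degree_le_def by simp

lemma degree_le_prod:
  "finite A \<Longrightarrow> (\<And>i. i \<in> A \<Longrightarrow> degree_le (d i) (f i)) \<Longrightarrow> degree_le (\<Sum>i\<in>A. d i) (prod f A)"
  by (induction A rule: finite_induct) (auto simp: degree_le_one intro: degree_le_mult)

lemma degree_le_det:
  fixes A :: "'k::comm_ring_1 mpoly mat"
  assumes A: "A \<in> carrier_mat n n" and d: "\<And>i j. i < n \<Longrightarrow> j < n \<Longrightarrow> degree_le (d i) (A $$ (i, j))"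
  shows "degree_le (\<Sum>i<n. d i) (det A)"
proof -
  have "degree_le (\<Sum>i<n. d i) (of_int (sign p) * (\<Prod>i = 0..<n. A $$ (i, p i)))" if p: "p permutes {0..<n}" for p
  proof -
    have "degree_le (\<Sum>i<n. d i) (\<Prod>i = 0..<n. A $$ (i, p i))"
      unfolding atLeast0LessThan by (rule degree_le_prod) (use d permutes_in_image[OF p] in auto)
    then show ?thesis by (simp add: sign_def degree_le_uminus)
  qed
  then show ?thesis using A unfolding det_def by (auto intro!: degree_le_sum)
qed

lemma mpoly_ring_add: "p \<in> mpoly_ring J \<Longrightarrow> q \<in> mpoly_ring J \<Longrightarrow> p + q \<in> mpoly_ring J"
  unfolding mpoly_ring_def using keys_add[of p q] by blast

lemma mpoly_ring_zero: "0 \<in> mpoly_ring J" by (simp add: mpoly_ring_def)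

lemma mpoly_ring_one: "1 \<in> mpoly_ring J" by (simp add: mpoly_ring_def)

lemma mpoly_ring_uminus: "p \<in> mpoly_ring J \<Longrightarrow> - p \<in> mpoly_ring J" by (simp add: mpoly_ring_def)

lemma mpoly_ring_sum: "(\<And>i. i \<in> A \<Longrightarrow> f i \<in> mpoly_ring J) \<Longrightarrow> sum f A \<in> mpoly_ring J"
  by (induction A rule: infinite_finite_induct) (auto simp: mpoly_ring_zero intro: mpoly_ring_add)

lemma mpoly_ring_mult: assumes "p \<in> mpoly_ring J" "q \<in> mpoly_ring J" shows "p * q \<in> mpoly_ring J"
  unfolding mpoly_ring_def
proof (intro CollectI ballI)
  fix \<alpha> assume "\<alpha> \<in> mkeys (p * q)"
  then obtain \<beta> \<gamma> where a: "\<alpha> = \<beta> + \<gamma>" "\<beta> \<in> mkeys p" "\<gamma> \<in> mkeys q" using keys_mult[of p q] by blast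
  then have "mkeys \<alpha> \<subseteq> mkeys \<beta> \<union> mkeys \<gamma>" using keys_add[of \<beta> \<gamma>] by simp
  then show "mkeys \<alpha> \<subseteq> J" using assms a unfolding mpoly_ring_def by blast
qed

lemma mpoly_ring_prod: "(\<And>i. i \<in> A \<Longrightarrow> f i \<in> mpoly_ring J) \<Longrightarrow> prod f A \<in> mpoly_ring J"
  by (induction A rule: infinite_finite_induct) (auto simp: mpoly_ring_one intro: mpoly_ring_mult)

lemma mpoly_ring_det:
  fixes A :: "'k::comm_ring_1 mpoly mat"
  assumes A: "A \<in> carrier_mat n n" and m: "\<And>i j. i < n \<Longrightarrow> j < n \<Longrightarrow> A $$ (i, j) \<in> mpoly_ring J"
  shows "det A \<in> mpoly_ring J"
proof -
  have "of_int (sign p) * (\<Prod>i = 0..<n. A $$ (i, p i)) \<in> mpoly_ring J" if p: "p permutes {0..<n}" for p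
  proof -
    have "(\<Prod>i = 0..<n. A $$ (i, p i)) \<in> mpoly_ring J"
      by (rule mpoly_ring_prod) (use m permutes_in_image[OF p] in auto)
    then show ?thesis by (simp add: sign_def mpoly_ring_uminus)
  qed
  then show ?thesis using A unfolding det_def by (auto intro!: mpoly_ring_sum)
qed

lemma meval_cong:
  assumes "p \<in> mpoly_ring J" "\<And>j. j \<in> J \<Longrightarrow> z j = z' j" shows "meval z p = meval z' p"
proof -
  have "mono_eval z \<alpha> = mono_eval z' \<alpha>" if "\<alpha> \<in> mkeys p" for \<alpha>
    unfolding mono_eval_def by (rule prod.cong) (use assms that in \<open>auto simp: mpoly_ring_def subset_iff\<close>)
  then show ?thesis unfolding meval_def mono_eval_def[symmetric] by (auto intro: sum.cong)
qed

text \<open>Induction on the set of variables. A nonzero coefficient \<open>sl e\<close> of \<open>v\<^sup>e\<close> does not vanish at some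
  grid point in the other variables, which leaves a nonzero univariate polynomial with fewer roots than the grid has
  values for \<open>v\<close>.\<close>

lemma nonvanishing_on_grid:
  fixes p :: "'k::idom mpoly"
  assumes "finite J" "p \<noteq> 0" "p \<in> mpoly_ring J" "\<And>\<alpha> j. \<alpha> \<in> mkeys p \<Longrightarrow> lookup \<alpha> j \<le> n" and S: "finite S" "n < card S"
  shows "\<exists>z. (\<forall>j\<in>J. z j \<in> S) \<and> meval z p \<noteq> 0"
  using assms(1-4)
proof (induction J arbitrary: p rule: finite_induct)
  case empty
  then have k: "mkeys p \<subseteq> {0}" by (auto simp: mpoly_ring_def)
  then have "meval (\<lambda>_. 0) p = lookup p 0" using meval_superset[of "{0}" p] by (simp add: mono_eval_def)
  moreover have "lookup p 0 \<noteq> 0" using k empty.prems(1) by (metis in_keys_iff keys_eq_empty subset_singletonD singletonI)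
  ultimately show ?case by (intro exI[of _ "\<lambda>_. 0"]) simp
next
  case (insert v J)
  \<comment> \<open>\<open>del \<alpha>\<close> is \<open>\<alpha>\<close> without its power of \<open>v\<close>, and \<open>sl e\<close> is the coefficient of \<open>v\<^sup>e\<close>\<close>
  define del where "del = (\<lambda>\<alpha> :: nat \<Rightarrow>\<^sub>0 nat. \<alpha> - msingle v (lookup \<alpha> v))"
  have del: "\<alpha> = del \<alpha> + msingle v (lookup \<alpha> v)" for \<alpha>
    by (rule poly_mapping_eqI) (simp add: del_def lookup_add lookup_minus lookup_single when_def)
  have delJ: "mkeys (del \<alpha>) \<subseteq> J" if "\<alpha> \<in> mkeys p" for \<alpha>
  proof
    fix j assume "j \<in> mkeys (del \<alpha>)"
    then have "j \<in> mkeys \<alpha>" "j \<noteq> v" by (auto simp: del_def in_keys_iff lookup_minus lookup_single when_def split: if_splits)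
    then show "j \<in> J" using insert.prems(2) that unfolding mpoly_ring_def by blast
  qed
  define sl where "sl = (\<lambda>e. \<Sum>\<alpha>\<in>{\<alpha>\<in>mkeys p. lookup \<alpha> v = e}. msingle (del \<alpha>) (lookup p \<alpha>))"
  have sl_keys: "\<exists>\<alpha>\<in>mkeys p. \<beta> = del \<alpha>" if "\<beta> \<in> mkeys (sl e)" for \<beta> e
  proof (rule ccontr)
    assume "\<not> ?thesis"
    then have "lookup (sl e) \<beta> = 0" by (auto simp: sl_def lookup_sum lookup_single when_def intro!: sum.neutral)
    then show False using that by (simp add: in_keys_iff)
  qed
  obtain \<alpha>0 where a0: "\<alpha>0 \<in> mkeys p" using insert.prems(1) keys_eq_empty by blast
  define e0 where "e0 = lookup \<alpha>0 v"
  have "lookup (sl e0) (del \<alpha>0) = (\<Sum>\<alpha>\<in>{\<alpha>\<in>mkeys p. lookup \<alpha> v = e0}. if \<alpha> = \<alpha>0 then lookup p \<alpha> else 0)"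
    unfolding sl_def lookup_sum
  proof (rule sum.cong)
    fix \<alpha> assume "\<alpha> \<in> {\<alpha>\<in>mkeys p. lookup \<alpha> v = e0}"
    then have e: "lookup \<alpha> v = lookup \<alpha>0 v" by (simp add: e0_def)
    have "\<alpha> = \<alpha>0" if d: "del \<alpha> = del \<alpha>0"
    proof -
      have "\<alpha> = del \<alpha>0 + msingle v (lookup \<alpha>0 v)" by (subst del[of \<alpha>], simp only: d e)
      also have "\<dots> = \<alpha>0" by (rule del[symmetric])
      finally show ?thesis .
    qed
    then have "del \<alpha> = del \<alpha>0 \<longleftrightarrow> \<alpha> = \<alpha>0" by blast
    then show "lookup (msingle (del \<alpha>) (lookup p \<alpha>)) (del \<alpha>0) = (if \<alpha> = \<alpha>0 then lookup p \<alpha> else 0)"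
      by (simp add: lookup_single when_def)
  qed simp
  also have "\<dots> = lookup p \<alpha>0" using a0 by (simp add: e0_def)
  finally have "lookup (sl e0) (del \<alpha>0) = lookup p \<alpha>0" .
  then have sl0: "sl e0 \<noteq> 0" using a0 by (auto simp: in_keys_iff)
  have slJ: "sl e \<in> mpoly_ring J" for e
    unfolding mpoly_ring_def using sl_keys delJ by blast
  have "lookup \<beta> j \<le> n" if bk: "\<beta> \<in> mkeys (sl e0)" for \<beta> j
  proof -
    obtain \<alpha> where "\<alpha> \<in> mkeys p" "\<beta> = del \<alpha>" using sl_keys[OF bk] by blast
    then show ?thesis using insert.prems(3)[of \<alpha> j] by (simp add: del_def lookup_minus)
  qed
  then obtain z where z: "\<forall>j\<in>J. z j \<in> S" "meval z (sl e0) \<noteq> 0" using insert.IH[OF sl0 slJ] by blast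
  define P where "P = (\<Sum>e\<le>n. Polynomial.monom (meval z (sl e)) e)"
  have coP: "poly.coeff P e = (if e \<le> n then meval z (sl e) else 0)" for e
    unfolding P_def by (simp add: coeff_sum sum.delta')
  have "e0 \<le> n" using insert.prems(3)[OF a0] by (simp add: e0_def)
  then have P0: "P \<noteq> 0" using coP[of e0] z(2) by auto
  have "Polynomial.degree P \<le> n" by (rule degree_le) (simp add: coP)
  then have "card {x. poly P x = 0} < card S" using card_poly_roots_bound[OF P0] S(2) by linarith
  then obtain x where x: "x \<in> S" "poly P x \<noteq> 0"
    using card_mono[OF poly_roots_finite[OF P0], of S] by (metis (mono_tags, lifting) mem_Collect_eq not_less subsetI)
  define z' where "z' = z(v := x)"
  have ev: "meval z' (sl e) = meval z (sl e)" for e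
    by (rule meval_cong[OF slJ]) (use insert.hyps in \<open>auto simp: z'_def\<close>)
  have "meval z' p = (\<Sum>\<alpha>\<in>mkeys p. lookup p \<alpha> * mono_eval z' \<alpha>)" by (rule meval_superset) auto
  also have "\<dots> = (\<Sum>\<alpha>\<in>mkeys p. meval z' (msingle (del \<alpha>) (lookup p \<alpha>)) * x ^ lookup \<alpha> v)"
  proof (rule sum.cong)
    fix \<alpha>
    have "mono_eval z' \<alpha> = mono_eval z' (del \<alpha>) * mono_eval z' (msingle v (lookup \<alpha> v))" using del mono_eval_add by metis
    also have "mono_eval z' (msingle v (lookup \<alpha> v)) = x ^ lookup \<alpha> v" by (simp add: mono_eval_def z'_def)
    finally show "lookup p \<alpha> * mono_eval z' \<alpha> = meval z' (msingle (del \<alpha>) (lookup p \<alpha>)) * x ^ lookup \<alpha> v" by (simp add: meval_single)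
  qed simp
  also have "\<dots> = (\<Sum>e\<le>n. \<Sum>\<alpha>\<in>{\<alpha>\<in>mkeys p. lookup \<alpha> v = e}. meval z' (msingle (del \<alpha>) (lookup p \<alpha>)) * x ^ lookup \<alpha> v)"
    by (rule sum.group[symmetric]) (use insert.prems(3) in auto)
  also have "\<dots> = (\<Sum>e\<le>n. meval z' (sl e) * x ^ e)"
    unfolding sl_def meval_sum sum_distrib_right by (intro sum.cong) auto
  also have "\<dots> = poly P x" unfolding ev P_def by (simp add: poly_sum poly_monom)
  finally have "meval z' p \<noteq> 0" using x(2) by simp
  moreover have "\<forall>j\<in>insert v J. z' j \<in> S" using z(1) x(1) by (auto simp: z'_def)
  ultimately show ?case by blast
qed

lemma lookup_mvar_mult:
  fixes p :: "'k::comm_ring_1 mpoly"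
  shows "lookup (mvar v * p) \<gamma> = (\<Sum>\<beta>\<in>mkeys p. if msingle v 1 + \<beta> = \<gamma> then lookup p \<beta> else 0)"
proof -
  have "mvar v * p = (\<Sum>\<beta>\<in>mkeys p. msingle (msingle v 1 + \<beta>) (lookup p \<beta>))"
    unfolding mpoly_mult_monomials[of "mvar v" p] by (simp add: mvar_def)
  then show ?thesis by (simp add: lookup_sum lookup_single when_def)
qed

lemma lookup_mvar_mult_shift: "lookup (mvar v * p) (msingle v 1 + \<alpha>) = lookup (p :: 'k::comm_ring_1 mpoly) \<alpha>"
  unfolding lookup_mvar_mult by (simp add: in_keys_iff)

lemma lookup_mvar_mult_other: "lookup \<gamma> v = 0 \<Longrightarrow> lookup (mvar v * p) \<gamma> = (0 :: 'k::comm_ring_1)"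
  unfolding lookup_mvar_mult by (intro sum.neutral ballI) (auto simp: lookup_add)

text \<open>The monomials \<open>x\<^sub>i\<^sub>j \<alpha>\<close> and \<open>\<alpha>\<close>, with \<open>\<alpha>\<close> in the variables of \<open>J\<close>, are pairwise different, so nothing
  cancels in the sum.\<close>

lemma lookup_linear_form:
  fixes G :: "nat \<Rightarrow> 'k::comm_ring_1 mpoly"
  assumes inj: "inj_on i {1..k}" and out: "\<And>j. j \<in> {1..k} \<Longrightarrow> i j \<notin> J" and G: "\<And>j. j \<in> {1..k+1} \<Longrightarrow> G j \<in> mpoly_ring J"
    and F: "F = (\<Sum>j=1..k. mvar (i j) * G j) + G (k + 1)" and \<alpha>: "mkeys \<alpha> \<subseteq> J"
  shows "j \<in> {1..k} \<Longrightarrow> lookup F (msingle (i j) 1 + \<alpha>) = lookup (G j) \<alpha>" and "lookup F \<alpha> = lookup (G (k + 1)) \<alpha>"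
proof -
  have z: "lookup \<alpha> (i j) = 0" if "j \<in> {1..k}" for j using \<alpha> out[OF that] by (auto simp: in_keys_iff)
  show "lookup F \<alpha> = lookup (G (k + 1)) \<alpha>"
    unfolding F lookup_add lookup_sum using z by (simp add: lookup_mvar_mult_other)
  assume j: "j \<in> {1..k}"
  have "msingle (i j) 1 + \<alpha> \<notin> mkeys (G (k + 1))"
  proof
    assume "msingle (i j) 1 + \<alpha> \<in> mkeys (G (k + 1))"
    then have "mkeys (msingle (i j) 1 + \<alpha>) \<subseteq> J" using G[of "k + 1"] unfolding mpoly_ring_def by auto
    moreover have "i j \<in> mkeys (msingle (i j) 1 + \<alpha>)" by (simp add: in_keys_iff lookup_add)
    ultimately show False using out[OF j] by blast
  qed
  then have "lookup (G (k + 1)) (msingle (i j) 1 + \<alpha>) = 0" by (simp add: in_keys_iff)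
  moreover have "lookup (mvar (i j') * G j') (msingle (i j) 1 + \<alpha>) = (if j' = j then lookup (G j) \<alpha> else 0)" if "j' \<in> {1..k}" for j'
  proof (cases "j' = j")
    case False
    then have "i j' \<noteq> i j" using inj_onD[OF inj, of j' j] j that by blast
    then have "lookup (msingle (i j) 1 + \<alpha>) (i j') = 0" using z[OF that] by (simp add: lookup_add lookup_single when_def)
    then show ?thesis using False by (simp add: lookup_mvar_mult_other)
  qed (use lookup_mvar_mult_shift in simp)
  then have "(\<Sum>j'=1..k. lookup (mvar (i j') * G j') (msingle (i j) 1 + \<alpha>)) = lookup (G j) \<alpha>" using j by simp
  ultimately show "lookup F (msingle (i j) 1 + \<alpha>) = lookup (G j) \<alpha>" unfolding F lookup_add lookup_sum by simp
qed

text \<open>The coefficients of each \<open>G j\<close> occur, shifted by a monomial, among the coefficients of \<open>F\<close>. This carries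
  bounds on the degree, the number of monomials and the local height of \<open>F\<close> over to its parts.\<close>

lemma linear_form_coefficients:
  fixes G :: "nat \<Rightarrow> 'k::comm_ring_1 mpoly"
  assumes inj: "inj_on i {1..k}" and out: "\<And>j. j \<in> {1..k} \<Longrightarrow> i j \<notin> J" and G: "\<And>j. j \<in> {1..k+1} \<Longrightarrow> G j \<in> mpoly_ring J"
    and F: "F = (\<Sum>j=1..k. mvar (i j) * G j) + G (k + 1)" and j: "j \<in> {1..k+1}"
  shows "\<exists>\<kappa>. mono_degree \<kappa> = (if j \<le> k then 1 else 0) \<and> (\<forall>\<alpha>\<in>mkeys (G j). \<kappa> + \<alpha> \<in> mkeys F \<and> lookup F (\<kappa> + \<alpha>) = lookup (G j) \<alpha>)"
proof -
  define \<kappa> :: "nat \<Rightarrow>\<^sub>0 nat" where "\<kappa> = (if j \<le> k then msingle (i j) 1 else 0)"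
  have "\<kappa> + \<alpha> \<in> mkeys F \<and> lookup F (\<kappa> + \<alpha>) = lookup (G j) \<alpha>" if a: "\<alpha> \<in> mkeys (G j)" for \<alpha>
  proof -
    have "mkeys \<alpha> \<subseteq> J" using G[OF j] a by (simp add: mpoly_ring_def)
    note L = lookup_linear_form[OF inj out G F this]
    have "lookup F (\<kappa> + \<alpha>) = lookup (G j) \<alpha>"
    proof (cases "j \<le> k")
      case True then show ?thesis using L(1)[of j] j by (simp add: \<kappa>_def)
    next
      case False then have "j = k + 1" using j by simp
      then show ?thesis using L(2) by (simp add: \<kappa>_def)
    qed
    then show ?thesis using a by (simp add: in_keys_iff)
  qed
  moreover have "mono_degree \<kappa> = (if j \<le> k then 1 else 0)" by (simp add: \<kappa>_def mono_degree_single) (simp add: mono_degree_def)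
  ultimately show ?thesis by blast
qed

lemma total_degree_ge: "\<alpha> \<in> mkeys p \<Longrightarrow> mono_degree \<alpha> \<le> total_degree p"
  unfolding total_degree_def mono_degree_def by (rule Max_ge) auto

text \<open>The bound of a single term; how terms are summed differs between the archimedean and the
  other places.\<close>

lemma monomial_absolute_value_le:
  fixes q :: "'k::field mpoly"
  assumes nu: "absolute_value \<nu>" and c: "\<And>\<alpha>. \<alpha> \<in> mkeys q \<Longrightarrow> \<nu> (lookup q \<alpha>) \<le> H"
    and d: "\<And>\<alpha>. \<alpha> \<in> mkeys q \<Longrightarrow> mono_degree \<alpha> \<le> m" and q: "q \<in> mpoly_ring J" and z: "\<And>j. j \<in> J \<Longrightarrow> \<nu> (z j) \<le> b" and b: "1 \<le> b"
    and \<alpha>: "\<alpha> \<in> mkeys q"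
  shows "\<nu> (lookup q \<alpha> * mono_eval z \<alpha>) \<le> H * b ^ m"
proof -
  note N = absolute_valueD[OF nu]
  have "\<nu> (mono_eval z \<alpha>) = (\<Prod>j\<in>mkeys \<alpha>. \<nu> (z j) ^ lookup \<alpha> j)"
    unfolding mono_eval_def by (simp add: absolute_value_prod[OF nu] N(8))
  also have "\<dots> \<le> (\<Prod>j\<in>mkeys \<alpha>. b ^ lookup \<alpha> j)"
    by (intro prod_mono conjI zero_le_power N(1) power_mono z) (use q \<alpha> in \<open>auto simp: mpoly_ring_def\<close>)
  also have "\<dots> = b ^ mono_degree \<alpha>" by (simp add: mono_degree_def power_sum)
  also have "\<dots> \<le> b ^ m" by (rule power_increasing[OF d[OF \<alpha>] b])
  finally have "\<nu> (mono_eval z \<alpha>) \<le> b ^ m" .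
  then show ?thesis unfolding N(3) using c[OF \<alpha>] N(1) by (intro mult_mono) (auto intro: order_trans)
qed


section \<open>Solvability from the equality of ranks\<close>

text \<open>The dimension of a span is the size of any maximal independent subset of the generators. If \<open>b\<close> were not
  in the span of \<open>C\<close>, adding it to such a subset of \<open>C\<close> would give one of \<open>insert b C\<close>.\<close>

lemma (in vectorspace) in_span_if_dim_eq:
  assumes C: "finite C" "C \<subseteq> carrier V" and b: "b \<in> carrier V"
    and eq: "vectorspace.dim K (V\<lparr>carrier := span C\<rparr>) = vectorspace.dim K (V\<lparr>carrier := span (insert b C)\<rparr>)"
  shows "b \<in> span C"
proof (rule ccontr)
  assume nb: "b \<notin> span C"
  have "lin_indpt {}" unfolding lin_dep_def by blast
  moreover have "finite T \<and> card T \<le> card C" if "T \<subseteq> C \<and> lin_indpt T" for T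
    using that C(1) finite_subset card_mono by blast
  ultimately have "\<exists>U. finite U \<and> maximal U (\<lambda>T. T \<subseteq> C \<and> lin_indpt T)"
    by (intro maximal_exists[where N="card C" and B="{}"]) blast+
  then obtain U where U: "finite U" "maximal U (\<lambda>T. T \<subseteq> C \<and> lin_indpt T)" by blast
  then have UC: "U \<subseteq> C" and Ui: "lin_indpt U"
    and Um: "\<And>T. U \<subseteq> T \<Longrightarrow> T \<subseteq> C \<Longrightarrow> lin_indpt T \<Longrightarrow> T = U"
    unfolding maximal_def by blast+
  have bC: "b \<notin> C" using nb in_own_span[OF C(2)] by blast
  then have bU: "b \<notin> U" using UC by blast
  have "b \<notin> span U" using nb span_is_monotone[OF UC] by blast
  then have ind: "lin_indpt (U \<union> {b})"
    using lin_dep_iff_in_span[of U b] UC C(2) Ui b bU by blast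
  have "maximal (U \<union> {b}) (\<lambda>T. T \<subseteq> insert b C \<and> lin_indpt T)"
    unfolding maximal_def
  proof (intro conjI allI impI)
    show "U \<union> {b} \<subseteq> insert b C" using UC by blast
    show "lin_indpt (U \<union> {b})" by (rule ind)
    fix T assume T: "U \<union> {b} \<subseteq> T \<and> T \<subseteq> insert b C \<and> lin_indpt T"
    have "lin_indpt (T - {b})" using T subset_li_is_li[of T "T - {b}"] by blast
    then have "T - {b} = U" using Um[of "T - {b}"] T bU by blast
    then show "T = U \<union> {b}" using T by blast
  qed
  then have "vectorspace.dim K (span_vs (insert b C)) = card (U \<union> {b})"
    using C b by (intro dim_span) auto
  moreover have "vectorspace.dim K (span_vs C) = card U" using C U(2) by (intro dim_span) auto
  ultimately show False using eq bU U(1) by simp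
qed

lemma ratfun_field_is_field: "Ring.field (ratfun_field J :: 'k::field mpoly fract ring)"
proof -
  let ?R = "ratfun_field J :: 'k mpoly fract ring"
  have ops: "x \<oplus>\<^bsub>?R\<^esub> y = x + y" "x \<otimes>\<^bsub>?R\<^esub> y = x * y" "\<zero>\<^bsub>?R\<^esub> = 0" "\<one>\<^bsub>?R\<^esub> = 1" for x y
    by (simp_all add: ratfun_field_def)
  have car: "x \<in> carrier ?R \<longleftrightarrow> (\<exists>p q. x = Fract p q \<and> p \<in> mpoly_ring J \<and> q \<in> mpoly_ring J \<and> q \<noteq> 0)" for x
    by (simp add: ratfun_field_def)
  have carI: "Fract p q \<in> carrier ?R" if "p \<in> mpoly_ring J" "q \<in> mpoly_ring J" "q \<noteq> 0" for p q
    unfolding car using that by blast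
  have zero: "0 \<in> carrier ?R" using carI[OF mpoly_ring_zero mpoly_ring_one one_neq_zero] by (simp only: Zero_fract_def)
  have one: "1 \<in> carrier ?R" using carI[OF mpoly_ring_one mpoly_ring_one one_neq_zero] by (simp only: One_fract_def)
  have add: "x + y \<in> carrier ?R" if xy: "x \<in> carrier ?R" "y \<in> carrier ?R" for x y
  proof -
    obtain p q p' q' where "x = Fract p q" "y = Fract p' q'" "p \<in> mpoly_ring J" "q \<in> mpoly_ring J" "q \<noteq> 0"
      "p' \<in> mpoly_ring J" "q' \<in> mpoly_ring J" "q' \<noteq> 0"
      using xy unfolding car by blast
    then show ?thesis by (auto intro!: carI mpoly_ring_add mpoly_ring_mult)
  qed
  have mul: "x * y \<in> carrier ?R" if xy: "x \<in> carrier ?R" "y \<in> carrier ?R" for x y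
  proof -
    obtain p q p' q' where "x = Fract p q" "y = Fract p' q'" "p \<in> mpoly_ring J" "q \<in> mpoly_ring J" "q \<noteq> 0"
      "p' \<in> mpoly_ring J" "q' \<in> mpoly_ring J" "q' \<noteq> 0"
      using xy unfolding car by blast
    then show ?thesis by (auto intro!: carI mpoly_ring_add mpoly_ring_mult)
  qed
  have neg: "- x \<in> carrier ?R" if "x \<in> carrier ?R" for x
    using that unfolding car by (metis minus_fract mpoly_ring_uminus)
  have inv: "inverse x \<in> carrier ?R" if nz: "x \<in> carrier ?R" "x \<noteq> 0" for x
  proof -
    obtain p q where x: "x = Fract p q" "p \<in> mpoly_ring J" "q \<in> mpoly_ring J" "q \<noteq> 0"
      using nz(1) unfolding car by blast
    have "p \<noteq> 0" using x(1) nz(2) by (auto simp: fract_collapse)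
    then show ?thesis using x carI by auto
  qed
  have cr: "cring ?R"
  proof (rule cringI)
    show "abelian_group ?R"
    proof (rule abelian_groupI)
      fix x assume x: "x \<in> carrier ?R"
      have "- x \<oplus>\<^bsub>?R\<^esub> x = \<zero>\<^bsub>?R\<^esub>" unfolding ops by simp
      then show "\<exists>y\<in>carrier ?R. y \<oplus>\<^bsub>?R\<^esub> x = \<zero>\<^bsub>?R\<^esub>" using neg[OF x] by (rule bexI)
    qed (auto simp: ops add zero algebra_simps)
    show "Group.comm_monoid ?R"
      by (rule comm_monoidI) (auto simp: ops mul one)
  qed (auto simp: ops distrib_right)
  show ?thesis
  proof (rule cring.cring_fieldI2[OF cr])
    show "\<zero>\<^bsub>?R\<^esub> \<noteq> \<one>\<^bsub>?R\<^esub>" unfolding ops by simp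
    fix a assume a: "a \<in> carrier ?R" "a \<noteq> \<zero>\<^bsub>?R\<^esub>"
    then have "a \<noteq> 0" by (simp add: ops)
    then have "a \<otimes>\<^bsub>?R\<^esub> inverse a = \<one>\<^bsub>?R\<^esub>" unfolding ops by simp
    then show "\<exists>b\<in>carrier ?R. a \<otimes>\<^bsub>?R\<^esub> b = \<one>\<^bsub>?R\<^esub>" using inv[OF a(1) \<open>a \<noteq> 0\<close>] by (rule bexI)
  qed
qed

lemma ratfun_vec_carrier:
  "v \<in> carrier (ratfun_vec J r) \<longleftrightarrow> v \<in> carrier_vec r \<and> (\<forall>i<r. v $ i \<in> carrier (ratfun_field J))"
  by (auto simp: ratfun_vec_def vec_set_def)

lemma ratfun_vec_ops:
  "v \<oplus>\<^bsub>ratfun_vec J r\<^esub> w = v + w" "a \<odot>\<^bsub>ratfun_vec J r\<^esub> v = a \<cdot>\<^sub>v v" "\<zero>\<^bsub>ratfun_vec J r\<^esub> = 0\<^sub>v r"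
  by (simp_all add: ratfun_vec_def module_vec_def)

lemma ratfun_vec_is_vectorspace:
  "vectorspace (ratfun_field J) (ratfun_vec J r :: ('k::field mpoly fract, 'k mpoly fract vec) module)"
proof -
  interpret R: Ring.field "ratfun_field J :: 'k mpoly fract ring" by (rule ratfun_field_is_field)
  let ?R = "ratfun_field J :: 'k mpoly fract ring"
  have ops: "x \<oplus>\<^bsub>?R\<^esub> y = x + y" "x \<otimes>\<^bsub>?R\<^esub> y = x * y" "\<zero>\<^bsub>?R\<^esub> = 0" "\<one>\<^bsub>?R\<^esub> = 1" for x y
    by (simp_all add: ratfun_field_def)
  have add: "x + y \<in> carrier ?R" if "x \<in> carrier ?R" "y \<in> carrier ?R" for x y
    using R.add.m_closed[OF that] by (simp add: ops)
  have mul: "x * y \<in> carrier ?R" if "x \<in> carrier ?R" "y \<in> carrier ?R" for x y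
    using R.m_closed[OF that] by (simp add: ops)
  have zero: "0 \<in> carrier ?R" using R.zero_closed by (simp add: ops)
  have m1: "- 1 \<in> carrier ?R"
  proof -
    have "1 \<in> carrier ?R" using R.one_closed by (simp add: ops)
    then obtain y where y: "y \<in> carrier ?R" "y + 1 = 0" using R.l_neg[of 1] R.a_inv_closed[of 1] by (auto simp: ops)
    then have "y = - 1" using y(2) by (simp add: eq_neg_iff_add_eq_0)
    then show ?thesis using y(1) by simp
  qed
  let ?V = "ratfun_vec J r :: ('k mpoly fract, 'k mpoly fract vec) module"
  show ?thesis
  proof (rule vs_criteria)
    show "\<forall>v\<in>carrier (?V). \<exists>w\<in>carrier (?V). v \<oplus>\<^bsub>?V\<^esub> w = \<zero>\<^bsub>?V\<^esub>"
    proof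
      fix v :: "'k mpoly fract vec" assume v: "v \<in> carrier (?V)"
      then have "(- 1) \<cdot>\<^sub>v v \<in> carrier (?V)"
        unfolding ratfun_vec_carrier using mul[OF m1] by auto
      moreover have "v \<oplus>\<^bsub>?V\<^esub> ((- 1) \<cdot>\<^sub>v v) = \<zero>\<^bsub>?V\<^esub>"
        using v unfolding ratfun_vec_ops ratfun_vec_carrier by (intro eq_vecI) auto
      ultimately show "\<exists>w\<in>carrier (?V). v \<oplus>\<^bsub>?V\<^esub> w = \<zero>\<^bsub>?V\<^esub>" by blast
    qed
  qed (auto simp: ratfun_field_is_field ratfun_vec_ops ratfun_vec_carrier ops add mul zero algebra_simps
        intro!: eq_vecI)
qed

text \<open>Equal ranks put the last column into the span of the others.\<close>

lemma ratfun_rank_eq_imp_solvable: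
  fixes G :: "nat \<Rightarrow> nat \<Rightarrow> 'k::field mpoly"
  assumes G: "\<And>a b. a < k \<Longrightarrow> b \<le> k \<Longrightarrow> G a b \<in> mpoly_ring J"
    and rank: "ratfun_rank J (mat k k (\<lambda>(a, b). Fract (G a b) 1)) =
      ratfun_rank J (mat k (k + 1) (\<lambda>(a, b). Fract (G a b) 1))"
  shows "\<exists>y. \<forall>a<k. Fract (G a k) 1 = (\<Sum>b<k. Fract (G a b) 1 * y b)"
proof -
  let ?R = "ratfun_field J :: 'k mpoly fract ring"
  let ?V = "ratfun_vec J k :: ('k mpoly fract, 'k mpoly fract vec) module"
  interpret V: vectorspace ?R ?V by (rule ratfun_vec_is_vectorspace)
  define c where "c b = vec k (\<lambda>a. Fract (G a b) 1)" for b
  have cin: "c b \<in> carrier ?V" if "b \<le> k" for b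
  proof -
    have "Fract (G a b) 1 \<in> carrier ?R" if "a < k" for a
      using G[OF that \<open>b \<le> k\<close>] mpoly_ring_one one_neq_zero
      unfolding ratfun_field_def by (simp only: partial_object.select_convs) blast
    then show ?thesis unfolding ratfun_vec_carrier c_def by simp
  qed
  define C where "C = c ` {..<k}"
  have C: "finite C" "C \<subseteq> carrier ?V" using cin unfolding C_def by auto
  have "set (cols (mat k k (\<lambda>(a, b). Fract (G a b) 1))) = C"
    unfolding C_def c_def cols_def by (auto simp: image_iff atLeast0LessThan intro!: bexI eq_vecI)
  moreover have "set (cols (mat k (k + 1) (\<lambda>(a, b). Fract (G a b) 1))) = insert (c k) C"
  proof -
    have "set (cols (mat k (k + 1) (\<lambda>(a, b). Fract (G a b) 1))) = c ` {0..<k + 1}"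
      unfolding cols_def set_map by (rule image_cong) (auto simp: c_def)
    also have "{0..<k + 1} = insert k {..<k}" by auto
    finally show ?thesis by (simp add: C_def)
  qed
  ultimately have "c k \<in> V.span C"
    using rank C cin[OF order_refl] unfolding ratfun_rank_def by (intro V.in_span_if_dim_eq) simp_all
  \<comment> \<open>the solvable right-hand sides form a subspace that contains the columns\<close>
  moreover have "V.span C \<subseteq> {v \<in> carrier ?V. \<exists>y. \<forall>a<k. v $ a = (\<Sum>b<k. Fract (G a b) 1 * y b)}" (is "_ \<subseteq> ?U")
  proof (rule V.span_is_subset)
    show "C \<subseteq> ?U"
    proof
      fix v assume "v \<in> C"
      then obtain b where b: "b < k" "v = c b" unfolding C_def by auto
      have sm: "\<forall>a<k. v $ a = (\<Sum>b'<k. Fract (G a b') 1 * of_bool (b' = b))"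
      proof (intro allI impI)
        fix a assume a: "a < k"
        have "(\<Sum>b'<k. Fract (G a b') 1 * of_bool (b' = b)) = (\<Sum>b'<k. if b' = b then Fract (G a b') 1 else 0)"
          by (rule sum.cong) auto
        then show "v $ a = (\<Sum>b'<k. Fract (G a b') 1 * of_bool (b' = b))" using b a by (simp add: c_def)
      qed
      have cl: "v \<in> carrier ?V" using cin[of b] b by simp
      show "v \<in> ?U" by (rule CollectI, rule conjI, rule cl, rule exI, rule sm)
    qed
    show "submodule ?R ?U ?V"
    proof
      show "?U \<subseteq> carrier ?V" by blast
      show "\<zero>\<^bsub>?V\<^esub> \<in> ?U" using V.zero_closed
        by (auto simp: ratfun_vec_ops intro!: exI[of _ "\<lambda>_. 0"])
      show "v \<oplus>\<^bsub>?V\<^esub> w \<in> ?U" if vU: "v \<in> ?U" "w \<in> ?U" for v w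
      proof -
        obtain y y' where *: "\<forall>a<k. v $ a = (\<Sum>b<k. Fract (G a b) 1 * y b)" "\<forall>a<k. w $ a = (\<Sum>b<k. Fract (G a b) 1 * y' b)"
          and vw: "v \<in> carrier ?V" "w \<in> carrier ?V"
          using vU unfolding mem_Collect_eq by (elim conjE exE)
        have dw: "dim_vec w = k" using vw(2) unfolding ratfun_vec_carrier by auto
        have sm: "\<forall>a<k. (v + w) $ a = (\<Sum>b<k. Fract (G a b) 1 * (y b + y' b))"
          using * dw by (simp add: distrib_left sum.distrib del: mult_fract)
        have cl: "v + w \<in> carrier ?V" using V.M.add.m_closed[OF vw] unfolding ratfun_vec_ops .
        show ?thesis unfolding ratfun_vec_ops by (rule CollectI, rule conjI, rule cl, rule exI[of _ "\<lambda>b. y b + y' b"], rule sm)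
      qed
      show "x \<odot>\<^bsub>?V\<^esub> v \<in> ?U" if xU: "x \<in> carrier ?R" "v \<in> ?U" for x v
      proof -
        obtain y where *: "\<forall>a<k. v $ a = (\<Sum>b<k. Fract (G a b) 1 * y b)" and v: "v \<in> carrier ?V"
          using xU unfolding mem_Collect_eq by (elim conjE exE)
        have dv: "dim_vec v = k" using v unfolding ratfun_vec_carrier by auto
        have sm: "\<forall>a<k. (x \<cdot>\<^sub>v v) $ a = (\<Sum>b<k. Fract (G a b) 1 * (x * y b))"
          using * dv by (simp add: sum_distrib_left mult_ac del: mult_fract)
        have cl: "x \<cdot>\<^sub>v v \<in> carrier ?V" using V.smult_closed[OF xU(1) v] unfolding ratfun_vec_ops .
        show ?thesis unfolding ratfun_vec_ops by (rule CollectI, rule conjI, rule cl, rule exI[of _ "\<lambda>b. x * y b"], rule sm)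
      qed
    qed
  qed
  ultimately have "c k \<in> ?U" by (rule rev_subsetD)
  then obtain y where "\<forall>a<k. c k $ a = (\<Sum>b<k. Fract (G a b) 1 * y b)"
    unfolding mem_Collect_eq by (elim conjE exE)
  then have "\<forall>a<k. Fract (G a k) 1 = (\<Sum>b<k. Fract (G a b) 1 * y b)" by (simp add: c_def)
  then show ?thesis by (rule exI[of _ y])
qed


section \<open>Maximal minors and Cramer's rule\<close>

text \<open>Laplace expansion along the last column, in a form that displays that the cofactors do not depend on
  that column.\<close>

lemma det_expand_last_column:
  fixes M :: "nat \<Rightarrow> nat \<Rightarrow> 'a::comm_ring_1"
  shows "det (mat (Suc r) (Suc r) (\<lambda>(s, t). if t < r then M s t else x s)) =
    (\<Sum>s<Suc r. x s * ((- 1) ^ (s + r) * det (mat r r (\<lambda>(s', t). M (if s' < s then s' else Suc s') t))))"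
proof -
  let ?A = "mat (Suc r) (Suc r) (\<lambda>(s, t). if t < r then M s t else x s)"
  have A: "?A \<in> carrier_mat (Suc r) (Suc r)" by simp
  have "det ?A = (\<Sum>s<Suc r. ?A $$ (s, r) * cofactor ?A s r)"
    by (rule laplace_expansion_column[OF A]) simp
  also have "\<dots> = (\<Sum>s<Suc r. x s * ((- 1) ^ (s + r) * det (mat r r (\<lambda>(s', t). M (if s' < s then s' else Suc s') t))))"
  proof (rule sum.cong)
    fix s assume s: "s \<in> {..<Suc r}"
    have "mat_delete ?A s r = mat r r (\<lambda>(s', t). M (if s' < s then s' else Suc s') t)"
      unfolding mat_delete_def by (rule eq_matI) (use s in auto)
    then show "?A $$ (s, r) * cofactor ?A s r =
        x s * ((- 1) ^ (s + r) * det (mat r r (\<lambda>(s', t). M (if s' < s then s' else Suc s') t)))"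
      using s unfolding cofactor_def by simp
  qed simp
  finally show ?thesis .
qed

text \<open>A repeated row or column would make the determinant vanish.\<close>

lemma det_minor_inj:
  fixes G :: "nat \<Rightarrow> nat \<Rightarrow> 'a::idom"
  assumes "det (mat r r (\<lambda>(s, t). G (\<rho> s) (\<kappa> t))) \<noteq> 0"
  shows "inj_on \<rho> {..<r}" "inj_on \<kappa> {..<r}"
proof -
  let ?A = "mat r r (\<lambda>(s, t). G (\<rho> s) (\<kappa> t))"
  have A: "?A \<in> carrier_mat r r" by simp
  show "inj_on \<rho> {..<r}"
  proof (rule inj_onI, rule ccontr)
    fix s t assume st: "s \<in> {..<r}" "t \<in> {..<r}" "\<rho> s = \<rho> t" "s \<noteq> t"
    have "row ?A s = row ?A t" by (rule eq_vecI) (use st in auto)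
    then show False using det_identical_rows[OF A st(4)] st(1,2) assms by simp
  qed
  show "inj_on \<kappa> {..<r}"
  proof (rule inj_onI, rule ccontr)
    fix s t assume st: "s \<in> {..<r}" "t \<in> {..<r}" "\<kappa> s = \<kappa> t" "s \<noteq> t"
    have "col ?A s = col ?A t" by (rule eq_vecI) (use st in auto)
    then show False using det_identical_columns[OF A st(4)] st(1,2) assms by simp
  qed
qed

text \<open>The empty minor is \<open>1\<close>, and the size of a nonzero minor is at most \<open>k\<close> by injectivity.\<close>

lemma maximal_minor_exists:
  fixes G :: "nat \<Rightarrow> nat \<Rightarrow> 'a::idom"
  shows "\<exists>r \<rho> \<kappa>. (\<forall>t<r. \<rho> t < k \<and> \<kappa> t < k) \<and> det (mat r r (\<lambda>(s, t). G (\<rho> s) (\<kappa> t))) \<noteq> 0 \<and>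
    (\<forall>a<k. \<forall>b<k. det (mat (Suc r) (Suc r) (\<lambda>(s, t). G ((\<rho>(r := a)) s) ((\<kappa>(r := b)) t))) = 0)"
proof -
  define P where "P r \<longleftrightarrow> (\<exists>\<rho> \<kappa>. (\<forall>t<r. \<rho> t < k \<and> \<kappa> t < k) \<and> det (mat r r (\<lambda>(s, t). G (\<rho> s) (\<kappa> t))) \<noteq> 0)" for r
  have P0: "P 0" unfolding P_def by (simp add: det_def)
  have bound: "r \<le> k" if Pr: "P r" for r
  proof -
    obtain \<rho> \<kappa> where *: "\<forall>t<r. \<rho> t < k \<and> \<kappa> t < k" "det (mat r r (\<lambda>(s, t). G (\<rho> s) (\<kappa> t))) \<noteq> 0"
      using Pr unfolding P_def by blast
    have "card {..<r} \<le> card {..<k}"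
      by (rule card_inj_on_le[OF det_minor_inj(1)[where G=G and \<rho>=\<rho> and \<kappa>=\<kappa>, OF *(2)]]) (use *(1) in auto)
    then show ?thesis by simp
  qed
  define r where "r = (GREATEST r. P r)"
  have "P r" unfolding r_def by (rule GreatestI_nat[where P=P, OF P0]) (use bound in blast)
  then obtain \<rho> \<kappa> where *: "\<forall>t<r. \<rho> t < k \<and> \<kappa> t < k" "det (mat r r (\<lambda>(s, t). G (\<rho> s) (\<kappa> t))) \<noteq> 0"
    unfolding P_def by blast
  have "\<not> P (Suc r)"
  proof
    assume "P (Suc r)"
    then have "Suc r \<le> (GREATEST r. P r)" by (rule Greatest_le_nat[where P=P]) (use bound in blast)
    then show False by (simp add: r_def)
  qed
  moreover have "\<forall>t<Suc r. (\<rho>(r := a)) t < k \<and> (\<kappa>(r := b)) t < k" if "a < k" "b < k" for a b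
    using *(1) that by simp
  ultimately have "det (mat (Suc r) (Suc r) (\<lambda>(s, t). G ((\<rho>(r := a)) s) ((\<kappa>(r := b)) t))) = 0" if "a < k" "b < k" for a b
    using that unfolding P_def by blast
  then show ?thesis using * by blast
qed

text \<open>The minor bordered by row \<open>a\<close> and column \<open>b\<close> vanishes by maximality. Expanded along the column \<open>b\<close> it is a
  relation among the entries of this column whose coefficients \<open>C\<close> do not depend on \<open>b\<close> and whose last coefficient is the
  minor itself. The column \<open>k\<close> satisfies the same relation because it is a combination of
  the others.\<close>

lemma minor_row_relations:
  fixes G :: "nat \<Rightarrow> nat \<Rightarrow> 'a::idom"
  assumes sol: "\<forall>a<k. Fract (G a k) 1 = (\<Sum>b<k. Fract (G a b) 1 * y b)"
  shows "\<exists>r \<rho> \<kappa>. (\<forall>t<r. \<rho> t < k \<and> \<kappa> t < k) \<and> det (mat r r (\<lambda>(s, t). G (\<rho> s) (\<kappa> t))) \<noteq> 0 \<and>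
    (\<forall>a<k. \<exists>C. \<forall>b\<le>k. (\<Sum>s<r. G (\<rho> s) b * C s) + G a b * det (mat r r (\<lambda>(s, t). G (\<rho> s) (\<kappa> t))) = 0)"
proof -
  obtain r \<rho> \<kappa> where r: "\<forall>t<r. \<rho> t < k \<and> \<kappa> t < k"
    and g: "det (mat r r (\<lambda>(s, t). G (\<rho> s) (\<kappa> t))) \<noteq> 0"
    and max: "\<forall>a<k. \<forall>b<k. det (mat (Suc r) (Suc r) (\<lambda>(s, t). G ((\<rho>(r := a)) s) ((\<kappa>(r := b)) t))) = 0"
    using maximal_minor_exists[of k G] by blast
  have "\<exists>C. \<forall>b\<le>k. (\<Sum>s<r. G (\<rho> s) b * C s) + G a b * det (mat r r (\<lambda>(s, t). G (\<rho> s) (\<kappa> t))) = 0" if a: "a < k" for a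
  proof -
    define \<rho>' where "\<rho>' = \<rho>(r := a)"
    define C where "C s = (- 1) ^ (s + r) * det (mat r r (\<lambda>(s', t). G (\<rho>' (if s' < s then s' else Suc s')) (\<kappa> t)))" for s
    have "mat r r (\<lambda>(s', t). G (\<rho>' (if s' < r then s' else Suc s')) (\<kappa> t)) = mat r r (\<lambda>(s, t). G (\<rho> s) (\<kappa> t))"
      by (rule eq_matI) (auto simp: \<rho>'_def)
    then have Cr: "C r = det (mat r r (\<lambda>(s, t). G (\<rho> s) (\<kappa> t)))" unfolding C_def by simp
    have rel: "(\<Sum>s<Suc r. G (\<rho>' s) b * C s) = 0" if b: "b < k" for b
    proof -
      have "mat (Suc r) (Suc r) (\<lambda>(s, t). G (\<rho>' s) ((\<kappa>(r := b)) t)) =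
          mat (Suc r) (Suc r) (\<lambda>(s, t). if t < r then G (\<rho>' s) (\<kappa> t) else G (\<rho>' s) b)"
        by (rule eq_matI) auto
      then have "(\<Sum>s<Suc r. G (\<rho>' s) b * C s) = det (mat (Suc r) (Suc r) (\<lambda>(s, t). G (\<rho>' s) ((\<kappa>(r := b)) t)))"
        unfolding C_def by (simp only: det_expand_last_column)
      then show ?thesis using max a b unfolding \<rho>'_def by simp
    qed
    have \<rho>'k: "\<rho>' s < k" if "s < Suc r" for s using that r a unfolding \<rho>'_def by (auto simp: less_Suc_eq)
    \<comment> \<open>the embedding into the field of fractions\<close>
    define \<phi> :: "'a \<Rightarrow> 'a fract" where "\<phi> p = Fract p 1" for p
    have \<phi>: "\<phi> (p * q) = \<phi> p * \<phi> q" "\<phi> (p + q) = \<phi> p + \<phi> q" "\<phi> 0 = 0" "\<phi> p = 0 \<longleftrightarrow> p = 0" for p q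
      by (simp_all add: \<phi>_def Zero_fract_def eq_fract)
    have \<phi>s: "\<phi> (\<Sum>s\<in>S. f s) = (\<Sum>s\<in>S. \<phi> (f s))" for S :: "nat set" and f
      by (induction S rule: infinite_finite_induct) (simp_all add: \<phi>)
    \<comment> \<open>transfer of the relation to column \<open>k\<close>, in the field of fractions\<close>
    have "\<phi> (\<Sum>s<Suc r. G (\<rho>' s) k * C s) = (\<Sum>s<Suc r. (\<Sum>b<k. \<phi> (G (\<rho>' s) b) * y b) * \<phi> (C s))"
      unfolding \<phi>s \<phi>(1) by (rule sum.cong) (use sol \<rho>'k in \<open>simp_all add: \<phi>_def\<close>)
    also have "\<dots> = (\<Sum>s<Suc r. \<Sum>b<k. y b * (\<phi> (G (\<rho>' s) b) * \<phi> (C s)))"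
      unfolding sum_distrib_right by (simp only: mult_ac)
    also have "\<dots> = (\<Sum>b<k. \<Sum>s<Suc r. y b * (\<phi> (G (\<rho>' s) b) * \<phi> (C s)))"
      by (rule sum.swap)
    also have "\<dots> = (\<Sum>b<k. y b * \<phi> (\<Sum>s<Suc r. G (\<rho>' s) b * C s))"
      unfolding \<phi>s \<phi>(1) by (simp only: sum_distrib_left)
    also have "\<dots> = 0" by (intro sum.neutral ballI) (simp only: rel \<phi>(3) mult_zero_right lessThan_iff)
    finally have "(\<Sum>s<Suc r. G (\<rho>' s) k * C s) = 0" by (simp only: \<phi>(4))
    then have all: "(\<Sum>s<Suc r. G (\<rho>' s) b * C s) = 0" if "b \<le> k" for b
      using rel that by (cases "b = k") simp_all
    have "(\<Sum>s<r. G (\<rho> s) b * C s) + G a b * det (mat r r (\<lambda>(s, t). G (\<rho> s) (\<kappa> t))) = 0" if b: "b \<le> k" for b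
    proof -
      have "(\<Sum>s<r. G (\<rho>' s) b * C s) = (\<Sum>s<r. G (\<rho> s) b * C s)"
        by (rule sum.cong) (simp_all add: \<rho>'_def)
      then show ?thesis using all[OF b] by (simp add: Cr \<rho>'_def)
    qed
    then show ?thesis by blast
  qed
  then show ?thesis using r g by blast
qed

text \<open>Solve the equations of the rows of the minor for the unknowns of its columns, with the other unknowns
  equal to \<open>0\<close>. By the relations every remaining equation, multiplied by the minor, is a combination of
  those solved. Cramer's rule gives the form of the solution.\<close>

lemma solve_by_minor:
  fixes A :: "nat \<Rightarrow> nat \<Rightarrow> 'a::field"
  assumes r: "\<forall>t<r. \<rho> t < k \<and> \<kappa> t < k" and w: "det (mat r r (\<lambda>(s, t). A (\<rho> s) (\<kappa> t))) \<noteq> 0"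
    and rel: "\<forall>a<k. \<exists>C. \<forall>b\<le>k. (\<Sum>s<r. A (\<rho> s) b * C s) + A a b * det (mat r r (\<lambda>(s, t). A (\<rho> s) (\<kappa> t))) = 0"
  shows "\<exists>x. (\<forall>a<k. (\<Sum>b<k. x b * A a b) + A a k = 0) \<and>
    (\<forall>b<k. x b = 0 \<or> (\<exists>t<r. det (mat r r (\<lambda>(s, t). A (\<rho> s) (\<kappa> t))) * x b =
       det (mat r r (\<lambda>(s, u). if u = t then - A (\<rho> s) k else A (\<rho> s) (\<kappa> u)))))"
proof -
  define M where "M = mat r r (\<lambda>(s, t). A (\<rho> s) (\<kappa> t))"
  define v where "v = vec r (\<lambda>s. - A (\<rho> s) k)"
  define y where "y = inverse (det M) \<cdot>\<^sub>v (adj_mat M *\<^sub>v v)"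
  have M: "M \<in> carrier_mat r r" by (simp add: M_def)
  have v: "v \<in> carrier_vec r" by (simp add: v_def)
  note adj = adj_mat[OF M]
  have adv: "adj_mat M *\<^sub>v v \<in> carrier_vec r" using adj(1) v by simp
  have y: "y \<in> carrier_vec r" using adv by (simp add: y_def)
  have "M *\<^sub>v y = inverse (det M) \<cdot>\<^sub>v (M *\<^sub>v (adj_mat M *\<^sub>v v))"
    unfolding y_def by (rule mult_mat_vec[OF M adv])
  also have "M *\<^sub>v (adj_mat M *\<^sub>v v) = (M * adj_mat M) *\<^sub>v v"
    by (rule assoc_mult_mat_vec[OF M adj(1) v, symmetric])
  also have "\<dots> = det M \<cdot>\<^sub>v v"
    unfolding adj(2) using v by (intro eq_vecI) auto
  also have "inverse (det M) \<cdot>\<^sub>v \<dots> = v"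
    using w v unfolding M_def[symmetric] by (intro eq_vecI) auto
  finally have My: "M *\<^sub>v y = v" .
  have row: "(\<Sum>t<r. A (\<rho> s) (\<kappa> t) * y $ t) = - A (\<rho> s) k" if s: "s < r" for s
  proof -
    have "(M *\<^sub>v y) $ s = (\<Sum>t<r. A (\<rho> s) (\<kappa> t) * y $ t)"
      using M y s by (simp add: scalar_prod_def M_def atLeast0LessThan)
    then show ?thesis using My s by (simp add: v_def)
  qed
  note inj = det_minor_inj(2)[where G=A and \<rho>=\<rho> and \<kappa>=\<kappa>, OF w]
  define x where "x b = (\<Sum>t<r. if \<kappa> t = b then y $ t else 0)" for b
  have sumx: "(\<Sum>b<k. x b * c b) = (\<Sum>t<r. c (\<kappa> t) * y $ t)" for c
  proof -
    have "(\<Sum>b<k. x b * c b) = (\<Sum>t<r. \<Sum>b<k. (if \<kappa> t = b then y $ t else 0) * c b)"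
      unfolding x_def sum_distrib_right by (rule sum.swap)
    also have "\<dots> = (\<Sum>t<r. c (\<kappa> t) * y $ t)"
    proof (rule sum.cong)
      fix t assume t: "t \<in> {..<r}"
      have "(\<Sum>b<k. (if \<kappa> t = b then y $ t else 0) * c b) = (\<Sum>b<k. if \<kappa> t = b then c b * y $ t else 0)"
        by (rule sum.cong) auto
      then show "(\<Sum>b<k. (if \<kappa> t = b then y $ t else 0) * c b) = c (\<kappa> t) * y $ t"
        using r t by simp
    qed simp
    finally show ?thesis .
  qed
  have eq: "(\<Sum>b<k. x b * A a b) + A a k = 0" if a: "a < k" for a
  proof -
    obtain C where C: "\<And>b. b \<le> k \<Longrightarrow> (\<Sum>s<r. A (\<rho> s) b * C s) + A a b * det M = 0"
      using rel a unfolding M_def by blast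
    have r1: "A a b * det M = - (\<Sum>s<r. A (\<rho> s) b * C s)" if "b \<le> k" for b
      using C[OF that] by (simp add: eq_neg_iff_add_eq_0 add.commute)
    have "(\<Sum>t<r. A a (\<kappa> t) * y $ t) * det M = (\<Sum>t<r. y $ t * (A a (\<kappa> t) * det M))"
      unfolding sum_distrib_right by (simp only: mult_ac)
    also have "\<dots> = (\<Sum>t<r. y $ t * - (\<Sum>s<r. A (\<rho> s) (\<kappa> t) * C s))"
    proof (rule sum.cong)
      fix t assume "t \<in> {..<r}"
      then have "\<kappa> t \<le> k" using r by (simp add: less_imp_le)
      then show "y $ t * (A a (\<kappa> t) * det M) = y $ t * - (\<Sum>s<r. A (\<rho> s) (\<kappa> t) * C s)" by (simp only: r1)
    qed simp
    also have "\<dots> = - (\<Sum>t<r. \<Sum>s<r. y $ t * (A (\<rho> s) (\<kappa> t) * C s))"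
      by (simp only: mult_minus_right sum_negf sum_distrib_left)
    also have "(\<Sum>t<r. \<Sum>s<r. y $ t * (A (\<rho> s) (\<kappa> t) * C s)) = (\<Sum>s<r. \<Sum>t<r. y $ t * (A (\<rho> s) (\<kappa> t) * C s))"
      by (rule sum.swap)
    also have "\<dots> = (\<Sum>s<r. (\<Sum>t<r. A (\<rho> s) (\<kappa> t) * y $ t) * C s)"
      unfolding sum_distrib_right by (simp only: mult_ac)
    also have "\<dots> = (\<Sum>s<r. - A (\<rho> s) k * C s)"
      by (rule sum.cong) (simp_all only: row lessThan_iff)
    also have "- \<dots> = (\<Sum>s<r. A (\<rho> s) k * C s)" by (simp add: sum_negf)
    also have "\<dots> = - (A a k * det M)" using r1[of k] by simp
    finally have "((\<Sum>b<k. x b * A a b) + A a k) * det M = 0" unfolding sumx by (simp add: distrib_right)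
    then show ?thesis using w unfolding M_def by simp
  qed
  have "x b = 0 \<or> (\<exists>t<r. det M * x b = det (mat r r (\<lambda>(s, u). if u = t then - A (\<rho> s) k else A (\<rho> s) (\<kappa> u))))" for b
  proof (cases "\<exists>t<r. \<kappa> t = b")
    case True
    then obtain t where t: "t < r" "\<kappa> t = b" by blast
    have "x b = (\<Sum>u<r. if u = t then y $ u else 0)"
      unfolding x_def by (rule sum.cong) (use t inj in \<open>auto dest: inj_onD\<close>)
    then have xb: "x b = y $ t" using t by simp
    have "replace_col M v t = mat r r (\<lambda>(s, u). if u = t then - A (\<rho> s) k else A (\<rho> s) (\<kappa> u))"
      unfolding replace_col_def by (rule eq_matI) (auto simp: M_def v_def)
    then have "det M * x b = det (mat r r (\<lambda>(s, u). if u = t then - A (\<rho> s) k else A (\<rho> s) (\<kappa> u)))"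
      using cramer_lemma_mat[OF M y t(1)] unfolding My xb by (simp add: mult.commute)
    then show ?thesis using t(1) by blast
  next
    case False
    then have "x b = 0" unfolding x_def by (intro sum.neutral) auto
    then show ?thesis by simp
  qed
  then show ?thesis using eq unfolding M_def by blast
qed


section \<open>The point of small height\<close>

lemma absolute_value_det_le_ultrametric:
  fixes M :: "'k::field mat"
  assumes nu: "absolute_value \<nu>" and int: "\<And>n::nat. \<nu> (of_nat n) \<le> 1"
    and M: "M \<in> carrier_mat n n" and R: "\<And>i j. i < n \<Longrightarrow> j < n \<Longrightarrow> \<nu> (M $$ (i, j)) \<le> R i"
  shows "\<nu> (det M) \<le> (\<Prod>i<n. R i)"
proof -
  note N = absolute_valueD[OF nu]
  have summand: "\<nu> (of_int (sign p) * (\<Prod>i = 0..<n. M $$ (i, p i))) \<le> (\<Prod>i<n. R i)" if p: "p permutes {0..<n}" for p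
  proof -
    have s: "\<nu> (of_int (sign p)) = 1" by (simp add: sign_def N(6,7))
    have "\<nu> (of_int (sign p) * (\<Prod>i = 0..<n. M $$ (i, p i))) = (\<Prod>i<n. \<nu> (M $$ (i, p i)))"
      by (simp only: N(3) s mult_1_left absolute_value_prod[OF nu] atLeast0LessThan)
    also have "\<dots> \<le> (\<Prod>i<n. R i)"
      by (intro prod_mono conjI N(1) R) (use permutes_in_image[OF p] in auto)
    finally show ?thesis .
  qed
  have "0 \<le> (\<Prod>i<n. R i)" using summand[OF permutes_id] N(1) order_trans by blast
  then have "\<nu> (\<Sum>p | p permutes {0..<n}. of_int (sign p) * (\<Prod>i = 0..<n. M $$ (i, p i))) \<le> (\<Prod>i<n. R i)"
    by (rule ultrametric_sum[OF nu int]) (use summand in simp)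
  then show ?thesis using M unfolding det_def by simp
qed

text \<open>Integers have absolute value at most \<open>1\<close> at the non-archimedean places, which makes this grid the
  economical choice.\<close>

lemma integer_grid:
  "finite (of_int ` {- int T..int T} :: 'k::field_char_0 set)" "card (of_int ` {- int T..int T} :: 'k set) = 2 * T + 1"
proof -
  have "inj_on (of_int :: int \<Rightarrow> 'k) {- int T..int T}" by (rule inj_onI) simp
  then show "card (of_int ` {- int T..int T} :: 'k set) = 2 * T + 1" by (simp add: card_image)
qed simp

lemma det_le_of_row_bounds:
  fixes e :: "nat \<Rightarrow> nat \<Rightarrow> 'k::field" and H :: "nat \<Rightarrow> real"
  assumes nu: "absolute_value \<nu>" and e: "\<And>s u. s < r \<Longrightarrow> u < r \<Longrightarrow> \<nu> (e s u) \<le> c * H s" and rk: "r \<le> k" and c: "1 \<le> c"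
    and H: "\<And>s. s < r \<Longrightarrow> 0 \<le> H s"
  shows "\<nu> (det (mat r r (\<lambda>(s, u). e s u))) \<le> fact k * c ^ k * (\<Prod>s<r. H s)"
proof -
  have "\<nu> (det (mat r r (\<lambda>(s, u). e s u))) \<le> fact r * (\<Prod>s<r. c * H s)"
    by (rule absolute_value_det_le[OF nu]) (use e in auto)
  also have "\<dots> = (fact r * c ^ r) * (\<Prod>s<r. H s)" by (simp add: prod.distrib)
  also have "\<dots> \<le> (fact k * c ^ k) * (\<Prod>s<r. H s)"
    using rk c by (intro mult_right_mono mult_mono fact_mono power_increasing prod_nonneg H) auto
  finally show ?thesis by simp
qed

text \<open>The slack of the claimed bound over the one obtained: \<open>k! \<le> k\<^sup>k\<close>, and all factors are at least
  \<open>1\<close>.\<close>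

lemma final_estimate:
  fixes B \<HH> \<Delta> :: real and N k m :: nat
  assumes "1 \<le> k" "1 \<le> B" "1 \<le> N" "1 \<le> \<HH>" "1 \<le> \<Delta>"
  shows "(fact k * (real N * B ^ m) ^ k * B) * \<HH> ^ k \<le>
    real k ^ (k + 1) * \<Delta> * B ^ (2 * k * m + 1) * (real N * \<HH>) ^ (2 * k)"
proof -
  have N: "1 \<le> real N" using assms by simp
  have f: "(fact k :: real) \<le> real k ^ (k + 1)"
  proof -
    have "(fact k :: real) \<le> real k ^ k" using fact_le_power[where n=k and 'a=real] by simp
    also have "\<dots> \<le> real k ^ (k + 1)" using assms(1) by (intro power_increasing) auto
    finally show ?thesis .
  qed
  have b: "B ^ (m * k + 1) \<le> B ^ (2 * k * m + 1)" using assms(2) by (intro power_increasing) auto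
  have n: "real N ^ k * \<HH> ^ k \<le> (real N * \<HH>) ^ (2 * k)"
  proof -
    have "1 \<le> real N * \<HH>" using mult_mono[OF N assms(4)] assms by simp
    then show ?thesis unfolding power_mult_distrib[symmetric] by (intro power_increasing) auto
  qed
  have "(fact k * (real N * B ^ m) ^ k * B) * \<HH> ^ k = fact k * B ^ (m * k + 1) * (real N ^ k * \<HH> ^ k)"
    by (simp add: power_mult_distrib power_mult)
  also have "\<dots> \<le> (real k ^ (k + 1) * \<Delta>) * B ^ (2 * k * m + 1) * (real N * \<HH>) ^ (2 * k)"
  proof (intro mult_mono b n)
    have "fact k * 1 \<le> real k ^ (k + 1) * \<Delta>" by (intro mult_mono f assms(5)) auto
    then show "fact k \<le> real k ^ (k + 1) * \<Delta>" by simp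
  qed (use assms N in auto)
  finally show ?thesis .
qed

lemma point_of_coordinates:
  fixes i :: "nat \<Rightarrow> nat" and z x :: "nat \<Rightarrow> 'a"
  assumes i: "bij_betw i {1..k} I" and I: "I \<subseteq> {1..n}"
  shows "\<exists>p \<in> {1..n} \<rightarrow>\<^sub>E UNIV. (\<forall>j\<in>{1..k}. p (i j) = x (j - 1)) \<and> (\<forall>j\<in>{1..n} - I. p j = z j)"
proof -
  define p where "p = restrict (\<lambda>j. if j \<in> I then x (the_inv_into {1..k} i j - 1) else z j) {1..n}"
  have inj: "inj_on i {1..k}" and im: "i ` {1..k} = I" using i by (auto simp: bij_betw_def)
  have "p (i j) = x (j - 1)" if "j \<in> {1..k}" for j
  proof -
    have "i j \<in> I" using im that by blast
    then show ?thesis using I the_inv_into_f_f[OF inj that] by (auto simp: p_def)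
  qed
  moreover have "p j = z j" if "j \<in> {1..n} - I" for j using that by (simp add: p_def)
  moreover have "p \<in> {1..n} \<rightarrow>\<^sub>E UNIV" by (simp add: p_def)
  ultimately show ?thesis by blast
qed

lemma meval_mvar: "meval z (mvar j) = z j"
  by (simp add: mvar_def meval_single mono_eval_def)

theorem theorem1p1:
  fixes k n d m D N :: nat
    and I I' :: "nat set"
    and i :: "nat \<Rightarrow> nat"
    and F :: "nat \<Rightarrow> 'k::number_field mpoly"
    and Fc :: "nat \<Rightarrow> nat \<Rightarrow> 'k mpoly"
    and deg :: "nat \<Rightarrow> nat"
    and \<HH> :: real
  assumes "d = nf_degree TYPE('k)"
    and "1 \<le> k" and "k < n"
    and "I \<subseteq> {1..n}" and "bij_betw i {1..k} I"
    and "I' = {1..n} - I"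
    and "\<And>l j. l \<in> {1..k} \<Longrightarrow> j \<in> {1..k + 1} \<Longrightarrow> Fc l j \<in> mpoly_ring I'"
    and "\<And>l. l \<in> {1..k} \<Longrightarrow> F l = (\<Sum>j=1..k. mvar (i j) * Fc l j) + Fc l (k + 1)"
    and "\<And>l. l \<in> {1..k} \<Longrightarrow> F l \<noteq> 0"
    and "\<And>l. l \<in> {1..k} \<Longrightarrow> total_degree (F l) = deg l"
    and "ratfun_rank I' (mat k k (\<lambda>(a, b). Fract (Fc (a + 1) (b + 1)) 1)) =
         ratfun_rank I' (mat k (k + 1) (\<lambda>(a, b). Fract (Fc (a + 1) (b + 1)) 1))"
    and "D = (\<Sum>l=1..k. deg l)"
    and "m = Max (deg ` {1..k})"
    and "N = Max ((\<lambda>l. num_monomials (F l)) ` {1..k})"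
    and "\<HH> = Max ((\<lambda>l. poly_height (F l)) ` {1..k})"
  shows "(\<Inter>l\<in>{1..k}. zero_locus n (F l)) \<noteq> {} \<and>
    (\<exists>z \<in> (\<Inter>l\<in>{1..k}. zero_locus n (F l)).
       weil_height {1..n} z \<le>
         real k ^ (k + 1) * \<bar>real_of_int (nf_discriminant TYPE('k))\<bar> powr (1 / real d)
           * ((real D + 2) / 2) ^ (2 * k * m + 1) * (real N * \<HH>) ^ (2 * k))"
proof -
  note k1 = assms(2) and Isub = assms(4) and bij = assms(5) and I' = assms(6) and Fcin = assms(7)
    and Fdef = assms(8) and Fnz = assms(9) and Fdeg = assms(10) and rank = assms(11)
    and D = assms(12) and m = assms(13) and N = assms(14) and H = assms(15)
  define G where "G a b = Fc (a + 1) (b + 1)" for a b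
  have Gin: "G a b \<in> mpoly_ring I'" if "a < k" "b \<le> k" for a b
    unfolding G_def by (rule Fcin) (use that in auto)
  have inji: "inj_on i {1..k}" and out: "\<And>j. j \<in> {1..k} \<Longrightarrow> i j \<notin> I'"
    using bij I' by (auto simp: bij_betw_def)
  have shift: "\<exists>\<kappa>. \<forall>\<alpha>\<in>mkeys (G a b). \<kappa> + \<alpha> \<in> mkeys (F (a + 1)) \<and> lookup (F (a + 1)) (\<kappa> + \<alpha>) = lookup (G a b) \<alpha>"
    if "a < k" "b \<le> k" for a b
  proof -
    have a1: "a + 1 \<in> {1..k}" and b1: "b + 1 \<in> {1..k + 1}" using that by auto
    have "\<exists>\<kappa>. mono_degree \<kappa> = (if b + 1 \<le> k then 1 else 0) \<and> (\<forall>\<alpha>\<in>mkeys (Fc (a + 1) (b + 1)).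
        \<kappa> + \<alpha> \<in> mkeys (F (a + 1)) \<and> lookup (F (a + 1)) (\<kappa> + \<alpha>) = lookup (Fc (a + 1) (b + 1)) \<alpha>)"
      by (rule linear_form_coefficients[OF inji out _ Fdef[OF a1] b1]) (use Fcin[OF a1] in auto)
    then show ?thesis unfolding G_def by blast
  qed
  have Gdeg: "degree_le (deg (a + 1)) (G a b)" if ab: "a < k" "b \<le> k" for a b
    unfolding degree_le_def
  proof
    fix \<alpha> assume "\<alpha> \<in> mkeys (G a b)"
    then obtain \<kappa> where "\<kappa> + \<alpha> \<in> mkeys (F (a + 1))" using shift[OF ab] by blast
    from total_degree_ge[OF this] show "mono_degree \<alpha> \<le> deg (a + 1)"
      using Fdeg[of "a + 1"] ab by (simp add: mono_degree_add)
  qed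
  have Gcard: "card (mkeys (G a b)) \<le> N" if ab: "a < k" "b \<le> k" for a b
  proof -
    obtain \<kappa> where "\<forall>\<alpha>\<in>mkeys (G a b). \<kappa> + \<alpha> \<in> mkeys (F (a + 1))" using shift[OF ab] by blast
    then have "card (mkeys (G a b)) \<le> card (mkeys (F (a + 1)))"
      by (intro card_inj_on_le[of "\<lambda>\<alpha>. \<kappa> + \<alpha>"]) (auto intro: inj_onI)
    also have "\<dots> \<le> N" unfolding N num_monomials_def by (rule Max_ge) (use ab in auto)
    finally show ?thesis .
  qed
  have degm: "deg l \<le> m" if "l \<in> {1..k}" for l unfolding m by (rule Max_ge) (use that in auto)
  have Hge: "poly_height (F l) \<le> \<HH>" if "l \<in> {1..k}" for l unfolding H by (rule Max_ge) (use that in auto)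
  have N1: "1 \<le> N"
  proof -
    have "mkeys (F 1) \<noteq> {}" using Fnz[of 1] k1 by simp
    then have "1 \<le> num_monomials (F 1)" unfolding num_monomials_def by (simp add: Suc_le_eq card_gt_0_iff)
    also have "\<dots> \<le> N" unfolding N by (rule Max_ge) (use k1 in auto)
    finally show ?thesis .
  qed
  have ph1: "1 \<le> poly_height (F l)" for l unfolding poly_height_def by (rule weil_height_ge_1) simp
  have H1: "1 \<le> \<HH>" using ph1[of 1] Hge[of 1] k1 by simp
  define B where "B = (real D + 2) / 2"
  have B1: "1 \<le> B" by (simp add: B_def)
  have "\<exists>y. \<forall>a<k. Fract (G a k) 1 = (\<Sum>b<k. Fract (G a b) 1 * y b)"
    by (rule ratfun_rank_eq_imp_solvable[where J=I']) (use Gin rank in \<open>simp_all only: G_def\<close>)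
  then obtain y where "\<forall>a<k. Fract (G a k) 1 = (\<Sum>b<k. Fract (G a b) 1 * y b)" ..
  from minor_row_relations[OF this] obtain r \<rho> \<kappa> where r: "\<forall>t<r. \<rho> t < k \<and> \<kappa> t < k"
    and g: "det (mat r r (\<lambda>(s, t). G (\<rho> s) (\<kappa> t))) \<noteq> 0"
    and rel: "\<forall>a<k. \<exists>C. \<forall>b\<le>k. (\<Sum>s<r. G (\<rho> s) b * C s) + G a b * det (mat r r (\<lambda>(s, t). G (\<rho> s) (\<kappa> t))) = 0"
    by (elim exE conjE)
  define g0 where "g0 = det (mat r r (\<lambda>(s, t). G (\<rho> s) (\<kappa> t)))"
  note inj\<rho> = det_minor_inj(1)[where G=G and \<rho>=\<rho> and \<kappa>=\<kappa>, OF g]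
  have rk: "r \<le> k"
    using card_inj_on_le[OF inj\<rho>, of "{..<k}"] r by auto
  have g0in: "g0 \<in> mpoly_ring I'"
    unfolding g0_def by (rule mpoly_ring_det) (use r in \<open>auto intro!: Gin less_imp_le\<close>)
  have g0deg: "degree_le D g0"
  proof -
    have "degree_le (\<Sum>s<r. deg (\<rho> s + 1)) g0"
      unfolding g0_def by (rule degree_le_det) (use r Gdeg in \<open>auto intro: less_imp_le\<close>)
    moreover have "(\<Sum>s<r. deg (\<rho> s + 1)) \<le> D"
    proof -
      have "(\<Sum>s<r. deg (\<rho> s + 1)) = (\<Sum>l\<in>(\<lambda>s. \<rho> s + 1) ` {..<r}. deg l)"
        using inj\<rho> by (subst sum.reindex) (auto simp: inj_on_def)
      also have "\<dots> \<le> D" unfolding D by (rule sum_mono2) (use r in auto)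
      finally show ?thesis .
    qed
    ultimately show ?thesis by (rule degree_le_mono)
  qed
  \<comment> \<open>\<open>2 T + 1 > D\<close>, so a polynomial of degree at most \<open>D\<close> cannot vanish on the whole grid\<close>
  define T where "T = (D + 1) div 2"
  define S where "S = (of_int ` {- int T..int T} :: 'k set)"
  have TB: "real T \<le> B" unfolding B_def T_def using of_nat_mono[of "2 * ((D + 1) div 2)" "D + 1", where 'a=real] by simp
  have "finite I'" using I' by simp
  then have "\<exists>z. (\<forall>j\<in>I'. z j \<in> S) \<and> meval z g0 \<noteq> 0"
  proof (rule nonvanishing_on_grid[OF _ _ g0in])
    show "g0 \<noteq> 0" using g by (simp add: g0_def)
    show "lookup \<alpha> j \<le> D" if "\<alpha> \<in> mkeys g0" for \<alpha> j
      using g0deg that mono_degree_ge[of \<alpha> j] unfolding degree_le_def by (auto intro: order_trans)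
    show "finite S" "D < card S" unfolding S_def integer_grid by (auto simp: T_def)
  qed
  then obtain z where zS: "\<And>j. j \<in> I' \<Longrightarrow> z j \<in> S" and zg: "meval z g0 \<noteq> 0" by blast
  define A where "A a b = meval z (G a b)" for a b
  define w where "w = det (mat r r (\<lambda>(s, t). A (\<rho> s) (\<kappa> t)))"
  have weq: "meval z g0 = w"
  proof -
    have "map_mat (meval z) (mat r r (\<lambda>(s, t). G (\<rho> s) (\<kappa> t))) = mat r r (\<lambda>(s, t). A (\<rho> s) (\<kappa> t))"
      by (rule eq_matI) (auto simp: A_def)
    then show ?thesis unfolding g0_def w_def by (subst meval_det) auto
  qed
  have w0: "w \<noteq> 0" using zg weq by simp
  have "\<forall>a<k. \<exists>C. \<forall>b\<le>k. (\<Sum>s<r. A (\<rho> s) b * C s) + A a b * w = 0"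
  proof (intro allI impI)
    fix a assume "a < k"
    then obtain C where C: "\<And>b. b \<le> k \<Longrightarrow> (\<Sum>s<r. G (\<rho> s) b * C s) + G a b * g0 = 0"
      using rel unfolding g0_def by blast
    have "(\<Sum>s<r. A (\<rho> s) b * meval z (C s)) + A a b * w = 0" if "b \<le> k" for b
    proof -
      have "meval z ((\<Sum>s<r. G (\<rho> s) b * C s) + G a b * g0) = 0" unfolding C[OF that] by (rule meval_zero)
      then show ?thesis by (simp only: meval_add meval_sum meval_mult A_def weq)
    qed
    then show "\<exists>C. \<forall>b\<le>k. (\<Sum>s<r. A (\<rho> s) b * C s) + A a b * w = 0" by (intro exI[of _ "\<lambda>s. meval z (C s)"] allI impI)
  qed
  from solve_by_minor[OF r w0[unfolded w_def] this[unfolded w_def]]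
  obtain x where x: "\<And>a. a < k \<Longrightarrow> (\<Sum>b<k. x b * A a b) + A a k = 0"
    and xdet: "\<And>b. b < k \<Longrightarrow> x b = 0 \<or> (\<exists>t<r. w * x b = det (mat r r (\<lambda>(s, u). if u = t then - A (\<rho> s) k else A (\<rho> s) (\<kappa> u))))"
    unfolding w_def by blast
  obtain p where pin: "p \<in> {1..n} \<rightarrow>\<^sub>E UNIV" and pI: "\<And>j. j \<in> {1..k} \<Longrightarrow> p (i j) = x (j - 1)"
    and pI': "\<And>j. j \<in> I' \<Longrightarrow> p j = z j"
    using point_of_coordinates[OF bij Isub, of x z] unfolding I' by blast
  have zero: "p \<in> zero_locus n (F l)" if l: "l \<in> {1..k}" for l
  proof -
    define a where "a = l - 1"
    have a: "a < k" "l = a + 1" using l by (auto simp: a_def)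
    have Geval: "meval p (G a b) = A a b" if "b \<le> k" for b
      unfolding A_def by (rule meval_cong[OF Gin[OF a(1) that]]) (rule pI')
    have "meval p (F l) = (\<Sum>j=1..k. p (i j) * meval p (Fc l j)) + meval p (Fc l (k + 1))"
      unfolding Fdef[OF l] by (simp only: meval_add meval_sum meval_mult meval_mvar)
    also have "(\<Sum>j=1..k. p (i j) * meval p (Fc l j)) = (\<Sum>b<k. x b * A a b)"
    proof (rule sum.reindex_bij_witness[of _ Suc "\<lambda>j. j - 1"])
      fix j assume j: "j \<in> {1..k}"
      then have "meval p (Fc l j) = A a (j - 1)" using Geval[of "j - 1"] a(2) by (auto simp: G_def)
      then show "x (j - 1) * A a (j - 1) = p (i j) * meval p (Fc l j)" using pI[OF j] by simp
    qed auto
    also have "meval p (Fc l (k + 1)) = A a k" using Geval[of k] a(2) by (simp add: G_def)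
    finally have "meval p (F l) = 0" using x[OF a(1)] by simp
    then show ?thesis using pin by (simp add: zero_locus_def)
  qed
  define Bl where "Bl s = mkeys (F (\<rho> s + 1))" for s
  define fl where "fl s = lookup (F (\<rho> s + 1))" for s
  \<comment> \<open>the local height of the polynomial in row \<open>s\<close> of the minor\<close>
  define E where "E \<nu> s = sup_abs \<nu> (insert None (Some ` Bl s)) (case_option 1 (fl s))" for \<nu> s
  have E1: "1 \<le> E \<nu> s" and Eco: "\<And>\<alpha>. \<alpha> \<in> Bl s \<Longrightarrow> \<nu> (fl s \<alpha>) \<le> E \<nu> s" if "absolute_value \<nu>" for \<nu> s
    unfolding E_def by (rule local_height_ge[OF that]; simp add: Bl_def)+
  have Gco: "\<nu> (lookup (G (\<rho> s) b) \<alpha>) \<le> E \<nu> s"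
    if nu: "absolute_value \<nu>" and s: "s < r" and b: "b \<le> k" and \<alpha>: "\<alpha> \<in> mkeys (G (\<rho> s) b)" for \<nu> s b \<alpha>
  proof -
    have "\<rho> s < k" using r s by blast
    then obtain \<kappa>' where "\<kappa>' + \<alpha> \<in> mkeys (F (\<rho> s + 1))" "lookup (F (\<rho> s + 1)) (\<kappa>' + \<alpha>) = lookup (G (\<rho> s) b) \<alpha>"
      using shift[OF _ b] \<alpha> by blast
    then show ?thesis using Eco[OF nu, of "\<kappa>' + \<alpha>" s] unfolding Bl_def fl_def by simp
  qed
  have term_le: "\<nu> (lookup (G (\<rho> s) b) \<alpha> * mono_eval z \<alpha>) \<le> E \<nu> s * c ^ m"
    if nu: "absolute_value \<nu>" and zc: "\<And>j. j \<in> I' \<Longrightarrow> \<nu> (z j) \<le> c" and c: "1 \<le> c"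
      and s: "s < r" and b: "b \<le> k" and \<alpha>: "\<alpha> \<in> mkeys (G (\<rho> s) b)" for \<nu> c s b \<alpha>
  proof -
    have \<rho>: "\<rho> s < k" using r s by blast
    have "mono_degree \<beta> \<le> m" if "\<beta> \<in> mkeys (G (\<rho> s) b)" for \<beta>
    proof -
      have "mono_degree \<beta> \<le> deg (\<rho> s + 1)" using Gdeg[OF \<rho> b] that unfolding degree_le_def by blast
      also have "\<dots> \<le> m" by (rule degm) (use \<rho> in auto)
      finally show ?thesis .
    qed
    then show ?thesis
      by (intro monomial_absolute_value_le[OF nu Gco[OF nu s b] _ Gin[OF \<rho> b] zc c \<alpha>])
  qed
  have Adef: "A a b = (\<Sum>\<alpha>\<in>mkeys (G a b). lookup (G a b) \<alpha> * mono_eval z \<alpha>)" for a b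
    unfolding A_def meval_def mono_eval_def ..
  \<comment> \<open>the matrix of Cramer's rule for the unknown of column \<open>t\<close>; the column index \<open>r\<close> is out of range, so \<open>e r\<close> is the unmodified minor\<close>
  define e where "e t s u = (if u = t then - A (\<rho> s) k else A (\<rho> s) (\<kappa> u))" for t s u
  have wdet: "w = det (mat r r (\<lambda>(s, u). e r s u))"
    unfolding w_def e_def by (rule arg_cong[of _ _ det]) (rule eq_matI, auto)
  have xe: "x b = 0 \<or> (\<exists>t<r. w * x b = det (mat r r (\<lambda>(s, u). e t s u)))" if "b < k" for b
    using xdet[OF that] unfolding e_def .
  have eA: "\<nu> (e t s u) \<le> c" if nu: "absolute_value \<nu>" and "u < r" and "\<And>b. b \<le> k \<Longrightarrow> \<nu> (A (\<rho> s) b) \<le> c" for \<nu> t s u c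
    unfolding e_def using that(2,3) r by (simp add: absolute_valueD(7)[OF nu] less_imp_le)
  have coords: "\<nu> w \<le> Q \<and> (\<forall>j\<in>{1..n}. \<nu> (w * p j) \<le> Q)"
    if nu: "absolute_value \<nu>" and zc: "\<And>j. j \<in> I' \<Longrightarrow> \<nu> (z j) \<le> c" and c: "1 \<le> c"
      and dets: "\<And>t. \<nu> (det (mat r r (\<lambda>(s, u). e t s u))) \<le> P" and Q: "P * c = Q" for \<nu> c P Q
  proof -
    note V = absolute_valueD[OF nu]
    have P0: "0 \<le> P" using dets[of r] V(1) order_trans by blast
    have PQ: "P \<le> Q" using mult_left_mono[OF c P0] Q by simp
    have wP: "\<nu> w \<le> P" unfolding wdet by (rule dets)
    have "\<nu> (w * p j) \<le> Q" if j: "j \<in> {1..n}" for j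
    proof (cases "j \<in> I")
      case True
      then obtain l where l: "l \<in> {1..k}" "j = i l" using bij by (auto simp: bij_betw_def)
      then have "p j = 0 \<or> (\<exists>t<r. w * p j = det (mat r r (\<lambda>(s, u). e t s u)))" using pI[OF l(1)] xe[of "l - 1"] by auto
      then have "\<nu> (w * p j) \<le> P" using dets P0 V(5) by auto
      then show ?thesis using PQ by simp
    next
      case False
      then have j': "j \<in> I'" using j I' by simp
      have "\<nu> (w * p j) = \<nu> w * \<nu> (z j)" by (simp only: pI'[OF j'] V(3))
      also have "\<dots> \<le> P * c" by (intro mult_mono wP zc[OF j'] P0 V(1))
      finally show ?thesis using Q by simp
    qed
    then show ?thesis using wP PQ by auto
  qed
  define Cst where "Cst = fact k * (real N * B ^ m) ^ k * B"
  have NB: "1 \<le> real N * B ^ m" using mult_mono[of 1 "real N" 1 "B ^ m"] N1 B1 by simp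
  have "weil_height {1..n} p \<le> Cst * (\<Prod>s\<in>{..<r}. weil_height (Bl s) (fl s))"
  proof (rule weil_height_bound)
    show "w \<noteq> 0" by (rule w0)
    show "finite {1..n}" "finite {..<r}" by simp_all
    show "finite (Bl s)" for s by (simp add: Bl_def)
    have "1 \<le> fact k * (real N * B ^ m) ^ k" using mult_mono[of 1 "fact k" 1 "(real N * B ^ m) ^ k"] NB by (simp add: fact_ge_1)
    then show "1 \<le> Cst" unfolding Cst_def using B1 mult_mono[of 1 "fact k * (real N * B ^ m) ^ k" 1 B] by simp
  next
    fix \<nu> :: "'k \<Rightarrow> real" assume ext: "\<nu> \<in> extensions inf_abs"
    note nu = extensionsD(1)[OF ext]
    have zc: "\<nu> (z j) \<le> B" if j: "j \<in> I'" for j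
    proof -
      obtain t where t: "z j = of_int t" "- int T \<le> t" "t \<le> int T" using zS[OF j] unfolding S_def by auto
      have "\<nu> (z j) = \<bar>real_of_int t\<bar>" using extensionsD(2)[OF ext, of "of_int t"] t(1) by (simp add: inf_abs_def)
      also have "\<dots> \<le> real T" using t(2,3) by linarith
      finally show ?thesis using TB by simp
    qed
    have Ab: "\<nu> (A (\<rho> s) b) \<le> (real N * B ^ m) * E \<nu> s" if s: "s < r" and b: "b \<le> k" for s b
    proof -
      have \<rho>: "\<rho> s < k" using r s by blast
      have "\<nu> (A (\<rho> s) b) \<le> (\<Sum>\<alpha>\<in>mkeys (G (\<rho> s) b). \<nu> (lookup (G (\<rho> s) b) \<alpha> * mono_eval z \<alpha>))"
        unfolding Adef by (rule absolute_value_sum[OF nu])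
      also have "\<dots> \<le> real (card (mkeys (G (\<rho> s) b))) * (E \<nu> s * B ^ m)"
        by (rule sum_bounded_above) (rule term_le[OF nu zc B1 s b])
      also have "\<dots> \<le> real N * (E \<nu> s * B ^ m)"
        using Gcard[OF \<rho> b] E1[OF nu, of s] B1 by (intro mult_right_mono) auto
      finally show ?thesis by (simp add: mult_ac)
    qed
    have "\<nu> (det (mat r r (\<lambda>(s, u). e t s u))) \<le> fact k * (real N * B ^ m) ^ k * (\<Prod>s<r. E \<nu> s)" for t
    proof (rule det_le_of_row_bounds[OF nu _ rk NB])
      show "\<nu> (e t s u) \<le> real N * B ^ m * E \<nu> s" if "s < r" "u < r" for s u
        by (rule eA[OF nu that(2) Ab[OF that(1)]])
      show "0 \<le> E \<nu> s" if "s < r" for s using E1[OF nu, of s] by simp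
    qed
    moreover have "fact k * (real N * B ^ m) ^ k * (\<Prod>s<r. E \<nu> s) * B = Cst * (\<Prod>s<r. E \<nu> s)"
      by (simp add: Cst_def)
    ultimately have "\<nu> w \<le> Cst * (\<Prod>s<r. E \<nu> s) \<and> (\<forall>j\<in>{1..n}. \<nu> (w * p j) \<le> Cst * (\<Prod>s<r. E \<nu> s))"
      by (intro coords[OF nu zc B1])
    then
    show "\<nu> w \<le> Cst * (\<Prod>s\<in>{..<r}. sup_abs \<nu> (insert None (Some ` Bl s)) (case_option 1 (fl s))) \<and>
      (\<forall>j\<in>{1..n}. \<nu> (w * p j) \<le> Cst * (\<Prod>s\<in>{..<r}. sup_abs \<nu> (insert None (Some ` Bl s)) (case_option 1 (fl s))))"
      unfolding E_def .
  next
    fix \<nu> :: "'k \<Rightarrow> real" and q assume q: "prime q" and ext: "\<nu> \<in> extensions (padic_abs q)"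
    note nu = extensionsD(1)[OF ext]
    have nat: "\<nu> (of_nat c) \<le> 1" for c by (rule padic_extension_nat[OF q ext])
    have zc: "\<nu> (z j) \<le> 1" if "j \<in> I'" for j
      using zS[OF that] padic_extension_int[OF q ext] unfolding S_def by auto
    have Ab: "\<nu> (A (\<rho> s) b) \<le> E \<nu> s" if s: "s < r" and b: "b \<le> k" for s b
    proof -
      have "\<nu> (lookup (G (\<rho> s) b) \<alpha> * mono_eval z \<alpha>) \<le> E \<nu> s" if "\<alpha> \<in> mkeys (G (\<rho> s) b)" for \<alpha>
        using term_le[OF nu zc order_refl s b that] by simp
      moreover have "0 \<le> E \<nu> s" using E1[OF nu, of s] by simp
      ultimately show ?thesis unfolding Adef by (intro ultrametric_sum[OF nu nat])
    qed
    have "\<nu> (det (mat r r (\<lambda>(s, u). e t s u))) \<le> (\<Prod>s<r. E \<nu> s)" for t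
    proof (rule absolute_value_det_le_ultrametric[OF nu nat])
      show "\<nu> (mat r r (\<lambda>(s, u). e t s u) $$ (s, u)) \<le> E \<nu> s" if "s < r" "u < r" for s u
        using eA[OF nu that(2) Ab[OF that(1)]] that by simp
    qed simp
    from coords[OF nu zc order_refl this mult_1_right]
    show "\<nu> w \<le> (\<Prod>s\<in>{..<r}. sup_abs \<nu> (insert None (Some ` Bl s)) (case_option 1 (fl s))) \<and>
      (\<forall>j\<in>{1..n}. \<nu> (w * p j) \<le> (\<Prod>s\<in>{..<r}. sup_abs \<nu> (insert None (Some ` Bl s)) (case_option 1 (fl s))))"
      unfolding E_def .
  qed
  also have "(\<Prod>s\<in>{..<r}. weil_height (Bl s) (fl s)) \<le> \<HH> ^ k"
  proof -
    have "(\<Prod>s\<in>{..<r}. weil_height (Bl s) (fl s)) \<le> (\<Prod>s\<in>{..<r}. \<HH>)"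
    proof (intro prod_mono conjI)
      fix s assume s: "s \<in> {..<r}"
      have *: "weil_height (Bl s) (fl s) = poly_height (F (\<rho> s + 1))" by (simp add: poly_height_def Bl_def fl_def)
      show "0 \<le> weil_height (Bl s) (fl s)" using ph1[of "\<rho> s + 1"] unfolding * by simp
      show "weil_height (Bl s) (fl s) \<le> \<HH>" unfolding * by (rule Hge) (use r s in auto)
    qed
    also have "\<dots> = \<HH> ^ r" by simp
    also have "\<dots> \<le> \<HH> ^ k" by (rule power_increasing[OF rk H1])
    finally show ?thesis .
  qed
  also have "Cst * \<HH> ^ k \<le> real k ^ (k + 1) * \<bar>real_of_int (nf_discriminant TYPE('k))\<bar> powr (1 / real d)
           * ((real D + 2) / 2) ^ (2 * k * m + 1) * (real N * \<HH>) ^ (2 * k)"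
    unfolding Cst_def B_def[symmetric]
    by (rule final_estimate[OF k1 B1 N1 H1]) (rule ge_one_powr_ge_zero[OF nf_discriminant_ge_1], simp)
  finally have height: "weil_height {1..n} p \<le> real k ^ (k + 1) * \<bar>real_of_int (nf_discriminant TYPE('k))\<bar> powr (1 / real d)
           * ((real D + 2) / 2) ^ (2 * k * m + 1) * (real N * \<HH>) ^ (2 * k)"
    using NB B1 by (simp add: Cst_def mult_left_mono)
  have "p \<in> (\<Inter>l\<in>{1..k}. zero_locus n (F l))" using zero by blast
  then show ?thesis using height by blast
qed

end
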